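(* Assume $0<\varepsilon<\omega_1$ and let $2\le\iota<\omega$. Let $S=(\omega,\bar r,\bar\jmath,\bar k)$ be a cute $\mathcal{YZR}(\varepsilon)$-system. Then there is a sequence $\bar T=\langle T_m:m<\omega\rangle$ of trees $T_m\subseteq{}^{\omega>}2$ without maximal nodes and a sequence $\bar c=\langle c_m:m<\omega\rangle$ of integers (i.e. elements of $\omega$) such that (1) $\bar T$ has the $(\bar c,S)$-controlled amalgamation property, and (2) $\varepsilon\le\mathrm{ndrk}_\iota(\bar T)\le\omega\cdot(\varepsilon+2)+2$ (ordinal multiplication).
   Context: **Basic notation.** Every ordinal (in particular every natural number) is identified with the set of smaller ordinals; for a set $w$ of ordinals and an ordinal $b$, $w\cap b=\{a\in w:a<b\}$. $[X]^{<\omega}$ is the family of finite subsets of $X$. For a set $u$, $u^{\langle2\rangle}=\{(x,y)\in u\times u:x\ne y\}$. ${}^n2$ is the set of 0-1 sequences of length $n$, ${}^{\omega>}2=\bigcup_{n<\omega}{}^n2$, ${}^{\omega}2$ is the Cantor space; $+$ on ${}^n2$ and on ${}^{\omega}2$ is coordinatewise addition mod 2. $\nu\vartriangleleft\eta$ means that $\nu$ is a proper initial segment of $\eta$; $\nu\trianglelefteq\eta$ means $\nu\vartriangleleft\eta$ or $\nu=\eta$. A tree is a $\vartriangleleft$-downward closed set of sequences; $\lim(T)$ is the set of $\omega$-branches through $T\subseteq{}^{\omega>}2$. **$\mathcal{YZR}$-systems.** Let $0<\varepsilon<\omega_1$. A $\mathcal{YZR}(\varepsilon)$-system is a tuple $s=(X^s,\bar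 r^s,\bar\jmath^s,\bar k^s)=(X,\bar r,\bar\jmath,\bar k)$ such that: $( * )_1$ $X$ is a nonempty set of ordinals; $( * )_2$ $\bar r:[X]^{<\omega}\setminus\{\emptyset\}\to\varepsilon+1$, $\bar\jmath,\bar k:[X]^{<\omega}\setminus\{\emptyset\}\to\omega$; $( * )_3$ if $\emptyset\ne u\subseteq w\in[X]^{<\omega}$ then $\bar r(u)\ge\bar r(w)$; $( * )_4$ $\bar r(\{a\})>0$ for all $a\in X$; $( * )_5$ if $\emptyset\neq w\in[X]^{<\omega}$ and $w=\{a_0,\dots,a_{n-1}\}$ is the increasing enumeration, then $\bar k(w)<n$ and there is no $b\in X\setminus w$ such that $|w\cap b|=\bar k(w)$ and $\bar\jmath((w\setminus\{a_{\bar k(w)}\})\cup\{b\})=\bar\jmath(w)$ and $\bar r(w\cup\{b\})=\bar r(w)$. It is finite if $X^s$ is finite. A quasi-embedding of $q$ in $s$ (both $\mathcal{YZR}(\varepsilon)$-systems) is an increasing injection $\varphi:X^q\to X^s$ such that for all nonempty finite $v\subseteq X^q$: $\bar r^s(\varphi[v])=\bar r^q(v)$, $\bar k^s(\varphi[v])=\bar k^q(v)$, and if $\bar r^q(v)>0$ then $\bar\jmath^s(\varphi[v])=\bar\jmath^q(v)$. If $w\subseteq X^s$, an increasing injection $\varphi:w\to X^s$ is a quasi-embedding (into $s$) if it is a quasi-embedding of the restricted system $s\restriction w$ in $s$. A $\mathcal{YZR}(\varepsilon)$-system $S$ is cute if $X^S=\omega$ and for every finite $\mathcal{YZR}(\varepsilon)$-system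 $q$ and $M<\omega$ there is a quasi-embedding $\varphi$ of $q$ in $S$ with $\mathrm{rng}(\varphi)\subseteq[M,\omega)$. **The family $\mathbf M_{\bar T,\iota}$.** Let $2\le\iota<\omega$ and let $\bar T=\langle T_n:n<\omega\rangle$ be a sequence of trees $T_n\subseteq{}^{\omega>}2$ with no maximal nodes. $\mathbf M_{\bar T,\iota}$ consists of all tuples $\mathbf m=(\ell_{\mathbf m},u_{\mathbf m},\bar h_{\mathbf m},\bar g_{\mathbf m})=(\ell,u,\bar h,\bar g)$ such that: (a) $0<\ell<\omega$, $u\subseteq{}^\ell2$, $|u|\ge2$; (b) $\bar h=\langle h_i:i<\iota\rangle$, $\bar g=\langle g_i:i<\iota\rangle$, $h_i:u^{\langle2\rangle}\to\omega$, $g_i:u^{\langle2\rangle}\to\bigcup_{n<\omega}(T_n\cap{}^\ell2)$; (c) $g_i(\eta,\nu)\in T_{h_i(\eta,\nu)}\cap{}^\ell2$ for all $(\eta,\nu)\in u^{\langle2\rangle}$, $i<\iota$; (d) $\eta+g_i(\eta,\nu)=\nu+g_i(\nu,\eta)$ for $(\eta,\nu)\in u^{\langle2\rangle}$, $i<\iota$; (e) for each $(\eta,\nu)\in u^{\langle2\rangle}$ there are no repetitions in $\langle g_i(\eta,\nu),g_i(\nu,\eta):i<\iota\rangle$; (f) there are $\langle F(\eta):\eta\in u\rangle$ and $\langle G_i(\eta,\nu):i<\iota,(\eta,\nu)\in u^{\langle2\rangle}\rangle$ such that $\eta\vartriangleleft F(\eta)\in{}^{\omega}2$, $g_i(\eta,\nu)\vartriangleleft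 G_i(\eta,\nu)\in\lim(T_{h_i(\eta,\nu)})$ and $F(\eta)+G_i(\eta,\nu)=F(\nu)+G_i(\nu,\eta)$ for all $i<\iota$, $(\eta,\nu)\in u^{\langle 2\rangle}$. We write $h_i^{\mathbf m},g_i^{\mathbf m}$ for the components. For $\rho\in{}^{\ell_{\mathbf m}}2$, $\mathbf m+\rho=(\ell',u',\bar h',\bar g')$ where $\ell'=\ell_{\mathbf m}$, $u'=\{\eta+\rho:\eta\in u_{\mathbf m}\}$, $h'_i(\eta+\rho,\nu+\rho)=h^{\mathbf m}_i(\eta,\nu)$, $g'_i(\eta+\rho,\nu+\rho)=g^{\mathbf m}_i(\eta,\nu)$. For $\mathbf m,\mathbf n\in\mathbf M_{\bar T,\iota}$, $\mathbf n$ essentially extends $\mathbf m$ ($\mathbf m\sqsubseteq^*\mathbf n$) iff $\ell_{\mathbf m}\le\ell_{\mathbf n}$, $u_{\mathbf m}=\{\eta\restriction\ell_{\mathbf m}:\eta\in u_{\mathbf n}\}$ and for every $(\eta,\nu)\in(u_{\mathbf n})^{\langle2\rangle}$ with $\eta'=\eta\restriction\ell_{\mathbf m}\ne\nu'=\nu\restriction\ell_{\mathbf m}$: if $\iota>2$ then $\{\{g_i^{\mathbf m}(\eta',\nu'),g_i^{\mathbf m}(\nu',\eta')\}:i<\iota\}=\{\{g_i^{\mathbf n}(\eta,\nu)\restriction\ell_{\mathbf m},g_i^{\mathbf n}(\nu,\eta)\restriction\ell_{\mathbf m}\}:i<\iota\}$; if $\iota=2$ then $\{g_0^{\mathbf m}(\eta',\nu'),g_0^{\mathbf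 m}(\nu',\eta'),g_1^{\mathbf m}(\eta',\nu'),g_1^{\mathbf m}(\nu',\eta')\}=\{g_0^{\mathbf n}(\eta,\nu)\restriction\ell_{\mathbf m},g_0^{\mathbf n}(\nu,\eta)\restriction\ell_{\mathbf m},g_1^{\mathbf n}(\eta,\nu)\restriction\ell_{\mathbf m},g_1^{\mathbf n}(\nu,\eta)\restriction\ell_{\mathbf m}\}$; and for $i,j<\iota$: if $g_i^{\mathbf m}(\eta',\nu')=g_j^{\mathbf n}(\eta,\nu)\restriction\ell_{\mathbf m}$ then $h_i^{\mathbf m}(\eta',\nu')=h_j^{\mathbf n}(\eta,\nu)$, and if $g_i^{\mathbf m}(\eta',\nu')=g_j^{\mathbf n}(\nu,\eta)\restriction\ell_{\mathbf m}$ then $h_i^{\mathbf m}(\eta',\nu')=h_j^{\mathbf n}(\nu,\eta)$. $\mathbf m,\mathbf n$ are essentially the same ($\mathbf m\doteqdot\mathbf n$) iff $\ell_{\mathbf m}=\ell_{\mathbf n}$, $u_{\mathbf m}=u_{\mathbf n}$ and these same conditions hold for all $(\eta,\nu)\in(u_{\mathbf m})^{\langle2\rangle}$ (with $\eta'=\eta$, $\nu'=\nu$). **Bricks.** Let $S=(\omega,\bar r,\bar\jmath,\bar k)$ be a cute $\mathcal{YZR}(\varepsilon)$-system and $\bar c=\langle c_m:m<\omega\rangle\subseteq\omega$. An $(S,\iota,\bar T,\bar c)$-brick is a tuple $\mathfrak b=(w^{\mathfrak b},n^{\mathfrak b},\bar\eta^{\mathfrak b},\bar h^{\mathfrak b},\bar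 g^{\mathfrak b},\mathcal M^{\mathfrak b})=(w,n,\bar\eta,\bar h,\bar g,\mathcal M)$ such that: $(\boxplus)_1$ $w\in[\omega]^{<\omega}$, $|w|\ge3$, $0<n<\omega$. $(\boxplus)_2$ $\bar\eta=\langle\eta_a:a\in w\rangle$ is a sequence of linearly independent vectors in ${}^n2$ over $\mathbb Z_2$. $(\boxplus)_3$ $\bar h=\langle h_i:i<\iota\rangle$, $h_i:w^{\langle2\rangle}\to\omega$, $c_{h_i(a,b)}\le n$ for all $(a,b)\in w^{\langle2\rangle}$, $i<\iota$; $\bar g=\langle g_i:i<\iota\rangle$, $g_i:w^{\langle2\rangle}\to\bigcup_{m<\omega}(T_m\cap{}^n2)$. $(\boxplus)_4$ Letting $n^*=n$, $u^*=\{\eta_a:a\in w\}$, $h_i^*(\eta_a,\eta_b)=h_i(a,b)$, $g_i^*(\eta_a,\eta_b)=g_i(a,b)$, we have $(n^*,u^*,\bar h^*,\bar g^* )\in\mathbf M_{\bar T,\iota}$. $(\boxplus)_5$ $\mathcal M$ consists of all $\mathbf m\in\mathbf M_{\bar T,\iota}$ such that for some $\ell_*,w_*$: $w_*\subseteq w$, $|w_*|\ge3$, $0<\ell_{\mathbf m}=\ell_*\le n$, and $c_{h_i(a,b)}\le\ell_*$ for all $(a,b)\in(w_* )^{\langle2\rangle}$, $i<\iota$; $u_{\mathbf m}=\{\eta_a\restriction\ell_*:a\in w_*\}$ and $\eta_a\restriction\ell_*\ne\eta_b\restriction\ell_*$ for distinct $a,b\in w_*$; $h_i^{\mathbf m}(\eta_a\restriction\ell_*,\eta_b\restriction\ell_*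 )=h_i(a,b)$ and $g_i^{\mathbf m}(\eta_a\restriction\ell_*,\eta_b\restriction\ell_* )=g_i(a,b)\restriction\ell_*$ for $(a,b)\in (w_* )^{\langle 2\rangle}$, $i<\iota$. In this situation we write $\mathbf m=\mathbf m(\ell_*,w_* )$. $(\boxplus)_6$ If $\mathbf m(\ell,w_0),\mathbf m(\ell,w_1)\in\mathcal M$, $\rho\in{}^\ell2$ and $\mathbf m(\ell,w_0)\doteqdot\mathbf m(\ell,w_1)+\rho$, then the order isomorphism $\pi:w_0\to w_1$ is a quasi-embedding (into $S$) and $(\eta_a\restriction\ell)+\rho=\eta_{\pi(a)}\restriction\ell$ for all $a\in w_0$. $(\boxplus)_7$ If $\mathbf m(\ell_*,w_* )\in\mathcal M$, $a\in w_*$, $|a\cap w_*|=\bar k(w_* )$, $\bar r(w_* )=0$ and $\mathbf m(\ell_*,w_* )\sqsubseteq^*\mathbf n\in\mathcal M$, then $|\{\nu\in u_{\mathbf n}:(\eta_a\restriction\ell_* )\trianglelefteq\nu\}|=1$. For bricks, $\mathfrak b_0\Subset\mathfrak b_1$ iff $w^{\mathfrak b_0}\subseteq w^{\mathfrak b_1}$, $n^{\mathfrak b_0}\le n^{\mathfrak b_1}$, $\eta_a^{\mathfrak b_0}\trianglelefteq\eta_a^{\mathfrak b_1}$ for $a\in w^{\mathfrak b_0}$, and $h_i^{\mathfrak b_1}\restriction(w^{\mathfrak b_0})^{\langle2\rangle}=h_i^{\mathfrak b_0}$, $g_i^{\mathfrak b_0}(a,b)\trianglelefteq g_i^{\mathfrak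 b_1}(a,b)$ for $i<\iota$, $(a,b)\in(w^{\mathfrak b_0})^{\langle2\rangle}$. For $w^*\subseteq w^{\mathfrak b}$ with $|w^*|\ge3$, $\mathfrak b\restriction w^*$ is the unique brick $\mathfrak b^*$ with $w^{\mathfrak b^*}=w^*$, $n^{\mathfrak b^*}=n^{\mathfrak b}$, $\mathfrak b^*\Subset\mathfrak b$. For a quasi-embedding $\varphi:w^{\mathfrak b}\to\omega$ (into $S$), $\varphi(\mathfrak b)$ is the unique brick $\mathfrak b^*$ with $w^{\mathfrak b^*}=\varphi[w^{\mathfrak b}]$, $n^{\mathfrak b^*}=n^{\mathfrak b}$, $\mathcal M^{\mathfrak b^*}=\mathcal M^{\mathfrak b}$, $\eta^{\mathfrak b}_a=\eta^{\mathfrak b^*}_{\varphi(a)}$, $h_i^{\mathfrak b}(a,b)=h_i^{\mathfrak b^*}(\varphi(a),\varphi(b))$, $g_i^{\mathfrak b}(a,b)=g_i^{\mathfrak b^*}(\varphi(a),\varphi(b))$. **Controlled amalgamation.** $\bar T$ has the $(\bar c,S)$-controlled amalgamation property if there is a sequence $\langle\mathfrak b_n:n<\omega\rangle$ of $(S,\iota,\bar T,\bar c)$-bricks such that: (1) $\mathfrak b_n\Subset\mathfrak b_{n+1}$ for each $n$; (2) $\bigcup_nw^{\mathfrak b_n}=\omega$ and $\lim_{n\to\infty}n^{\mathfrak b_n}=\infty$; (3) if (a) $n<\omega$, $u\subseteq w\subseteq w^{\mathfrak b_n}$, $|w|\ge3$, (b) $\bar k(v\cup\{\delta\})\ne|\delta\cap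 v|$ whenever $v\subseteq u$, $\delta\in w\setminus u$ and $\bar r(v\cup\{\delta\})=0$, and (c) $\pi_0,\pi_1:w\to\omega$ are quasi-embeddings (into $S$) with $\pi_0(a)=\pi_1(a)$ for $a\in u$ and $\pi_0[w\setminus u]\cap\pi_1[w\setminus u]=\emptyset$, then there are $K<\omega$ and a quasi-embedding $\pi:\mathrm{rng}(\pi_0)\cup\mathrm{rng}(\pi_1)\to w^{\mathfrak b_K}$ (into $S$) such that $(\pi\circ\pi_0)(\mathfrak b_n\restriction w)\Subset\mathfrak b_K\restriction(\pi\circ\pi_0[w])$ and $(\pi\circ\pi_1)(\mathfrak b_n\restriction w)\Subset\mathfrak b_K\restriction(\pi\circ\pi_1[w])$; (4) if $n<\omega$, $w\subseteq w^{\mathfrak b_n}$, $|w|\ge3$, $\pi_0:w\to\omega$ is a quasi-embedding (into $S$) and $\mathrm{rng}(\pi_0)\subseteq u\in[\omega]^{<\omega}$, then there are $K<\omega$ and a quasi-embedding $\pi:u\to w^{\mathfrak b_K}$ (into $S$) such that $(\pi\circ\pi_0)(\mathfrak b_n\restriction w)\Subset\mathfrak b_K\restriction(\pi\circ\pi_0[w])$. **Non-disjointness rank.** For $\mathbf m,\mathbf n\in\mathbf M_{\bar T,\iota}$, $\mathbf n$ extends $\mathbf m$ ($\mathbf m\sqsubseteq\mathbf n$) iff $\ell_{\mathbf m}\le\ell_{\mathbf n}$, $u_{\mathbf m}=\{\eta\restriction\ell_{\mathbf m}:\eta\in u_{\mathbf n}\}$, and for every $(\eta,\nu)\in(u_{\mathbf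 n})^{\langle2\rangle}$ with $\eta\restriction\ell_{\mathbf m}\ne\nu\restriction\ell_{\mathbf m}$ and each $i<\iota$: $h_i^{\mathbf m}(\eta\restriction\ell_{\mathbf m},\nu\restriction\ell_{\mathbf m})=h_i^{\mathbf n}(\eta,\nu)$ and $g_i^{\mathbf m}(\eta\restriction\ell_{\mathbf m},\nu\restriction\ell_{\mathbf m})=g_i^{\mathbf n}(\eta,\nu)\restriction\ell_{\mathbf m}$. The function $\mathrm{ndrk}_\iota:\mathbf M_{\bar T,\iota}\to\mathrm{ON}\cup\{\infty\}$ is defined by declaring when $\mathrm{ndrk}_\iota(\mathbf m)\ge\alpha$: always for $\alpha=0$; for limit $\alpha$ iff $\mathrm{ndrk}_\iota(\mathbf m)\ge\beta$ for all $\beta<\alpha$; for $\alpha=\beta+1$ iff for every $\nu\in u_{\mathbf m}$ there is $\mathbf n\in\mathbf M_{\bar T,\iota}$ with $\ell_{\mathbf n}>\ell_{\mathbf m}$, $\mathbf m\sqsubseteq\mathbf n$, $\mathrm{ndrk}_\iota(\mathbf n)\ge\beta$ and $|\{\eta\in u_{\mathbf n}:\nu\vartriangleleft\eta\}|\ge2$; and $\mathrm{ndrk}_\iota(\mathbf m)=\infty$ iff $\mathrm{ndrk}_\iota(\mathbf m)\ge\alpha$ for all ordinals $\alpha$. Put $\mathrm{ndrk}_\iota(\bar T)=\sup\{\mathrm{ndrk}_\iota(\mathbf m):\mathbf m\in\mathbf M_{\bar T,\iota}\}$. *)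

theory Defs
  imports
    Complex_Main
    "HOL-Library.Countable_Set"
    "HOL-Library.FuncSet"
    "HOL-Library.Sublist"
    "HOL-Library.Z2"
begin

section \<open>Ordinals\<close>

text \<open>
  Ordinals are rendered as elements of a well-ordered type, an element \<open>a\<close> standing for the order
  type of \<open>{..<a}\<close>.  The class below only asks that the type be uncountable, so that it contains
  (at least) all ordinals below \<open>\<omega>\<^sub>1\<close>; it may be arbitrarily long, and statements are polymorphic in it.
  An element \<open>a\<close> is below \<open>\<omega>\<^sub>1\<close> iff \<open>{..<a}\<close> is countable.
\<close>

class ordinals = wellorder +
  assumes uncountable_ordinals: "uncountable (UNIV :: 'a set)"

definition ozero :: "'o::wellorder" where
  "ozero = (LEAST a. True)"

definition osuc :: "'o::wellorder \<Rightarrow> 'o" where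
  "osuc a = (LEAST b. a < b)"

text \<open>\<^term>\<open>osuc a\<close> is unspecified if \<open>a\<close> is the largest element of the type; below, it is only
  applied to elements that have something above them.\<close>

definition olimit :: "'o::wellorder \<Rightarrow> bool" where
  "olimit a \<longleftrightarrow> a \<noteq> ozero \<and> (\<forall>b<a. osuc b < a)"

definition omega :: "'o::wellorder" where
  "omega = (LEAST a. olimit a)"

definition ord_of_nat :: "nat \<Rightarrow> 'o::wellorder" where
  "ord_of_nat n = (osuc ^^ n) ozero"

text \<open>\<open>a + b\<close> is the least ordinal that is \<open>\<ge> a\<close> and above \<open>a + c\<close> for all \<open>c < b\<close>;
  \<open>a \<cdot> b\<close> is the supremum of \<open>a \<cdot> c + a\<close> over \<open>c < b\<close> (that is, \<open>b\<close> consecutive copies of \<open>a\<close>).\<close>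

function ord_add :: "'o::wellorder \<Rightarrow> 'o \<Rightarrow> 'o" (infixl "\<oplus>" 65) where
  "a \<oplus> b = (LEAST d. a \<le> d \<and> (\<forall>c\<in>{..<b}. a \<oplus> c < d))"
  by auto
termination
  by (relation "inv_image {(x, y). x < y} snd") (auto intro: wf_inv_image wf)

declare ord_add.simps [simp del]

function ord_mult :: "'o::wellorder \<Rightarrow> 'o \<Rightarrow> 'o" (infixl "\<otimes>" 70) where
  "a \<otimes> b = (LEAST d. \<forall>c\<in>{..<b}. (a \<otimes> c) \<oplus> a \<le> d)"
  by auto
termination
  by (relation "inv_image {(x, y). x < y} snd") (auto intro: wf_inv_image wf)

declare ord_mult.simps [simp del]

text \<open>Ordinals extended by a largest element \<open>\<infinity>\<close>.\<close>

datatype 'o rank_value = Rank 'o | Infinite_Rank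

instantiation rank_value :: (wellorder) wellorder
begin

definition less_eq_rank_value :: "'a rank_value \<Rightarrow> 'a rank_value \<Rightarrow> bool" where
  "x \<le> y \<longleftrightarrow> (case y of Infinite_Rank \<Rightarrow> True
    | Rank b \<Rightarrow> (case x of Infinite_Rank \<Rightarrow> False | Rank a \<Rightarrow> a \<le> b))"

definition less_rank_value :: "'a rank_value \<Rightarrow> 'a rank_value \<Rightarrow> bool" where
  "x < y \<longleftrightarrow> x \<le> y \<and> \<not> y \<le> (x :: 'a rank_value)"

instance
proof
  fix P :: "'a rank_value \<Rightarrow> bool" and x
  assume step: "\<And>x. (\<And>y. y < x \<Longrightarrow> P y) \<Longrightarrow> P x"
  have *: "P (Rank a)" for a
  proof (induction a rule: less_induct)
    case (less a)
    show ?case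
      by (rule step)
        (use less in \<open>auto simp: less_rank_value_def less_eq_rank_value_def split: rank_value.splits\<close>)
  qed
  show "P x"
  proof (cases x)
    case Infinite_Rank
    show ?thesis unfolding Infinite_Rank
    proof (rule step)
      fix y :: "'a rank_value"
      assume "y < Infinite_Rank"
      then show "P y"
        using * by (cases y) (auto simp: less_rank_value_def less_eq_rank_value_def)
    qed
  qed (use * in auto)
qed (auto simp: less_rank_value_def less_eq_rank_value_def split: rank_value.splits)

end

text \<open>The class is inhabited: \<open>\<omega>\<^sub>1\<close> itself is an instance.\<close>

typedef omega1 = "Field (cardSuc natLeq)"
  using Field_cardSuc_not_empty[OF natLeq_Card_order] by auto

instantiation omega1 :: ordinals
begin

definition less_eq_omega1 :: "omega1 \<Rightarrow> omega1 \<Rightarrow> bool" where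
  "x \<le> y \<longleftrightarrow> (Rep_omega1 x, Rep_omega1 y) \<in> cardSuc natLeq"

definition less_omega1 :: "omega1 \<Rightarrow> omega1 \<Rightarrow> bool" where
  "x < y \<longleftrightarrow> x \<le> y \<and> \<not> y \<le> (x :: omega1)"

instance
proof
  let ?r = "cardSuc natLeq"
  have wo: "Well_order ?r"
    by (rule cardSuc_Well_order[OF natLeq_Card_order])
  then have refl: "Refl ?r" and trans: "trans ?r" and antisym: "antisym ?r" and tot: "Total ?r"
    and wf: "wf (?r - Id)"
    unfolding well_order_on_def linear_order_on_def partial_order_on_def preorder_on_def by auto
  fix x y z :: omega1
  show "x < y \<longleftrightarrow> x \<le> y \<and> \<not> y \<le> x"
    by (rule less_omega1_def)
  show "x \<le> x"
    using refl Rep_omega1[of x] by (auto simp: less_eq_omega1_def refl_on_def)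
  show "x \<le> z" if "x \<le> y" "y \<le> z"
    using that trans by (auto simp: less_eq_omega1_def elim: transE)
  show "x = y" if "x \<le> y" "y \<le> x"
    using that antisym by (auto simp: less_eq_omega1_def Rep_omega1_inject dest: antisymD)
  show "x \<le> y \<or> y \<le> x"
    using tot refl Rep_omega1[of x] Rep_omega1[of y]
    by (cases "x = y") (auto simp: less_eq_omega1_def total_on_def refl_on_def Rep_omega1_inject)
  show "P x" if step: "\<And>x. (\<And>y. y < x \<Longrightarrow> P y) \<Longrightarrow> P x" for P
  proof (induction x rule: wf_induct_rule[OF wf_inv_image[OF wf, of Rep_omega1]])
    case (1 x)
    show ?case
      by (rule step, rule 1)
        (use refl Rep_omega1 in \<open>auto simp: less_omega1_def less_eq_omega1_def refl_on_def\<close>)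
  qed
  show "uncountable (UNIV :: omega1 set)"
  proof
    assume "countable (UNIV :: omega1 set)"
    then have "countable (range Rep_omega1)"
      by (rule countable_image)
    then have "countable (Field ?r)"
      using type_definition.Rep_range[OF type_definition_omega1] by simp
    then have "(card_of (Field ?r), card_of (UNIV :: nat set)) \<in> ordLeq"
      unfolding countable_def card_of_ordLeq[symmetric] by auto
    moreover have "(card_of (Field ?r), ?r) \<in> ordIso"
      by (rule card_of_Field_ordIso[OF cardSuc_Card_order[OF natLeq_Card_order]])
    ultimately have "(?r, natLeq) \<in> ordLeq"
      using card_of_nat ordIso_symmetric ordIso_ordLeq_trans ordLeq_ordIso_trans by blast
    moreover have "(natLeq, ?r) \<in> ordLess"
      by (rule cardSuc_greater[OF natLeq_Card_order])
    ultimately show False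
      using not_ordLess_ordLeq by blast
  qed
qed

end


section \<open>YZR-systems\<close>

text \<open>\<open>yr, yj, yk\<close> matter only on nonempty finite subsets of \<open>yX\<close>; every notion below looks at them
  only there.  The system is polymorphic in the index type, so that \<open>\<omega>\<close> as a set of ordinals is
  simply \<open>UNIV :: nat set\<close>.\<close>

record ('x, 'o) yzr =
  yX :: "'x set"
  yr :: "'x set \<Rightarrow> 'o"
  yj :: "'x set \<Rightarrow> nat"
  yk :: "'x set \<Rightarrow> nat"

definition fin_subsets :: "'x set \<Rightarrow> 'x set set" where
  "fin_subsets X = {w. w \<subseteq> X \<and> finite w \<and> w \<noteq> {}}"

definition yzr_system :: "'o::wellorder \<Rightarrow> ('x::wellorder, 'o) yzr \<Rightarrow> bool" where
  "yzr_system \<epsilon> s \<longleftrightarrow>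
     yX s \<noteq> {} \<and>
     (\<forall>w\<in>fin_subsets (yX s). yr s w \<le> \<epsilon>) \<and>
     (\<forall>w\<in>fin_subsets (yX s). \<forall>u. u \<noteq> {} \<and> u \<subseteq> w \<longrightarrow> yr s w \<le> yr s u) \<and>
     (\<forall>a\<in>yX s. ozero < yr s {a}) \<and>
     (\<forall>w\<in>fin_subsets (yX s). yk s w < card w \<and>
        \<not> (\<exists>b\<in>yX s - w. card (w \<inter> {..<b}) = yk s w \<and>
             yj s (insert b (w - {sorted_list_of_set w ! yk s w})) = yj s w \<and>
             yr s (insert b w) = yr s w))"

definition quasi_embedding ::
    "('x::wellorder, 'o::wellorder) yzr \<Rightarrow> ('y::wellorder, 'o) yzr \<Rightarrow> ('x \<Rightarrow> 'y) \<Rightarrow> bool" where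
  "quasi_embedding q s \<phi> \<longleftrightarrow>
     \<phi> ` yX q \<subseteq> yX s \<and> strict_mono_on (yX q) \<phi> \<and>
     (\<forall>v\<in>fin_subsets (yX q).
        yr s (\<phi> ` v) = yr q v \<and> yk s (\<phi> ` v) = yk q v \<and>
        (ozero < yr q v \<longrightarrow> yj s (\<phi> ` v) = yj q v))"

definition yzr_restrict :: "('x, 'o) yzr \<Rightarrow> 'x set \<Rightarrow> ('x, 'o) yzr" where
  "yzr_restrict s w = s\<lparr>yX := w\<rparr>"

definition quasi_embedding_on ::
    "('x::wellorder, 'o::wellorder) yzr \<Rightarrow> 'x set \<Rightarrow> ('x \<Rightarrow> 'x) \<Rightarrow> bool" where
  "quasi_embedding_on s w \<phi> \<longleftrightarrow> w \<subseteq> yX s \<and> quasi_embedding (yzr_restrict s w) s \<phi>"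

definition cute :: "'o::wellorder \<Rightarrow> (nat, 'o) yzr \<Rightarrow> bool" where
  "cute \<epsilon> S \<longleftrightarrow> yzr_system \<epsilon> S \<and> yX S = UNIV \<and>
     (\<forall>q :: ('o, 'o) yzr. yzr_system \<epsilon> q \<and> finite (yX q) \<longrightarrow>
        (\<forall>M. \<exists>\<phi>. quasi_embedding q S \<phi> \<and> \<phi> ` yX q \<subseteq> {M..}))"


section \<open>0-1 sequences and trees\<close>

text \<open>Elements of \<open>\<^sup>n2\<close> are lists of length \<open>n\<close> over the field \<open>\<int>\<^sub>2\<close>, elements of \<open>\<^sup>\<omega>2\<close> are functions
  from \<open>nat\<close> to it; the relation \<open>\<trianglelefteq>\<close> on finite sequences is \<^const>\<open>prefix\<close>.\<close>

definition seq_add :: "bit list \<Rightarrow> bit list \<Rightarrow> bit list" where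
  "seq_add x y = map2 (+) x y"

definition cantor_add :: "(nat \<Rightarrow> bit) \<Rightarrow> (nat \<Rightarrow> bit) \<Rightarrow> (nat \<Rightarrow> bit)" where
  "cantor_add F G = (\<lambda>n. F n + G n)"

definition initial_of :: "bit list \<Rightarrow> (nat \<Rightarrow> bit) \<Rightarrow> bool" where
  "initial_of x F \<longleftrightarrow> map F [0..<length x] = x"

definition off_diag :: "'a set \<Rightarrow> ('a \<times> 'a) set" where
  "off_diag u = {(x, y). x \<in> u \<and> y \<in> u \<and> x \<noteq> y}"

definition tree :: "bit list set \<Rightarrow> bool" where
  "tree T \<longleftrightarrow> (\<forall>x\<in>T. \<forall>y. strict_prefix y x \<longrightarrow> y \<in> T)"

definition no_maximal_nodes :: "bit list set \<Rightarrow> bool" where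
  "no_maximal_nodes T \<longleftrightarrow> (\<forall>x\<in>T. \<exists>y\<in>T. strict_prefix x y)"

definition tree_lim :: "bit list set \<Rightarrow> (nat \<Rightarrow> bit) set" where
  "tree_lim T = {F. \<forall>n. map F [0..<n] \<in> T}"

definition lin_indep_seqs :: "nat \<Rightarrow> 'a set \<Rightarrow> ('a \<Rightarrow> bit list) \<Rightarrow> bool" where
  "lin_indep_seqs n w \<eta> \<longleftrightarrow>
     (\<forall>c :: 'a \<Rightarrow> bit. (\<forall>i<n. (\<Sum>a\<in>w. c a * \<eta> a ! i) = 0) \<longrightarrow> (\<forall>a\<in>w. c a = 0))"


section \<open>The family M\<close>

text \<open>The functions in a tuple are \<^const>\<open>undefined\<close> outside their domains (this is what
  \<open>\<rightarrow>\<^sub>E\<close> enforces below), so that equality of tuples is set-theoretic equality.\<close>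

record mtuple =
  ml :: nat
  mu :: "bit list set"
  mh :: "nat \<Rightarrow> bit list \<times> bit list \<Rightarrow> nat"
  mg :: "nat \<Rightarrow> bit list \<times> bit list \<Rightarrow> bit list"

definition M_family :: "nat \<Rightarrow> (nat \<Rightarrow> bit list set) \<Rightarrow> mtuple set" where
  "M_family \<iota> T = {m.
     0 < ml m \<and> mu m \<subseteq> {x. length x = ml m} \<and> 2 \<le> card (mu m) \<and>
     mh m \<in> {..<\<iota>} \<rightarrow>\<^sub>E (off_diag (mu m) \<rightarrow>\<^sub>E UNIV) \<and>
     mg m \<in> {..<\<iota>} \<rightarrow>\<^sub>E (off_diag (mu m) \<rightarrow>\<^sub>E (\<Union>n. T n \<inter> {x. length x = ml m})) \<and>
     (\<forall>i<\<iota>. \<forall>(\<eta>, \<nu>)\<in>off_diag (mu m).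
        mg m i (\<eta>, \<nu>) \<in> T (mh m i (\<eta>, \<nu>)) \<and> length (mg m i (\<eta>, \<nu>)) = ml m) \<and>
     (\<forall>i<\<iota>. \<forall>(\<eta>, \<nu>)\<in>off_diag (mu m).
        seq_add \<eta> (mg m i (\<eta>, \<nu>)) = seq_add \<nu> (mg m i (\<nu>, \<eta>))) \<and>
     (\<forall>(\<eta>, \<nu>)\<in>off_diag (mu m).
        distinct (concat (map (\<lambda>i. [mg m i (\<eta>, \<nu>), mg m i (\<nu>, \<eta>)]) [0..<\<iota>]))) \<and>
     (\<exists>F G.
        (\<forall>\<eta>\<in>mu m. initial_of \<eta> (F \<eta>)) \<and>
        (\<forall>i<\<iota>. \<forall>(\<eta>, \<nu>)\<in>off_diag (mu m).
           initial_of (mg m i (\<eta>, \<nu>)) (G i (\<eta>, \<nu>)) \<and>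
           G i (\<eta>, \<nu>) \<in> tree_lim (T (mh m i (\<eta>, \<nu>))) \<and>
           cantor_add (F \<eta>) (G i (\<eta>, \<nu>)) = cantor_add (F \<nu>) (G i (\<nu>, \<eta>))))}"

text \<open>\<open>m + \<rho>\<close>; note that \<open>\<eta> \<mapsto> \<eta> + \<rho>\<close> is its own inverse.\<close>

definition m_shift :: "nat \<Rightarrow> mtuple \<Rightarrow> bit list \<Rightarrow> mtuple" where
  "m_shift \<iota> m \<rho> =
     (let u' = (\<lambda>\<eta>. seq_add \<eta> \<rho>) ` mu m in
      \<lparr>ml = ml m, mu = u',
       mh = (\<lambda>i\<in>{..<\<iota>}. \<lambda>(\<eta>, \<nu>)\<in>off_diag u'. mh m i (seq_add \<eta> \<rho>, seq_add \<nu> \<rho>)),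
       mg = (\<lambda>i\<in>{..<\<iota>}. \<lambda>(\<eta>, \<nu>)\<in>off_diag u'. mg m i (seq_add \<eta> \<rho>, seq_add \<nu> \<rho>))\<rparr>)"

text \<open>The condition on a pair \<open>(\<eta>, \<nu>)\<close> shared by the relations \<open>\<sqsubseteq>\<^sup>*\<close> and \<open>\<doteqdot>\<close>.\<close>

definition ess_agree :: "nat \<Rightarrow> mtuple \<Rightarrow> mtuple \<Rightarrow> bit list \<Rightarrow> bit list \<Rightarrow> bool" where
  "ess_agree \<iota> m n \<eta> \<nu> \<longleftrightarrow>
     (let \<eta>' = take (ml m) \<eta>; \<nu>' = take (ml m) \<nu>;
          g = (\<lambda>i x y. mg m i (x, y));
          g' = (\<lambda>i x y. take (ml m) (mg n i (x, y)))
      in (\<iota> > 2 \<longrightarrow>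
            {{g i \<eta>' \<nu>', g i \<nu>' \<eta>'} | i. i < \<iota>} = {{g' i \<eta> \<nu>, g' i \<nu> \<eta>} | i. i < \<iota>}) \<and>
         (\<iota> = 2 \<longrightarrow>
            {g 0 \<eta>' \<nu>', g 0 \<nu>' \<eta>', g 1 \<eta>' \<nu>', g 1 \<nu>' \<eta>'} =
            {g' 0 \<eta> \<nu>, g' 0 \<nu> \<eta>, g' 1 \<eta> \<nu>, g' 1 \<nu> \<eta>}) \<and>
         (\<forall>i<\<iota>. \<forall>j<\<iota>.
            (g i \<eta>' \<nu>' = g' j \<eta> \<nu> \<longrightarrow> mh m i (\<eta>', \<nu>') = mh n j (\<eta>, \<nu>)) \<and>
            (g i \<eta>' \<nu>' = g' j \<nu> \<eta> \<longrightarrow> mh m i (\<eta>', \<nu>') = mh n j (\<nu>, \<eta>))))"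

definition ess_extends :: "nat \<Rightarrow> mtuple \<Rightarrow> mtuple \<Rightarrow> bool" where
  "ess_extends \<iota> m n \<longleftrightarrow>
     ml m \<le> ml n \<and> mu m = take (ml m) ` mu n \<and>
     (\<forall>(\<eta>, \<nu>)\<in>off_diag (mu n). take (ml m) \<eta> \<noteq> take (ml m) \<nu> \<longrightarrow> ess_agree \<iota> m n \<eta> \<nu>)"

definition ess_same :: "nat \<Rightarrow> mtuple \<Rightarrow> mtuple \<Rightarrow> bool" where
  "ess_same \<iota> m n \<longleftrightarrow>
     ml m = ml n \<and> mu m = mu n \<and> (\<forall>(\<eta>, \<nu>)\<in>off_diag (mu m). ess_agree \<iota> m n \<eta> \<nu>)"

definition extends :: "nat \<Rightarrow> mtuple \<Rightarrow> mtuple \<Rightarrow> bool" where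
  "extends \<iota> m n \<longleftrightarrow>
     ml m \<le> ml n \<and> mu m = take (ml m) ` mu n \<and>
     (\<forall>(\<eta>, \<nu>)\<in>off_diag (mu n). take (ml m) \<eta> \<noteq> take (ml m) \<nu> \<longrightarrow>
        (\<forall>i<\<iota>. mh m i (take (ml m) \<eta>, take (ml m) \<nu>) = mh n i (\<eta>, \<nu>) \<and>
               mg m i (take (ml m) \<eta>, take (ml m) \<nu>) = take (ml m) (mg n i (\<eta>, \<nu>))))"


section \<open>Bricks\<close>

record brick =
  bw :: "nat set"
  bn :: nat
  beta :: "nat \<Rightarrow> bit list"
  bh :: "nat \<Rightarrow> nat \<times> nat \<Rightarrow> nat"
  bg :: "nat \<Rightarrow> nat \<times> nat \<Rightarrow> bit list"
  bM :: "mtuple set"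

text \<open>\<open>induced \<iota> b l w m\<close>: the components of \<open>m\<close> are read off from the restrictions to length \<open>l\<close> of
  the sequences of \<open>b\<close> with indices in \<open>w\<close>.  Among the members of \<^const>\<open>M_family\<close> this determines \<open>m\<close>.\<close>

definition induced :: "nat \<Rightarrow> brick \<Rightarrow> nat \<Rightarrow> nat set \<Rightarrow> mtuple \<Rightarrow> bool" where
  "induced \<iota> b l w m \<longleftrightarrow>
     ml m = l \<and> mu m = (\<lambda>a. take l (beta b a)) ` w \<and> inj_on (\<lambda>a. take l (beta b a)) w \<and>
     (\<forall>i<\<iota>. \<forall>(a, a')\<in>off_diag w.
        mh m i (take l (beta b a), take l (beta b a')) = bh b i (a, a') \<and>
        mg m i (take l (beta b a), take l (beta b a')) = take l (bg b i (a, a')))"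

text \<open>\<open>m = m(l, w)\<close> and \<open>m \<in> \<M>\<close>; as \<open>l\<close> and \<open>w\<close> are existentially quantified in the definition of
  \<open>\<M>\<close>, they are arguments here.\<close>

definition brick_m ::
    "nat \<Rightarrow> (nat \<Rightarrow> bit list set) \<Rightarrow> (nat \<Rightarrow> nat) \<Rightarrow> brick \<Rightarrow> nat \<Rightarrow> nat set \<Rightarrow> mtuple \<Rightarrow> bool" where
  "brick_m \<iota> T c b l w m \<longleftrightarrow>
     m \<in> M_family \<iota> T \<and> w \<subseteq> bw b \<and> 3 \<le> card w \<and> 0 < l \<and> l \<le> bn b \<and>
     (\<forall>i<\<iota>. \<forall>p\<in>off_diag w. c (bh b i p) \<le> l) \<and> induced \<iota> b l w m"

text \<open>The sequences of \<open>b\<close> have length \<open>bn b\<close>, so the truncation in \<open>induced \<iota> b (bn b) (bw b) m\<close>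
  is vacuous and \<open>m\<close> is the whole brick read as a member of \<^const>\<open>M_family\<close>.\<close>

definition is_brick ::
    "(nat, 'o::wellorder) yzr \<Rightarrow> nat \<Rightarrow> (nat \<Rightarrow> bit list set) \<Rightarrow> (nat \<Rightarrow> nat) \<Rightarrow> brick \<Rightarrow> bool" where
  "is_brick S \<iota> T c b \<longleftrightarrow>
     (finite (bw b) \<and> 3 \<le> card (bw b) \<and> 0 < bn b) \<and>
     (beta b \<in> bw b \<rightarrow>\<^sub>E {x. length x = bn b} \<and> lin_indep_seqs (bn b) (bw b) (beta b)) \<and>
     (bh b \<in> {..<\<iota>} \<rightarrow>\<^sub>E (off_diag (bw b) \<rightarrow>\<^sub>E UNIV) \<and>
      (\<forall>i<\<iota>. \<forall>p\<in>off_diag (bw b). c (bh b i p) \<le> bn b) \<and>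
      bg b \<in> {..<\<iota>} \<rightarrow>\<^sub>E (off_diag (bw b) \<rightarrow>\<^sub>E (\<Union>m. T m \<inter> {x. length x = bn b}))) \<and>
     (\<exists>m\<in>M_family \<iota> T. induced \<iota> b (bn b) (bw b) m) \<and>
     bM b = {m. \<exists>l w. brick_m \<iota> T c b l w m} \<and>
     (\<forall>l w0 w1 m0 m1 \<rho>.
        brick_m \<iota> T c b l w0 m0 \<and> brick_m \<iota> T c b l w1 m1 \<and> length \<rho> = l \<and>
        ess_same \<iota> m0 (m_shift \<iota> m1 \<rho>) \<longrightarrow>
        (\<exists>\<pi>. strict_mono_on w0 \<pi> \<and> \<pi> ` w0 = w1 \<and> quasi_embedding_on S w0 \<pi> \<and>
             (\<forall>a\<in>w0. seq_add (take l (beta b a)) \<rho> = take l (beta b (\<pi> a))))) \<and>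
     (\<forall>l w m n a.
        brick_m \<iota> T c b l w m \<and> a \<in> w \<and> card (w \<inter> {..<a}) = yk S w \<and> yr S w = ozero \<and>
        n \<in> bM b \<and> ess_extends \<iota> m n \<longrightarrow>
        card {\<nu> \<in> mu n. prefix (take l (beta b a)) \<nu>} = 1)"

definition brick_le :: "nat \<Rightarrow> brick \<Rightarrow> brick \<Rightarrow> bool" where
  "brick_le \<iota> b0 b1 \<longleftrightarrow>
     bw b0 \<subseteq> bw b1 \<and> bn b0 \<le> bn b1 \<and> (\<forall>a\<in>bw b0. prefix (beta b0 a) (beta b1 a)) \<and>
     (\<forall>i<\<iota>. \<forall>p\<in>off_diag (bw b0). bh b1 i p = bh b0 i p \<and> prefix (bg b0 i p) (bg b1 i p))"

definition brick_restrict ::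
    "(nat, 'o::wellorder) yzr \<Rightarrow> nat \<Rightarrow> (nat \<Rightarrow> bit list set) \<Rightarrow> (nat \<Rightarrow> nat) \<Rightarrow>
     brick \<Rightarrow> nat set \<Rightarrow> brick" where
  "brick_restrict S \<iota> T c b w =
     (THE b'. is_brick S \<iota> T c b' \<and> bw b' = w \<and> bn b' = bn b \<and> brick_le \<iota> b' b)"

definition brick_image ::
    "(nat, 'o::wellorder) yzr \<Rightarrow> nat \<Rightarrow> (nat \<Rightarrow> bit list set) \<Rightarrow> (nat \<Rightarrow> nat) \<Rightarrow>
     (nat \<Rightarrow> nat) \<Rightarrow> brick \<Rightarrow> brick" where
  "brick_image S \<iota> T c \<phi> b =
     (THE b'. is_brick S \<iota> T c b' \<and> bw b' = \<phi> ` bw b \<and> bn b' = bn b \<and> bM b' = bM b \<and>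
        (\<forall>a\<in>bw b. beta b a = beta b' (\<phi> a)) \<and>
        (\<forall>i<\<iota>. \<forall>(x, y)\<in>off_diag (bw b).
           bh b i (x, y) = bh b' i (\<phi> x, \<phi> y) \<and> bg b i (x, y) = bg b' i (\<phi> x, \<phi> y)))"


section \<open>Controlled amalgamation\<close>

definition controlled_amalgamation ::
    "(nat, 'o::wellorder) yzr \<Rightarrow> nat \<Rightarrow> (nat \<Rightarrow> bit list set) \<Rightarrow> (nat \<Rightarrow> nat) \<Rightarrow> bool" where
  "controlled_amalgamation S \<iota> T c \<longleftrightarrow>
     (\<exists>b :: nat \<Rightarrow> brick.
        (\<forall>n. is_brick S \<iota> T c (b n)) \<and>
        (\<forall>n. brick_le \<iota> (b n) (b (Suc n))) \<and>
        ((\<Union>n. bw (b n)) = UNIV \<and> filterlim (\<lambda>n. bn (b n)) at_top sequentially) \<and>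
        (\<forall>n u w \<pi>0 \<pi>1.
           u \<subseteq> w \<and> w \<subseteq> bw (b n) \<and> 3 \<le> card w \<and>
           (\<forall>v \<delta>. v \<subseteq> u \<and> \<delta> \<in> w - u \<and> yr S (insert \<delta> v) = ozero \<longrightarrow>
              yk S (insert \<delta> v) \<noteq> card (v \<inter> {..<\<delta>})) \<and>
           quasi_embedding_on S w \<pi>0 \<and> quasi_embedding_on S w \<pi>1 \<and>
           (\<forall>a\<in>u. \<pi>0 a = \<pi>1 a) \<and> \<pi>0 ` (w - u) \<inter> \<pi>1 ` (w - u) = {} \<longrightarrow>
           (\<exists>K \<pi>. quasi_embedding_on S (\<pi>0 ` w \<union> \<pi>1 ` w) \<pi> \<and>
              \<pi> ` (\<pi>0 ` w \<union> \<pi>1 ` w) \<subseteq> bw (b K) \<and>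
              (\<forall>\<pi>'\<in>{\<pi>0, \<pi>1}.
                 brick_le \<iota> (brick_image S \<iota> T c (\<pi> \<circ> \<pi>') (brick_restrict S \<iota> T c (b n) w))
                            (brick_restrict S \<iota> T c (b K) ((\<pi> \<circ> \<pi>') ` w))))) \<and>
        (\<forall>n w \<pi>0 u.
           w \<subseteq> bw (b n) \<and> 3 \<le> card w \<and> quasi_embedding_on S w \<pi>0 \<and>
           \<pi>0 ` w \<subseteq> u \<and> finite u \<longrightarrow>
           (\<exists>K \<pi>. quasi_embedding_on S u \<pi> \<and> \<pi> ` u \<subseteq> bw (b K) \<and>
              brick_le \<iota> (brick_image S \<iota> T c (\<pi> \<circ> \<pi>0) (brick_restrict S \<iota> T c (b n) w))
                         (brick_restrict S \<iota> T c (b K) ((\<pi> \<circ> \<pi>0) ` w)))))"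


section \<open>Non-disjointness rank\<close>

text \<open>For \<open>\<alpha> = ozero\<close> both conjuncts are vacuous.\<close>

function ndrk_ge :: "nat \<Rightarrow> (nat \<Rightarrow> bit list set) \<Rightarrow> 'o::wellorder \<Rightarrow> mtuple \<Rightarrow> bool" where
  "ndrk_ge \<iota> T \<alpha> m \<longleftrightarrow>
     (\<forall>\<beta>\<in>{..<\<alpha>}. olimit \<alpha> \<longrightarrow> ndrk_ge \<iota> T \<beta> m) \<and>
     (\<forall>\<beta>\<in>{..<\<alpha>}. \<alpha> = osuc \<beta> \<longrightarrow>
        (\<forall>\<nu>\<in>mu m. \<exists>n. n \<in> M_family \<iota> T \<and> ml n > ml m \<and> extends \<iota> m n \<and> ndrk_ge \<iota> T \<beta> n \<and>
           2 \<le> card {\<eta> \<in> mu n. strict_prefix \<nu> \<eta>}))"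
  by auto
termination
  by (relation "inv_image {(x, y). x < y} (\<lambda>(\<iota>, T, \<alpha>, m). \<alpha>)") (auto intro: wf_inv_image wf)

declare ndrk_ge.simps [simp del]

definition ndrk :: "nat \<Rightarrow> (nat \<Rightarrow> bit list set) \<Rightarrow> mtuple \<Rightarrow> 'o::wellorder rank_value" where
  "ndrk \<iota> T m =
     (if \<forall>\<alpha>::'o. ndrk_ge \<iota> T \<alpha> m then Infinite_Rank
      else Rank (GREATEST \<alpha>. ndrk_ge \<iota> T \<alpha> m))"

definition ndrk_sup :: "nat \<Rightarrow> (nat \<Rightarrow> bit list set) \<Rightarrow> 'o::wellorder rank_value" where
  "ndrk_sup \<iota> T = (LEAST x. \<forall>m\<in>M_family \<iota> T. ndrk \<iota> T m \<le> x)"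

end

theory Submission
  imports Defs "HOL-Library.Nat_Bijection"
begin

text \<open>
  The trees are built together with the bricks, from one limit object, the locale \<open>tower\<close>.  Every index \<open>a\<close> has a branch
  \<open>E a\<close>, every edge \<open>e\<close> (a set of two indices) has branches \<open>Gam i e\<close> and heights \<open>H i e\<close>, the ordered pair \<open>(a, b)\<close> is given the
  branch \<open>E b + Gam i {a, b}\<close>, and \<open>T h\<close> is the tree of all such branches of height \<open>h\<close>.  A stage of the
  construction adds new points to a finite set of indices.  Among them may be two copies of one set of old
  points, as some amalgamation demands; up to the current level a copied point or edge has the branches and
  heights of its original, and from there on all branches are linearly independent.  An edge inside no
  copy is fresh: its heights are used for no other edge.

  Hence heights remember where an edge comes from.  Suppose two configurations of nodes are translates of each
  other, with equal labels.  If a fresh edge occurs, it pins the translation down to 0; otherwise both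
  configurations are copies of configurations of the previous stage.  By induction, translations come
  from quasi-embeddings (\<open>rigid\<close>).  The same induction shows that over a rank zero configuration the critical point
  does not split (\<open>critical_no_split\<close>): only an amalgamation could split it, and the hypothesis of the demand excludes
  this.  These two facts are the substantial clauses in the definition of a brick.

  For the lower bound, doubling a point in a system gives a system whose rank is any prescribed smaller ordinal;
  by cuteness it occurs in \<open>S\<close>, and the corresponding demand provides an extension that splits the
  point.  So configurations of rank \<open>\<epsilon>\<close> have non-disjointness rank at least \<open>\<epsilon>\<close> (\<open>config_rank\<close>).

  For the upper bound, an arbitrary tuple has to be recognised first.  In it, every pair of elements gives two
  different ways of writing their sum as a sum of two nodes.  At brick levels above the thresholds, independence
  permits this only inside one edge, and a tuple with at least five elements turns out to be a translate of a part of a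
  brick (\<open>normal_form\<close>); reaching such a level costs at most \<open>\<omega>\<close> in rank (\<open>normalise\<close>).  Now split the critical point of
  the corresponding set of indices and normalise again.  By rigidity the new set contains a twin of
  the critical point, so by the last axiom of systems the rank \<open>yr\<close> has dropped, and at rank zero there
  is no such split.  So a normal tuple with index set \<open>v\<close> has rank at most \<open>\<omega> \<cdot> yr S v + \<omega>\<close>
  (\<open>placed_rank\<close>).  Starting with an arbitrary tuple, three splits yield five elements and one
  normalisation makes it normal, which gives the bound \<open>\<omega> \<cdot> (\<epsilon> + 2) + 2\<close>.
\<close>

section \<open>Countable ordinals\<close>

lemma ozero_le [simp]: "ozero \<le> (a::'o::wellorder)"
  unfolding ozero_def by (rule Least_le) simp

lemma osuc_le: "(a::'o::wellorder) < b \<Longrightarrow> osuc a \<le> b"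
  unfolding osuc_def by (rule Least_le)

text \<open>Uncountability of the type enters only here: countable sets of countable ordinals have upper bounds.\<close>

lemma countable_bounded:
  fixes A :: "'o::ordinals set"
  assumes "countable A" "\<And>a. a \<in> A \<Longrightarrow> countable {..<a}"
  shows "\<exists>d. \<forall>a\<in>A. a < d"
proof (rule ccontr)
  assume *: "\<not> ?thesis"
  have "countable (\<Union>a\<in>A. insert a {..<a})"
    using assms by auto
  moreover have "(\<Union>a\<in>A. insert a {..<a}) = UNIV"
    using * by (auto simp: not_less le_less)
  ultimately show False
    using uncountable_ordinals by metis
qed

lemma countable_Least_above:
  fixes A :: "'o::ordinals set"
  assumes "countable A" "\<And>a. a \<in> A \<Longrightarrow> countable {..<a}"
    and "\<And>d. d < (LEAST d. P d) \<Longrightarrow> \<exists>a\<in>A. d \<le> a"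
  shows "countable {..<LEAST d. P d}"
proof -
  have "{..<LEAST d. P d} \<subseteq> (\<Union>a\<in>A. insert a {..<a})"
    using assms(3) by (force simp: le_less)
  moreover have "countable (\<Union>a\<in>A. insert a {..<a})"
    using assms by auto
  ultimately show ?thesis
    using countable_subset by blast
qed

lemma less_osuc: "countable {..<a::'o::ordinals} \<Longrightarrow> a < osuc a"
  using countable_bounded[of "{a}"] unfolding osuc_def by (auto intro: LeastI)

lemma less_osuc_iff: "countable {..<b::'o::ordinals} \<Longrightarrow> a < osuc b \<longleftrightarrow> a \<le> b"
  by (meson less_osuc osuc_le le_less_trans leD leI)

lemma countable_osuc:
  assumes "countable {..<a::'o::ordinals}"
  shows "countable {..<osuc a}"
proof -
  have "{..<osuc a} = insert a {..<a}"
    using assms less_osuc_iff by auto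
  then show ?thesis
    using assms by simp
qed

lemma zero_suc_or_limit:
  fixes a :: "'o::wellorder"
  obtains "a = ozero" | b where "b < a" "a = osuc b" | "olimit a"
proof (cases "a = ozero \<or> olimit a")
  case False
  then obtain b where "b < a" "a \<le> osuc b"
    unfolding olimit_def by (meson not_less)
  then show ?thesis
    using osuc_le[of b a] that by force
qed (use that in auto)

lemma countable_ozero [simp]: "countable {..<ozero::'o::wellorder}"
  by (metis ozero_le countable_empty lessThan_iff not_less ex_in_conv)

lemma countable_osuc_funpow:
  "countable {..<a::'o::ordinals} \<Longrightarrow> countable {..<(osuc ^^ n) a}"
  by (induction n) (auto intro: countable_osuc)

lemma countable_ord_of_nat [simp]: "countable {..<ord_of_nat n :: 'o::ordinals}"
  unfolding ord_of_nat_def by (rule countable_osuc_funpow) simp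

lemma ord_of_nat_less_Suc: "(ord_of_nat n :: 'o::ordinals) < ord_of_nat (Suc n)"
  using less_osuc[OF countable_ord_of_nat[of n]] unfolding ord_of_nat_def by simp

lemma strict_mono_ord_of_nat: "strict_mono (ord_of_nat :: nat \<Rightarrow> 'o::ordinals)"
  by (simp add: strict_mono_Suc_iff ord_of_nat_less_Suc)

lemma omega_limit_countable:
  "olimit (omega :: 'o::ordinals) \<and> countable {..<omega :: 'o}"
proof -
  let ?A = "range (ord_of_nat :: nat \<Rightarrow> 'o)"
  let ?P = "\<lambda>d. \<forall>a\<in>?A. a < d"
  define d where "d = (LEAST d. ?P d)"
  have d: "\<forall>a\<in>?A. a < d"
    unfolding d_def by (rule LeastI_ex[OF countable_bounded]) auto
  have below: "\<exists>n. b \<le> ord_of_nat n" if "b < d" for b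
    using not_less_Least[of b ?P] that unfolding d_def by (auto simp: not_less)
  have cd: "countable {..<d}"
    unfolding d_def
    by (rule countable_Least_above[of ?A]) (use below in \<open>auto simp: d_def\<close>)
  have "olimit d"
    unfolding olimit_def
  proof (intro conjI allI impI)
    show "d \<noteq> ozero"
      using d by (metis rangeI ozero_le not_less)
    fix b assume "b < d"
    then obtain n where "b \<le> ord_of_nat n"
      using below by blast
    then have "osuc b \<le> ord_of_nat (Suc n)"
      by (intro osuc_le) (rule le_less_trans[OF _ ord_of_nat_less_Suc])
    then show "osuc b < d"
      using d by (meson rangeI le_less_trans)
  qed
  then have "olimit (omega :: 'o)" "omega \<le> d"
    unfolding omega_def by (auto intro: LeastI Least_le)
  moreover have "countable {..<omega :: 'o}"
    by (rule countable_subset[OF _ cd]) (use \<open>omega \<le> d\<close> in auto)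
  ultimately show ?thesis
    by blast
qed

lemma ord_of_nat_less_omega: "(ord_of_nat n :: 'o::ordinals) < omega"
proof (induction n)
  case 0
  have "omega \<noteq> (ozero :: 'o)"
    using omega_limit_countable[where 'o = 'o] unfolding olimit_def by blast
  then show ?case
    using ozero_le[of "omega :: 'o"] unfolding ord_of_nat_def by (simp add: order.order_iff_strict)
next
  case (Suc n)
  then show ?case
    using omega_limit_countable[where 'o = 'o] unfolding olimit_def ord_of_nat_def by simp
qed

text \<open>Both arithmetic operations are least upper bounds.  Upper bounds exist as long as the arguments are
  countable, and then the values are countable again.\<close>

lemma ord_add_props:
  fixes a b :: "'o::ordinals"
  assumes "countable {..<a}" "countable {..<b}"
  shows "countable {..<a \<oplus> b} \<and> a \<le> a \<oplus> b \<and> (\<forall>c<b. a \<oplus> c < a \<oplus> b)"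
  using assms(2)
proof (induction b rule: less_induct)
  case (less b)
  let ?A = "insert a ((\<oplus>) a ` {..<b})"
  let ?P = "\<lambda>d. a \<le> d \<and> (\<forall>c\<in>{..<b}. a \<oplus> c < d)"
  have c: "countable {..<c}" if "c < b" for c
    by (rule countable_subset[OF _ less.prems]) (use that in auto)
  have eq: "a \<oplus> b = (LEAST d. ?P d)"
    by (rule ord_add.simps)
  have A: "countable ?A" "\<And>x. x \<in> ?A \<Longrightarrow> countable {..<x}"
    using less.prems less.IH c assms(1) by auto
  obtain d0 where d0: "\<forall>x\<in>?A. x < d0"
    using countable_bounded[OF A] by blast
  have P: "?P (a \<oplus> b)"
    unfolding eq by (rule LeastI[of ?P d0]) (use d0 in auto)
  have "countable {..<LEAST d. ?P d}"
  proof (rule countable_Least_above[OF A])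
    fix d assume "d < (LEAST d. ?P d)"
    then have "\<not> ?P d" by (rule not_less_Least)
    then show "\<exists>x\<in>?A. d \<le> x"
      by (auto simp: not_le not_less)
  qed auto
  then show ?case
    using P unfolding eq[symmetric] by auto
qed

lemma ord_add_ozero: "(a::'o::wellorder) \<oplus> ozero = a"
proof -
  have "{..<ozero::'o} = {}"
    by (metis ozero_le lessThan_iff not_less ex_in_conv)
  then show ?thesis
    by (subst ord_add.simps) (auto intro!: Least_equality)
qed

lemma ord_add_osuc:
  fixes a b :: "'o::ordinals"
  assumes "countable {..<a}" "countable {..<b}"
  shows "a \<oplus> osuc b = osuc (a \<oplus> b)"
proof -
  note P = ord_add_props[OF assms]
  have "(LEAST d. a \<le> d \<and> (\<forall>c\<in>{..<osuc b}. a \<oplus> c < d)) = osuc (a \<oplus> b)"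
  proof (rule Least_equality)
    have "a \<oplus> b < osuc (a \<oplus> b)"
      using less_osuc P by blast
    moreover have "a \<oplus> c \<le> a \<oplus> b" if "c < osuc b" for c
      using that P less_osuc_iff[OF assms(2), of c] by (metis le_less)
    ultimately show "a \<le> osuc (a \<oplus> b) \<and> (\<forall>c\<in>{..<osuc b}. a \<oplus> c < osuc (a \<oplus> b))"
      using P by force
    fix d assume "a \<le> d \<and> (\<forall>c\<in>{..<osuc b}. a \<oplus> c < d)"
    then show "osuc (a \<oplus> b) \<le> d"
      using less_osuc[OF assms(2)] by (auto intro: osuc_le)
  qed
  then show ?thesis
    by (subst ord_add.simps)
qed

lemma ord_add_of_nat:
  fixes a :: "'o::ordinals"
  assumes "countable {..<a}"
  shows "a \<oplus> ord_of_nat n = (osuc ^^ n) a"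
proof (induction n)
  case 0
  then show ?case by (simp add: ord_of_nat_def ord_add_ozero)
next
  case (Suc n)
  have "ord_of_nat (Suc n) = osuc (ord_of_nat n :: 'o)"
    by (simp add: ord_of_nat_def)
  then show ?case
    using ord_add_osuc[OF assms countable_ord_of_nat[of n]] Suc by simp
qed

lemma osuc_funpow_less_add_omega:
  fixes a :: "'o::ordinals"
  assumes "countable {..<a}"
  shows "(osuc ^^ n) a < a \<oplus> omega"
  using ord_add_props[OF assms, of omega] omega_limit_countable[where 'o = 'o]
    ord_of_nat_less_omega[of n] ord_add_of_nat[OF assms, of n] by metis

lemma ord_mult_props:
  fixes a b :: "'o::ordinals"
  assumes "countable {..<a}" "countable {..<b}"
  shows "countable {..<a \<otimes> b} \<and> (\<forall>c<b. (a \<otimes> c) \<oplus> a \<le> a \<otimes> b)"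
  using assms(2)
proof (induction b rule: less_induct)
  case (less b)
  let ?A = "(\<lambda>c. (a \<otimes> c) \<oplus> a) ` {..<b}"
  let ?P = "\<lambda>d. \<forall>c\<in>{..<b}. (a \<otimes> c) \<oplus> a \<le> d"
  have c: "countable {..<c}" if "c < b" for c
    by (rule countable_subset[OF _ less.prems]) (use that in auto)
  have eq: "a \<otimes> b = (LEAST d. ?P d)"
    by (rule ord_mult.simps)
  have A: "countable ?A" "\<And>x. x \<in> ?A \<Longrightarrow> countable {..<x}"
    using less.prems less.IH c ord_add_props[OF _ assms(1)] by auto
  obtain d0 where d0: "\<forall>x\<in>?A. x < d0"
    using countable_bounded[OF A] by blast
  have P: "?P (a \<otimes> b)"
    unfolding eq by (rule LeastI[of ?P d0]) (use d0 in \<open>auto intro: less_imp_le\<close>)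
  have "countable {..<LEAST d. ?P d}"
  proof (rule countable_Least_above[OF A])
    fix d assume "d < (LEAST d. ?P d)"
    then have "\<not> ?P d" by (rule not_less_Least)
    then show "\<exists>x\<in>?A. d \<le> x"
      by (auto simp: not_le not_less intro: less_imp_le)
  qed auto
  then show ?case
    using P unfolding eq[symmetric] by auto
qed

section \<open>The non-disjointness rank\<close>

lemma ndrk_ge_limit: "olimit \<alpha> \<Longrightarrow> ndrk_ge \<iota> T \<alpha> m \<longleftrightarrow> (\<forall>\<beta><\<alpha>. ndrk_ge \<iota> T \<beta> m)"
  by (subst ndrk_ge.simps) (auto simp: olimit_def)

lemma not_olimit_osuc: "\<beta> < osuc \<beta> \<Longrightarrow> \<not> olimit (osuc \<beta>)"
  by (auto simp: olimit_def)

lemma osuc_inject: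
  assumes "\<beta> < osuc \<beta>" "\<gamma> < osuc \<gamma>" "osuc \<beta> = osuc (\<gamma>::'o::wellorder)"
  shows "\<beta> = \<gamma>"
  using assms osuc_le[of \<beta> \<gamma>] osuc_le[of \<gamma> \<beta>] by (metis antisym_conv3 not_less)

definition splitting_ext :: "nat \<Rightarrow> (nat \<Rightarrow> bit list set) \<Rightarrow> mtuple \<Rightarrow> bit list \<Rightarrow> mtuple \<Rightarrow> bool" where
  "splitting_ext \<iota> T m \<nu> n \<longleftrightarrow> n \<in> M_family \<iota> T \<and> ml n > ml m \<and> extends \<iota> m n \<and>
     2 \<le> card {\<eta> \<in> mu n. strict_prefix \<nu> \<eta>}"

lemma ndrk_ge_osuc:
  fixes \<beta> :: "'o::wellorder"
  assumes "\<beta> < osuc \<beta>"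
  shows "ndrk_ge \<iota> T (osuc \<beta>) m \<longleftrightarrow> (\<forall>\<nu>\<in>mu m. \<exists>n. splitting_ext \<iota> T m \<nu> n \<and> ndrk_ge \<iota> T \<beta> n)"
proof -
  define R where "R \<gamma> \<longleftrightarrow> (\<forall>\<nu>\<in>mu m. \<exists>n. splitting_ext \<iota> T m \<nu> n \<and> ndrk_ge \<iota> T \<gamma> n)" for \<gamma> :: 'o
  have R: "R \<gamma> \<longleftrightarrow> (\<forall>\<nu>\<in>mu m. \<exists>n. n \<in> M_family \<iota> T \<and> ml n > ml m \<and> extends \<iota> m n \<and>
     ndrk_ge \<iota> T \<gamma> n \<and> 2 \<le> card {\<eta> \<in> mu n. strict_prefix \<nu> \<eta>})" for \<gamma>
    unfolding R_def splitting_ext_def by (intro ball_cong ex_cong1) auto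
  have *: "\<gamma> = \<beta>" if "\<gamma> < osuc \<beta>" "osuc \<beta> = osuc \<gamma>" for \<gamma>
    using osuc_inject[OF assms _ that(2)] that by simp
  have "ndrk_ge \<iota> T (osuc \<beta>) m \<longleftrightarrow> (\<forall>\<gamma>\<in>{..<osuc \<beta>}. osuc \<beta> = osuc \<gamma> \<longrightarrow> R \<gamma>)"
    unfolding R by (subst ndrk_ge.simps) (simp add: not_olimit_osuc[OF assms] del: ball_simps)
  also have "\<dots> \<longleftrightarrow> R \<beta>"
    using * assms by blast
  finally show ?thesis unfolding R_def .
qed

lemma ndrk_ge_ozero: "ndrk_ge \<iota> T (ozero::'o::wellorder) m"
proof -
  have "{..<ozero::'o} = {}"
    by (metis ozero_le lessThan_iff not_less ex_in_conv)
  then show ?thesis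
    by (subst ndrk_ge.simps) auto
qed

text \<open>The extensions that witness a successor rank also witness the ranks below it; this is not part of
  the recursion, whose successor step does not mention smaller ordinals.\<close>

lemma ndrk_ge_osucD:
  fixes \<beta> :: "'o::wellorder"
  assumes "\<beta> < osuc \<beta>" "ndrk_ge \<iota> T (osuc \<beta>) m" "mu m \<noteq> {}"
  shows "ndrk_ge \<iota> T \<beta> m"
  using assms
proof (induction \<beta> arbitrary: m rule: less_induct)
  case (less \<beta>)
  have nonempty: "mu n \<noteq> {}" if "extends \<iota> m n" for n
    using that less.prems(3) unfolding extends_def by auto
  show ?case
  proof (cases \<beta> rule: zero_suc_or_limit)
    case 1
    then show ?thesis by (simp add: ndrk_ge_ozero)
  next
    case (2 \<gamma>)
    have \<gamma>: "\<gamma> < osuc \<gamma>" using 2 by simp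
    show ?thesis
      unfolding 2(2) ndrk_ge_osuc[OF \<gamma>]
    proof
      fix \<nu> assume "\<nu> \<in> mu m"
      then obtain n where n: "splitting_ext \<iota> T m \<nu> n" "ndrk_ge \<iota> T \<beta> n"
        using less.prems(2) unfolding ndrk_ge_osuc[OF less.prems(1)] by blast
      have "mu n \<noteq> {}" using nonempty n(1) unfolding splitting_ext_def by blast
      then have "ndrk_ge \<iota> T \<gamma> n"
        using less.IH[OF 2(1) \<gamma>] n(2) 2(2) by simp
      then show "\<exists>n. splitting_ext \<iota> T m \<nu> n \<and> ndrk_ge \<iota> T \<gamma> n" using n(1) by blast
    qed
  next
    case 3
    have "ndrk_ge \<iota> T \<gamma> m" if "\<gamma> < \<beta>" for \<gamma>
    proof (rule less.IH[OF that])
      have "osuc \<gamma> < \<beta>" using 3 that unfolding olimit_def by blast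
      then have \<gamma>: "\<gamma> < osuc \<gamma>"
        using that unfolding osuc_def by (metis LeastI)
      then show "\<gamma> < osuc \<gamma>" .
      show "ndrk_ge \<iota> T (osuc \<gamma>) m"
        using less.prems(2) 3 that unfolding ndrk_ge_osuc[OF less.prems(1)] ndrk_ge_osuc[OF \<gamma>]
          ndrk_ge_limit[OF 3] by blast
    qed (use less.prems in auto)
    then show ?thesis
      using ndrk_ge_limit[OF 3] by blast
  qed
qed

lemma ndrk_ge_mono:
  fixes \<alpha> \<beta> :: "'o::wellorder"
  assumes "ndrk_ge \<iota> T \<alpha> m" "\<beta> \<le> \<alpha>" "mu m \<noteq> {}"
  shows "ndrk_ge \<iota> T \<beta> m"
  using assms
proof (induction \<alpha> rule: less_induct)
  case (less \<alpha>)
  show ?case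
  proof (cases \<alpha> rule: zero_suc_or_limit)
    case 1
    then show ?thesis using less by (metis antisym ozero_le)
  next
    case (2 \<gamma>)
    show ?thesis
    proof (cases "\<beta> = \<alpha>")
      case False
      then have "\<beta> \<le> \<gamma>"
        using less.prems(2) 2 osuc_le[of \<gamma> \<beta>] by force
      then show ?thesis
        using less.IH[OF 2(1)] ndrk_ge_osucD less.prems 2 by metis
    qed (use less in auto)
  next
    case 3
    then show ?thesis
      using less.prems ndrk_ge_limit[OF 3] by (metis le_less)
  qed
qed

text \<open>The set of ordinals below the rank is closed, so a rank that is not infinite is attained.\<close>

lemma ndrk_attained:
  fixes \<delta> :: "'o::wellorder"
  assumes "\<not> ndrk_ge \<iota> T \<delta> m" "mu m \<noteq> {}"
  obtains \<beta> :: 'o where "ndrk \<iota> T m = Rank \<beta>" "\<And>\<alpha>. ndrk_ge \<iota> T \<alpha> m \<longleftrightarrow> \<alpha> \<le> \<beta>"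
proof -
  define \<gamma> :: 'o where "\<gamma> = (LEAST \<alpha>. \<not> ndrk_ge \<iota> T \<alpha> m)"
  have \<gamma>: "\<not> ndrk_ge \<iota> T \<gamma> m"
    unfolding \<gamma>_def using assms(1) LeastI_ex[of "\<lambda>\<alpha>. \<not> ndrk_ge \<iota> T \<alpha> m"] by blast
  have less: "ndrk_ge \<iota> T \<alpha> m" if "\<alpha> < \<gamma>" for \<alpha> :: 'o
    using not_less_Least that unfolding \<gamma>_def by blast
  obtain \<beta> where \<beta>: "\<beta> < \<gamma>" "\<gamma> = osuc \<beta>"
    by (cases \<gamma> rule: zero_suc_or_limit)
      (use \<gamma> less in \<open>auto simp: ndrk_ge_ozero ndrk_ge_limit\<close>)
  have iff: "ndrk_ge \<iota> T \<alpha> m \<longleftrightarrow> \<alpha> \<le> \<beta>" for \<alpha> :: 'o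
  proof
    assume "ndrk_ge \<iota> T \<alpha> m"
    then have "\<not> \<gamma> \<le> \<alpha>"
      using \<gamma> ndrk_ge_mono assms(2) by blast
    then show "\<alpha> \<le> \<beta>"
      using \<beta> osuc_le[of \<beta> \<alpha>] by force
  qed (use less \<beta> in \<open>metis le_less_trans\<close>)
  then have "(GREATEST \<alpha>::'o. ndrk_ge \<iota> T \<alpha> m) = \<beta>"
    by (intro Greatest_equality) auto
  moreover have "ndrk \<iota> T m = Rank (GREATEST \<alpha>::'o. ndrk_ge \<iota> T \<alpha> m)"
    unfolding ndrk_def using assms(1) by auto
  ultimately show thesis
    using that iff by simp
qed

lemma ndrk_le:
  fixes \<Omega> :: "'o::wellorder"
  assumes "\<Omega> < osuc \<Omega>" "\<not> ndrk_ge \<iota> T (osuc \<Omega>) m" "mu m \<noteq> {}"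
  shows "ndrk \<iota> T m \<le> Rank \<Omega>"
proof -
  obtain \<beta> where \<beta>: "ndrk \<iota> T m = Rank \<beta>" "\<And>\<alpha>::'o. ndrk_ge \<iota> T \<alpha> m \<longleftrightarrow> \<alpha> \<le> \<beta>"
    using ndrk_attained assms(2,3) by blast
  then have "\<not> osuc \<Omega> \<le> \<beta>"
    using assms(2) by blast
  then have "\<beta> \<le> \<Omega>"
    using osuc_le[of \<Omega> \<beta>] by force
  then show ?thesis
    by (simp add: \<beta>(1) less_eq_rank_value_def)
qed

lemma le_ndrk:
  fixes \<alpha> :: "'o::wellorder"
  assumes "ndrk_ge \<iota> T \<alpha> m" "mu m \<noteq> {}"
  shows "Rank \<alpha> \<le> ndrk \<iota> T m"
proof (cases "\<forall>\<alpha>::'o. ndrk_ge \<iota> T \<alpha> m")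
  case False
  then obtain \<beta> where "ndrk \<iota> T m = Rank \<beta>" "\<And>\<alpha>::'o. ndrk_ge \<iota> T \<alpha> m \<longleftrightarrow> \<alpha> \<le> \<beta>"
    using ndrk_attained assms(2) by blast
  then show ?thesis
    using assms(1) by (simp add: less_eq_rank_value_def)
qed (simp add: ndrk_def less_eq_rank_value_def)

lemma ndrk_le_ndrk_sup:
  assumes "m \<in> M_family \<iota> T"
  shows "ndrk \<iota> T m \<le> (ndrk_sup \<iota> T :: 'o::wellorder rank_value)"
proof -
  have "\<forall>m\<in>M_family \<iota> T. ndrk \<iota> T m \<le> (Infinite_Rank :: 'o rank_value)"
    by (simp add: less_eq_rank_value_def)
  then show ?thesis
    unfolding ndrk_sup_def by (rule LeastI2) (use assms in auto)
qed

lemma ndrk_sup_le: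
  "(\<And>m. m \<in> M_family \<iota> T \<Longrightarrow> ndrk \<iota> T m \<le> x) \<Longrightarrow> ndrk_sup \<iota> T \<le> (x :: 'o::wellorder rank_value)"
  unfolding ndrk_sup_def by (rule Least_le) auto

section \<open>Tuples, their restrictions and their labels\<close>

definition nonrep :: "nat \<Rightarrow> (nat \<Rightarrow> 'a) \<Rightarrow> (nat \<Rightarrow> 'a) \<Rightarrow> bool" where
  "nonrep k f g \<longleftrightarrow> (\<forall>i<k. \<forall>j<k. (f i = f j \<longrightarrow> i = j) \<and> (g i = g j \<longrightarrow> i = j) \<and> f i \<noteq> g j)"

lemma distinct_concat_pairs:
  "distinct (concat (map (\<lambda>i. [f i, g i]) [0..<k])) \<longleftrightarrow> nonrep k f g"
proof (induction k)
  case (Suc k)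
  define xs where "xs = concat (map (\<lambda>i. [f i, g i]) [0..<k])"
  have set: "set xs = f ` {..<k} \<union> g ` {..<k}"
    unfolding xs_def by (auto simp: atLeast0LessThan)
  have "distinct (concat (map (\<lambda>i. [f i, g i]) [0..<Suc k])) \<longleftrightarrow>
      distinct xs \<and> f k \<noteq> g k \<and> f k \<notin> set xs \<and> g k \<notin> set xs"
    by (auto simp flip: xs_def)
  moreover have "f k \<notin> set xs \<and> g k \<notin> set xs \<longleftrightarrow>
      (\<forall>i<k. f i \<noteq> f k \<and> g i \<noteq> g k \<and> f i \<noteq> g k \<and> f k \<noteq> g i)"
    unfolding set Un_iff image_iff Bex_def lessThan_iff by metis
  moreover have "distinct xs \<longleftrightarrow> nonrep k f g"
    using Suc unfolding xs_def .
  moreover have "nonrep (Suc k) f g \<longleftrightarrow> nonrep k f g \<and> f k \<noteq> g k \<and>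
      (\<forall>i<k. f i \<noteq> f k \<and> g i \<noteq> g k \<and> f i \<noteq> g k \<and> f k \<noteq> g i)"
  proof
    assume *: "nonrep (Suc k) f g"
    have "(f i = f j \<longrightarrow> i = j) \<and> (g i = g j \<longrightarrow> i = j) \<and> f i \<noteq> g j" if "i \<le> k" "j \<le> k" for i j
      using * that by (simp add: nonrep_def less_Suc_eq_le)
    note ** = this
    have "nonrep k f g"
      using * by (simp add: nonrep_def less_Suc_eq_le)
    moreover have "f i \<noteq> f k \<and> g i \<noteq> g k \<and> f i \<noteq> g k \<and> f k \<noteq> g i" if "i < k" for i
      using that **[of i k] **[of k i] by auto
    ultimately show "nonrep k f g \<and> f k \<noteq> g k \<and>
        (\<forall>i<k. f i \<noteq> f k \<and> g i \<noteq> g k \<and> f i \<noteq> g k \<and> f k \<noteq> g i)"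
      using **[of k k] by auto
  next
    assume *: "nonrep k f g \<and> f k \<noteq> g k \<and>
      (\<forall>i<k. f i \<noteq> f k \<and> g i \<noteq> g k \<and> f i \<noteq> g k \<and> f k \<noteq> g i)"
    show "nonrep (Suc k) f g"
      unfolding nonrep_def
    proof (intro allI impI)
      fix i j assume "i < Suc k" "j < Suc k"
      then consider "i < k" "j < k" | "i = k" "j < k" | "i < k" "j = k" | "i = k" "j = k"
        by linarith
      then show "(f i = f j \<longrightarrow> i = j) \<and> (g i = g j \<longrightarrow> i = j) \<and> f i \<noteq> g j"
      proof cases
        case 1
        then show ?thesis using * unfolding nonrep_def by blast
      next
        case 2
        then have "f j \<noteq> f k" "g j \<noteq> g k" "f k \<noteq> g j" using * by auto
        then show ?thesis using 2 by auto
      next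
        case 3
        then have "f i \<noteq> f k" "g i \<noteq> g k" "f i \<noteq> g k" using * by auto
        then show ?thesis using 3 by auto
      qed (use * in auto)
    qed
  qed
  ultimately show ?case
    by (simp only:)
qed (simp add: nonrep_def)

lemma length_seq_add [simp]: "length (seq_add x y) = min (length x) (length y)"
  by (simp add: seq_add_def)

lemma nth_seq_add [simp]:
  "t < length x \<Longrightarrow> t < length y \<Longrightarrow> seq_add x y ! t = x ! t + y ! t"
  by (simp add: seq_add_def)

lemma take_seq_add: "take l (seq_add x y) = seq_add (take l x) (take l y)"
  by (simp add: seq_add_def take_map take_zip)

lemma seq_add_map_upt:
  "seq_add (map F [0..<l]) (map G [0..<l]) = map (\<lambda>t. F t + G t) [0..<l]"
  by (rule nth_equalityI) auto

lemma bit_add_self [simp]: "(b::bit) + b = 0"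
  by (cases b) auto

lemma bit_add_self_left [simp]: "(b::bit) + (b + c) = c"
  by (cases b; cases c) auto

lemma seq_add_cancel_right:
  "length x = l \<Longrightarrow> length y = l \<Longrightarrow> seq_add (seq_add x y) y = x"
  by (rule nth_equalityI) (auto simp: add.assoc)

lemma seq_add_right_inject:
  "length x = l \<Longrightarrow> length y = l \<Longrightarrow> length z = l \<Longrightarrow> seq_add x z = seq_add y z \<longleftrightarrow> x = y"
  by (metis seq_add_cancel_right)

lemma take_map_upt [simp]: "take k (map F [0..<l]) = map F [0..<min k l]"
  by (simp add: take_map min_def)

lemma initial_of_iff: "length x = l \<Longrightarrow> initial_of x F \<longleftrightarrow> x = map F [0..<l]"
  by (auto simp: initial_of_def)

lemma initial_of_take: "initial_of x F \<Longrightarrow> initial_of (take L x) F"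
  unfolding initial_of_def by (metis take_map_upt length_take min.commute)

lemma prefix_same_length: "prefix x y \<Longrightarrow> length x = length y \<Longrightarrow> x = y"
  by (auto simp: prefix_def)

lemma M_familyD:
  assumes "m \<in> M_family \<iota> T"
  shows "0 < ml m" "\<eta> \<in> mu m \<Longrightarrow> length \<eta> = ml m" "2 \<le> card (mu m)" "finite (mu m)" "mu m \<noteq> {}"
    "mh m \<in> {..<\<iota>} \<rightarrow>\<^sub>E (off_diag (mu m) \<rightarrow>\<^sub>E UNIV)"
    "mg m \<in> {..<\<iota>} \<rightarrow>\<^sub>E (off_diag (mu m) \<rightarrow>\<^sub>E (\<Union>n. T n \<inter> {x. length x = ml m}))"
    "i < \<iota> \<Longrightarrow> \<eta> \<in> mu m \<Longrightarrow> \<nu> \<in> mu m \<Longrightarrow> \<eta> \<noteq> \<nu> \<Longrightarrow> mg m i (\<eta>, \<nu>) \<in> T (mh m i (\<eta>, \<nu>))"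
    "i < \<iota> \<Longrightarrow> \<eta> \<in> mu m \<Longrightarrow> \<nu> \<in> mu m \<Longrightarrow> \<eta> \<noteq> \<nu> \<Longrightarrow> length (mg m i (\<eta>, \<nu>)) = ml m"
    "i < \<iota> \<Longrightarrow> \<eta> \<in> mu m \<Longrightarrow> \<nu> \<in> mu m \<Longrightarrow> \<eta> \<noteq> \<nu> \<Longrightarrow>
       seq_add \<eta> (mg m i (\<eta>, \<nu>)) = seq_add \<nu> (mg m i (\<nu>, \<eta>))"
    "\<eta> \<in> mu m \<Longrightarrow> \<nu> \<in> mu m \<Longrightarrow> \<eta> \<noteq> \<nu> \<Longrightarrow>
       nonrep \<iota> (\<lambda>i. mg m i (\<eta>, \<nu>)) (\<lambda>i. mg m i (\<nu>, \<eta>))"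
proof -
  note M = assms[unfolded M_family_def mem_Collect_eq]
  note M1 = M[THEN conjunct2] and M0 = M[THEN conjunct1]
  note M2 = M1[THEN conjunct2] and sub = M1[THEN conjunct1]
  note M3 = M2[THEN conjunct2] and card = M2[THEN conjunct1]
  note M4 = M3[THEN conjunct2] and h = M3[THEN conjunct1]
  note M5 = M4[THEN conjunct2] and g = M4[THEN conjunct1]
  note M6 = M5[THEN conjunct2] and 1 = M5[THEN conjunct1]
  note M7 = M6[THEN conjunct2] and 2 = M6[THEN conjunct1]
  note 3 = M7[THEN conjunct1]
  show "0 < ml m" "2 \<le> card (mu m)" by (rule M0, rule card)
  show "finite (mu m)" "mu m \<noteq> {}"
    using card by (auto intro: card_ge_0_finite)
  show "\<eta> \<in> mu m \<Longrightarrow> length \<eta> = ml m" using sub by blast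
  show "mh m \<in> {..<\<iota>} \<rightarrow>\<^sub>E (off_diag (mu m) \<rightarrow>\<^sub>E UNIV)"
    "mg m \<in> {..<\<iota>} \<rightarrow>\<^sub>E (off_diag (mu m) \<rightarrow>\<^sub>E (\<Union>n. T n \<inter> {x. length x = ml m}))"
    by (rule h, rule g)
  show "i < \<iota> \<Longrightarrow> \<eta> \<in> mu m \<Longrightarrow> \<nu> \<in> mu m \<Longrightarrow> \<eta> \<noteq> \<nu> \<Longrightarrow> mg m i (\<eta>, \<nu>) \<in> T (mh m i (\<eta>, \<nu>))"
    "i < \<iota> \<Longrightarrow> \<eta> \<in> mu m \<Longrightarrow> \<nu> \<in> mu m \<Longrightarrow> \<eta> \<noteq> \<nu> \<Longrightarrow> length (mg m i (\<eta>, \<nu>)) = ml m"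
    using 1 unfolding off_diag_def by auto
  show "i < \<iota> \<Longrightarrow> \<eta> \<in> mu m \<Longrightarrow> \<nu> \<in> mu m \<Longrightarrow> \<eta> \<noteq> \<nu> \<Longrightarrow>
       seq_add \<eta> (mg m i (\<eta>, \<nu>)) = seq_add \<nu> (mg m i (\<nu>, \<eta>))"
    using 2 unfolding off_diag_def by auto
  show "\<eta> \<in> mu m \<Longrightarrow> \<nu> \<in> mu m \<Longrightarrow> \<eta> \<noteq> \<nu> \<Longrightarrow>
       nonrep \<iota> (\<lambda>i. mg m i (\<eta>, \<nu>)) (\<lambda>i. mg m i (\<nu>, \<eta>))"
    using 3 unfolding off_diag_def distinct_concat_pairs by auto
qed

lemma M_family_branches:
  assumes "m \<in> M_family \<iota> T"
  obtains F G where "\<And>\<eta>. \<eta> \<in> mu m \<Longrightarrow> initial_of \<eta> (F \<eta>)"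
    "\<And>i \<eta> \<nu>. i < \<iota> \<Longrightarrow> \<eta> \<in> mu m \<Longrightarrow> \<nu> \<in> mu m \<Longrightarrow> \<eta> \<noteq> \<nu> \<Longrightarrow>
       initial_of (mg m i (\<eta>, \<nu>)) (G i (\<eta>, \<nu>)) \<and> G i (\<eta>, \<nu>) \<in> tree_lim (T (mh m i (\<eta>, \<nu>))) \<and>
       cantor_add (F \<eta>) (G i (\<eta>, \<nu>)) = cantor_add (F \<nu>) (G i (\<nu>, \<eta>))"
proof -
  have "\<exists>F G.
        (\<forall>\<eta>\<in>mu m. initial_of \<eta> (F \<eta>)) \<and>
        (\<forall>i<\<iota>. \<forall>(\<eta>, \<nu>)\<in>off_diag (mu m).
           initial_of (mg m i (\<eta>, \<nu>)) (G i (\<eta>, \<nu>)) \<and>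
           G i (\<eta>, \<nu>) \<in> tree_lim (T (mh m i (\<eta>, \<nu>))) \<and>
           cantor_add (F \<eta>) (G i (\<eta>, \<nu>)) = cantor_add (F \<nu>) (G i (\<nu>, \<eta>)))"
    using assms unfolding M_family_def by blast
  then obtain F G where FG: "\<forall>\<eta>\<in>mu m. initial_of \<eta> (F \<eta>)"
      "\<forall>i<\<iota>. \<forall>(\<eta>, \<nu>)\<in>off_diag (mu m).
           initial_of (mg m i (\<eta>, \<nu>)) (G i (\<eta>, \<nu>)) \<and>
           G i (\<eta>, \<nu>) \<in> tree_lim (T (mh m i (\<eta>, \<nu>))) \<and>
           cantor_add (F \<eta>) (G i (\<eta>, \<nu>)) = cantor_add (F \<nu>) (G i (\<nu>, \<eta>))"
    by blast
  show thesis
    by (rule that[of F G]) (use FG in \<open>auto simp: off_diag_def\<close>)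
qed

text \<open>The finite data of a tuple are determined by the branches through them, so a member of
  \<^const>\<open>M_family\<close> is best produced by giving the branches.\<close>

lemma M_familyI:
  assumes "0 < ml m" "2 \<le> card (mu m)"
    and ext: "mh m \<in> extensional {..<\<iota>}" "mg m \<in> extensional {..<\<iota>}"
      "\<And>i. i < \<iota> \<Longrightarrow> mh m i \<in> extensional (off_diag (mu m)) \<and> mg m i \<in> extensional (off_diag (mu m))"
    and F: "\<And>\<eta>. \<eta> \<in> mu m \<Longrightarrow> \<eta> = map (F \<eta>) [0..<ml m]"
    and G: "\<And>i \<eta> \<nu>. i < \<iota> \<Longrightarrow> \<eta> \<in> mu m \<Longrightarrow> \<nu> \<in> mu m \<Longrightarrow> \<eta> \<noteq> \<nu> \<Longrightarrow>
       mg m i (\<eta>, \<nu>) = map (G i (\<eta>, \<nu>)) [0..<ml m] \<and> G i (\<eta>, \<nu>) \<in> tree_lim (T (mh m i (\<eta>, \<nu>))) \<and>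
       cantor_add (F \<eta>) (G i (\<eta>, \<nu>)) = cantor_add (F \<nu>) (G i (\<nu>, \<eta>))"
    and nonrep: "\<And>\<eta> \<nu>. \<eta> \<in> mu m \<Longrightarrow> \<nu> \<in> mu m \<Longrightarrow> \<eta> \<noteq> \<nu> \<Longrightarrow>
       nonrep \<iota> (\<lambda>i. mg m i (\<eta>, \<nu>)) (\<lambda>i. mg m i (\<nu>, \<eta>))"
  shows "m \<in> M_family \<iota> T"
proof -
  have len: "length \<eta> = ml m" if "\<eta> \<in> mu m" for \<eta>
    by (subst F[OF that]) simp
  have glen: "length (mg m i (\<eta>, \<nu>)) = ml m" and gT: "mg m i (\<eta>, \<nu>) \<in> T (mh m i (\<eta>, \<nu>))"
    and sum: "seq_add \<eta> (mg m i (\<eta>, \<nu>)) = seq_add \<nu> (mg m i (\<nu>, \<eta>))"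
    if "i < \<iota>" "\<eta> \<in> mu m" "\<nu> \<in> mu m" "\<eta> \<noteq> \<nu>" for i \<eta> \<nu>
  proof -
    note G1 = G[OF that] and G2 = G[OF that(1,3,2) that(4)[symmetric]]
    show "length (mg m i (\<eta>, \<nu>)) = ml m" using G1 by simp
    show "mg m i (\<eta>, \<nu>) \<in> T (mh m i (\<eta>, \<nu>))"
      using G1 unfolding tree_lim_def by auto
    have "seq_add \<eta> (mg m i (\<eta>, \<nu>)) = map (cantor_add (F \<eta>) (G i (\<eta>, \<nu>))) [0..<ml m]"
      using F[OF that(2)] G1 seq_add_map_upt unfolding cantor_add_def by metis
    also have "\<dots> = map (cantor_add (F \<nu>) (G i (\<nu>, \<eta>))) [0..<ml m]"
      using G1 by simp
    also have "\<dots> = seq_add \<nu> (mg m i (\<nu>, \<eta>))"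
      using F[OF that(3)] G2 seq_add_map_upt unfolding cantor_add_def by metis
    finally show "seq_add \<eta> (mg m i (\<eta>, \<nu>)) = seq_add \<nu> (mg m i (\<nu>, \<eta>))" .
  qed
  have "mh m \<in> {..<\<iota>} \<rightarrow>\<^sub>E (off_diag (mu m) \<rightarrow>\<^sub>E UNIV)"
    using ext by (auto simp: PiE_def)
  moreover have "mg m \<in> {..<\<iota>} \<rightarrow>\<^sub>E (off_diag (mu m) \<rightarrow>\<^sub>E (\<Union>n. T n \<inter> {x. length x = ml m}))"
  proof (intro PiE_I)
    fix i p assume ip: "i \<in> {..<\<iota>}" "p \<in> off_diag (mu m)"
    then obtain \<eta> \<nu> where p: "p = (\<eta>, \<nu>)" "\<eta> \<in> mu m" "\<nu> \<in> mu m" "\<eta> \<noteq> \<nu>"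
      unfolding off_diag_def by blast
    show "mg m i p \<in> (\<Union>n. T n \<inter> {x. length x = ml m})"
      using glen[OF _ p(2-4)] gT[OF _ p(2-4)] ip(1) unfolding p(1) by blast
  qed (use ext in \<open>auto simp: extensional_def\<close>)
  moreover have "\<exists>F G.
        (\<forall>\<eta>\<in>mu m. initial_of \<eta> (F \<eta>)) \<and>
        (\<forall>i<\<iota>. \<forall>(\<eta>, \<nu>)\<in>off_diag (mu m).
           initial_of (mg m i (\<eta>, \<nu>)) (G i (\<eta>, \<nu>)) \<and>
           G i (\<eta>, \<nu>) \<in> tree_lim (T (mh m i (\<eta>, \<nu>))) \<and>
           cantor_add (F \<eta>) (G i (\<eta>, \<nu>)) = cantor_add (F \<nu>) (G i (\<nu>, \<eta>)))"
  proof (intro exI conjI ballI allI impI)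
    show "initial_of \<eta> (F \<eta>)" if "\<eta> \<in> mu m" for \<eta>
      using F[OF that] len[OF that] unfolding initial_of_def by simp
    show "case p of (\<eta>, \<nu>) \<Rightarrow> initial_of (mg m i (\<eta>, \<nu>)) (G i (\<eta>, \<nu>)) \<and>
           G i (\<eta>, \<nu>) \<in> tree_lim (T (mh m i (\<eta>, \<nu>))) \<and>
           cantor_add (F \<eta>) (G i (\<eta>, \<nu>)) = cantor_add (F \<nu>) (G i (\<nu>, \<eta>))"
      if "i < \<iota>" "p \<in> off_diag (mu m)" for i p
      using that G glen unfolding initial_of_def off_diag_def by auto
  qed
  ultimately show ?thesis
    unfolding M_family_def distinct_concat_pairs mem_Collect_eq
    apply (intro conjI)
    subgoal by (rule assms(1))
    subgoal using len by blast
    subgoal by (rule assms(2))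
    subgoal .
    subgoal .
    subgoal using glen gT unfolding off_diag_def by force
    subgoal using sum unfolding off_diag_def by force
    subgoal using nonrep unfolding off_diag_def by force
    subgoal .
    done
qed

text \<open>One operation serves both for passing to a subset (\<open>L = ml m\<close>) and for interpolating a level between a
  tuple and an extension.\<close>

definition sub_tuple :: "nat \<Rightarrow> mtuple \<Rightarrow> bit list set \<Rightarrow> nat \<Rightarrow> mtuple" where
  "sub_tuple \<iota> m U L = (let V = take L ` U; s = inv_into U (take L) in
     \<lparr>ml = L, mu = V,
      mh = (\<lambda>i\<in>{..<\<iota>}. \<lambda>p\<in>off_diag V. mh m i (s (fst p), s (snd p))),
      mg = (\<lambda>i\<in>{..<\<iota>}. \<lambda>p\<in>off_diag V. take L (mg m i (s (fst p), s (snd p))))\<rparr>)"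

lemma sub_tuple_simps [simp]:
  "ml (sub_tuple \<iota> m U L) = L" "mu (sub_tuple \<iota> m U L) = take L ` U"
  by (simp_all add: sub_tuple_def Let_def)

lemma sub_tuple_nth:
  assumes "inj_on (take L) U" "x \<in> U" "y \<in> U" "x \<noteq> y" "i < \<iota>"
  shows "mh (sub_tuple \<iota> m U L) i (take L x, take L y) = mh m i (x, y)"
    "mg (sub_tuple \<iota> m U L) i (take L x, take L y) = take L (mg m i (x, y))"
proof -
  have "(take L x, take L y) \<in> off_diag (take L ` U)"
    using assms by (auto simp: off_diag_def inj_on_def)
  then show "mh (sub_tuple \<iota> m U L) i (take L x, take L y) = mh m i (x, y)"
    "mg (sub_tuple \<iota> m U L) i (take L x, take L y) = take L (mg m i (x, y))"
    using assms by (simp_all add: sub_tuple_def Let_def)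
qed

lemma sub_tuple_in_M:
  assumes m: "m \<in> M_family \<iota> T" and U: "U \<subseteq> mu m" "2 \<le> card U"
    and L: "0 < L" "L \<le> ml m" and inj: "inj_on (take L) U"
    and nonrep: "\<And>x y. x \<in> U \<Longrightarrow> y \<in> U \<Longrightarrow> x \<noteq> y \<Longrightarrow>
       nonrep \<iota> (\<lambda>i. take L (mg m i (x, y))) (\<lambda>i. take L (mg m i (y, x)))"
  shows "sub_tuple \<iota> m U L \<in> M_family \<iota> T"
proof -
  let ?s = "inv_into U (take L)"
  obtain F G where F: "\<And>\<eta>. \<eta> \<in> mu m \<Longrightarrow> initial_of \<eta> (F \<eta>)"
    and G: "\<And>i \<eta> \<nu>. i < \<iota> \<Longrightarrow> \<eta> \<in> mu m \<Longrightarrow> \<nu> \<in> mu m \<Longrightarrow> \<eta> \<noteq> \<nu> \<Longrightarrow>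
       initial_of (mg m i (\<eta>, \<nu>)) (G i (\<eta>, \<nu>)) \<and> G i (\<eta>, \<nu>) \<in> tree_lim (T (mh m i (\<eta>, \<nu>))) \<and>
       cantor_add (F \<eta>) (G i (\<eta>, \<nu>)) = cantor_add (F \<nu>) (G i (\<nu>, \<eta>))"
    by (rule M_family_branches[OF m]) blast
  have len: "length x = ml m" if "x \<in> U" for x
    using M_familyD(2)[OF m] that U by blast
  have lg: "length (mg m i (x, y)) = ml m" if "x \<in> U" "y \<in> U" "x \<noteq> y" "i < \<iota>" for x y i
    using M_familyD(9)[OF m] that U by blast
  show ?thesis
  proof (rule M_familyI[where F = "\<lambda>x. F (?s x)" and G = "\<lambda>i p. G i (?s (fst p), ?s (snd p))"],
      unfold sub_tuple_simps)
    show "2 \<le> card (take L ` U)" using U(2) card_image[OF inj] by simp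
    fix \<eta> assume "\<eta> \<in> take L ` U"
    then obtain x where x: "x \<in> U" "\<eta> = take L x" by blast
    show "\<eta> = map (F (?s \<eta>)) [0..<L]"
      using initial_of_take[OF F, of x L] x inj U(1) len[OF x(1)] L(2)
      by (subst initial_of_iff[symmetric]) auto
    fix \<nu> assume "\<nu> \<in> take L ` U" and ne: "\<eta> \<noteq> \<nu>"
    then obtain y where y: "y \<in> U" "\<nu> = take L y" by blast
    have xy: "x \<noteq> y" using ne x y by auto
    show "nonrep \<iota> (\<lambda>i. mg (sub_tuple \<iota> m U L) i (\<eta>, \<nu>)) (\<lambda>i. mg (sub_tuple \<iota> m U L) i (\<nu>, \<eta>))"
      using nonrep[OF x(1) y(1) xy] sub_tuple_nth[OF inj x(1) y(1) xy]
        sub_tuple_nth[OF inj y(1) x(1) xy[symmetric]]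
      unfolding x y nonrep_def by simp
    fix i assume i: "i < \<iota>"
    have "initial_of (take L (mg m i (x, y))) (G i (x, y))"
      using G[OF i, of x y] x y xy U(1) by (intro initial_of_take) auto
    then have "take L (mg m i (x, y)) = map (G i (x, y)) [0..<L]"
      using lg[OF x(1) y(1) xy i] L(2) by (subst initial_of_iff[symmetric]) auto
    then show "mg (sub_tuple \<iota> m U L) i (\<eta>, \<nu>) = map (G i (?s (fst (\<eta>, \<nu>)), ?s (snd (\<eta>, \<nu>)))) [0..<L] \<and>
       G i (?s (fst (\<eta>, \<nu>)), ?s (snd (\<eta>, \<nu>))) \<in> tree_lim (T (mh (sub_tuple \<iota> m U L) i (\<eta>, \<nu>))) \<and>
       cantor_add (F (?s \<eta>)) (G i (?s (fst (\<eta>, \<nu>)), ?s (snd (\<eta>, \<nu>)))) =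
         cantor_add (F (?s \<nu>)) (G i (?s (fst (\<nu>, \<eta>)), ?s (snd (\<nu>, \<eta>))))"
      using G[OF i, of x y] x y xy U(1) inj
      by (simp add: sub_tuple_nth[OF inj x(1) y(1) xy i] subset_iff)
  qed (use L in \<open>auto simp: sub_tuple_def Let_def\<close>)
qed

lemma finite_mu: "m \<in> M_family \<iota> T \<Longrightarrow> finite {\<eta> \<in> mu m. P \<eta>}"
  using M_familyD(4) by simp

lemma take_neq_mono: "take l x \<noteq> take l y \<Longrightarrow> l \<le> L \<Longrightarrow> take L x \<noteq> take L y"
  by (metis take_take min.absorb1)

lemma extends_trans:
  assumes "extends \<iota> m n" "extends \<iota> n p"
  shows "extends \<iota> m p"
  unfolding extends_def
proof (intro conjI ballI)
  have le: "ml m \<le> ml n" "ml n \<le> ml p" and mu: "mu m = take (ml m) ` mu n" "mu n = take (ml n) ` mu p"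
    using assms unfolding extends_def by auto
  show "ml m \<le> ml p" using le by simp
  show "mu m = take (ml m) ` mu p"
    unfolding mu using le by (simp add: image_image min_def)
  fix q assume q: "q \<in> off_diag (mu p)"
  obtain x y where xy: "q = (x, y)" "x \<in> mu p" "y \<in> mu p" "x \<noteq> y"
    using q unfolding off_diag_def by auto
  have tt: "take (ml m) (take (ml n) z) = take (ml m) z" for z :: "bit list"
    using le by (simp add: min_def)
  show "case q of (\<eta>, \<nu>) \<Rightarrow> take (ml m) \<eta> \<noteq> take (ml m) \<nu> \<longrightarrow>
        (\<forall>i<\<iota>. mh m i (take (ml m) \<eta>, take (ml m) \<nu>) = mh p i (\<eta>, \<nu>) \<and>
               mg m i (take (ml m) \<eta>, take (ml m) \<nu>) = take (ml m) (mg p i (\<eta>, \<nu>)))"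
    unfolding xy prod.case
  proof (intro impI allI)
    fix i assume i: "i < \<iota>" and ne: "take (ml m) x \<noteq> take (ml m) y"
    have ne': "take (ml n) x \<noteq> take (ml n) y"
      using take_neq_mono[OF ne le(1)] .
    have 1: "mh n i (take (ml n) x, take (ml n) y) = mh p i (x, y)"
      "mg n i (take (ml n) x, take (ml n) y) = take (ml n) (mg p i (x, y))"
      using assms(2) i xy ne' unfolding extends_def off_diag_def by blast+
    have "(take (ml n) x, take (ml n) y) \<in> off_diag (mu n)"
      using xy ne' mu unfolding off_diag_def by auto
    then have "mh m i (take (ml m) (take (ml n) x), take (ml m) (take (ml n) y)) = mh n i (take (ml n) x, take (ml n) y) \<and>
       mg m i (take (ml m) (take (ml n) x), take (ml m) (take (ml n) y)) = take (ml m) (mg n i (take (ml n) x, take (ml n) y))"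
      using assms(1) i ne tt unfolding extends_def by fastforce
    then show "mh m i (take (ml m) x, take (ml m) y) = mh p i (x, y) \<and>
       mg m i (take (ml m) x, take (ml m) y) = take (ml m) (mg p i (x, y))"
      unfolding tt 1 .
  qed
qed

lemma extends_pair:
  assumes "extends \<iota> m n" "x \<in> mu n" "y \<in> mu n" "take (ml m) x \<noteq> take (ml m) y" "i < \<iota>"
  shows "mh m i (take (ml m) x, take (ml m) y) = mh n i (x, y)"
    "mg m i (take (ml m) x, take (ml m) y) = take (ml m) (mg n i (x, y))"
proof -
  have "(x, y) \<in> off_diag (mu n)"
    using assms by (auto simp: off_diag_def)
  then show "mh m i (take (ml m) x, take (ml m) y) = mh n i (x, y)"
    "mg m i (take (ml m) x, take (ml m) y) = take (ml m) (mg n i (x, y))"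
    using assms unfolding extends_def by blast+
qed

lemma extendsI:
  assumes "ml m \<le> ml n" "mu m = take (ml m) ` mu n"
    "\<And>x y i. x \<in> mu n \<Longrightarrow> y \<in> mu n \<Longrightarrow> take (ml m) x \<noteq> take (ml m) y \<Longrightarrow> i < \<iota> \<Longrightarrow>
      mh m i (take (ml m) x, take (ml m) y) = mh n i (x, y) \<and>
      mg m i (take (ml m) x, take (ml m) y) = take (ml m) (mg n i (x, y))"
  shows "extends \<iota> m n"
  using assms unfolding extends_def off_diag_def by auto

text \<open>Fewer elements and a lower level only make splitting easier: a splitting extension of \<open>m\<close>, restricted
  to the elements above \<open>U\<close>, splits the restricted tuple.\<close>

lemma ndrk_ge_sub_tuple:
  fixes \<alpha> :: "'o::wellorder"
  assumes m: "m \<in> M_family \<iota> T" and U: "U \<subseteq> mu m" "2 \<le> card U"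
    and L: "0 < L" "L \<le> ml m" and inj: "inj_on (take L) U"
    and rk: "ndrk_ge \<iota> T \<alpha> m"
  shows "ndrk_ge \<iota> T \<alpha> (sub_tuple \<iota> m U L)"
  using assms
proof (induction \<alpha> arbitrary: m U L rule: less_induct)
  case (less \<alpha>)
  note m = less.prems(1) and U = less.prems(2,3) and L = less.prems(4,5) and inj = less.prems(6)
  show ?case
  proof (cases \<alpha> rule: zero_suc_or_limit)
    case 1
    then show ?thesis by (simp add: ndrk_ge_ozero)
  next
    case 3
    then show ?thesis
      using less ndrk_ge_limit[OF 3] by blast
  next
    case (2 \<beta>)
    then have \<beta>: "\<beta> < osuc \<beta>" by simp
    show ?thesis
      unfolding 2(2) ndrk_ge_osuc[OF \<beta>]
    proof
      fix \<nu> assume "\<nu> \<in> mu (sub_tuple \<iota> m U L)"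
      then obtain x where x: "x \<in> U" "\<nu> = take L x" by auto
      then obtain n where n: "splitting_ext \<iota> T m x n" "ndrk_ge \<iota> T \<beta> n"
        using less.prems(7) U unfolding 2(2) ndrk_ge_osuc[OF \<beta>] by blast
      have nM: "n \<in> M_family \<iota> T" and ext: "extends \<iota> m n" and lmn: "ml m < ml n"
        using n unfolding splitting_ext_def by auto
      define W where "W = {y \<in> mu n. take (ml m) y \<in> U}"
      define n' where "n' = sub_tuple \<iota> n W (ml n)"
      have tk: "take (ml n) y = y" if "y \<in> mu n" for y
        using M_familyD(2)[OF nM that] by simp
      have len: "length y = ml m" if "y \<in> U" for y
        using M_familyD(2)[OF m] that U by blast
      have W: "W \<subseteq> mu n" unfolding W_def by blast
      have finW: "finite W" unfolding W_def by (rule finite_mu[OF nM])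
      have injn: "inj_on (take (ml n)) W"
        using tk W by (auto simp: inj_on_def subset_iff)
      have muW: "take (ml n) ` W = W"
        using tk W by force
      have "U = take (ml m) ` W"
        using ext U(1) unfolding W_def extends_def by auto
      then have cW: "2 \<le> card W"
        using U(2) card_image_le[OF finW] by (metis le_trans)
      have g: "mh n' i (y, z) = mh n i (y, z) \<and> mg n' i (y, z) = mg n i (y, z)"
        if "y \<in> W" "z \<in> W" "y \<noteq> z" "i < \<iota>" for y z i
        using sub_tuple_nth[OF injn that, of n] tk W that M_familyD(9)[OF nM, of i y z]
        unfolding n'_def by (auto simp: subset_iff)
      have n'M: "n' \<in> M_family \<iota> T"
        unfolding n'_def
      proof (rule sub_tuple_in_M[OF nM W cW])
        show "nonrep \<iota> (\<lambda>i. take (ml n) (mg n i (y, z))) (\<lambda>i. take (ml n) (mg n i (z, y)))"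
          if "y \<in> W" "z \<in> W" "y \<noteq> z" for y z
        proof -
          have yz: "y \<in> mu n" "z \<in> mu n" using that W by auto
          then show ?thesis
            using M_familyD(11)[OF nM yz that(3)] M_familyD(9)[OF nM _ yz that(3)]
              M_familyD(9)[OF nM _ yz(2,1) that(3)[symmetric]] unfolding nonrep_def by simp
        qed
      qed (use lmn injn in auto)
      have rk': "ndrk_ge \<iota> T \<beta> n'"
        unfolding n'_def using less.IH[OF 2(1) nM W cW _ _ injn n(2)] lmn by simp
      have tt: "take L (take (ml m) z) = take L z" for z :: "bit list"
        using L by (simp add: min_def)
      have extn': "extends \<iota> (sub_tuple \<iota> m U L) n'"
      proof (rule extendsI)
        show "ml (sub_tuple \<iota> m U L) \<le> ml n'"
          using L lmn by (simp add: n'_def)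
        have "take L ` U = take L ` W"
          unfolding \<open>U = take (ml m) ` W\<close> image_image tt ..
        then show "mu (sub_tuple \<iota> m U L) = take (ml (sub_tuple \<iota> m U L)) ` mu n'"
          by (simp add: n'_def muW)
        fix y z i
        assume "y \<in> mu n'" "z \<in> mu n'" "i < \<iota>"
          and ne: "take (ml (sub_tuple \<iota> m U L)) y \<noteq> take (ml (sub_tuple \<iota> m U L)) z"
        then have yz: "y \<in> W" "z \<in> W" "i < \<iota>" "y \<noteq> z" by (auto simp: n'_def muW)
        have ne': "take (ml m) y \<noteq> take (ml m) z"
          using take_neq_mono[OF ne] L by simp
        have 1: "take (ml m) y \<in> U" "take (ml m) z \<in> U" using yz unfolding W_def by auto
        show "mh (sub_tuple \<iota> m U L) i (take (ml (sub_tuple \<iota> m U L)) y, take (ml (sub_tuple \<iota> m U L)) z) = mh n' i (y, z) \<and>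
          mg (sub_tuple \<iota> m U L) i (take (ml (sub_tuple \<iota> m U L)) y, take (ml (sub_tuple \<iota> m U L)) z) =
            take (ml (sub_tuple \<iota> m U L)) (mg n' i (y, z))"
          using sub_tuple_nth[OF inj 1 ne' yz(3), of m] g[OF yz(1,2,4,3)]
            extends_pair[OF ext _ _ ne' yz(3)] yz W by (auto simp: tt subset_iff min.absorb1[OF L(2)])
      qed
      have "{\<eta> \<in> mu n. strict_prefix x \<eta>} \<subseteq> {\<eta> \<in> mu n'. strict_prefix \<nu> \<eta>}"
      proof (intro subsetI CollectI conjI)
        fix \<eta> assume "\<eta> \<in> {\<eta> \<in> mu n. strict_prefix x \<eta>}"
        then have \<eta>: "\<eta> \<in> mu n" "strict_prefix x \<eta>" by auto
        have "take (ml m) \<eta> = x"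
          using \<eta>(2) len[OF x(1)] by (auto simp: strict_prefix_def prefix_def)
        then show "\<eta> \<in> mu n'"
          using \<eta>(1) x(1) unfolding n'_def sub_tuple_simps muW by (simp add: W_def)
        show "strict_prefix \<nu> \<eta>"
          unfolding x(2) by (rule prefix_order.le_less_trans[OF take_is_prefix \<eta>(2)])
      qed
      then have "2 \<le> card {\<eta> \<in> mu n'. strict_prefix \<nu> \<eta>}"
        using n(1) card_mono[OF finite_mu[OF n'M]] unfolding splitting_ext_def by (meson le_trans)
      then show "\<exists>n. splitting_ext \<iota> T (sub_tuple \<iota> m U L) \<nu> n \<and> ndrk_ge \<iota> T \<beta> n"
        using n'M rk' extn' lmn L by (intro exI[of _ n']) (simp add: splitting_ext_def n'_def)
    qed
  qed
qed

text \<open>The labels of a pair forget the indexing by \<open>i < \<iota>\<close> and the orientation of the pair.  They are all that the relations \<^const>\<open>ess_same\<close> and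
  \<^const>\<open>ess_extends\<close> are needed for: equality of labels follows from either, is transitive, and
  survives cutting off at a lower level.\<close>

definition labels :: "nat \<Rightarrow> mtuple \<Rightarrow> bit list \<Rightarrow> bit list \<Rightarrow> (bit list \<times> nat) set" where
  "labels \<iota> m \<eta> \<nu> = (\<Union>i<\<iota>. {(mg m i (\<eta>, \<nu>), mh m i (\<eta>, \<nu>)), (mg m i (\<nu>, \<eta>), mh m i (\<nu>, \<eta>))})"

abbreviation cut :: "nat \<Rightarrow> (bit list \<times> nat) set \<Rightarrow> (bit list \<times> nat) set" where
  "cut l A \<equiv> map_prod (take l) id ` A"

text \<open>The clause on heights starts from the values of \<open>m\<close> at one orientation of the pair only, so both
  orientations are needed.\<close>

lemma ess_agree_labels:
  assumes "2 \<le> \<iota>" "ess_agree \<iota> m n \<eta> \<nu>" "ess_agree \<iota> m n \<nu> \<eta>"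
  shows "labels \<iota> m (take (ml m) \<eta>) (take (ml m) \<nu>) = cut (ml m) (labels \<iota> n \<eta> \<nu>)"
proof -
  define g where "g i x y = mg m i (take (ml m) x, take (ml m) y)" for i x y
  define g' where "g' i x y = take (ml m) (mg n i (x, y))" for i x y
  define h where "h i x y = mh m i (take (ml m) x, take (ml m) y)" for i x y
  define h' where "h' i x y = mh n i (x, y)" for i x y
  note eqs = g_def[symmetric] g'_def[symmetric] h_def[symmetric] h'_def[symmetric]
  have A: "i < \<iota> \<Longrightarrow> j < \<iota> \<Longrightarrow> (g i x y = g' j x y \<longrightarrow> h i x y = h' j x y) \<and> (g i x y = g' j y x \<longrightarrow> h i x y = h' j y x)"
    if "x = \<eta> \<and> y = \<nu> \<or> x = \<nu> \<and> y = \<eta>" for i j x y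
    using that assms(2,3) unfolding ess_agree_def Let_def eqs by auto
  have B: "(\<iota> > 2 \<longrightarrow> {{g i \<eta> \<nu>, g i \<nu> \<eta>} | i. i < \<iota>} = {{g' i \<eta> \<nu>, g' i \<nu> \<eta>} | i. i < \<iota>}) \<and>
         (\<iota> = 2 \<longrightarrow> {g 0 \<eta> \<nu>, g 0 \<nu> \<eta>, g 1 \<eta> \<nu>, g 1 \<nu> \<eta>} = {g' 0 \<eta> \<nu>, g' 0 \<nu> \<eta>, g' 1 \<eta> \<nu>, g' 1 \<nu> \<eta>})"
    using assms(2) unfolding ess_agree_def Let_def eqs by auto
  have C: "(\<Union>i<\<iota>. {g i \<eta> \<nu>, g i \<nu> \<eta>}) = (\<Union>i<\<iota>. {g' i \<eta> \<nu>, g' i \<nu> \<eta>})"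
  proof (cases "\<iota> = 2")
    case True
    have "{..<2} = {0, 1::nat}" by auto
    then show ?thesis using B True by auto
  next
    case False
    have "(\<Union>i<\<iota>. {f i \<eta> \<nu>, f i \<nu> \<eta>}) = \<Union>{{f i \<eta> \<nu>, f i \<nu> \<eta>} | i. i < \<iota>}" for f :: "nat \<Rightarrow> bit list \<Rightarrow> bit list \<Rightarrow> bit list"
      by auto
    then show ?thesis using B assms(1) False by simp
  qed
  have "labels \<iota> m (take (ml m) \<eta>) (take (ml m) \<nu>) = (\<Union>i<\<iota>. {(g i \<eta> \<nu>, h i \<eta> \<nu>), (g i \<nu> \<eta>, h i \<nu> \<eta>)})"
    unfolding labels_def g_def h_def ..
  also have "\<dots> = (\<Union>i<\<iota>. {(g' i \<eta> \<nu>, h' i \<eta> \<nu>), (g' i \<nu> \<eta>, h' i \<nu> \<eta>)})"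
  proof (intro set_eqI iffI)
    fix z assume "z \<in> (\<Union>i<\<iota>. {(g i \<eta> \<nu>, h i \<eta> \<nu>), (g i \<nu> \<eta>, h i \<nu> \<eta>)})"
    then obtain i x y where i: "i < \<iota>" "x = \<eta> \<and> y = \<nu> \<or> x = \<nu> \<and> y = \<eta>" "z = (g i x y, h i x y)"
      by auto
    then have "g i x y \<in> (\<Union>i<\<iota>. {g' i \<eta> \<nu>, g' i \<nu> \<eta>})"
      using C by blast
    then obtain j where "j < \<iota>" "g i x y = g' j x y \<or> g i x y = g' j y x"
      using i(2) by blast
    then show "z \<in> (\<Union>i<\<iota>. {(g' i \<eta> \<nu>, h' i \<eta> \<nu>), (g' i \<nu> \<eta>, h' i \<nu> \<eta>)})"
      using A[OF i(2,1), of j] i(2) unfolding i(3) by auto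
  next
    fix z assume "z \<in> (\<Union>i<\<iota>. {(g' i \<eta> \<nu>, h' i \<eta> \<nu>), (g' i \<nu> \<eta>, h' i \<nu> \<eta>)})"
    then obtain i x y where i: "i < \<iota>" "x = \<eta> \<and> y = \<nu> \<or> x = \<nu> \<and> y = \<eta>" "z = (g' i x y, h' i x y)"
      by auto
    then have "g' i x y \<in> (\<Union>i<\<iota>. {g i \<eta> \<nu>, g i \<nu> \<eta>})"
      using C by blast
    then obtain j where "j < \<iota>" "g' i x y = g j x y \<or> g' i x y = g j y x"
      using i(2) by blast
    moreover have "y = \<eta> \<and> x = \<nu> \<or> y = \<nu> \<and> x = \<eta>" using i(2) by auto
    ultimately show "z \<in> (\<Union>i<\<iota>. {(g i \<eta> \<nu>, h i \<eta> \<nu>), (g i \<nu> \<eta>, h i \<nu> \<eta>)})"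
      using A[of x y j i] A[of y x j i] i unfolding i(3) by auto
  qed
  also have "\<dots> = cut (ml m) (labels \<iota> n \<eta> \<nu>)"
    unfolding labels_def g'_def h'_def by (simp add: image_UN)
  finally show ?thesis .
qed

lemma ess_extends_labels:
  assumes "2 \<le> \<iota>" "ess_extends \<iota> m n" "\<eta> \<in> mu n" "\<nu> \<in> mu n" "take (ml m) \<eta> \<noteq> take (ml m) \<nu>"
  shows "labels \<iota> m (take (ml m) \<eta>) (take (ml m) \<nu>) = cut (ml m) (labels \<iota> n \<eta> \<nu>)"
proof (rule ess_agree_labels[OF assms(1)])
  have *: "ess_agree \<iota> m n x y" if "x \<in> mu n" "y \<in> mu n" "take (ml m) x \<noteq> take (ml m) y" for x y
    using assms(2) that unfolding ess_extends_def off_diag_def by auto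
  show "ess_agree \<iota> m n \<eta> \<nu>" "ess_agree \<iota> m n \<nu> \<eta>"
    using *[OF assms(3-5)] *[OF assms(4,3) assms(5)[symmetric]] .
qed

lemma extends_labels:
  assumes "extends \<iota> m n" "\<eta> \<in> mu n" "\<nu> \<in> mu n" "take (ml m) \<eta> \<noteq> take (ml m) \<nu>"
  shows "labels \<iota> m (take (ml m) \<eta>) (take (ml m) \<nu>) = cut (ml m) (labels \<iota> n \<eta> \<nu>)"
  unfolding labels_def image_UN
  using extends_pair[OF assms] extends_pair[OF assms(1,3,2) assms(4)[symmetric]] by auto

lemma cut_full:
  assumes "\<And>x. x \<in> A \<Longrightarrow> length (fst x) \<le> l"
  shows "cut l A = A"
proof -
  have "map_prod (take l) id x = x" if "x \<in> A" for x
    using assms[OF that] by (cases x) auto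
  then show ?thesis by force
qed

lemma labels_length:
  assumes "m \<in> M_family \<iota> T" "\<eta> \<in> mu m" "\<nu> \<in> mu m" "\<eta> \<noteq> \<nu>" "x \<in> labels \<iota> m \<eta> \<nu>"
  shows "length (fst x) = ml m"
  using assms M_familyD(9)[OF assms(1)] unfolding labels_def by auto

lemma ess_same_shift:
  assumes "2 \<le> \<iota>" "m1 \<in> M_family \<iota> T" "m0 \<in> M_family \<iota> T" "length \<rho> = ml m1"
    and same: "ess_same \<iota> m0 (m_shift \<iota> m1 \<rho>)"
  shows "mu m0 = (\<lambda>\<eta>. seq_add \<eta> \<rho>) ` mu m1"
    "\<eta> \<in> mu m0 \<Longrightarrow> \<nu> \<in> mu m0 \<Longrightarrow> \<eta> \<noteq> \<nu> \<Longrightarrow>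
       labels \<iota> m0 \<eta> \<nu> = labels \<iota> m1 (seq_add \<eta> \<rho>) (seq_add \<nu> \<rho>)"
proof -
  let ?n = "m_shift \<iota> m1 \<rho>"
  have ml: "ml ?n = ml m1" "mu ?n = (\<lambda>\<eta>. seq_add \<eta> \<rho>) ` mu m1"
    by (simp_all add: m_shift_def Let_def)
  have l01: "ml m0 = ml m1" and mu: "mu m0 = mu ?n"
    using same unfolding ess_same_def ml(1) by auto
  show "mu m0 = (\<lambda>\<eta>. seq_add \<eta> \<rho>) ` mu m1" using mu ml by simp
  assume \<eta>\<nu>: "\<eta> \<in> mu m0" "\<nu> \<in> mu m0" "\<eta> \<noteq> \<nu>"
  have tk: "take (ml m0) x = x" if "x \<in> mu m0" for x
    using M_familyD(2)[OF assms(3) that] by simp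
  have "ess_extends \<iota> m0 ?n"
    using same tk unfolding ess_same_def ess_extends_def mu[symmetric] by (auto simp: image_def)
  then have "labels \<iota> m0 \<eta> \<nu> = cut (ml m0) (labels \<iota> ?n \<eta> \<nu>)"
    using ess_extends_labels[OF assms(1), of m0 ?n \<eta> \<nu>] \<eta>\<nu> tk by (simp add: mu[symmetric])
  also have "labels \<iota> ?n \<eta> \<nu> = labels \<iota> m1 (seq_add \<eta> \<rho>) (seq_add \<nu> \<rho>)"
  proof -
    have "(\<eta>, \<nu>) \<in> off_diag ((\<lambda>\<eta>. seq_add \<eta> \<rho>) ` mu m1)" "(\<nu>, \<eta>) \<in> off_diag ((\<lambda>\<eta>. seq_add \<eta> \<rho>) ` mu m1)"
      using \<eta>\<nu> unfolding mu ml off_diag_def by auto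
    then show ?thesis
      unfolding labels_def m_shift_def Let_def by auto
  qed
  also have "cut (ml m0) \<dots> = \<dots>"
  proof -
    have in1: "seq_add x \<rho> \<in> mu m1" if x: "x \<in> mu m0" for x
    proof -
      obtain y where y: "y \<in> mu m1" "x = seq_add y \<rho>"
        using x unfolding mu ml(2) by blast
      then show ?thesis
        using seq_add_cancel_right[of y "ml m1" \<rho>] M_familyD(2)[OF assms(2)] assms(4) by simp
    qed
    have "seq_add \<eta> \<rho> \<noteq> seq_add \<nu> \<rho>"
      using \<eta>\<nu> M_familyD(2)[OF assms(3)] assms(4) l01 by (simp add: seq_add_right_inject[where l = "ml m1"])
    then show ?thesis
      using cut_full labels_length[OF assms(2)] in1 \<eta>\<nu> l01 by (metis order_refl)
  qed
  finally show "labels \<iota> m0 \<eta> \<nu> = labels \<iota> m1 (seq_add \<eta> \<rho>) (seq_add \<nu> \<rho>)" .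
qed

section \<open>Quasi-embeddings and transport of bricks\<close>

lemma quasi_embedding_on_iff:
  fixes S :: "('x::wellorder, 'o::wellorder) yzr"
  assumes "yX S = UNIV"
  shows "quasi_embedding_on S w \<phi> \<longleftrightarrow> strict_mono_on w \<phi> \<and>
    (\<forall>v. v \<subseteq> w \<and> finite v \<and> v \<noteq> {} \<longrightarrow> yr S (\<phi> ` v) = yr S v \<and> yk S (\<phi> ` v) = yk S v \<and>
        (ozero < yr S v \<longrightarrow> yj S (\<phi> ` v) = yj S v))"
  unfolding quasi_embedding_on_def quasi_embedding_def yzr_restrict_def fin_subsets_def
  using assms by simp

lemma quasi_embedding_onD:
  fixes S :: "('x::wellorder, 'o::wellorder) yzr"
  assumes "yX S = UNIV" "quasi_embedding_on S w \<phi>"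
  shows "strict_mono_on w \<phi>" "inj_on \<phi> w"
    "v \<subseteq> w \<Longrightarrow> finite v \<Longrightarrow> v \<noteq> {} \<Longrightarrow> yr S (\<phi> ` v) = yr S v"
    "v \<subseteq> w \<Longrightarrow> finite v \<Longrightarrow> v \<noteq> {} \<Longrightarrow> yk S (\<phi> ` v) = yk S v"
    "v \<subseteq> w \<Longrightarrow> finite v \<Longrightarrow> v \<noteq> {} \<Longrightarrow> ozero < yr S v \<Longrightarrow> yj S (\<phi> ` v) = yj S v"
  using assms(2) strict_mono_on_imp_inj_on unfolding quasi_embedding_on_iff[OF assms(1)] by blast+

lemma quasi_embedding_on_id: "yX S = UNIV \<Longrightarrow> quasi_embedding_on S w (\<lambda>x. x)"
  by (simp add: quasi_embedding_on_iff strict_mono_on_def)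

lemma quasi_embedding_on_subset:
  "yX S = UNIV \<Longrightarrow> quasi_embedding_on S w \<phi> \<Longrightarrow> v \<subseteq> w \<Longrightarrow> quasi_embedding_on S v \<phi>"
  unfolding quasi_embedding_on_iff strict_mono_on_def by (meson subset_iff)

lemma quasi_embedding_on_cong:
  fixes S :: "('x::wellorder, 'o::wellorder) yzr"
  assumes "yX S = UNIV" "quasi_embedding_on S w \<phi>" "\<And>a. a \<in> w \<Longrightarrow> \<phi> a = \<psi> a"
  shows "quasi_embedding_on S w \<psi>"
proof -
  have "\<psi> ` v = \<phi> ` v" if "v \<subseteq> w" for v
    by (intro image_cong refl) (use that assms(3) in auto)
  moreover have "strict_mono_on w \<psi>"
    using quasi_embedding_onD(1)[OF assms(1,2)] assms(3) by (auto simp: strict_mono_on_def)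
  ultimately show ?thesis
    using assms(2) unfolding quasi_embedding_on_iff[OF assms(1)] by simp
qed

lemma quasi_embedding_on_comp:
  fixes S :: "('x::wellorder, 'o::wellorder) yzr"
  assumes X: "yX S = UNIV" and "quasi_embedding_on S w \<phi>" "quasi_embedding_on S (\<phi> ` w) \<psi>"
  shows "quasi_embedding_on S w (\<psi> \<circ> \<phi>)"
proof -
  note 1 = quasi_embedding_onD[OF X assms(2)] and 2 = quasi_embedding_onD[OF X assms(3)]
  have "strict_mono_on w (\<psi> \<circ> \<phi>)"
    using 1(1) 2(1) by (auto simp: strict_mono_on_def)
  moreover have "yr S ((\<psi> \<circ> \<phi>) ` v) = yr S v \<and> yk S ((\<psi> \<circ> \<phi>) ` v) = yk S v \<and>
      (ozero < yr S v \<longrightarrow> yj S ((\<psi> \<circ> \<phi>) ` v) = yj S v)" if "v \<subseteq> w" "finite v" "v \<noteq> {}" for v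
    using 1(3-5)[OF that] 2(3-5)[of "\<phi> ` v"] that by (simp add: image_comp image_mono)
  ultimately show ?thesis
    unfolding quasi_embedding_on_iff[OF X] by blast
qed

lemma quasi_embedding_on_inverse:
  fixes S :: "('x::wellorder, 'o::wellorder) yzr"
  assumes X: "yX S = UNIV" and "quasi_embedding_on S w \<phi>"
  shows "quasi_embedding_on S (\<phi> ` w) (inv_into w \<phi>)"
proof -
  note 1 = quasi_embedding_onD[OF X assms(2)]
  have "strict_mono_on (\<phi> ` w) (inv_into w \<phi>)"
    unfolding strict_mono_on_def
  proof (intro allI impI, elim conjE)
    fix x y assume "x \<in> \<phi> ` w" "y \<in> \<phi> ` w" "x < y"
    then obtain a b where ab: "a \<in> w" "b \<in> w" "x = \<phi> a" "y = \<phi> b" by blast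
    then have "a < b"
      using strict_mono_on_less[OF 1(1)] \<open>x < y\<close> by simp
    then show "inv_into w \<phi> x < inv_into w \<phi> y"
      using ab 1(2) by simp
  qed
  moreover have "yr S (inv_into w \<phi> ` v) = yr S v \<and> yk S (inv_into w \<phi> ` v) = yk S v \<and>
      (ozero < yr S v \<longrightarrow> yj S (inv_into w \<phi> ` v) = yj S v)"
    if v: "v \<subseteq> \<phi> ` w" "finite v" "v \<noteq> {}" for v
  proof -
    have eq: "\<phi> ` inv_into w \<phi> ` v = v"
      using v(1) by (rule image_inv_into_cancel[OF refl])
    have "inv_into w \<phi> ` v \<subseteq> w"
      using v(1) by (auto intro!: inv_into_into)
    then show ?thesis
      using 1(3-5)[of "inv_into w \<phi> ` v"] v unfolding eq by simp
  qed
  ultimately show ?thesis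
    unfolding quasi_embedding_on_iff[OF X] by blast
qed

lemma card_below_image:
  assumes "strict_mono_on w (\<phi> :: 'x::linorder \<Rightarrow> 'y::linorder)" "a \<in> w"
  shows "card (\<phi> ` w \<inter> {..<\<phi> a}) = card (w \<inter> {..<a})"
proof -
  have "\<phi> x < \<phi> a \<longleftrightarrow> x < a" if "x \<in> w" for x
    using strict_mono_on_less[OF assms(1) that assms(2)] .
  then have "\<phi> ` w \<inter> {..<\<phi> a} = \<phi> ` (w \<inter> {..<a})"
    by auto
  moreover have "inj_on \<phi> (w \<inter> {..<a})"
    using strict_mono_on_imp_inj_on[OF assms(1)] by (rule inj_on_subset) blast
  ultimately show ?thesis
    by (simp add: card_image)
qed

text \<open>A brick refers to its indices only through their branches and heights, so renaming indices changes
  neither the tuples read off it nor its set \<open>bM\<close>.\<close>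

lemma brick_m_transport:
  assumes \<phi>: "inj_on \<phi> (bw b0)" "\<phi> ` bw b0 \<subseteq> bw b1" and n: "bn b0 = bn b1"
    and \<beta>: "\<And>a. a \<in> bw b0 \<Longrightarrow> beta b0 a = beta b1 (\<phi> a)"
    and hg: "\<And>i x y. i < \<iota> \<Longrightarrow> x \<in> bw b0 \<Longrightarrow> y \<in> bw b0 \<Longrightarrow> x \<noteq> y \<Longrightarrow>
      bh b0 i (x, y) = bh b1 i (\<phi> x, \<phi> y) \<and> bg b0 i (x, y) = bg b1 i (\<phi> x, \<phi> y)"
    and w: "w \<subseteq> bw b0"
  shows "induced \<iota> b0 l w m \<longleftrightarrow> induced \<iota> b1 l (\<phi> ` w) m"
    and "brick_m \<iota> T c b0 l w m \<longleftrightarrow> brick_m \<iota> T c b1 l (\<phi> ` w) m"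
proof -
  have inj: "inj_on \<phi> w" using \<phi>(1) w by (rule inj_on_subset)
  have od: "off_diag (\<phi> ` w) = (\<lambda>(x, y). (\<phi> x, \<phi> y)) ` off_diag w"
    using inj by (auto simp: off_diag_def inj_on_def)
  have \<beta>': "beta b1 (\<phi> a) = beta b0 a" if "a \<in> w" for a using \<beta> w that by auto
  have hg': "bh b0 i (x, y) = bh b1 i (\<phi> x, \<phi> y) \<and> bg b0 i (x, y) = bg b1 i (\<phi> x, \<phi> y)"
    if "(x, y) \<in> off_diag w" "i < \<iota>" for x y i
    using hg that w unfolding off_diag_def by auto
  have 1: "(\<lambda>a. take l (beta b0 a)) ` w = (\<lambda>a. take l (beta b1 a)) ` \<phi> ` w"
    using \<beta>' by (auto simp: image_image)
  have "inj_on (\<lambda>a. take l (beta b1 a)) (\<phi> ` w) \<longleftrightarrow> inj_on (\<lambda>a. take l (beta b0 a)) w"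
    unfolding comp_inj_on_iff[OF inj] by (rule inj_on_cong) (simp add: \<beta>')
  moreover have "(\<forall>(a, a')\<in>off_diag (\<phi> ` w).
        mh m i (take l (beta b1 a), take l (beta b1 a')) = bh b1 i (a, a') \<and>
        mg m i (take l (beta b1 a), take l (beta b1 a')) = take l (bg b1 i (a, a'))) \<longleftrightarrow>
      (\<forall>(a, a')\<in>off_diag w.
        mh m i (take l (beta b0 a), take l (beta b0 a')) = bh b0 i (a, a') \<and>
        mg m i (take l (beta b0 a), take l (beta b0 a')) = take l (bg b0 i (a, a')))" if "i < \<iota>" for i
  proof -
    have "beta b1 (\<phi> a) = beta b0 a \<and> beta b1 (\<phi> a') = beta b0 a'" if "(a, a') \<in> off_diag w" for a a'
      using that \<beta>' unfolding off_diag_def by auto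
    then show ?thesis
      unfolding od using hg'[OF _ that] by fastforce
  qed
  ultimately show *: "induced \<iota> b0 l w m \<longleftrightarrow> induced \<iota> b1 l (\<phi> ` w) m"
    unfolding induced_def 1 by auto
  have "(\<forall>i<\<iota>. \<forall>p\<in>off_diag w. c (bh b0 i p) \<le> l) \<longleftrightarrow> (\<forall>i<\<iota>. \<forall>p\<in>off_diag (\<phi> ` w). c (bh b1 i p) \<le> l)"
    unfolding od using hg' by fastforce
  then show "brick_m \<iota> T c b0 l w m \<longleftrightarrow> brick_m \<iota> T c b1 l (\<phi> ` w) m"
    unfolding brick_m_def * n using w \<phi>(2) card_image[OF inj] by auto
qed

text \<open>A brick pulled back along a quasi-embedding is a brick.  With the inclusion of a subset this gives
  restrictions of bricks, with the inverse of a quasi-embedding it gives images.\<close>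

lemma is_brick_pullback:
  fixes S :: "(nat, 'o::wellorder) yzr"
  assumes X: "yX S = UNIV" and b1: "is_brick S \<iota> T c b1"
    and \<phi>: "quasi_embedding_on S (bw b0) \<phi>" "\<phi> ` bw b0 \<subseteq> bw b1" and n: "bn b0 = bn b1"
    and card: "3 \<le> card (bw b0)"
    and \<beta>: "\<And>a. a \<in> bw b0 \<Longrightarrow> beta b0 a = beta b1 (\<phi> a)"
    and hg: "\<And>i x y. i < \<iota> \<Longrightarrow> x \<in> bw b0 \<Longrightarrow> y \<in> bw b0 \<Longrightarrow> x \<noteq> y \<Longrightarrow>
      bh b0 i (x, y) = bh b1 i (\<phi> x, \<phi> y) \<and> bg b0 i (x, y) = bg b1 i (\<phi> x, \<phi> y)"
    and ext: "beta b0 \<in> extensional (bw b0)" "bh b0 \<in> extensional {..<\<iota>}" "bg b0 \<in> extensional {..<\<iota>}"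
      "\<And>i. i < \<iota> \<Longrightarrow> bh b0 i \<in> extensional (off_diag (bw b0)) \<and> bg b0 i \<in> extensional (off_diag (bw b0))"
    and M: "bM b0 = {m. \<exists>l w. brick_m \<iota> T c b0 l w m}"
  shows "is_brick S \<iota> T c b0"
proof -
  note qe = quasi_embedding_onD[OF X \<phi>(1)]
  note B = b1[unfolded is_brick_def]
  have n0: "0 < bn b1" and fin1: "finite (bw b1)" using B by auto
  have tr: "brick_m \<iota> T c b0 l w m \<longleftrightarrow> w \<subseteq> bw b0 \<and> brick_m \<iota> T c b1 l (\<phi> ` w) m" for l w m
  proof (cases "w \<subseteq> bw b0")
    case True
    then show ?thesis
      using brick_m_transport(2)[OF qe(2) \<phi>(2) n \<beta> hg True] by simp
  qed (simp add: brick_m_def)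
  have fin: "finite (bw b0)"
    using card by (auto intro: card_ge_0_finite)
  have od: "(\<phi> x, \<phi> y) \<in> off_diag (bw b1)" if "(x, y) \<in> off_diag (bw b0)" for x y
    using that qe(2) \<phi>(2) unfolding off_diag_def inj_on_def by auto
  have hg': "bh b0 i (x, y) = bh b1 i (\<phi> x, \<phi> y) \<and> bg b0 i (x, y) = bg b1 i (\<phi> x, \<phi> y)"
    if "(x, y) \<in> off_diag (bw b0)" "i < \<iota>" for x y i
    using hg that unfolding off_diag_def by auto
  show ?thesis
    unfolding is_brick_def
  proof (intro conjI)
    show "finite (bw b0)" "3 \<le> card (bw b0)" "0 < bn b0" "bM b0 = {m. \<exists>l w. brick_m \<iota> T c b0 l w m}"
      using fin card n0 n M by auto
    have "beta b1 \<in> bw b1 \<rightarrow>\<^sub>E {x. length x = bn b1}" using B by blast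
    then have "beta b0 a \<in> {x. length x = bn b0}" if "a \<in> bw b0" for a
      unfolding \<beta>[OF that] n using that \<phi>(2) by (meson PiE_mem image_subset_iff)
    then show "beta b0 \<in> bw b0 \<rightarrow>\<^sub>E {x. length x = bn b0}"
      using ext(1) by (auto simp: PiE_def)
    show "bh b0 \<in> {..<\<iota>} \<rightarrow>\<^sub>E off_diag (bw b0) \<rightarrow>\<^sub>E UNIV"
      using ext by (auto simp: PiE_def)
    have "bg b1 \<in> {..<\<iota>} \<rightarrow>\<^sub>E (off_diag (bw b1) \<rightarrow>\<^sub>E (\<Union>m. T m \<inter> {x. length x = bn b1}))" using B by blast
    then have "bg b1 i p \<in> (\<Union>m. T m \<inter> {x. length x = bn b1})" if "i < \<iota>" "p \<in> off_diag (bw b1)" for i p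
      using that by (meson PiE_mem lessThan_iff)
    then have "bg b0 i p \<in> (\<Union>m. T m \<inter> {x. length x = bn b0})" if "i < \<iota>" "p \<in> off_diag (bw b0)" for i p
      using that od hg' n by (cases p) auto
    then show "bg b0 \<in> {..<\<iota>} \<rightarrow>\<^sub>E off_diag (bw b0) \<rightarrow>\<^sub>E (\<Union>m. T m \<inter> {x. length x = bn b0})"
      using ext by (intro PiE_I) (auto simp: extensional_def)
    have "c (bh b1 i p) \<le> bn b1" if "i < \<iota>" "p \<in> off_diag (bw b1)" for i p
      using B that by blast
    then show "\<forall>i<\<iota>. \<forall>p\<in>off_diag (bw b0). c (bh b0 i p) \<le> bn b0"
      using od hg' n by auto
    have lin1: "lin_indep_seqs (bn b1) (bw b1) (beta b1)" using B by blast
    show "lin_indep_seqs (bn b0) (bw b0) (beta b0)"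
      unfolding lin_indep_seqs_def
    proof (intro allI impI)
      fix d :: "nat \<Rightarrow> bit"
      assume d: "\<forall>i<bn b0. (\<Sum>a\<in>bw b0. d a * beta b0 a ! i) = 0"
      define d' where "d' a = (if a \<in> \<phi> ` bw b0 then d (inv_into (bw b0) \<phi> a) else 0)" for a
      have "(\<Sum>a\<in>bw b1. d' a * beta b1 a ! i) = 0" if i: "i < bn b1" for i
      proof -
        have "(\<Sum>a\<in>bw b1. d' a * beta b1 a ! i) = (\<Sum>a\<in>\<phi> ` bw b0. d' a * beta b1 a ! i)"
          by (rule sum.mono_neutral_right) (use fin1 \<phi>(2) in \<open>auto simp: d'_def\<close>)
        also have "\<dots> = (\<Sum>a\<in>bw b0. d' (\<phi> a) * beta b1 (\<phi> a) ! i)"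
          using sum.reindex[OF qe(2)] by (simp add: o_def)
        also have "\<dots> = (\<Sum>a\<in>bw b0. d a * beta b0 a ! i)"
          by (rule sum.cong) (use qe(2) \<beta> in \<open>auto simp: d'_def\<close>)
        finally show ?thesis using d i n by simp
      qed
      then have d'0: "\<forall>a\<in>bw b1. d' a = 0"
        using lin1 unfolding lin_indep_seqs_def by blast
      show "\<forall>a\<in>bw b0. d a = 0"
      proof
        fix a assume a: "a \<in> bw b0"
        then have "d' (\<phi> a) = 0" using d'0 \<phi>(2) by blast
        then show "d a = 0" using a qe(2) by (simp add: d'_def)
      qed
    qed
    obtain m1 where m1: "m1 \<in> M_family \<iota> T" "induced \<iota> b1 (bn b1) (bw b1) m1" using B by blast
    define V where "V = \<phi> ` bw b0"
    define U where "U = (\<lambda>a. take (bn b1) (beta b1 a)) ` V"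
    have V: "V \<subseteq> bw b1" using \<phi>(2) unfolding V_def .
    have ml: "ml m1 = bn b1" and mu: "mu m1 = (\<lambda>a. take (bn b1) (beta b1 a)) ` bw b1"
      and inj1: "inj_on (\<lambda>a. take (bn b1) (beta b1 a)) (bw b1)"
      using m1(2) unfolding induced_def by blast+
    have ind: "mh m1 i (take (bn b1) (beta b1 a), take (bn b1) (beta b1 a')) = bh b1 i (a, a') \<and>
        mg m1 i (take (bn b1) (beta b1 a), take (bn b1) (beta b1 a')) = take (bn b1) (bg b1 i (a, a'))"
      if "i < \<iota>" "(a, a') \<in> off_diag (bw b1)" for i a a'
      using m1(2) that unfolding induced_def by blast+
    have cardV: "3 \<le> card V" using card card_image[OF qe(2)] unfolding V_def by simp
    have injV: "inj_on (\<lambda>a. take (bn b1) (beta b1 a)) V" using inj1 V by (rule inj_on_subset)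
    have U: "U \<subseteq> mu m1" "2 \<le> card U"
      using V mu cardV card_image[OF injV] unfolding U_def by auto
    have tkU: "take (bn b1) x = x" if "x \<in> U" for x using that unfolding U_def by auto
    have injU: "inj_on (take (bn b1)) U" using tkU by (auto simp: inj_on_def)
    have nr: "nonrep \<iota> (\<lambda>i. take (bn b1) (mg m1 i (x, y))) (\<lambda>i. take (bn b1) (mg m1 i (y, x)))"
      if "x \<in> U" "y \<in> U" "x \<noteq> y" for x y
    proof -
      have xy: "x \<in> mu m1" "y \<in> mu m1" using that U by auto
      show ?thesis
        using M_familyD(11)[OF m1(1) xy that(3)] M_familyD(9)[OF m1(1) _ xy that(3)]
          M_familyD(9)[OF m1(1) _ xy(2,1) that(3)[symmetric]] ml unfolding nonrep_def by simp
    qed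
    have m0M: "sub_tuple \<iota> m1 U (bn b1) \<in> M_family \<iota> T"
      by (rule sub_tuple_in_M[OF m1(1) U]) (use n0 ml injU nr in auto)
    have "induced \<iota> b1 (bn b1) V (sub_tuple \<iota> m1 U (bn b1))"
      unfolding induced_def
    proof (intro conjI allI impI ballI)
      show "mu (sub_tuple \<iota> m1 U (bn b1)) = (\<lambda>a. take (bn b1) (beta b1 a)) ` V"
      proof -
        have "take (bn b1) ` U = (\<lambda>x. x) ` U" by (intro image_cong refl tkU)
        then show ?thesis unfolding sub_tuple_simps U_def[symmetric] by simp
      qed
      fix i p assume i: "i < \<iota>" and "p \<in> off_diag V"
      then obtain a a' where p: "p = (a, a')" "a \<in> V" "a' \<in> V" "a \<noteq> a'"
        unfolding off_diag_def by blast
      let ?x = "take (bn b1) (beta b1 a)" and ?y = "take (bn b1) (beta b1 a')"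
      have xy: "?x \<in> U" "?y \<in> U" "?x \<noteq> ?y"
        using p injV unfolding U_def inj_on_def by auto
      have od: "(a, a') \<in> off_diag (bw b1)" using p V unfolding off_diag_def by auto
      show "case p of (a, a') \<Rightarrow> mh (sub_tuple \<iota> m1 U (bn b1)) i (take (bn b1) (beta b1 a), take (bn b1) (beta b1 a')) = bh b1 i (a, a') \<and>
        mg (sub_tuple \<iota> m1 U (bn b1)) i (take (bn b1) (beta b1 a), take (bn b1) (beta b1 a')) = take (bn b1) (bg b1 i (a, a'))"
        using sub_tuple_nth[OF injU xy i, of m1] ind[OF i od] unfolding p by simp
    qed (use injV in simp_all)
    then have "induced \<iota> b0 (bn b0) (bw b0) (sub_tuple \<iota> m1 U (bn b1))"
      using brick_m_transport(1)[OF qe(2) \<phi>(2) n \<beta> hg order_refl] unfolding V_def n by blast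
    then show "\<exists>m\<in>M_family \<iota> T. induced \<iota> b0 (bn b0) (bw b0) m"
      using m0M by blast
    show "\<forall>l w0 w1 m0 m1 \<rho>.
        brick_m \<iota> T c b0 l w0 m0 \<and> brick_m \<iota> T c b0 l w1 m1 \<and> length \<rho> = l \<and>
        ess_same \<iota> m0 (m_shift \<iota> m1 \<rho>) \<longrightarrow>
        (\<exists>\<pi>. strict_mono_on w0 \<pi> \<and> \<pi> ` w0 = w1 \<and> quasi_embedding_on S w0 \<pi> \<and>
             (\<forall>a\<in>w0. seq_add (take l (beta b0 a)) \<rho> = take l (beta b0 (\<pi> a))))"
    proof (intro allI impI, elim conjE)
      fix l w0 w1 m0 m1 \<rho>
      assume *: "brick_m \<iota> T c b0 l w0 m0" "brick_m \<iota> T c b0 l w1 m1" "length \<rho> = l"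
        "ess_same \<iota> m0 (m_shift \<iota> m1 \<rho>)"
      then have w: "w0 \<subseteq> bw b0" "w1 \<subseteq> bw b0" and 1: "brick_m \<iota> T c b1 l (\<phi> ` w0) m0" "brick_m \<iota> T c b1 l (\<phi> ` w1) m1"
        unfolding tr by auto
      have "\<exists>\<pi>. strict_mono_on (\<phi> ` w0) \<pi> \<and> \<pi> ` \<phi> ` w0 = \<phi> ` w1 \<and> quasi_embedding_on S (\<phi> ` w0) \<pi> \<and>
             (\<forall>a\<in>\<phi> ` w0. seq_add (take l (beta b1 a)) \<rho> = take l (beta b1 (\<pi> a)))"
        using B 1 *(3,4) by blast
      then obtain \<pi> where \<pi>: "\<pi> ` \<phi> ` w0 = \<phi> ` w1" "quasi_embedding_on S (\<phi> ` w0) \<pi>"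
        "\<forall>a\<in>\<phi> ` w0. seq_add (take l (beta b1 a)) \<rho> = take l (beta b1 (\<pi> a))" by blast
      define \<psi> where "\<psi> = inv_into w1 \<phi> \<circ> (\<pi> \<circ> \<phi>)"
      have inj1: "inj_on \<phi> w1" using qe(2) w(2) by (rule inj_on_subset)
      have im: "(\<pi> \<circ> \<phi>) ` w0 = \<phi> ` w1" using \<pi>(1) by (simp add: image_comp)
      have q: "quasi_embedding_on S w0 \<psi>"
        unfolding \<psi>_def
      proof (intro quasi_embedding_on_comp[OF X])
        show "quasi_embedding_on S w0 \<phi>" using quasi_embedding_on_subset[OF X \<phi>(1) w(1)] .
        show "quasi_embedding_on S ((\<pi> \<circ> \<phi>) ` w0) (inv_into w1 \<phi>)"
          unfolding im by (rule quasi_embedding_on_inverse[OF X quasi_embedding_on_subset[OF X \<phi>(1) w(2)]])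
      qed (rule \<pi>(2))
      have "\<psi> ` w0 = inv_into w1 \<phi> ` ((\<pi> \<circ> \<phi>) ` w0)" by (simp add: \<psi>_def image_comp o_assoc)
      also have "\<dots> = w1" unfolding im using inj1 by simp
      finally have im': "\<psi> ` w0 = w1" .
      have "seq_add (take l (beta b0 a)) \<rho> = take l (beta b0 (\<psi> a))" if a: "a \<in> w0" for a
      proof -
        have "\<psi> a \<in> w1" using im' a by blast
        moreover have "\<phi> (\<psi> a) = \<pi> (\<phi> a)"
          using \<pi>(1) a unfolding \<psi>_def by (auto intro!: f_inv_into_f)
        moreover have "beta b0 a = beta b1 (\<phi> a)" "beta b0 (\<psi> a) = beta b1 (\<phi> (\<psi> a))"
          using \<beta> w a calculation(1) by blast+
        ultimately show ?thesis
          using a \<pi>(3) by simp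
      qed
      then show "\<exists>\<pi>. strict_mono_on w0 \<pi> \<and> \<pi> ` w0 = w1 \<and> quasi_embedding_on S w0 \<pi> \<and>
             (\<forall>a\<in>w0. seq_add (take l (beta b0 a)) \<rho> = take l (beta b0 (\<pi> a)))"
        using q im' quasi_embedding_onD(1)[OF X q] by blast
    qed
    show "\<forall>l w m n a.
        brick_m \<iota> T c b0 l w m \<and> a \<in> w \<and> card (w \<inter> {..<a}) = yk S w \<and> yr S w = ozero \<and>
        n \<in> bM b0 \<and> ess_extends \<iota> m n \<longrightarrow>
        card {\<nu> \<in> mu n. prefix (take l (beta b0 a)) \<nu>} = 1"
    proof (intro allI impI, elim conjE)
      fix l w m n a
      assume *: "brick_m \<iota> T c b0 l w m" "a \<in> w" "card (w \<inter> {..<a}) = yk S w" "yr S w = ozero"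
        "n \<in> bM b0" "ess_extends \<iota> m n"
      have w: "w \<subseteq> bw b0" and 1: "brick_m \<iota> T c b1 l (\<phi> ` w) m" using *(1) unfolding tr by auto
      have "n \<in> bM b1" using *(5) B unfolding M tr by auto
      moreover have w': "finite w" "w \<noteq> {}"
        using w fin *(2) by (auto intro: finite_subset)
      moreover have "card (\<phi> ` w \<inter> {..<\<phi> a}) = yk S (\<phi> ` w)"
        using card_below_image[of w \<phi> a] *(2,3) qe(4)[OF w w']
          quasi_embedding_onD(1)[OF X quasi_embedding_on_subset[OF X \<phi>(1) w]] by simp
      moreover have "yr S (\<phi> ` w) = ozero" using *(4) qe(3)[OF w w'] by simp
      ultimately have "card {\<nu> \<in> mu n. prefix (take l (beta b1 (\<phi> a))) \<nu>} = 1"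
        using B 1 *(2,6) by blast
      then show "card {\<nu> \<in> mu n. prefix (take l (beta b0 a)) \<nu>} = 1"
        using \<beta> *(2) w by auto
    qed
  qed
qed

lemma is_brickD:
  assumes "is_brick S \<iota> T c b"
  shows "finite (bw b)" "3 \<le> card (bw b)" "a \<in> bw b \<Longrightarrow> length (beta b a) = bn b"
    "beta b \<in> extensional (bw b)" "bh b \<in> extensional {..<\<iota>}" "bg b \<in> extensional {..<\<iota>}"
    "i < \<iota> \<Longrightarrow> bh b i \<in> extensional (off_diag (bw b))" "i < \<iota> \<Longrightarrow> bg b i \<in> extensional (off_diag (bw b))"
    "i < \<iota> \<Longrightarrow> p \<in> off_diag (bw b) \<Longrightarrow> length (bg b i p) = bn b"
    "bM b = {m. \<exists>l w. brick_m \<iota> T c b l w m}"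
proof -
  note B = assms[unfolded is_brick_def]
  note B1 = B[THEN conjunct2] and fin = B[THEN conjunct1]
  note B2 = B1[THEN conjunct2] and 1 = B1[THEN conjunct1, THEN conjunct1]
  note B3 = B2[THEN conjunct2] and hg = B2[THEN conjunct1]
  note 2 = hg[THEN conjunct1] and 3 = hg[THEN conjunct2, THEN conjunct2]
  show "finite (bw b)" "3 \<le> card (bw b)" using fin by blast+
  show "bM b = {m. \<exists>l w. brick_m \<iota> T c b l w m}"
    by (rule B3[THEN conjunct2, THEN conjunct1])
  show "a \<in> bw b \<Longrightarrow> length (beta b a) = bn b" "beta b \<in> extensional (bw b)"
    using 1 by (auto simp: PiE_def)
  show "bh b \<in> extensional {..<\<iota>}" "bg b \<in> extensional {..<\<iota>}"
    "i < \<iota> \<Longrightarrow> bh b i \<in> extensional (off_diag (bw b))" "i < \<iota> \<Longrightarrow> bg b i \<in> extensional (off_diag (bw b))"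
    using 2 3 by (auto simp: PiE_def Pi_def)
  have "bg b i p \<in> (\<Union>m. T m \<inter> {x. length x = bn b})" if "i < \<iota>" "p \<in> off_diag (bw b)"
    using 3 that by (meson PiE_mem lessThan_iff)
  then show "i < \<iota> \<Longrightarrow> p \<in> off_diag (bw b) \<Longrightarrow> length (bg b i p) = bn b" by auto
qed

text \<open>The set \<open>bM\<close> is determined by the other components, so the definite descriptions behind restrictions and images are
  unique.\<close>

lemma brick_eqI:
  assumes "is_brick S \<iota> T c b" "is_brick S \<iota> T c b'" "bw b = bw b'" "bn b = bn b'"
    "\<And>a. a \<in> bw b \<Longrightarrow> beta b a = beta b' a"
    "\<And>i x y. i < \<iota> \<Longrightarrow> x \<in> bw b \<Longrightarrow> y \<in> bw b \<Longrightarrow> x \<noteq> y \<Longrightarrow>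
      bh b i (x, y) = bh b' i (x, y) \<and> bg b i (x, y) = bg b' i (x, y)"
  shows "b = b'"
proof -
  note D = is_brickD[OF assms(1)] and D' = is_brickD[OF assms(2), folded assms(3)]
  have hg: "bh b i p = bh b' i p \<and> bg b i p = bg b' i p" if "p \<in> off_diag (bw b)" "i < \<iota>" for p i
    using assms(6)[OF that(2)] that(1) by (cases p) (simp add: off_diag_def)
  have \<beta>: "beta b = beta b'"
    using D(4) D'(4) assms(5) by (rule extensionalityI)
  have h: "bh b = bh b'"
    by (rule extensionalityI[OF D(5) D'(5)], rule extensionalityI[OF D(7) D'(7)]) (use hg in auto)
  have g: "bg b = bg b'"
    by (rule extensionalityI[OF D(6) D'(6)], rule extensionalityI[OF D(8) D'(8)]) (use hg in auto)
  have "brick_m \<iota> T c b = brick_m \<iota> T c b'"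
    using assms(3,4) \<beta> h g by (intro ext) (simp add: brick_m_def induced_def)
  then have "bM b = bM b'" using D(10) D'(10) by simp
  then show ?thesis
    using assms(3,4) \<beta> h g by (cases b; cases b') simp
qed

definition pulled_brick :: "nat \<Rightarrow> (nat \<Rightarrow> bit list set) \<Rightarrow> (nat \<Rightarrow> nat) \<Rightarrow> brick \<Rightarrow> nat set \<Rightarrow> (nat \<Rightarrow> nat) \<Rightarrow> brick" where
  "pulled_brick \<iota> T c b w \<phi> =
     (let b' = \<lparr>bw = w, bn = bn b, beta = (\<lambda>a\<in>w. beta b (\<phi> a)),
        bh = (\<lambda>i\<in>{..<\<iota>}. \<lambda>p\<in>off_diag w. bh b i (\<phi> (fst p), \<phi> (snd p))),
        bg = (\<lambda>i\<in>{..<\<iota>}. \<lambda>p\<in>off_diag w. bg b i (\<phi> (fst p), \<phi> (snd p))), bM = {}\<rparr>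
      in b'\<lparr>bM := {m. \<exists>l w. brick_m \<iota> T c b' l w m}\<rparr>)"

lemma pulled_brick_simps [simp]:
  "bw (pulled_brick \<iota> T c b w \<phi>) = w" "bn (pulled_brick \<iota> T c b w \<phi>) = bn b"
  "a \<in> w \<Longrightarrow> beta (pulled_brick \<iota> T c b w \<phi>) a = beta b (\<phi> a)"
  "i < \<iota> \<Longrightarrow> x \<in> w \<Longrightarrow> y \<in> w \<Longrightarrow> x \<noteq> y \<Longrightarrow> bh (pulled_brick \<iota> T c b w \<phi>) i (x, y) = bh b i (\<phi> x, \<phi> y)"
  "i < \<iota> \<Longrightarrow> x \<in> w \<Longrightarrow> y \<in> w \<Longrightarrow> x \<noteq> y \<Longrightarrow> bg (pulled_brick \<iota> T c b w \<phi>) i (x, y) = bg b i (\<phi> x, \<phi> y)"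
  by (simp_all add: pulled_brick_def Let_def off_diag_def)

lemma is_brick_pulled_brick:
  fixes S :: "(nat, 'o::wellorder) yzr"
  assumes "yX S = UNIV" "is_brick S \<iota> T c b" "quasi_embedding_on S w \<phi>" "\<phi> ` w \<subseteq> bw b" "3 \<le> card w"
  shows "is_brick S \<iota> T c (pulled_brick \<iota> T c b w \<phi>)"
proof (rule is_brick_pullback[OF assms(1,2), where \<phi> = \<phi>])
  show "bM (pulled_brick \<iota> T c b w \<phi>) = {m. \<exists>l w'. brick_m \<iota> T c (pulled_brick \<iota> T c b w \<phi>) l w' m}"
    by (simp add: pulled_brick_def Let_def brick_m_def induced_def)
qed (use assms in \<open>auto simp: pulled_brick_def Let_def off_diag_def\<close>)

lemma brick_restrict_eq:
  fixes S :: "(nat, 'o::wellorder) yzr"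
  assumes X: "yX S = UNIV" and b: "is_brick S \<iota> T c b" and w: "w \<subseteq> bw b" "3 \<le> card w"
  shows "brick_restrict S \<iota> T c b w = pulled_brick \<iota> T c b w (\<lambda>x. x)"
  unfolding brick_restrict_def
proof (rule the_equality)
  let ?b = "pulled_brick \<iota> T c b w (\<lambda>x. x)"
  have br: "is_brick S \<iota> T c ?b"
    by (rule is_brick_pulled_brick[OF X b quasi_embedding_on_id[OF X]]) (use w in auto)
  have "brick_le \<iota> ?b b"
    unfolding brick_le_def using w by (auto simp: off_diag_def)
  then show "is_brick S \<iota> T c ?b \<and> bw ?b = w \<and> bn ?b = bn b \<and> brick_le \<iota> ?b b"
    using br by simp
  fix b' assume b': "is_brick S \<iota> T c b' \<and> bw b' = w \<and> bn b' = bn b \<and> brick_le \<iota> b' b"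
  show "b' = ?b"
  proof (rule brick_eqI[OF _ br])
    show "beta b' a = beta ?b a" if "a \<in> bw b'" for a
    proof -
      have "prefix (beta b' a) (beta b a)" using b' that unfolding brick_le_def by blast
      then have "beta b' a = beta b a"
        by (rule prefix_same_length) (use b' that w is_brickD(3) b in \<open>metis subsetD\<close>)
      then show ?thesis using that b' by simp
    qed
    fix i x y assume i: "i < \<iota>" and xy: "x \<in> bw b'" "y \<in> bw b'" "x \<noteq> y"
    then have od: "(x, y) \<in> off_diag (bw b')" "(x, y) \<in> off_diag (bw b)"
      using b' w by (auto simp: off_diag_def)
    then have "bh b i (x, y) = bh b' i (x, y)" "prefix (bg b' i (x, y)) (bg b i (x, y))"
      using b' i unfolding brick_le_def by auto
    moreover have "length (bg b' i (x, y)) = length (bg b i (x, y))"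
      using is_brickD(9)[OF b i od(2)] is_brickD(9)[OF _ i od(1)] b' by metis
    ultimately show "bh b' i (x, y) = bh ?b i (x, y) \<and> bg b' i (x, y) = bg ?b i (x, y)"
      using prefix_same_length b' i xy by auto
  qed (use b' in auto)
qed

lemma brick_image_eq:
  fixes S :: "(nat, 'o::wellorder) yzr"
  assumes X: "yX S = UNIV" and b: "is_brick S \<iota> T c b" and \<phi>: "quasi_embedding_on S (bw b) \<phi>"
  shows "brick_image S \<iota> T c \<phi> b = pulled_brick \<iota> T c b (\<phi> ` bw b) (inv_into (bw b) \<phi>)"
  unfolding brick_image_def
proof (rule the_equality)
  let ?b = "pulled_brick \<iota> T c b (\<phi> ` bw b) (inv_into (bw b) \<phi>)"
  note inj = quasi_embedding_onD(2)[OF X \<phi>]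
  have br: "is_brick S \<iota> T c ?b"
  proof (rule is_brick_pulled_brick[OF X b quasi_embedding_on_inverse[OF X \<phi>]])
    show "inv_into (bw b) \<phi> ` \<phi> ` bw b \<subseteq> bw b" using inj by simp
    show "3 \<le> card (\<phi> ` bw b)" using card_image[OF inj] is_brickD(2)[OF b] by simp
  qed
  have ne: "\<phi> x \<noteq> \<phi> y" if "x \<in> bw b" "y \<in> bw b" "x \<noteq> y" for x y
    using inj that by (auto simp: inj_on_def)
  have tr: "brick_m \<iota> T c b l w m \<longleftrightarrow> brick_m \<iota> T c ?b l (\<phi> ` w) m" if "w \<subseteq> bw b" for l w m
    by (rule brick_m_transport(2)) (use inj ne that in auto)
  have "bM ?b = bM b"
    unfolding is_brickD(10)[OF br] is_brickD(10)[OF b]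
  proof (intro set_eqI iffI; elim CollectE exE)
    fix m l w assume *: "brick_m \<iota> T c ?b l w m"
    then have "w \<subseteq> \<phi> ` bw b" unfolding brick_m_def by simp
    then obtain w' where "w' \<subseteq> bw b" "w = \<phi> ` w'" by (auto simp: subset_image_iff)
    then show "m \<in> {m. \<exists>l w. brick_m \<iota> T c b l w m}" using tr * by blast
  next
    fix m l w assume *: "brick_m \<iota> T c b l w m"
    then have "w \<subseteq> bw b" unfolding brick_m_def by simp
    then show "m \<in> {m. \<exists>l w. brick_m \<iota> T c ?b l w m}" using tr * by blast
  qed
  then show "is_brick S \<iota> T c ?b \<and> bw ?b = \<phi> ` bw b \<and> bn ?b = bn b \<and> bM ?b = bM b \<and>
    (\<forall>a\<in>bw b. beta b a = beta ?b (\<phi> a)) \<and>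
    (\<forall>i<\<iota>. \<forall>(x, y)\<in>off_diag (bw b).
      bh b i (x, y) = bh ?b i (\<phi> x, \<phi> y) \<and> bg b i (x, y) = bg ?b i (\<phi> x, \<phi> y))"
    using br inj ne by (auto simp: off_diag_def)
  fix b' assume b': "is_brick S \<iota> T c b' \<and> bw b' = \<phi> ` bw b \<and> bn b' = bn b \<and> bM b' = bM b \<and>
    (\<forall>a\<in>bw b. beta b a = beta b' (\<phi> a)) \<and>
    (\<forall>i<\<iota>. \<forall>(x, y)\<in>off_diag (bw b).
      bh b i (x, y) = bh b' i (\<phi> x, \<phi> y) \<and> bg b i (x, y) = bg b' i (\<phi> x, \<phi> y))"
  show "b' = ?b"
  proof (rule brick_eqI[OF _ br])
    show "beta b' a = beta ?b a" if "a \<in> bw b'" for a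
      using that b' inj by auto
    fix i x y assume "i < \<iota>" "x \<in> bw b'" "y \<in> bw b'" "x \<noteq> y"
    moreover obtain p q where "p \<in> bw b" "x = \<phi> p" "q \<in> bw b" "y = \<phi> q"
      using calculation b' by auto
    moreover have "(p, q) \<in> off_diag (bw b)"
      using calculation by (auto simp: off_diag_def)
    then have "bh b i (p, q) = bh b' i (\<phi> p, \<phi> q) \<and> bg b i (p, q) = bg b' i (\<phi> p, \<phi> q)"
      using b' calculation(1) by blast
    ultimately show "bh b' i (x, y) = bh ?b i (x, y) \<and> bg b' i (x, y) = bg ?b i (x, y)"
      using inj by simp
  qed (use b' in auto)
qed

text \<open>What the two amalgamation clauses demand of \<open>\<pi> \<circ> \<pi>0\<close> and \<open>\<pi> \<circ> \<pi>1\<close>, free of restrictions and images of bricks.\<close>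

lemma brick_le_image_restrict:
  fixes S :: "(nat, 'o::wellorder) yzr"
  assumes X: "yX S = UNIV" and b: "is_brick S \<iota> T c b" and w: "w \<subseteq> bw b" "3 \<le> card w"
    and b': "is_brick S \<iota> T c b'" and \<phi>: "quasi_embedding_on S w \<phi>" "\<phi> ` w \<subseteq> bw b'"
    and n: "bn b \<le> bn b'" and \<beta>: "\<And>a. a \<in> w \<Longrightarrow> prefix (beta b a) (beta b' (\<phi> a))"
    and hg: "\<And>i x y. i < \<iota> \<Longrightarrow> x \<in> w \<Longrightarrow> y \<in> w \<Longrightarrow> x \<noteq> y \<Longrightarrow>
       bh b' i (\<phi> x, \<phi> y) = bh b i (x, y) \<and> prefix (bg b i (x, y)) (bg b' i (\<phi> x, \<phi> y))"
  shows "brick_le \<iota> (brick_image S \<iota> T c \<phi> (brick_restrict S \<iota> T c b w)) (brick_restrict S \<iota> T c b' (\<phi> ` w))"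
proof -
  note inj = quasi_embedding_onD(2)[OF X \<phi>(1)]
  have c: "3 \<le> card (\<phi> ` w)" using card_image[OF inj] w by simp
  let ?r = "pulled_brick \<iota> T c b w (\<lambda>x. x)"
  have r: "is_brick S \<iota> T c ?r"
    by (rule is_brick_pulled_brick[OF X b quasi_embedding_on_id[OF X]]) (use w in auto)
  have ne: "\<phi> x \<noteq> \<phi> y" if "x \<in> w" "y \<in> w" "x \<noteq> y" for x y
    using inj that by (auto simp: inj_on_def)
  show ?thesis
    unfolding brick_restrict_eq[OF X b w] brick_restrict_eq[OF X b' \<phi>(2) c]
  proof (subst brick_image_eq[OF X r])
    show "quasi_embedding_on S (bw ?r) \<phi>" using \<phi> by simp
    show "brick_le \<iota> (pulled_brick \<iota> T c ?r (\<phi> ` bw ?r) (inv_into (bw ?r) \<phi>)) (pulled_brick \<iota> T c b' (\<phi> ` w) (\<lambda>x. x))"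
      unfolding brick_le_def
    proof (intro conjI ballI allI impI)
      fix i p assume i: "i < \<iota>" and "p \<in> off_diag (bw (pulled_brick \<iota> T c ?r (\<phi> ` bw ?r) (inv_into (bw ?r) \<phi>)))"
      then obtain x y where p: "p = (\<phi> x, \<phi> y)" "x \<in> w" "y \<in> w" "x \<noteq> y"
        by (auto simp: off_diag_def)
      show "bh (pulled_brick \<iota> T c b' (\<phi> ` w) (\<lambda>x. x)) i p = bh (pulled_brick \<iota> T c ?r (\<phi> ` bw ?r) (inv_into (bw ?r) \<phi>)) i p"
        "prefix (bg (pulled_brick \<iota> T c ?r (\<phi> ` bw ?r) (inv_into (bw ?r) \<phi>)) i p) (bg (pulled_brick \<iota> T c b' (\<phi> ` w) (\<lambda>x. x)) i p)"
        using hg[OF i p(2-4)] ne[OF p(2-4)] p i inj by simp_all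
    qed (use n \<beta> inj in auto)
  qed
qed

section \<open>Towers\<close>

(* Sums of bits stay sums, so that they can be rearranged and cancelled. *)
declare add_bit_eq_xor [simp del] mult_bit_eq_and [simp del]

definition edges :: "nat set \<Rightarrow> nat set set" where
  "edges A = {e. e \<subseteq> A \<and> card e = 2}"

lemma edgesI: "a \<in> A \<Longrightarrow> b \<in> A \<Longrightarrow> a \<noteq> b \<Longrightarrow> {a, b} \<in> edges A"
  by (simp add: edges_def)

lemma edgesE:
  assumes "e \<in> edges A"
  obtains a b where "e = {a, b}" "a \<in> A" "b \<in> A" "a \<noteq> b"
  using assms unfolding edges_def card_2_iff by blast

lemma edges_mono: "A \<subseteq> B \<Longrightarrow> edges A \<subseteq> edges B"
  by (auto simp: edges_def)

lemma edges_image: "inj_on p A \<Longrightarrow> edges (p ` A) = (\<lambda>e. p ` e) ` edges A"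
proof (intro set_eqI iffI)
  fix e assume p: "inj_on p A" and "e \<in> edges (p ` A)"
  then obtain a b where "e = {p a, p b}" "a \<in> A" "b \<in> A" "a \<noteq> b"
    by (elim edgesE) auto
  then have "{a, b} \<in> edges A" "e = p ` {a, b}"
    by (auto intro: edgesI)
  then show "e \<in> (\<lambda>e. p ` e) ` edges A" by blast
next
  fix e assume p: "inj_on p A" and "e \<in> (\<lambda>e. p ` e) ` edges A"
  then obtain e' where e': "e' \<in> edges A" "e = p ` e'" by blast
  then obtain a b where "e' = {a, b}" "a \<in> A" "b \<in> A" "a \<noteq> b"
    by (elim edgesE) auto
  then show "e \<in> edges (p ` A)"
    using p e' by (auto intro!: edgesI simp: inj_on_def)
qed

text \<open>\<open>avoids S C C'\<close> is the hypothesis of the amalgamation demand: a point of \<open>C - C'\<close> never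
  occupies the critical position of a rank zero set it forms with common points of \<open>C\<close> and \<open>C'\<close>.\<close>

definition avoids :: "(nat, 'o::wellorder) yzr \<Rightarrow> nat set \<Rightarrow> nat set \<Rightarrow> bool" where
  "avoids S C C' \<longleftrightarrow> (\<forall>v x. v \<subseteq> C \<inter> C' \<and> x \<in> C - C' \<and> yr S (insert x v) = ozero \<longrightarrow>
     yk S (insert x v) \<noteq> card (v \<inter> {..<x}))"

text \<open>A labelling assigns branches \<open>lE a\<close> to the indices \<open>a\<close>, and branches \<open>lG i e\<close> and heights
  \<open>lH i e\<close> to the edges \<open>e\<close>, for \<open>i < \<iota>\<close>.  The branch for the ordered pair \<open>(a, b)\<close> is going to be
  \<open>lE b + lG i {a, b}\<close>: this makes the sum of \<open>lE a\<close> and that branch symmetric in the pair, as the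
  tuples require, and leaves \<open>lG\<close> unconstrained.\<close>

record labelling =
  lE :: "nat \<Rightarrow> nat \<Rightarrow> bit"
  lG :: "nat \<Rightarrow> nat set \<Rightarrow> nat \<Rightarrow> bit"
  lH :: "nat \<Rightarrow> nat set \<Rightarrow> nat"

definition heights :: "nat \<Rightarrow> labelling \<Rightarrow> nat set \<Rightarrow> nat set" where
  "heights \<iota> D A = {lH D i e | i e. i < \<iota> \<and> e \<in> edges A}"

definition embeds :: "nat \<Rightarrow> nat \<Rightarrow> labelling \<Rightarrow> labelling \<Rightarrow> nat set \<Rightarrow> (nat \<Rightarrow> nat) \<Rightarrow> bool" where
  "embeds \<iota> k D D' v \<phi> \<longleftrightarrow> (\<forall>a\<in>v. \<forall>t<k. lE D' (\<phi> a) t = lE D a t) \<and>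
     (\<forall>i<\<iota>. \<forall>e\<in>edges v. lH D' i (\<phi> ` e) = lH D i e \<and> (\<forall>t<k. lG D' i (\<phi> ` e) t = lG D i e t))"

definition projects ::
    "(nat, 'o::wellorder) yzr \<Rightarrow> nat \<Rightarrow> nat set \<Rightarrow> nat \<Rightarrow> labelling \<Rightarrow> labelling \<Rightarrow> nat set \<Rightarrow> (nat \<Rightarrow> nat) \<Rightarrow> bool" where
  "projects S \<iota> A k D D' C p \<longleftrightarrow> p ` C \<subseteq> A \<and> quasi_embedding_on S C p \<and> embeds \<iota> k D' D C p"

text \<open>One step of the construction, from \<open>A\<close> to \<open>A'\<close>: two sets of new points are copies of parts of \<open>A\<close> up
  to level \<open>k\<close>, and the heights of every edge that lies in no copy are unique to that edge.\<close>

definition stage_ok ::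
    "(nat, 'o::wellorder) yzr \<Rightarrow> nat \<Rightarrow> nat set \<Rightarrow> nat \<Rightarrow> labelling \<Rightarrow> nat set \<Rightarrow> labelling \<Rightarrow> bool" where
  "stage_ok S \<iota> A k D A' D' \<longleftrightarrow> (\<exists>C1 C2 p. C1 \<inter> A = {} \<and> C2 \<inter> A = {} \<and> C1 \<subseteq> A' \<and> C2 \<subseteq> A' \<and>
     (\<forall>a\<in>A. p a = a) \<and> projects S \<iota> A k D D' C1 p \<and> projects S \<iota> A k D D' C2 p \<and> avoids S C1 C2 \<and>
     (\<forall>e\<in>edges A'. \<not> e \<subseteq> A \<and> \<not> e \<subseteq> C1 \<and> \<not> e \<subseteq> C2 \<longrightarrow>
       (\<forall>i<\<iota>. lH D' i e \<notin> heights \<iota> D A \<and> (\<forall>j<\<iota>. \<forall>e'\<in>edges A'. lH D' j e' = lH D' i e \<longrightarrow> e' = e))))"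

text \<open>Every generator owns a position below level \<open>k\<close>; whatever linear independence is needed later is read off at
  these positions.\<close>

definition independent :: "nat \<Rightarrow> nat set \<Rightarrow> nat \<Rightarrow> labelling \<Rightarrow> bool" where
  "independent \<iota> A k D \<longleftrightarrow>
     (\<forall>a\<in>A. \<exists>t<k. \<forall>x\<in>A. lE D x t = (if x = a then 1 else 0)) \<and>
     (\<forall>i<\<iota>. \<forall>e\<in>edges A. \<exists>t<k. (\<forall>x\<in>A. lE D x t = 0) \<and>
       (\<forall>j<\<iota>. \<forall>e'\<in>edges A. lG D j e' t = (if j = i \<and> e' = e then 1 else 0)))"

text \<open>A demand asks for copies of \<open>v\<close> along \<open>\<pi>0\<close> and \<open>\<pi>1\<close> inside a copy of \<open>U\<close>.  It covers both clauses of
  controlled amalgamation: the last one is the case \<open>\<pi>0 = \<pi>1\<close>.\<close>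

definition demand ::
    "(nat, 'o::wellorder) yzr \<Rightarrow> nat set \<Rightarrow> nat set \<Rightarrow> (nat \<Rightarrow> nat) \<Rightarrow> (nat \<Rightarrow> nat) \<Rightarrow> nat set \<Rightarrow> bool" where
  "demand S A v \<pi>0 \<pi>1 U \<longleftrightarrow> v \<subseteq> A \<and> quasi_embedding_on S v \<pi>0 \<and> quasi_embedding_on S v \<pi>1 \<and>
     \<pi>0 ` v \<union> \<pi>1 ` v \<subseteq> U \<and> finite U \<and> U \<noteq> {} \<and> (\<forall>a\<in>v. \<forall>b\<in>v. \<pi>0 a = \<pi>1 b \<longrightarrow> a = b) \<and>
     avoids S (\<pi>0 ` v) (\<pi>1 ` v)"

definition demand_met ::
    "(nat, 'o::wellorder) yzr \<Rightarrow> nat \<Rightarrow> nat \<Rightarrow> labelling \<Rightarrow> nat set \<Rightarrow> labelling \<Rightarrow>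
     nat set \<Rightarrow> (nat \<Rightarrow> nat) \<Rightarrow> (nat \<Rightarrow> nat) \<Rightarrow> nat set \<Rightarrow> bool" where
  "demand_met S \<iota> k D A' D' v \<pi>0 \<pi>1 U \<longleftrightarrow> (\<exists>\<pi>. quasi_embedding_on S U \<pi> \<and> \<pi> ` U \<subseteq> A' \<and>
     embeds \<iota> k D D' v (\<pi> \<circ> \<pi>0) \<and> embeds \<iota> k D D' v (\<pi> \<circ> \<pi>1))"

text \<open>The limit of the construction.  Stage 0 is empty, so the first brick, which is stage 1, needs no separate
  treatment: all its edges are fresh.\<close>

locale tower =
  fixes \<epsilon> :: "'o::ordinals" and S :: "(nat, 'o) yzr" and \<iota> :: nat
    and w :: "nat \<Rightarrow> nat set" and N :: "nat \<Rightarrow> nat"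
    and E :: "nat \<Rightarrow> nat \<Rightarrow> bit" and Gam :: "nat \<Rightarrow> nat set \<Rightarrow> nat \<Rightarrow> bit"
    and H :: "nat \<Rightarrow> nat set \<Rightarrow> nat"
  assumes cute: "cute \<epsilon> S" and \<iota>: "2 \<le> \<iota>"
    and w_0: "w 0 = {}" and finite_w: "finite (w n)" and w_Suc: "w n \<subseteq> w (Suc n)"
    and card_w: "3 \<le> card (w (Suc n))" and w_exhausts: "\<exists>n. a \<in> w n"
    and N_Suc: "N n < N (Suc n)"
    and independent: "independent \<iota> (w n) (N n) \<lparr>lE = E, lG = Gam, lH = H\<rparr>"
    and stage_ok: "stage_ok S \<iota> (w n) (N n) \<lparr>lE = E, lG = Gam, lH = H\<rparr> (w (Suc n)) \<lparr>lE = E, lG = Gam, lH = H\<rparr>"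
    and demands_met: "demand S (w n) v \<pi>0 \<pi>1 U \<Longrightarrow> \<exists>K. N n < N K \<and>
      demand_met S \<iota> (N n) \<lparr>lE = E, lG = Gam, lH = H\<rparr> (w K) \<lparr>lE = E, lG = Gam, lH = H\<rparr> v \<pi>0 \<pi>1 U"
begin

definition Hval :: "nat \<Rightarrow> nat set" where
  "Hval n = {H i e | i e. i < \<iota> \<and> e \<in> edges (w n)}"

definition copies :: "nat \<Rightarrow> nat set \<Rightarrow> (nat \<Rightarrow> nat) \<Rightarrow> bool" where
  "copies n C p \<longleftrightarrow> C \<subseteq> w (Suc n) \<and> p ` C \<subseteq> w n \<and> quasi_embedding_on S C p \<and>
      (\<forall>a\<in>C. \<forall>t<N n. E a t = E (p a) t) \<and>
      (\<forall>i<\<iota>. \<forall>e\<in>edges C. H i e = H i (p ` e) \<and> (\<forall>t<N n. Gam i e t = Gam i (p ` e) t))"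

lemma E_indep: "a \<in> w n \<Longrightarrow> \<exists>t<N n. \<forall>x\<in>w n. E x t = (if x = a then 1 else 0)"
  using independent[of n] unfolding independent_def by simp

lemma Gam_indep: "i < \<iota> \<Longrightarrow> e \<in> edges (w n) \<Longrightarrow> \<exists>t<N n. (\<forall>x\<in>w n. E x t = 0) \<and>
      (\<forall>j<\<iota>. \<forall>e'\<in>edges (w n). Gam j e' t = (if j = i \<and> e' = e then 1 else 0))"
  using independent[of n] unfolding independent_def by simp

lemma S_UNIV: "yX S = UNIV" and S_system: "yzr_system \<epsilon> S"
  using cute unfolding cute_def by auto

lemmas qeD = quasi_embedding_onD[OF S_UNIV]
lemmas qe_subset = quasi_embedding_on_subset[OF S_UNIV]

lemma w_mono: "m \<le> n \<Longrightarrow> w m \<subseteq> w n"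
  by (rule lift_Suc_mono_le[of w]) (use w_Suc in auto)

lemma N_mono: "m \<le> n \<Longrightarrow> N m \<le> N n"
  by (rule lift_Suc_mono_le[of N]) (use N_Suc in \<open>auto intro: less_imp_le\<close>)

lemma N_less_iff: "N m < N n \<longleftrightarrow> m < n"
  by (rule lift_Suc_mono_less_iff[of N]) (rule N_Suc)

lemma finite_subset_w:
  assumes "finite A" shows "\<exists>n. A \<subseteq> w n"
  using assms
proof induction
  case (insert x A)
  then obtain n m where "A \<subseteq> w n" "x \<in> w m" using w_exhausts by meson
  then have "insert x A \<subseteq> w (max n m)"
    using w_mono[of n "max n m"] w_mono[of m "max n m"] by auto
  then show ?case by blast
qed simp

lemma Hval_mono: "m \<le> n \<Longrightarrow> Hval m \<subseteq> Hval n"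
  unfolding Hval_def using edges_mono[OF w_mono] by blast

text \<open>Only from the level of the stage at which a height first occurs are the nodes of its tree kept apart by
  independent positions.\<close>

definition c :: "nat \<Rightarrow> nat" where
  "c h = N (LEAST K. h \<in> Hval K)"

lemma c_le: "h \<in> Hval K \<Longrightarrow> c h \<le> N K"
  unfolding c_def by (intro N_mono Least_le)

lemma c_le_iff:
  assumes "h \<in> Hval K'"
  shows "c h \<le> N K \<longleftrightarrow> h \<in> Hval K"
proof
  assume "c h \<le> N K"
  then have "(LEAST K. h \<in> Hval K) \<le> K"
    unfolding c_def using N_less_iff[of K] by (metis not_less)
  then show "h \<in> Hval K"
    using Hval_mono LeastI[of "\<lambda>K. h \<in> Hval K", OF assms] by blast
qed (rule c_le)

definition node :: "nat \<Rightarrow> nat \<Rightarrow> bit list" where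
  "node l a = map (E a) [0..<l]"

definition Lab :: "nat \<Rightarrow> nat set \<Rightarrow> (bit list \<times> nat) set" where
  "Lab l e = (\<Union>i<\<iota>. (\<lambda>b. (map (\<lambda>t. E b t + Gam i e t) [0..<l], H i e)) ` e)"

lemma length_node [simp]: "length (node l a) = l"
  by (simp add: node_def)

lemma take_node [simp]: "take l (node L a) = node (min l L) a"
  by (simp add: node_def)

lemma node_eq_iff: "node l a = node l b \<longleftrightarrow> (\<forall>t<l. E a t = E b t)"
  by (auto simp: node_def list_eq_iff_nth_eq)

lemma inj_node: "inj_on (node (N K)) (w K)"
proof (rule inj_onI)
  fix a b assume *: "a \<in> w K" "b \<in> w K" "node (N K) a = node (N K) b"
  obtain t where "t < N K" "\<forall>x\<in>w K. E x t = (if x = a then 1 else 0)"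
    using E_indep[OF *(1)] by blast
  then show "a = b"
    using * unfolding node_eq_iff by (metis zero_neq_one)
qed

lemma cut_Lab: "l \<le> L \<Longrightarrow> cut l (Lab L e) = Lab l e"
  unfolding Lab_def image_UN image_image by (intro SUP_cong refl image_cong) simp_all

lemma Lab_H:
  assumes "Lab l e = Lab l e'" "i < \<iota>" "e \<noteq> {}"
  shows "\<exists>j<\<iota>. H i e = H j e'"
proof -
  obtain b where "b \<in> e" using assms(3) by blast
  then have "(map (\<lambda>t. E b t + Gam i e t) [0..<l], H i e) \<in> Lab l e"
    using assms(2) unfolding Lab_def by blast
  then show ?thesis
    unfolding assms(1) unfolding Lab_def by auto
qed

lemma copies_Lab:
  assumes "copies n C p" "e \<in> edges C" "l \<le> N n"
  shows "Lab l e = Lab l (p ` e)"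
proof -
  have "e \<subseteq> C" using assms(2) by (simp add: edges_def)
  then have E: "E b t = E (p b) t" if "b \<in> e" "t < l" for b t
    using assms(1,3) that unfolding copies_def by auto
  have HG: "H i e = H i (p ` e)" "t < l \<Longrightarrow> Gam i e t = Gam i (p ` e) t" if "i < \<iota>" for i t
    using assms that unfolding copies_def by auto
  show ?thesis
    unfolding Lab_def image_image
    by (intro SUP_cong refl image_cong) (use E HG in auto)
qed

definition level_ok :: "nat \<Rightarrow> nat set \<Rightarrow> bool" where
  "level_ok l v \<longleftrightarrow> (\<forall>i<\<iota>. \<forall>e\<in>edges v. c (H i e) \<le> l)"

lemma H_in_Hval: "i < \<iota> \<Longrightarrow> e \<in> edges v \<Longrightarrow> v \<subseteq> w K \<Longrightarrow> H i e \<in> Hval K"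
  unfolding Hval_def using edges_mono by blast

text \<open>The parts of \<open>w (Suc n)\<close> that are projected to \<open>w n\<close>; an edge inside none of them is fresh.\<close>

definition chunks :: "nat \<Rightarrow> nat set \<Rightarrow> nat set \<Rightarrow> nat set set" where
  "chunks n C1 C2 = {w n, C1, C2}"

lemma stageE:
  obtains C1 C2 p where "C1 \<inter> w n = {}" "C2 \<inter> w n = {}" "avoids S C1 C2" "C1 \<subseteq> w (Suc n)" "C2 \<subseteq> w (Suc n)"
    "\<And>C. C \<in> chunks n C1 C2 \<Longrightarrow> copies n C p"
    "\<And>e i. e \<in> edges (w (Suc n)) \<Longrightarrow> (\<And>C. C \<in> chunks n C1 C2 \<Longrightarrow> \<not> e \<subseteq> C) \<Longrightarrow> i < \<iota> \<Longrightarrow> H i e \<notin> Hval n"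
    "\<And>e i j e'. e \<in> edges (w (Suc n)) \<Longrightarrow> (\<And>C. C \<in> chunks n C1 C2 \<Longrightarrow> \<not> e \<subseteq> C) \<Longrightarrow> i < \<iota> \<Longrightarrow>
       j < \<iota> \<Longrightarrow> e' \<in> edges (w (Suc n)) \<Longrightarrow> H j e' = H i e \<Longrightarrow> e' = e"
proof -
  have hv: "heights \<iota> \<lparr>lE = E, lG = Gam, lH = H\<rparr> (w n) = Hval n"
    by (simp add: heights_def Hval_def)
  obtain C1 C2 p where st: "C1 \<inter> w n = {}" "C2 \<inter> w n = {}" "\<forall>a\<in>w n. p a = a"
      "C1 \<subseteq> w (Suc n)" "C2 \<subseteq> w (Suc n)"
      "projects S \<iota> (w n) (N n) \<lparr>lE = E, lG = Gam, lH = H\<rparr> \<lparr>lE = E, lG = Gam, lH = H\<rparr> C1 p"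
      "projects S \<iota> (w n) (N n) \<lparr>lE = E, lG = Gam, lH = H\<rparr> \<lparr>lE = E, lG = Gam, lH = H\<rparr> C2 p"
      "avoids S C1 C2"
    and fresh0: "\<forall>e\<in>edges (w (Suc n)). \<not> e \<subseteq> w n \<and> \<not> e \<subseteq> C1 \<and> \<not> e \<subseteq> C2 \<longrightarrow>
        (\<forall>i<\<iota>. H i e \<notin> Hval n \<and> (\<forall>j<\<iota>. \<forall>e'\<in>edges (w (Suc n)). H j e' = H i e \<longrightarrow> e' = e))"
    using stage_ok[of n, unfolded stage_ok_def hv labelling.simps]
    by (elim exE conjE) (rule that; assumption)
  have cp: "copies n C1 p" "copies n C2 p"
    using st(4-7) unfolding copies_def projects_def embeds_def by auto
  have "p ` e = e" if "e \<in> edges (w n)" for e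
    using that st(3) unfolding edges_def by force
  moreover have "quasi_embedding_on S (w n) p"
    by (rule quasi_embedding_on_cong[OF S_UNIV quasi_embedding_on_id[OF S_UNIV]]) (use st(3) in auto)
  ultimately have "copies n (w n) p"
    unfolding copies_def using w_Suc st(3) by auto
  then have chunks: "copies n C p" if "C \<in> chunks n C1 C2" for C
    using that cp unfolding chunks_def by auto
  have fresh: "\<not> e \<subseteq> w n \<and> \<not> e \<subseteq> C1 \<and> \<not> e \<subseteq> C2"
    if "\<And>C. C \<in> chunks n C1 C2 \<Longrightarrow> \<not> e \<subseteq> C" for e
    using that unfolding chunks_def by blast
  show thesis
  proof (rule that[OF st(1,2,8,4,5) chunks])
    show "H i e \<notin> Hval n"
      if "e \<in> edges (w (Suc n))" "\<And>C. C \<in> chunks n C1 C2 \<Longrightarrow> \<not> e \<subseteq> C" "i < \<iota>" for e i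
      using fresh0 that(1,3) fresh[OF that(2)] by blast
    show "e' = e"
      if "e \<in> edges (w (Suc n))" "\<And>C. C \<in> chunks n C1 C2 \<Longrightarrow> \<not> e \<subseteq> C" "i < \<iota>"
        "j < \<iota>" "e' \<in> edges (w (Suc n))" "H j e' = H i e" for e i j e'
      using fresh0 that(1,3-) fresh[OF that(2)] by blast
  qed
qed

text \<open>An old and a new point form a fresh edge, and so do points that belong to different copies only.\<close>

lemma chunk_of:
  assumes "C1 \<inter> w n = {}" "C2 \<inter> w n = {}"
    and "\<And>e. e \<in> edges W \<Longrightarrow> \<exists>C\<in>chunks n C1 C2. e \<subseteq> C" and "2 \<le> card W"
  shows "\<exists>C\<in>chunks n C1 C2. W \<subseteq> C"
proof -
  have pair: "\<exists>C\<in>chunks n C1 C2. x \<in> C \<and> z \<in> C" if "x \<in> W" "z \<in> W" "x \<noteq> z" for x z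
    using assms(3)[OF edgesI[OF that]] by auto
  have other: "\<exists>z\<in>W. z \<noteq> x" for x
  proof (rule ccontr)
    assume "\<not> ?thesis"
    then have "W \<subseteq> {x}" by blast
    then have "card W \<le> 1" using card_mono[of "{x}" W] by simp
    then show False using assms(4) by simp
  qed
  show ?thesis
  proof (cases "W \<inter> w n = {}")
    case False
    then obtain x where x: "x \<in> W" "x \<in> w n" by blast
    have "z \<in> w n" if "z \<in> W" for z
      using pair[OF x(1) that] x assms(1,2) by (cases "x = z") (auto simp: chunks_def)
    then show ?thesis unfolding chunks_def by blast
  next
    case True
    then have pair': "x \<in> C1 \<and> z \<in> C1 \<or> x \<in> C2 \<and> z \<in> C2" if "x \<in> W" "z \<in> W" "x \<noteq> z" for x z
      using pair[OF that] that unfolding chunks_def by blast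
    show ?thesis
    proof (cases "W \<subseteq> C1")
      case False
      then obtain x where x: "x \<in> W" "x \<notin> C1" by blast
      have "z \<in> C2" if "z \<in> W" for z
        using pair'[OF x(1) that] pair'[OF x(1)] other[of x] x by blast
      then show ?thesis unfolding chunks_def by blast
    qed (auto simp: chunks_def)
  qed
qed

lemma copies_image: "copies n C p \<Longrightarrow> v \<subseteq> C \<Longrightarrow> p ` v \<subseteq> w n"
  unfolding copies_def by (meson image_mono order_trans)

lemma copies_qe: "copies n C p \<Longrightarrow> v \<subseteq> C \<Longrightarrow> quasi_embedding_on S v p"
  unfolding copies_def using qe_subset by metis

lemma copies_inj: "copies n C p \<Longrightarrow> v \<subseteq> C \<Longrightarrow> inj_on p v"
  using qeD(2) copies_qe by metis

lemma copies_level_ok: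
  assumes "copies n C p" "v \<subseteq> C" "level_ok l v"
  shows "level_ok (min l (N n)) (p ` v)"
  unfolding level_ok_def edges_image[OF copies_inj[OF assms(1,2)]]
proof (intro allI impI ballI, elim imageE)
  fix i e e' assume i: "i < \<iota>" and e: "e = p ` e'" "e' \<in> edges v"
  have e'C: "e' \<in> edges C" using e(2) edges_mono[OF assms(2)] by blast
  have "H i e = H i e'" using assms(1) i e'C e(1) unfolding copies_def by auto
  moreover have "c (H i e') \<le> l" using assms(3) i e(2) unfolding level_ok_def by blast
  moreover have "p ` v \<subseteq> w n" using assms(1,2) unfolding copies_def by blast
  then have "H i e \<in> Hval n"
    using i e edges_image[OF copies_inj[OF assms(1,2)]] by (intro H_in_Hval) auto
  ultimately show "c (H i e) \<le> min l (N n)" using c_le by simp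
qed

lemma copies_node:
  assumes "copies n C p" "a \<in> C" "l \<le> N n"
  shows "node l (p a) = node l a"
  using assms unfolding copies_def node_eq_iff by auto

lemma copies_inj_node:
  assumes "copies n C p" "v \<subseteq> C" "inj_on (node l) v"
  shows "inj_on (node (min l (N n))) (p ` v)"
proof (cases "l \<le> N n")
  case True
  have "inj_on (node l \<circ> p) v"
    using assms(3) by (rule inj_on_cong[THEN iffD1, rotated]) (use copies_node[OF assms(1) _ True] assms(2) in auto)
  then have "inj_on (node l) (p ` v)"
    by (subst comp_inj_on_iff[OF copies_inj[OF assms(1,2)]])
  then show ?thesis
    using True by (simp add: min_def)
next
  case False
  have "p ` v \<subseteq> w n" using assms(1,2) unfolding copies_def by blast
  then show ?thesis
    using False inj_on_subset[OF inj_node] by (simp add: min_def)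
qed

text \<open>Rigidity: translations between labelled configurations come from quasi-embeddings.  A fresh
  edge determines the configuration outright, since its heights occur nowhere else; without fresh
  edges both sides are copies of configurations of the previous stage.\<close>

lemma rigid:
  assumes "v0 \<subseteq> w K" "v1 \<subseteq> w K" "3 \<le> card v0" "l \<le> N K" "level_ok l v0"
    and "inj_on (node l) v0" "inj_on (node l) v1" "\<tau> ` v0 = v1"
    and "\<And>a t. a \<in> v0 \<Longrightarrow> t < l \<Longrightarrow> E a t + \<rho> t = E (\<tau> a) t"
    and "\<And>e. e \<in> edges v0 \<Longrightarrow> Lab l (\<tau> ` e) = Lab l e"
  shows "quasi_embedding_on S v0 \<tau>"
  using assms
proof (induction K arbitrary: v0 v1 l \<tau>)
  case 0
  then show ?case using 0(1,3) w_0 by simp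
next
  case (Suc n)
  note v0 = Suc.prems(1) and v1 = Suc.prems(2) and im = Suc.prems(8)
  have inj\<tau>: "inj_on \<tau> v0"
  proof (rule inj_onI)
    fix a b assume *: "a \<in> v0" "b \<in> v0" "\<tau> a = \<tau> b"
    have "E a t = E b t" if "t < l" for t
      using Suc.prems(9)[OF *(1) that] Suc.prems(9)[OF *(2) that] *(3) by (metis add_right_cancel)
    then show "a = b"
      using Suc.prems(6) * unfolding inj_on_def node_eq_iff by blast
  qed
  have e1: "\<tau> ` e \<in> edges v1" if "e \<in> edges v0" for e
    using that edges_image[OF inj\<tau>] im by blast
  obtain C1 C2 p where C: "C1 \<inter> w n = {}" "C2 \<inter> w n = {}"
    and copies: "\<And>C. C \<in> chunks n C1 C2 \<Longrightarrow> copies n C p"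
    and new: "\<And>e i. e \<in> edges (w (Suc n)) \<Longrightarrow> (\<And>C. C \<in> chunks n C1 C2 \<Longrightarrow> \<not> e \<subseteq> C) \<Longrightarrow> i < \<iota> \<Longrightarrow> H i e \<notin> Hval n"
    and uniq: "\<And>e i j e'. e \<in> edges (w (Suc n)) \<Longrightarrow> (\<And>C. C \<in> chunks n C1 C2 \<Longrightarrow> \<not> e \<subseteq> C) \<Longrightarrow> i < \<iota> \<Longrightarrow>
       j < \<iota> \<Longrightarrow> e' \<in> edges (w (Suc n)) \<Longrightarrow> H j e' = H i e \<Longrightarrow> e' = e"
    by (rule stageE[of n]) blast
  have ew: "e \<in> edges (w (Suc n))" if "e \<in> edges v0 \<or> e \<in> edges v1" for e
    using that edges_mono[OF v0] edges_mono[OF v1] by blast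
  show ?case
  proof (cases "\<exists>e\<in>edges v0. \<forall>C\<in>chunks n C1 C2. \<not> e \<subseteq> C")
    case True
    then obtain e where e: "e \<in> edges v0" "\<And>C. C \<in> chunks n C1 C2 \<Longrightarrow> \<not> e \<subseteq> C" by blast
    have "0 < \<iota>" using \<iota> by simp
    have "\<not> c (H 0 e) \<le> N n"
      using c_le_iff[OF H_in_Hval[OF \<open>0 < \<iota>\<close> e(1) v0]] new[OF ew e(2) \<open>0 < \<iota>\<close>] e(1) by blast
    moreover have "c (H 0 e) = N (Suc n)"
    proof -
      have "\<not> (LEAST K. H 0 e \<in> Hval K) \<le> n"
        using calculation N_mono unfolding c_def by blast
      moreover have "(LEAST K. H 0 e \<in> Hval K) \<le> Suc n"
        by (rule Least_le) (rule H_in_Hval[OF \<open>0 < \<iota>\<close> e(1) v0])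
      ultimately show ?thesis unfolding c_def by (metis le_SucE)
    qed
    ultimately have l: "l = N (Suc n)"
      using Suc.prems(4,5) e(1) \<open>0 < \<iota>\<close> unfolding level_ok_def by force
    have "e \<noteq> {}" using e(1) by (auto simp: edges_def)
    then obtain j where "j < \<iota>" "H 0 e = H j (\<tau> ` e)"
      using Lab_H[OF Suc.prems(10)[OF e(1), symmetric] \<open>0 < \<iota>\<close>] by blast
    then have \<tau>e: "\<tau> ` e = e"
      using uniq[OF ew e(2) \<open>0 < \<iota>\<close>, of j "\<tau> ` e"] e(1) e1 ew by metis
    obtain x y where xy: "e = {x, y}" "x \<in> v0" "y \<in> v0" "x \<noteq> y"
      using e(1) by (rule edgesE)
    have \<rho>0: "\<forall>t<l. \<rho> t = 0"
    proof (cases "\<tau> x = x")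
      case True
      have "\<rho> t = 0" if "t < l" for t
        using Suc.prems(9)[OF xy(2) that] True by simp
      then show ?thesis by blast
    next
      case False
      then have \<tau>x: "\<tau> x = y" using \<tau>e xy by auto
      have "\<exists>z. z \<in> v0 - {x, y}"
      proof (rule ccontr)
        assume "\<not> ?thesis"
        then have "v0 \<subseteq> {x, y}" by blast
        then have "card v0 \<le> card {x, y}" by (rule card_mono[rotated]) simp
        then show False using Suc.prems(3) xy by simp
      qed
      then obtain z where z: "z \<in> v0" "z \<noteq> x" "z \<noteq> y" by blast
      have "z \<in> w (Suc n)" using z v0 by blast
      then obtain t where t: "t < N (Suc n)" "\<forall>u\<in>w (Suc n). E u t = (if u = z then 1 else 0)"
        using E_indep by blast
      have inw: "x \<in> w (Suc n)" "y \<in> w (Suc n)" "\<tau> z \<in> w (Suc n)"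
        using xy z v0 v1 im by blast+
      have "\<rho> t = 0"
        using Suc.prems(9)[OF xy(2), of t] t inw z unfolding \<tau>x l by simp
      then have "E (\<tau> z) t = 1"
        using Suc.prems(9)[OF z(1), of t] t \<open>z \<in> w (Suc n)\<close> unfolding l by simp
      then have "\<tau> z = z"
        using t(2) inw(3) by (metis zero_neq_one)
      then have "\<rho> t = 0" if "t < l" for t
        using Suc.prems(9)[OF z(1) that] by simp
      then show ?thesis by blast
    qed
    have "a = \<tau> a" if "a \<in> v0" for a
    proof -
      have "node (N (Suc n)) a = node (N (Suc n)) (\<tau> a)"
        using Suc.prems(9)[OF that] \<rho>0 unfolding node_eq_iff l by auto
      then show ?thesis
        using inj_node[of "Suc n"] that v0 v1 im unfolding inj_on_def by blast
    qed
    then show ?thesis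
      by (rule quasi_embedding_on_cong[OF S_UNIV quasi_embedding_on_id[OF S_UNIV]])
  next
    case False
    have c0: "2 \<le> card v0" using Suc.prems(3) by simp
    then have c1: "2 \<le> card v1" using card_image[OF inj\<tau>] im by simp
    have "\<exists>C\<in>chunks n C1 C2. v0 \<subseteq> C"
      by (rule chunk_of[OF C _ c0]) (use False in blast)
    then obtain C where CC: "C \<in> chunks n C1 C2" "v0 \<subseteq> C" by blast
    have "\<exists>C\<in>chunks n C1 C2. v1 \<subseteq> C"
    proof (rule chunk_of[OF C _ c1], rule ccontr)
      fix e' assume e': "e' \<in> edges v1" and "\<not> (\<exists>C\<in>chunks n C1 C2. e' \<subseteq> C)"
      then have fresh: "\<And>C. C \<in> chunks n C1 C2 \<Longrightarrow> \<not> e' \<subseteq> C" by blast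
      obtain e where e: "e \<in> edges v0" "e' = \<tau> ` e"
        using e' edges_image[OF inj\<tau>] im by blast
      have "0 < \<iota>" "e' \<noteq> {}" using \<iota> e' by (auto simp: edges_def)
      then obtain j where j: "j < \<iota>" "H 0 e' = H j e"
        using Lab_H[OF Suc.prems(10)[OF e(1)]] e(2) by blast
      have "e = e'"
        by (rule uniq[OF ew fresh \<open>0 < \<iota>\<close> j(1) ew]) (use e e' j in auto)
      then show False using fresh False e(1) by blast
    qed
    then obtain C' where CC': "C' \<in> chunks n C1 C2" "v1 \<subseteq> C'" by blast
    note cp = copies[OF CC(1)] and cp' = copies[OF CC'(1)]
    note inj0 = copies_inj[OF cp CC(2)] and inj1 = copies_inj[OF cp' CC'(2)]
    define l' where "l' = min l (N n)"
    have l': "l' \<le> N n" "l' \<le> l" unfolding l'_def by auto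
    define \<tau>' where "\<tau>' = p \<circ> \<tau> \<circ> inv_into v0 p"
    have \<tau>': "\<tau>' (p a) = p (\<tau> a)" if "a \<in> v0" for a
      using that inj0 by (simp add: \<tau>'_def)
    have \<tau>'im: "\<tau>' ` p ` A = p ` \<tau> ` A" if "A \<subseteq> v0" for A
      unfolding image_image by (intro image_cong refl) (use \<tau>' that in auto)
    have qe': "quasi_embedding_on S (p ` v0) \<tau>'"
    proof (rule Suc.IH[where ?v1.0 = "p ` v1" and l = l'])
      show "p ` v0 \<subseteq> w n" "p ` v1 \<subseteq> w n"
        by (rule copies_image[OF cp CC(2)], rule copies_image[OF cp' CC'(2)])
      show "3 \<le> card (p ` v0)" using card_image[OF inj0] Suc.prems(3) by simp
      show "l' \<le> N n" by (rule l')
      show "level_ok l' (p ` v0)" unfolding l'_def by (rule copies_level_ok[OF cp CC(2) Suc.prems(5)])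
      show "inj_on (node l') (p ` v0)" unfolding l'_def by (rule copies_inj_node[OF cp CC(2) Suc.prems(6)])
      show "inj_on (node l') (p ` v1)" unfolding l'_def by (rule copies_inj_node[OF cp' CC'(2) Suc.prems(7)])
      show "\<tau>' ` p ` v0 = p ` v1" using \<tau>'im im by simp
      show "E a t + \<rho> t = E (\<tau>' a) t" if a: "a \<in> p ` v0" and t: "t < l'" for a t
      proof -
        obtain a' where a': "a' \<in> v0" "a = p a'" using a by blast
        have "\<tau> a' \<in> C'" "a' \<in> C" using a' im CC CC' by blast+
        then have "E a t = E a' t" "E (\<tau>' a) t = E (\<tau> a') t"
          using cp cp' t l'(1) \<tau>'[OF a'(1)] unfolding a'(2) copies_def by auto
        then show ?thesis using Suc.prems(9)[OF a'(1), of t] t l'(2) by simp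
      qed
      show "Lab l' (\<tau>' ` e) = Lab l' e" if e: "e \<in> edges (p ` v0)" for e
      proof -
        obtain e' where e': "e' \<in> edges v0" "e = p ` e'"
          using e edges_image[OF inj0] by blast
        have sub: "e' \<subseteq> v0" using e'(1) by (simp add: edges_def)
        have "Lab l' e = Lab l' e'"
          unfolding e'(2) using copies_Lab[OF cp _ l'(1)] e'(1) edges_mono[OF CC(2)] by blast
        also have "\<dots> = Lab l' (\<tau> ` e')"
          using Suc.prems(10)[OF e'(1)] cut_Lab[OF l'(2)] by metis
        also have "\<dots> = Lab l' (p ` \<tau> ` e')"
          using copies_Lab[OF cp' _ l'(1)] e1[OF e'(1)] edges_mono[OF CC'(2)] by blast
        also have "\<dots> = Lab l' (\<tau>' ` e)"
          unfolding e'(2) \<tau>'im[OF sub] ..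
        finally show ?thesis ..
      qed
    qed
    have qep: "quasi_embedding_on S v0 p"
      by (rule copies_qe[OF cp CC(2)])
    have qep': "quasi_embedding_on S (p ` v1) (inv_into v1 p)"
      by (rule quasi_embedding_on_inverse[OF S_UNIV]) (rule copies_qe[OF cp' CC'(2)])
    have im': "(\<tau>' \<circ> p) ` v0 = p ` v1"
      using \<tau>'im[OF order_refl] im by (simp only: image_comp[symmetric])
    have "quasi_embedding_on S v0 (inv_into v1 p \<circ> (\<tau>' \<circ> p))"
      by (intro quasi_embedding_on_comp[OF S_UNIV] qep qe') (simp only: im' qep')
    then show ?thesis
      by (rule quasi_embedding_on_cong[OF S_UNIV]) (use \<tau>' inj1 im in auto)
  qed
qed

text \<open>The proof that the critical point of a rank zero configuration never splits goes by induction on the stage.  The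
  only danger is an extension with points of both new copies; these points lie over one index \<open>d\<close>
  and everything else lies in the common part, so for the critical point \<open>d = a\<close> this contradicts
  the hypothesis of the amalgamation demand.\<close>

lemma critical_no_split:
  assumes "v \<subseteq> w K" "W \<subseteq> w K" "3 \<le> card v" "l \<le> L" "L \<le> N K" "level_ok l v"
    and "inj_on (node l) v" "inj_on (node L) W" "\<sigma> ` W = v"
    and "\<And>x. x \<in> W \<Longrightarrow> node l x = node l (\<sigma> x)"
    and "\<And>x y. x \<in> W \<Longrightarrow> y \<in> W \<Longrightarrow> \<sigma> x \<noteq> \<sigma> y \<Longrightarrow> Lab l {x, y} = Lab l {\<sigma> x, \<sigma> y}"
    and "yr S v = ozero" "a \<in> v" "card (v \<inter> {..<a}) = yk S v"
    and "x \<in> W" "y \<in> W" "\<sigma> x = a" "\<sigma> y = a"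
  shows "x = y"
  using assms
proof (induction K arbitrary: v W l L \<sigma> a x y)
  case 0
  have "card v = 0" using 0(1) w_0 by simp
  then show ?case using 0(3) by simp
next
  case (Suc n)
  note v = Suc.prems(1) and W = Suc.prems(2) and im = Suc.prems(9) and lab = Suc.prems(11)
  obtain C1 C2 p where C: "C1 \<inter> w n = {}" "C2 \<inter> w n = {}" and avoid: "avoids S C1 C2"
    and copies: "\<And>C. C \<in> chunks n C1 C2 \<Longrightarrow> copies n C p"
    and new: "\<And>e i. e \<in> edges (w (Suc n)) \<Longrightarrow> (\<And>C. C \<in> chunks n C1 C2 \<Longrightarrow> \<not> e \<subseteq> C) \<Longrightarrow> i < \<iota> \<Longrightarrow> H i e \<notin> Hval n"
    and uniq: "\<And>e i j e'. e \<in> edges (w (Suc n)) \<Longrightarrow> (\<And>C. C \<in> chunks n C1 C2 \<Longrightarrow> \<not> e \<subseteq> C) \<Longrightarrow> i < \<iota> \<Longrightarrow>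
       j < \<iota> \<Longrightarrow> e' \<in> edges (w (Suc n)) \<Longrightarrow> H j e' = H i e \<Longrightarrow> e' = e"
    by (rule stageE[of n]) blast
  have "0 < \<iota>" using \<iota> by simp
  have ew: "e \<in> edges (w (Suc n))" if "e \<in> edges v \<or> e \<in> edges W" for e
    using that edges_mono[OF v] edges_mono[OF W] by blast
  have finW: "finite W" using W finite_w finite_subset by blast
  have finv: "finite v" using v finite_w finite_subset by blast
  show ?case
  proof (cases "\<exists>e\<in>edges v. \<forall>C\<in>chunks n C1 C2. \<not> e \<subseteq> C")
    case True
    then obtain e where e: "e \<in> edges v" "\<And>C. C \<in> chunks n C1 C2 \<Longrightarrow> \<not> e \<subseteq> C" by blast
    have nle: "\<not> c (H 0 e) \<le> N n"
      using c_le_iff[OF H_in_Hval[OF \<open>0 < \<iota>\<close> e(1) v]] new[OF ew e(2) \<open>0 < \<iota>\<close>] e(1) by blast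
    have "\<not> (LEAST K. H 0 e \<in> Hval K) \<le> n"
      using nle N_mono unfolding c_def by blast
    moreover have "(LEAST K. H 0 e \<in> Hval K) \<le> Suc n"
      by (rule Least_le) (rule H_in_Hval[OF \<open>0 < \<iota>\<close> e(1) v])
    ultimately have "c (H 0 e) = N (Suc n)"
      unfolding c_def by (metis le_SucE)
    then have "l = N (Suc n)" "L = l"
      using Suc.prems(4,5,6) e(1) \<open>0 < \<iota>\<close> unfolding level_ok_def by force+
    then have "node L x = node L y"
      using Suc.prems(10)[OF Suc.prems(15)] Suc.prems(10)[OF Suc.prems(16)] Suc.prems(17,18) by simp
    then show ?thesis
      using Suc.prems(8,15,16) unfolding inj_on_def by blast
  next
    case False
    have "\<exists>C\<in>chunks n C1 C2. v \<subseteq> C"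
      by (rule chunk_of[OF C]) (use False Suc.prems(3) in auto)
    then obtain D where D: "D \<in> chunks n C1 C2" "v \<subseteq> D" by blast
    note cpD = copies[OF D(1)] and injv = copies_inj[OF copies[OF D(1)] D(2)]
    have nonfresh: "\<exists>C\<in>chunks n C1 C2. x \<in> C \<and> z \<in> C" if ne: "x \<in> W" "z \<in> W" "\<sigma> x \<noteq> \<sigma> z" for x z
    proof (rule ccontr)
      assume *: "\<not> ?thesis"
      then have fresh: "\<And>C. C \<in> chunks n C1 C2 \<Longrightarrow> \<not> {x, z} \<subseteq> C" by blast
      have xz: "{x, z} \<in> edges W" using ne by (intro edgesI) auto
      have sxz: "{\<sigma> x, \<sigma> z} \<in> edges v" using ne im by (intro edgesI) auto
      obtain j where j: "j < \<iota>" "H 0 {x, z} = H j {\<sigma> x, \<sigma> z}"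
        using Lab_H[OF lab[OF ne] \<open>0 < \<iota>\<close>] by blast
      have "{\<sigma> x, \<sigma> z} = {x, z}"
        by (rule uniq[OF ew fresh \<open>0 < \<iota>\<close> j(1) ew]) (use xz sxz j in auto)
      then show False using fresh False sxz by metis
    qed
    have main: "x = y" if W': "W' \<subseteq> W" "\<sigma> ` W' = v" "x \<in> W'" "y \<in> W'"
      and nf: "\<And>e. e \<in> edges W' \<Longrightarrow> \<exists>C\<in>chunks n C1 C2. e \<subseteq> C" for W'
    proof -
      have "finite W'" using W'(1) finW finite_subset by blast
      then have "3 \<le> card W'"
        using card_image_le[of W' \<sigma>] W'(2) Suc.prems(3) by simp
      then have "2 \<le> card W'" by simp
      with nf have "\<exists>C\<in>chunks n C1 C2. W' \<subseteq> C"
        by (rule chunk_of[OF C])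
      then obtain C' where C': "C' \<in> chunks n C1 C2" "W' \<subseteq> C'" by blast
      note cp' = copies[OF C'(1)] and injW = copies_inj[OF copies[OF C'(1)] C'(2)]
      define l' L' where "l' = min l (N n)" and "L' = min L (N n)"
      have l': "l' \<le> N n" "l' \<le> l" "l' \<le> L'" using Suc.prems(4) unfolding l'_def L'_def by auto
      define \<sigma>' where "\<sigma>' = p \<circ> \<sigma> \<circ> inv_into W' p"
      have \<sigma>': "\<sigma>' (p z) = p (\<sigma> z)" if "z \<in> W'" for z
        using that injW by (simp add: \<sigma>'_def)
      have \<sigma>v: "\<sigma> z \<in> v" if "z \<in> W'" for z using that W'(2) by blast
      have pne: "p s \<noteq> p t \<longleftrightarrow> s \<noteq> t" if "s \<in> v" "t \<in> v" for s t
        using injv that unfolding inj_on_def by blast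
      have "p x = p y"
      proof (rule Suc.IH[where v = "p ` v" and W = "p ` W'" and l = l' and L = L' and \<sigma> = \<sigma>' and a = "p a"])
        show "p ` v \<subseteq> w n" "p ` W' \<subseteq> w n"
          by (rule copies_image[OF cpD D(2)], rule copies_image[OF cp' C'(2)])
        show "3 \<le> card (p ` v)" using card_image[OF injv] Suc.prems(3) by simp
        show "l' \<le> L'" "L' \<le> N n" using l' unfolding L'_def by auto
        show "level_ok l' (p ` v)" unfolding l'_def by (rule copies_level_ok[OF cpD D(2) Suc.prems(6)])
        show "inj_on (node l') (p ` v)" unfolding l'_def by (rule copies_inj_node[OF cpD D(2) Suc.prems(7)])
        show "inj_on (node L') (p ` W')"
          unfolding L'_def by (rule copies_inj_node[OF cp' C'(2)]) (use Suc.prems(8) W'(1) inj_on_subset in blast)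
        have "\<sigma>' ` p ` W' = p ` \<sigma> ` W'"
          unfolding image_image by (intro image_cong refl) (use \<sigma>' in auto)
        then show "\<sigma>' ` p ` W' = p ` v" using W'(2) by simp
        have nd: "node l' (p z) = node l' z" if "z \<in> W'" for z
          using copies_node[OF cp' _ l'(1)] that C'(2) by blast
        have ndv: "node l' (p z) = node l' z" if "z \<in> v" for z
          using copies_node[OF cpD _ l'(1)] that D(2) by blast
        show "node l' z = node l' (\<sigma>' z)" if z: "z \<in> p ` W'" for z
        proof -
          obtain z' where z': "z' \<in> W'" "z = p z'" using z by blast
          have "node l z' = node l (\<sigma> z')" using Suc.prems(10) z'(1) W'(1) by blast
          then have "node l' z' = node l' (\<sigma> z')"
            using l'(2) unfolding node_eq_iff by auto
          then show ?thesis
            using nd[OF z'(1)] ndv[OF \<sigma>v[OF z'(1)]] \<sigma>'[OF z'(1)] z'(2) by simp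
        qed
        show "Lab l' {z1, z2} = Lab l' {\<sigma>' z1, \<sigma>' z2}"
          if z: "z1 \<in> p ` W'" "z2 \<in> p ` W'" "\<sigma>' z1 \<noteq> \<sigma>' z2" for z1 z2
        proof -
          obtain y1 y2 where y: "y1 \<in> W'" "z1 = p y1" "y2 \<in> W'" "z2 = p y2" using z by blast
          have ne: "\<sigma> y1 \<noteq> \<sigma> y2" using z(3) y \<sigma>' by auto
          have "{y1, y2} \<in> edges C'" using y C'(2) ne by (intro edgesI) auto
          then have "Lab l' {z1, z2} = Lab l' {y1, y2}"
            using copies_Lab[OF cp' _ l'(1)] y by fastforce
          also have "\<dots> = Lab l' {\<sigma> y1, \<sigma> y2}"
            using lab[OF _ _ ne] y(1,3) W'(1) cut_Lab[OF l'(2)] by (metis subsetD)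
          also have "{\<sigma> y1, \<sigma> y2} \<in> edges D"
            using \<sigma>v y D(2) ne by (intro edgesI) auto
          then have "Lab l' {\<sigma> y1, \<sigma> y2} = Lab l' {\<sigma>' z1, \<sigma>' z2}"
            using copies_Lab[OF cpD _ l'(1), of "{\<sigma> y1, \<sigma> y2}"] y \<sigma>' by simp
          finally show ?thesis .
        qed
        have qeD': "quasi_embedding_on S v p"
          by (rule copies_qe[OF cpD D(2)])
        have ne: "v \<noteq> {}" using Suc.prems(13) by blast
        show "yr S (p ` v) = ozero"
          using qeD(3)[OF qeD' order_refl finv ne] Suc.prems(12) by simp
        show "p a \<in> p ` v" using Suc.prems(13) by blast
        show "card (p ` v \<inter> {..<p a}) = yk S (p ` v)"
          using qeD(4)[OF qeD' order_refl finv ne] Suc.prems(14)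
            card_below_image[OF qeD(1)[OF qeD'] Suc.prems(13)] by simp
        show "p x \<in> p ` W'" "p y \<in> p ` W'" using W' by auto
        show "\<sigma>' (p x) = p a" "\<sigma>' (p y) = p a" using \<sigma>' W' Suc.prems(17,18) by auto
      qed
      then show "x = y" using injW W' unfolding inj_on_def by blast
    qed
    show ?thesis
    proof (cases "\<exists>e\<in>edges W. \<forall>C\<in>chunks n C1 C2. \<not> e \<subseteq> C")
      case False
      show ?thesis by (rule main[of W]) (use False im Suc.prems(15,16) in auto)
    next
      case True
      then obtain x0 y0 where xy0: "x0 \<in> W" "y0 \<in> W" "x0 \<noteq> y0"
        and fr0: "\<And>C. C \<in> chunks n C1 C2 \<Longrightarrow> \<not> (x0 \<in> C \<and> y0 \<in> C)"
        by (force elim!: edgesE)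
      have other: "\<exists>z\<in>W. \<sigma> z \<noteq> s" for s
      proof (rule ccontr)
        assume "\<not> ?thesis"
        then have "v \<subseteq> {s}" using im by blast
        then have "card v \<le> 1" using card_mono[of "{s}" v] by simp
        then show False using Suc.prems(3) by simp
      qed
      \<comment> \<open>An old point of \<open>W\<close> drags all of \<open>W\<close> into the old stage, where nothing is fresh.\<close>
      have Wnew: "W \<inter> w n = {}"
      proof (rule ccontr)
        assume "W \<inter> w n \<noteq> {}"
        then obtain z0 where z0: "z0 \<in> W" "z0 \<in> w n" by blast
        have step: "z \<in> w n" if "z \<in> W" "u \<in> W" "u \<in> w n" "\<sigma> u \<noteq> \<sigma> z" for z u
          using nonfresh[OF that(2,1,4)] that(3) C unfolding chunks_def by blast
        have "z \<in> w n" if "z \<in> W" for z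
        proof (cases "\<sigma> z = \<sigma> z0")
          case True
          obtain z' where "z' \<in> W" "\<sigma> z' \<noteq> \<sigma> z0" using other by blast
          then show ?thesis using step[OF _ z0] step[OF that, of z'] True by metis
        qed (use step[OF that z0] in auto)
        then show False using fr0[of "w n"] xy0 unfolding chunks_def by blast
      qed
      have pair: "u \<in> C1 \<and> z \<in> C1 \<or> u \<in> C2 \<and> z \<in> C2" if "u \<in> W" "z \<in> W" "\<sigma> u \<noteq> \<sigma> z" for u z
        using nonfresh[OF that] Wnew that unfolding chunks_def by blast
      have W12: "u \<in> C1 \<union> C2" if u: "u \<in> W" for u
      proof -
        obtain z where z: "z \<in> W" "\<sigma> z \<noteq> \<sigma> u" using other by blast
        then show ?thesis using pair[OF u z(1) z(2)[symmetric]] by blast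
      qed
      have "\<not> (x0 \<in> C1 \<and> y0 \<in> C1)" "\<not> (x0 \<in> C2 \<and> y0 \<in> C2)"
        using fr0[of C1] fr0[of C2] unfolding chunks_def by auto
      then obtain x1 y1 where xy1: "x1 \<in> W" "x1 \<in> C1 - C2" "y1 \<in> W" "y1 \<in> C2 - C1"
        using W12[OF xy0(1)] W12[OF xy0(2)] xy0(1,2) by blast
      define d where "d = \<sigma> x1"
      have y1d: "\<sigma> y1 = d"
        unfolding d_def by (rule ccontr) (use pair[OF xy1(1,3)] xy1 in auto)
      have common: "u \<in> C1 \<inter> C2" if "u \<in> W" "\<sigma> u \<noteq> d" for u
        using pair[OF that(1) xy1(1)] pair[OF that(1) xy1(3)] that(2) xy1 y1d by (simp add: d_def)
      show ?thesis
      proof (cases "a = d")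
        case False
        show ?thesis
        proof (rule main)
          show "W \<inter> C1 \<subseteq> W" by blast
          show "\<sigma> ` (W \<inter> C1) = v"
          proof
            show "v \<subseteq> \<sigma> ` (W \<inter> C1)"
            proof
              fix s assume "s \<in> v"
              then obtain z where z: "z \<in> W" "\<sigma> z = s" using im by blast
              show "s \<in> \<sigma> ` (W \<inter> C1)"
                using z common[of z] xy1 unfolding d_def by (cases "s = \<sigma> x1") (auto simp: d_def)
            qed
          qed (use im in blast)
          show "x \<in> W \<inter> C1" "y \<in> W \<inter> C1"
            using common Suc.prems(15-18) False by auto
          show "\<exists>C\<in>chunks n C1 C2. e \<subseteq> C" if "e \<in> edges (W \<inter> C1)" for e
            using that unfolding edges_def chunks_def by blast
        qed
      next
        case True
        define s where "s b = (if b = a then x1 else inv_into W \<sigma> b)" for b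
        have s: "s b \<in> W" "\<sigma> (s b) = b" if "b \<in> v" for b
          using that im True xy1(1) unfolding s_def d_def by (auto simp: inv_into_into f_inv_into_f)
        have sub: "s ` v \<subseteq> W" using s by blast
        have qe: "quasi_embedding_on S v s"
        proof (rule rigid[where K = "Suc n" and l = l and \<rho> = "\<lambda>_. 0" and ?v1.0 = "s ` v"])
          show "v \<subseteq> w (Suc n)" "s ` v \<subseteq> w (Suc n)" "3 \<le> card v" "l \<le> N (Suc n)" "level_ok l v"
            "inj_on (node l) v" using Suc.prems sub by auto
          show "inj_on (node l) (s ` v)"
          proof (rule inj_onI)
            fix u z assume "u \<in> s ` v" "z \<in> s ` v" "node l u = node l z"
            then obtain u' z' where uz: "u' \<in> v" "u = s u'" "z' \<in> v" "z = s z'" by blast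
            have "node l u' = node l z'"
              using Suc.prems(10)[OF s(1)[OF uz(1)]] Suc.prems(10)[OF s(1)[OF uz(3)]] s uz \<open>node l u = node l z\<close> by simp
            then show "u = z" using Suc.prems(7) uz unfolding inj_on_def by blast
          qed
          show "E b t + 0 = E (s b) t" if "b \<in> v" "t < l" for b t
            using Suc.prems(10)[OF s(1)[OF that(1)]] s(2)[OF that(1)] that(2) unfolding node_eq_iff by simp
          show "Lab l (s ` e) = Lab l e" if e: "e \<in> edges v" for e
          proof -
            obtain b1 b2 where b: "e = {b1, b2}" "b1 \<in> v" "b2 \<in> v" "b1 \<noteq> b2" using e by (rule edgesE)
            then show ?thesis using lab[of "s b1" "s b2"] s by simp
          qed
        qed simp
        have ne: "v \<noteq> {}" using Suc.prems(13) by blast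
        have sa: "s a = x1" by (simp add: s_def)
        define u where "u = s ` (v - {a})"
        have sv: "s ` v = insert x1 u" using Suc.prems(13) sa unfolding u_def by blast
        have u: "u \<subseteq> C1 \<inter> C2"
          using common s True unfolding u_def by fastforce
        have r0: "yr S (insert x1 u) = ozero"
          using qeD(3)[OF qe order_refl finv ne] Suc.prems(12) sv by simp
        have "card (insert x1 u \<inter> {..<x1}) = yk S (insert x1 u)"
          using qeD(4)[OF qe order_refl finv ne] Suc.prems(14)
            card_below_image[OF qeD(1)[OF qe] Suc.prems(13)] sv sa by simp
        moreover have "insert x1 u \<inter> {..<x1} = u \<inter> {..<x1}" by auto
        ultimately have "yk S (insert x1 u) = card (u \<inter> {..<x1})" by simp
        then have False
          using avoid u xy1(2) r0 unfolding avoids_def by blast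
        then show ?thesis ..
      qed
    qed
  qed
qed

end

section \<open>The bricks of a tower\<close>

context tower
begin

definition gnode :: "nat \<Rightarrow> nat \<Rightarrow> nat \<Rightarrow> nat \<Rightarrow> bit list" where
  "gnode l i a b = map (\<lambda>t. E b t + Gam i {a, b} t) [0..<l]"

definition T :: "nat \<Rightarrow> bit list set" where
  "T h = {gnode l i a b | l i a b. i < \<iota> \<and> a \<noteq> b \<and> H i {a, b} = h}"

lemma length_gnode [simp]: "length (gnode l i a b) = l"
  by (simp add: gnode_def)

lemma take_gnode [simp]: "take l (gnode L i a b) = gnode (min l L) i a b"
  by (simp add: gnode_def)

lemma gnode_in_T: "i < \<iota> \<Longrightarrow> a \<noteq> b \<Longrightarrow> gnode l i a b \<in> T (H i {a, b})"
  unfolding T_def by blast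

lemma tree_T: "tree (T h)"
  unfolding tree_def
proof (intro ballI allI impI)
  fix x y assume "x \<in> T h" "strict_prefix y x"
  then obtain l i a b where x: "x = gnode l i a b" "i < \<iota>" "a \<noteq> b" "H i {a, b} = h"
    unfolding T_def by blast
  have "y = take (length y) x"
    using \<open>strict_prefix y x\<close> by (auto simp: strict_prefix_def prefix_def)
  then have "y = gnode (min (length y) l) i a b"
    using x(1) by simp
  then show "y \<in> T h"
    using gnode_in_T[OF x(2,3)] x(4) by metis
qed

lemma no_maximal_nodes_T: "no_maximal_nodes (T h)"
  unfolding no_maximal_nodes_def
proof
  fix x assume "x \<in> T h"
  then obtain l i a b where x: "x = gnode l i a b" "i < \<iota>" "a \<noteq> b" "H i {a, b} = h"
    unfolding T_def by blast
  have "x = take l (gnode (Suc l) i a b)" "x \<noteq> gnode (Suc l) i a b"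
    using x(1) by (simp add: min_def, metis length_gnode n_not_Suc_n)
  then have "strict_prefix x (gnode (Suc l) i a b)"
    unfolding strict_prefix_def by (metis take_is_prefix)
  then show "\<exists>y\<in>T h. strict_prefix x y"
    using gnode_in_T[OF x(2,3)] x(4) by blast
qed

lemma Lab_insert: "Lab l {a, b} = (\<Union>i<\<iota>. {(gnode l i a b, H i {a, b}), (gnode l i b a, H i {a, b})})"
  unfolding Lab_def gnode_def by (auto simp: insert_commute)

lemma N_pos: "a \<in> w K \<Longrightarrow> 0 < N K"
  using w_0 N_Suc by (cases K) (auto intro: le_less_trans[OF le0])

lemma gnode_inject:
  assumes ij: "i < \<iota>" "j < \<iota>" and e: "a \<in> w K" "b \<in> w K" "a \<noteq> b" "x \<in> w K" "y \<in> w K" "x \<noteq> y"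
    and eq: "gnode (N K) i a b = gnode (N K) j x y"
  shows "i = j \<and> a = x \<and> b = y"
proof -
  have ed: "{a, b} \<in> edges (w K)" "{x, y} \<in> edges (w K)"
    using e by (auto intro: edgesI)
  have bits: "E b t + Gam i {a, b} t = E y t + Gam j {x, y} t" if "t < N K" for t
    using eq that by (auto simp: gnode_def list_eq_iff_nth_eq)
  obtain t where t: "t < N K" "\<forall>x\<in>w K. E x t = 0"
    "\<forall>j<\<iota>. \<forall>e'\<in>edges (w K). Gam j e' t = (if j = i \<and> e' = {a, b} then 1 else 0)"
    using Gam_indep[OF ij(1) ed(1)] by blast
  have "Gam j {x, y} t = 1"
    using bits[OF t(1)] t(2,3) e ed ij by simp
  then have ij': "i = j" "{a, b} = {x, y}"
    using t(3) ij(2) ed(2) by (auto split: if_splits)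
  then have "node (N K) b = node (N K) y"
    using bits unfolding node_eq_iff by simp
  then have "b = y"
    using inj_node e unfolding inj_on_def by blast
  then show ?thesis
    using ij' e by auto
qed

lemma nonrep_gnode:
  assumes "a \<in> w K" "b \<in> w K" "a \<noteq> b"
  shows "nonrep \<iota> (\<lambda>i. gnode (N K) i a b) (\<lambda>i. gnode (N K) i b a)"
  unfolding nonrep_def
  using gnode_inject[OF _ _ assms assms] gnode_inject[OF _ _ assms(2,1) assms(3)[symmetric] assms(2,1) assms(3)[symmetric]]
    gnode_inject[OF _ _ assms assms(2,1) assms(3)[symmetric]] assms(3) by blast

text \<open>The tuple \<open>m(l, v)\<close> of the bricks, read off the tower.\<close>

definition config :: "nat \<Rightarrow> nat set \<Rightarrow> mtuple \<Rightarrow> bool" where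
  "config l v m \<longleftrightarrow> ml m = l \<and> mu m = node l ` v \<and> inj_on (node l) v \<and>
     (\<forall>i<\<iota>. \<forall>a\<in>v. \<forall>b\<in>v. a \<noteq> b \<longrightarrow>
        mh m i (node l a, node l b) = H i {a, b} \<and> mg m i (node l a, node l b) = gnode l i a b)"

lemma config_labels:
  assumes "config l v m" "a \<in> v" "b \<in> v" "a \<noteq> b"
  shows "labels \<iota> m (node l a) (node l b) = Lab l {a, b}"
  unfolding labels_def Lab_insert
  using assms unfolding config_def by (intro SUP_cong refl) (auto simp: insert_commute)

lemma config_exists:
  assumes v: "v \<subseteq> w K" "2 \<le> card v"
  shows "\<exists>m\<in>M_family \<iota> T. config (N K) v m"
proof -
  let ?n = "node (N K)"
  define s where "s = inv_into v ?n"
  have inj: "inj_on ?n v" using inj_node v(1) by (rule inj_on_subset)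
  have s: "s (?n a) = a" if "a \<in> v" for a
    unfolding s_def using inj that by simp
  define m where "m = \<lparr>ml = N K, mu = ?n ` v,
    mh = (\<lambda>i\<in>{..<\<iota>}. \<lambda>p\<in>off_diag (?n ` v). H i {s (fst p), s (snd p)}),
    mg = (\<lambda>i\<in>{..<\<iota>}. \<lambda>p\<in>off_diag (?n ` v). gnode (N K) i (s (fst p)) (s (snd p)))\<rparr>"
  have ml: "ml m = N K" "mu m = ?n ` v" by (simp_all add: m_def)
  have hg: "mh m i (?n a, ?n b) = H i {a, b} \<and> mg m i (?n a, ?n b) = gnode (N K) i a b"
    if "i < \<iota>" "a \<in> v" "b \<in> v" "a \<noteq> b" for i a b
  proof -
    have "(?n a, ?n b) \<in> off_diag (?n ` v)"
      using that inj by (auto simp: off_diag_def inj_on_def)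
    then show ?thesis using that s by (simp add: m_def)
  qed
  then have "config (N K) v m"
    unfolding config_def ml using inj by blast
  moreover have "m \<in> M_family \<iota> T"
  proof (rule M_familyI[where F = "\<lambda>\<eta>. E (s \<eta>)" and G = "\<lambda>i p t. E (s (snd p)) t + Gam i {s (fst p), s (snd p)} t"],
      unfold ml)
    have "v \<noteq> {}" using v(2) by auto
    then show "0 < N K" using N_pos v(1) by blast
    show "2 \<le> card (?n ` v)" using v(2) card_image[OF inj] by simp
    fix \<eta> assume "\<eta> \<in> ?n ` v"
    then obtain a where a: "a \<in> v" "\<eta> = ?n a" by blast
    show "\<eta> = map (E (s \<eta>)) [0..<N K]" using a s by (simp add: node_def)
    fix \<nu> assume "\<nu> \<in> ?n ` v" and ne: "\<eta> \<noteq> \<nu>"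
    then obtain b where b: "b \<in> v" "\<nu> = ?n b" by blast
    have ab: "a \<noteq> b" using ne a b by blast
    have abw: "a \<in> w K" "b \<in> w K" using a b v(1) by auto
    show "nonrep \<iota> (\<lambda>i. mg m i (\<eta>, \<nu>)) (\<lambda>i. mg m i (\<nu>, \<eta>))"
      using nonrep_gnode[OF abw ab] hg[OF _ a(1) b(1) ab] hg[OF _ b(1) a(1) ab[symmetric]]
      unfolding a b nonrep_def by simp
    fix i assume i: "i < \<iota>"
    have "map (\<lambda>t. E b t + Gam i {a, b} t) [0..<n] \<in> T (H i {a, b})" for n
      using gnode_in_T[OF i ab] unfolding gnode_def .
    then show "mg m i (\<eta>, \<nu>) = map (\<lambda>t. E (s (snd (\<eta>, \<nu>))) t + Gam i {s (fst (\<eta>, \<nu>)), s (snd (\<eta>, \<nu>))} t) [0..<N K] \<and>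
       (\<lambda>t. E (s (snd (\<eta>, \<nu>))) t + Gam i {s (fst (\<eta>, \<nu>)), s (snd (\<eta>, \<nu>))} t) \<in> tree_lim (T (mh m i (\<eta>, \<nu>))) \<and>
       cantor_add (E (s \<eta>)) (\<lambda>t. E (s (snd (\<eta>, \<nu>))) t + Gam i {s (fst (\<eta>, \<nu>)), s (snd (\<eta>, \<nu>))} t) =
       cantor_add (E (s \<nu>)) (\<lambda>t. E (s (snd (\<nu>, \<eta>))) t + Gam i {s (fst (\<nu>, \<eta>)), s (snd (\<nu>, \<eta>))} t)"
      using hg[OF i a(1) b(1) ab] s a b
      by (auto simp: gnode_def tree_lim_def cantor_add_def insert_commute add_ac)
  qed (auto simp: m_def)
  ultimately show ?thesis by blast
qed

definition brick :: "nat \<Rightarrow> brick" where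
  "brick n = (let b = \<lparr>bw = w (Suc n), bn = N (Suc n), beta = (\<lambda>a\<in>w (Suc n). node (N (Suc n)) a),
      bh = (\<lambda>i\<in>{..<\<iota>}. \<lambda>p\<in>off_diag (w (Suc n)). H i {fst p, snd p}),
      bg = (\<lambda>i\<in>{..<\<iota>}. \<lambda>p\<in>off_diag (w (Suc n)). gnode (N (Suc n)) i (fst p) (snd p)), bM = {}\<rparr>
    in b\<lparr>bM := {m. \<exists>l v. brick_m \<iota> T c b l v m}\<rparr>)"

lemma brick_simps [simp]:
  "bw (brick n) = w (Suc n)" "bn (brick n) = N (Suc n)"
  "a \<in> w (Suc n) \<Longrightarrow> beta (brick n) a = node (N (Suc n)) a"
  "i < \<iota> \<Longrightarrow> a \<in> w (Suc n) \<Longrightarrow> b \<in> w (Suc n) \<Longrightarrow> a \<noteq> b \<Longrightarrow> bh (brick n) i (a, b) = H i {a, b}"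
  "i < \<iota> \<Longrightarrow> a \<in> w (Suc n) \<Longrightarrow> b \<in> w (Suc n) \<Longrightarrow> a \<noteq> b \<Longrightarrow> bg (brick n) i (a, b) = gnode (N (Suc n)) i a b"
  by (simp_all add: brick_def Let_def off_diag_def)

lemma bM_brick: "bM (brick n) = {m. \<exists>l v. brick_m \<iota> T c (brick n) l v m}"
  by (simp add: brick_def Let_def brick_m_def induced_def)

lemma induced_brick:
  assumes "v \<subseteq> w (Suc n)" "l \<le> N (Suc n)"
  shows "induced \<iota> (brick n) l v m \<longleftrightarrow> config l v m"
proof -
  have nd: "take l (beta (brick n) a) = node l a" if "a \<in> v" for a
    using that assms by (auto simp: min_def)
  have "(\<lambda>a. take l (beta (brick n) a)) ` v = node l ` v"
    by (intro image_cong refl nd)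
  moreover have "inj_on (\<lambda>a. take l (beta (brick n) a)) v \<longleftrightarrow> inj_on (node l) v"
    by (intro inj_on_cong nd)
  moreover have "(\<forall>(a, a')\<in>off_diag v.
        mh m i (take l (beta (brick n) a), take l (beta (brick n) a')) = bh (brick n) i (a, a') \<and>
        mg m i (take l (beta (brick n) a), take l (beta (brick n) a')) = take l (bg (brick n) i (a, a'))) \<longleftrightarrow>
      (\<forall>a\<in>v. \<forall>b\<in>v. a \<noteq> b \<longrightarrow>
        mh m i (node l a, node l b) = H i {a, b} \<and> mg m i (node l a, node l b) = gnode l i a b)"
    if "i < \<iota>" for i
  proof -
    have "mh m i (take l (beta (brick n) a), take l (beta (brick n) a')) = bh (brick n) i (a, a') \<and>
        mg m i (take l (beta (brick n) a), take l (beta (brick n) a')) = take l (bg (brick n) i (a, a')) \<longleftrightarrow>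
        mh m i (node l a, node l a') = H i {a, a'} \<and> mg m i (node l a, node l a') = gnode l i a a'"
      if "a \<in> v" "a' \<in> v" "a \<noteq> a'" for a a'
      using that \<open>i < \<iota>\<close> assms nd[OF that(1)] nd[OF that(2)] by (auto simp: subset_iff min_def)
    then show ?thesis unfolding off_diag_def by fastforce
  qed
  ultimately show ?thesis
    unfolding induced_def config_def by auto
qed

lemma brick_m_iff:
  "brick_m \<iota> T c (brick n) l v m \<longleftrightarrow> m \<in> M_family \<iota> T \<and> v \<subseteq> w (Suc n) \<and> 3 \<le> card v \<and> 0 < l \<and>
     l \<le> N (Suc n) \<and> level_ok l v \<and> config l v m"
proof -
  have "(\<forall>i<\<iota>. \<forall>p\<in>off_diag v. c (bh (brick n) i p) \<le> l) \<longleftrightarrow> level_ok l v" if "v \<subseteq> w (Suc n)"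
  proof
    assume *: "\<forall>i<\<iota>. \<forall>p\<in>off_diag v. c (bh (brick n) i p) \<le> l"
    show "level_ok l v"
      unfolding level_ok_def
    proof (intro allI impI ballI)
      fix i e assume i: "i < \<iota>" and "e \<in> edges v"
      then obtain a b where e: "e = {a, b}" "a \<in> v" "b \<in> v" "a \<noteq> b" by (elim edgesE)
      then have "c (bh (brick n) i (a, b)) \<le> l" using * i by (auto simp: off_diag_def)
      moreover have "bh (brick n) i (a, b) = H i e" using e i that by (simp add: subset_iff)
      ultimately show "c (H i e) \<le> l" by simp
    qed
  next
    assume *: "level_ok l v"
    show "\<forall>i<\<iota>. \<forall>p\<in>off_diag v. c (bh (brick n) i p) \<le> l"
    proof (intro allI impI ballI)
      fix i p assume i: "i < \<iota>" and "p \<in> off_diag v"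
      then obtain a b where p: "p = (a, b)" "a \<in> v" "b \<in> v" "a \<noteq> b" by (auto simp: off_diag_def)
      then have "bh (brick n) i p = H i {a, b}" using i that by (simp add: subset_iff)
      moreover have "c (H i {a, b}) \<le> l" using * i edgesI[OF p(2-4)] unfolding level_ok_def by blast
      ultimately show "c (bh (brick n) i p) \<le> l" by simp
    qed
  qed
  then show ?thesis
    unfolding brick_m_def using induced_brick by auto
qed

lemma level_ok_w: "v \<subseteq> w K \<Longrightarrow> level_ok (N K) v"
  unfolding level_ok_def using c_le H_in_Hval by blast

lemma lin_indep_brick: "lin_indep_seqs (N (Suc n)) (w (Suc n)) (beta (brick n))"
  unfolding lin_indep_seqs_def
proof (intro allI impI ballI)
  fix d :: "nat \<Rightarrow> bit" and a
  assume d: "\<forall>i<N (Suc n). (\<Sum>a\<in>w (Suc n). d a * beta (brick n) a ! i) = 0" and a: "a \<in> w (Suc n)"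
  obtain t where t: "t < N (Suc n)" "\<forall>x\<in>w (Suc n). E x t = (if x = a then 1 else 0)"
    using E_indep[OF a] by blast
  have "(\<Sum>x\<in>w (Suc n). d x * beta (brick n) x ! t) = (\<Sum>x\<in>w (Suc n). if x = a then d x else 0)"
    by (rule sum.cong) (use t in \<open>auto simp: node_def\<close>)
  also have "\<dots> = d a"
    using a finite_w by (simp add: sum.delta)
  finally show "d a = 0" using d t(1) by simp
qed

text \<open>The last two clauses are rigidity and the absence of critical splits, once the two relations between
  tuples are replaced by equality of labels.\<close>

lemma is_brick_brick: "is_brick S \<iota> T c (brick n)"
  unfolding is_brick_def
proof (intro conjI)
  let ?w = "w (Suc n)" and ?N = "N (Suc n)"
  have N0: "0 < ?N" using N_Suc[of n] by simp
  show "finite (bw (brick n))" "3 \<le> card (bw (brick n))" "0 < bn (brick n)"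
    "bM (brick n) = {m. \<exists>l w. brick_m \<iota> T c (brick n) l w m}"
    using finite_w card_w N0 bM_brick by auto
  show "beta (brick n) \<in> bw (brick n) \<rightarrow>\<^sub>E {x. length x = bn (brick n)}"
    by (simp add: brick_def Let_def)
  show "lin_indep_seqs (bn (brick n)) (bw (brick n)) (beta (brick n))"
    using lin_indep_brick by simp
  show "bh (brick n) \<in> {..<\<iota>} \<rightarrow>\<^sub>E off_diag (bw (brick n)) \<rightarrow>\<^sub>E UNIV"
    by (simp add: brick_def Let_def)
  show "bg (brick n) \<in> {..<\<iota>} \<rightarrow>\<^sub>E off_diag (bw (brick n)) \<rightarrow>\<^sub>E (\<Union>m. T m \<inter> {x. length x = bn (brick n)})"
  proof (intro PiE_I)
    fix i p assume "i \<in> {..<\<iota>}" "p \<in> off_diag (bw (brick n))"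
    then obtain a b where "i < \<iota>" "p = (a, b)" "a \<in> ?w" "b \<in> ?w" "a \<noteq> b" by (auto simp: off_diag_def)
    then show "bg (brick n) i p \<in> (\<Union>m. T m \<inter> {x. length x = bn (brick n)})"
      by (auto intro!: exI[of _ "H i {a, b}"] gnode_in_T)
  qed (simp_all add: brick_def Let_def)
  obtain m where m: "m \<in> M_family \<iota> T" "config ?N ?w m"
    using config_exists[of ?w "Suc n"] card_w[of n] by auto
  then show "\<exists>m\<in>M_family \<iota> T. induced \<iota> (brick n) (bn (brick n)) (bw (brick n)) m"
    using induced_brick[of ?w n ?N m] by auto
  have "brick_m \<iota> T c (brick n) ?N ?w m"
    unfolding brick_m_iff using m card_w N0 level_ok_w by auto
  then show "\<forall>i<\<iota>. \<forall>p\<in>off_diag (bw (brick n)). c (bh (brick n) i p) \<le> bn (brick n)"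
    unfolding brick_m_def by simp
  show "\<forall>l w0 w1 m0 m1 \<rho>.
        brick_m \<iota> T c (brick n) l w0 m0 \<and> brick_m \<iota> T c (brick n) l w1 m1 \<and> length \<rho> = l \<and>
        ess_same \<iota> m0 (m_shift \<iota> m1 \<rho>) \<longrightarrow>
        (\<exists>\<pi>. strict_mono_on w0 \<pi> \<and> \<pi> ` w0 = w1 \<and> quasi_embedding_on S w0 \<pi> \<and>
             (\<forall>a\<in>w0. seq_add (take l (beta (brick n) a)) \<rho> = take l (beta (brick n) (\<pi> a))))"
  proof (intro allI impI, elim conjE)
    fix l w0 w1 m0 m1 \<rho>
    assume b0: "brick_m \<iota> T c (brick n) l w0 m0" and b1: "brick_m \<iota> T c (brick n) l w1 m1"
      and \<rho>: "length \<rho> = l" and same: "ess_same \<iota> m0 (m_shift \<iota> m1 \<rho>)"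
    note b0 = b0[unfolded brick_m_iff] and b1 = b1[unfolded brick_m_iff]
    have c0: "config l w0 m0" and c1: "config l w1 m1" using b0 b1 by auto
    have M0: "m0 \<in> M_family \<iota> T" and M1: "m1 \<in> M_family \<iota> T" using b0 b1 by auto
    have ml1: "length \<rho> = ml m1" using \<rho> c1 unfolding config_def by simp
    have mu0: "mu m0 = node l ` w0" and mu1: "mu m1 = node l ` w1"
      using c0 c1 unfolding config_def by auto
    note sh = ess_same_shift[OF \<iota> M1 M0 ml1 same]
    have img: "node l ` w0 = (\<lambda>\<eta>. seq_add \<eta> \<rho>) ` node l ` w1"
      using sh(1) unfolding mu0 mu1 .
    have canc: "seq_add (seq_add (node l a) \<rho>) \<rho> = node l a" for a
      by (rule seq_add_cancel_right) (use \<rho> in auto)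
    define \<tau> where "\<tau> a = (SOME b. b \<in> w1 \<and> seq_add (node l a) \<rho> = node l b)" for a
    have \<tau>: "\<tau> a \<in> w1 \<and> seq_add (node l a) \<rho> = node l (\<tau> a)" if "a \<in> w0" for a
    proof -
      have "node l a \<in> (\<lambda>\<eta>. seq_add \<eta> \<rho>) ` node l ` w1" using img that by blast
      then obtain b where "b \<in> w1" "node l a = seq_add (node l b) \<rho>" by blast
      then have "b \<in> w1 \<and> seq_add (node l a) \<rho> = node l b" using canc by simp
      then show ?thesis unfolding \<tau>_def by (rule someI)
    qed
    have im: "\<tau> ` w0 = w1"
    proof (intro equalityI subsetI)
      fix b assume b: "b \<in> w1"
      then have "seq_add (node l b) \<rho> \<in> node l ` w0" using img by blast
      then obtain a where a: "a \<in> w0" "node l a = seq_add (node l b) \<rho>" by force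
      then have "node l (\<tau> a) = node l b" using \<tau>[OF a(1)] canc by metis
      then have "\<tau> a = b" using c1 b \<tau>[OF a(1)] unfolding config_def inj_on_def by blast
      then show "b \<in> \<tau> ` w0" using a by blast
    qed (use \<tau> in blast)
    have inj0: "inj_on (node l) w0" and inj1: "inj_on (node l) w1"
      using c0 c1 unfolding config_def by auto
    have "quasi_embedding_on S w0 \<tau>"
    proof (rule rigid[where K = "Suc n" and ?v1.0 = w1 and l = l and \<rho> = "\<lambda>t. \<rho> ! t"])
      show "E a t + \<rho> ! t = E (\<tau> a) t" if "a \<in> w0" "t < l" for a t
      proof -
        have "seq_add (node l a) \<rho> ! t = node l (\<tau> a) ! t" using \<tau>[OF that(1)] by simp
        then show ?thesis using that(2) \<rho> by (simp add: node_def)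
      qed
      show "Lab l (\<tau> ` e) = Lab l e" if ed: "e \<in> edges w0" for e
      proof -
        obtain a b where e: "e = {a, b}" "a \<in> w0" "b \<in> w0" "a \<noteq> b" using ed by (rule edgesE)
        have ne: "node l a \<noteq> node l b" using e inj0 unfolding inj_on_def by blast
        then have "node l (\<tau> a) \<noteq> node l (\<tau> b)"
          using \<tau>[OF e(2)] \<tau>[OF e(3)] canc by metis
        then have ne': "\<tau> a \<noteq> \<tau> b" by auto
        have "Lab l e = labels \<iota> m0 (node l a) (node l b)"
          unfolding e(1) by (rule config_labels[OF c0 e(2-4), symmetric])
        also have "\<dots> = labels \<iota> m1 (node l (\<tau> a)) (node l (\<tau> b))"
          using sh(2)[OF _ _ ne] e mu0 \<tau> by auto
        also have "\<dots> = Lab l {\<tau> a, \<tau> b}"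
          by (rule config_labels[OF c1 _ _ ne']) (use \<tau> e in auto)
        finally show ?thesis unfolding e(1) by simp
      qed
    qed (use b0 b1 inj0 inj1 im in auto)
    moreover have "seq_add (take l (beta (brick n) a)) \<rho> = take l (beta (brick n) (\<tau> a))" if "a \<in> w0" for a
      using \<tau>[OF that] that b0 b1 by (auto simp: subset_iff min_def)
    ultimately show "\<exists>\<pi>. strict_mono_on w0 \<pi> \<and> \<pi> ` w0 = w1 \<and> quasi_embedding_on S w0 \<pi> \<and>
             (\<forall>a\<in>w0. seq_add (take l (beta (brick n) a)) \<rho> = take l (beta (brick n) (\<pi> a)))"
      using im qeD(1) by blast
  qed
  show "\<forall>l w m k a.
        brick_m \<iota> T c (brick n) l w m \<and> a \<in> w \<and> card (w \<inter> {..<a}) = yk S w \<and> yr S w = ozero \<and>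
        k \<in> bM (brick n) \<and> ess_extends \<iota> m k \<longrightarrow>
        card {\<nu> \<in> mu k. prefix (take l (beta (brick n) a)) \<nu>} = 1"
  proof (intro allI impI, elim conjE)
    fix l v m k a
    assume b: "brick_m \<iota> T c (brick n) l v m" and a: "a \<in> v" and crit: "card (v \<inter> {..<a}) = yk S v" "yr S v = ozero"
      and k: "k \<in> bM (brick n)" and ext: "ess_extends \<iota> m k"
    obtain L W where bk: "brick_m \<iota> T c (brick n) L W k" using k unfolding bM_brick by blast
    note b = b[unfolded brick_m_iff] and bk = bk[unfolded brick_m_iff]
    have cm: "config l v m" and ck: "config L W k" using b bk by auto
    have ml: "ml m = l" "ml k = L" and mu: "mu m = node l ` v" "mu k = node L ` W"
      and inj: "inj_on (node l) v" "inj_on (node L) W"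
      using cm ck unfolding config_def by auto
    have lL: "l \<le> L" using ext ml unfolding ess_extends_def by simp
    have "node l ` v = take l ` node L ` W"
      using ext unfolding ess_extends_def ml mu by simp
    then have im: "node l ` v = node l ` W"
      using lL by (simp add: image_image min_def)
    define \<sigma> where "\<sigma> x = inv_into v (node l) (node l x)" for x
    have \<sigma>: "\<sigma> x \<in> v" "node l (\<sigma> x) = node l x" if "x \<in> W" for x
      using that im unfolding \<sigma>_def by (metis imageI inv_into_into, metis imageI f_inv_into_f)
    have \<sigma>eq: "\<sigma> x = b" if "x \<in> W" "b \<in> v" "node l x = node l b" for x b
      using \<sigma>[OF that(1)] that inj(1) unfolding inj_on_def by metis
    have im\<sigma>: "\<sigma> ` W = v"
    proof (intro equalityI subsetI)
      fix b assume "b \<in> v"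
      then obtain x where "x \<in> W" "node l x = node l b" using im by (metis imageE imageI)
      then show "b \<in> \<sigma> ` W" using \<sigma>eq \<open>b \<in> v\<close> by blast
    qed (use \<sigma> in blast)
    have single: "x = y" if "x \<in> W" "y \<in> W" "\<sigma> x = a" "\<sigma> y = a" for x y
    proof (rule critical_no_split[where v = v and K = "Suc n" and l = l and L = L and W = W and \<sigma> = \<sigma> and a = a])
      show "Lab l {x, y} = Lab l {\<sigma> x, \<sigma> y}" if xy: "x \<in> W" "y \<in> W" "\<sigma> x \<noteq> \<sigma> y" for x y
      proof -
        have xy': "x \<noteq> y" using xy(3) by blast
        have ne: "node l x \<noteq> node l y" using \<sigma>eq[OF xy(2) \<sigma>(1)[OF xy(1)]] \<sigma>(2)[OF xy(1)] xy(3) by metis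
        have "labels \<iota> m (take (ml m) (node L x)) (take (ml m) (node L y)) = cut (ml m) (labels \<iota> k (node L x) (node L y))"
          by (rule ess_extends_labels[OF \<iota> ext]) (use xy ml mu lL ne in \<open>auto simp: min_def\<close>)
        then have "labels \<iota> m (node l x) (node l y) = Lab l {x, y}"
          using lL config_labels[OF ck xy(1,2) xy'] cut_Lab[OF lL] unfolding ml by (simp add: min_def)
        moreover have "labels \<iota> m (node l (\<sigma> x)) (node l (\<sigma> y)) = Lab l {\<sigma> x, \<sigma> y}"
          by (rule config_labels[OF cm \<sigma>(1)[OF xy(1)] \<sigma>(1)[OF xy(2)] xy(3)])
        ultimately show ?thesis using \<sigma>(2) xy by simp
      qed
    qed (use b bk inj lL \<sigma> im\<sigma> crit a that in auto)
    obtain x0 where x0: "x0 \<in> W" "\<sigma> x0 = a" using im\<sigma> a by blast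
    have ba: "take l (beta (brick n) a) = node l a" using a b by (auto simp: subset_iff min_def)
    have "{\<nu> \<in> mu k. prefix (node l a) \<nu>} = {node L x0}"
    proof (intro equalityI subsetI)
      fix \<nu> assume "\<nu> \<in> {\<nu> \<in> mu k. prefix (node l a) \<nu>}"
      then have "\<nu> \<in> node L ` W" "prefix (node l a) \<nu>" using mu(2) by auto
      then obtain x where x: "x \<in> W" "\<nu> = node L x" "prefix (node l a) (node L x)" by blast
      obtain zs where zs: "node L x = node l a @ zs" using x(3) by (rule prefixE)
      have "node l a = take l (node L x)" unfolding zs by simp
      then have "node l x = node l a" using lL by (simp add: min_def)
      then have "\<sigma> x = a" using \<sigma>eq x(1) a by blast
      then show "\<nu> \<in> {node L x0}" using single x x0 by blast
    next
      fix \<nu> assume "\<nu> \<in> {node L x0}"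
      moreover have "node l a = take l (node L x0)" using \<sigma>(2)[OF x0(1)] x0(2) lL by (simp add: min_def)
      then have "prefix (node l a) (node L x0)" by (simp only: take_is_prefix)
      ultimately show "\<nu> \<in> {\<nu> \<in> mu k. prefix (node l a) \<nu>}"
        using x0(1) mu(2) by blast
    qed
    then show "card {\<nu> \<in> mu k. prefix (take l (beta (brick n) a)) \<nu>} = 1"
      unfolding ba by simp
  qed
qed

lemma prefix_node: "l \<le> L \<Longrightarrow> (\<And>t. t < l \<Longrightarrow> E a t = E b t) \<Longrightarrow> prefix (node l a) (node L b)"
proof -
  assume "l \<le> L" "\<And>t. t < l \<Longrightarrow> E a t = E b t"
  then have "node l a = take l (node L b)"
    by (auto simp: min_def node_eq_iff)
  then show ?thesis by (metis take_is_prefix)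
qed

lemma prefix_gnode:
  "l \<le> L \<Longrightarrow> (\<And>t. t < l \<Longrightarrow> E b t = E y t) \<Longrightarrow> (\<And>t. t < l \<Longrightarrow> Gam i {a, b} t = Gam i {x, y} t) \<Longrightarrow>
   prefix (gnode l i a b) (gnode L i x y)"
proof -
  assume "l \<le> L" "\<And>t. t < l \<Longrightarrow> E b t = E y t" "\<And>t. t < l \<Longrightarrow> Gam i {a, b} t = Gam i {x, y} t"
  then have "gnode l i a b = take l (gnode L i x y)"
    by (auto simp: min_def gnode_def)
  then show ?thesis by (metis take_is_prefix)
qed

lemma demand_bricks:
  assumes v: "v \<subseteq> w (Suc n)" "3 \<le> card v"
    and qe: "quasi_embedding_on S v \<pi>0" "quasi_embedding_on S v \<pi>1"
    and U: "\<pi>0 ` v \<union> \<pi>1 ` v \<subseteq> U" "finite U"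
    and inj: "\<forall>a\<in>v. \<forall>b\<in>v. \<pi>0 a = \<pi>1 b \<longrightarrow> a = b" and avoids: "avoids S (\<pi>0 ` v) (\<pi>1 ` v)"
  shows "\<exists>K \<pi>. quasi_embedding_on S U \<pi> \<and> \<pi> ` U \<subseteq> bw (brick K) \<and>
    (\<forall>\<psi>\<in>{\<pi>0, \<pi>1}. brick_le \<iota> (brick_image S \<iota> T c (\<pi> \<circ> \<psi>) (brick_restrict S \<iota> T c (brick n) v))
        (brick_restrict S \<iota> T c (brick K) ((\<pi> \<circ> \<psi>) ` v)))"
proof -
  have "v \<noteq> {}" using v(2) by auto
  then have "U \<noteq> {}" using U by blast
  then have "demand S (w (Suc n)) v \<pi>0 \<pi>1 U"
    unfolding demand_def using v(1) qe U inj avoids by blast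
  from demands_met[OF this] obtain K' \<pi> where K': "N (Suc n) < N K'" and \<pi>: "quasi_embedding_on S U \<pi>" "\<pi> ` U \<subseteq> w K'"
    and copy: "\<forall>\<psi>\<in>{\<pi>0, \<pi>1}. (\<forall>a\<in>v. \<forall>t<N (Suc n). E (\<pi> (\<psi> a)) t = E a t) \<and>
          (\<forall>i<\<iota>. \<forall>e\<in>edges v. H i ((\<pi> \<circ> \<psi>) ` e) = H i e \<and> (\<forall>t<N (Suc n). Gam i ((\<pi> \<circ> \<psi>) ` e) t = Gam i e t))"
    unfolding demand_met_def embeds_def by auto
  obtain K where K: "K' = Suc K" using K' N_less_iff by (cases K') auto
  have "brick_le \<iota> (brick_image S \<iota> T c (\<pi> \<circ> \<psi>) (brick_restrict S \<iota> T c (brick n) v))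
        (brick_restrict S \<iota> T c (brick K) ((\<pi> \<circ> \<psi>) ` v))" if \<psi>: "\<psi> \<in> {\<pi>0, \<pi>1}" for \<psi>
  proof (rule brick_le_image_restrict[OF S_UNIV is_brick_brick _ v(2) is_brick_brick])
    have \<psi>U: "\<psi> ` v \<subseteq> U" using \<psi> U by auto
    then have im: "(\<pi> \<circ> \<psi>) ` v \<subseteq> w (Suc K)" using \<pi>(2) K by auto
    show qc: "quasi_embedding_on S v (\<pi> \<circ> \<psi>)"
      by (rule quasi_embedding_on_comp[OF S_UNIV _ qe_subset[OF \<pi>(1) \<psi>U]]) (use \<psi> qe in auto)
    show "v \<subseteq> bw (brick n)" "(\<pi> \<circ> \<psi>) ` v \<subseteq> bw (brick K)" using v im by auto
    show "bn (brick n) \<le> bn (brick K)" using K' K by simp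
    have le: "N (Suc n) \<le> N (Suc K)" using K' K by simp
    have E: "E a t = E ((\<pi> \<circ> \<psi>) a) t" if "a \<in> v" "t < N (Suc n)" for a t
      using copy \<psi> that by auto
    show "prefix (beta (brick n) a) (beta (brick K) ((\<pi> \<circ> \<psi>) a))" if "a \<in> v" for a
    proof -
      have "a \<in> w (Suc n)" "(\<pi> \<circ> \<psi>) a \<in> w (Suc K)" using that v(1) im by blast+
      then show ?thesis using prefix_node[OF le E[OF that]] by simp
    qed
    fix i x y assume i: "i < \<iota>" and xy: "x \<in> v" "y \<in> v" "x \<noteq> y"
    have ne: "(\<pi> \<circ> \<psi>) x \<noteq> (\<pi> \<circ> \<psi>) y" using qeD(2)[OF qc] xy unfolding inj_on_def by blast
    have in1: "x \<in> w (Suc n)" "y \<in> w (Suc n)" "(\<pi> \<circ> \<psi>) x \<in> w (Suc K)" "(\<pi> \<circ> \<psi>) y \<in> w (Suc K)"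
      using xy v(1) im by blast+
    have "{x, y} \<in> edges v" using xy by (rule edgesI)
    then have HG: "H i {(\<pi> \<circ> \<psi>) x, (\<pi> \<circ> \<psi>) y} = H i {x, y}"
      "t < N (Suc n) \<Longrightarrow> Gam i {x, y} t = Gam i {(\<pi> \<circ> \<psi>) x, (\<pi> \<circ> \<psi>) y} t" for t
      using copy \<psi> i by fastforce+
    show "bh (brick K) i ((\<pi> \<circ> \<psi>) x, (\<pi> \<circ> \<psi>) y) = bh (brick n) i (x, y) \<and>
       prefix (bg (brick n) i (x, y)) (bg (brick K) i ((\<pi> \<circ> \<psi>) x, (\<pi> \<circ> \<psi>) y))"
      unfolding brick_simps(4)[OF i in1(1,2) xy(3)] brick_simps(5)[OF i in1(1,2) xy(3)]
        brick_simps(4)[OF i in1(3,4) ne] brick_simps(5)[OF i in1(3,4) ne]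
      using HG(1) prefix_gnode[OF le E[OF xy(2)] HG(2)] by blast
  qed
  then show ?thesis using \<pi> K by auto
qed

text \<open>For the amalgamation clause the demanded set is the union of the two ranges.  They overlap exactly in the
  image of \<open>u\<close>, so the hypothesis of that clause says that the ranges avoid each other; for the last
  clause, where they coincide, there is nothing to avoid.\<close>

lemma controlled_amalgamation_T: "controlled_amalgamation S \<iota> T c"
  unfolding controlled_amalgamation_def
proof (intro exI[of _ brick] conjI allI impI)
  show "is_brick S \<iota> T c (brick n)" for n by (rule is_brick_brick)
  show "brick_le \<iota> (brick n) (brick (Suc n))" for n
    unfolding brick_le_def
  proof (intro conjI ballI allI impI)
    have le: "N (Suc n) \<le> N (Suc (Suc n))" by (rule N_mono) simp
    have sub: "w (Suc n) \<subseteq> w (Suc (Suc n))" by (rule w_Suc)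
    show "bw (brick n) \<subseteq> bw (brick (Suc n))" "bn (brick n) \<le> bn (brick (Suc n))" using le sub by auto
    show "prefix (beta (brick n) a) (beta (brick (Suc n)) a)" if "a \<in> bw (brick n)" for a
      using that sub prefix_node[OF le, of a a] by (auto simp: subset_iff)
    fix i p assume i: "i < \<iota>" and "p \<in> off_diag (bw (brick n))"
    then obtain a b where p: "p = (a, b)" "a \<in> w (Suc n)" "b \<in> w (Suc n)" "a \<noteq> b" by (auto simp: off_diag_def)
    then have p': "a \<in> w (Suc (Suc n))" "b \<in> w (Suc (Suc n))" using sub by auto
    show "bh (brick (Suc n)) i p = bh (brick n) i p" "prefix (bg (brick n) i p) (bg (brick (Suc n)) i p)"
      using p p' i prefix_gnode[OF le, of b b i a a] by auto
  qed
  have "a \<in> (\<Union>n. bw (brick n))" for a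
  proof -
    obtain n where "a \<in> w n" using w_exhausts by blast
    then have "a \<in> w (Suc n)" using w_Suc by blast
    then show ?thesis by auto
  qed
  then show "(\<Union>n. bw (brick n)) = UNIV" by blast
  have "strict_mono (\<lambda>n. N (Suc n))" by (simp add: strict_mono_Suc_iff N_Suc)
  then show "filterlim (\<lambda>n. bn (brick n)) at_top sequentially"
    using filterlim_subseq by simp
  fix n
  { fix u v \<pi>0 \<pi>1
    assume *: "u \<subseteq> v \<and> v \<subseteq> bw (brick n) \<and> 3 \<le> card v \<and>
           (\<forall>x \<delta>. x \<subseteq> u \<and> \<delta> \<in> v - u \<and> yr S (insert \<delta> x) = ozero \<longrightarrow>
              yk S (insert \<delta> x) \<noteq> card (x \<inter> {..<\<delta>})) \<and>
           quasi_embedding_on S v \<pi>0 \<and> quasi_embedding_on S v \<pi>1 \<and>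
           (\<forall>a\<in>u. \<pi>0 a = \<pi>1 a) \<and> \<pi>0 ` (v - u) \<inter> \<pi>1 ` (v - u) = {}"
    have u: "u \<subseteq> v" and v: "v \<subseteq> w (Suc n)" "3 \<le> card v"
      and crit: "\<And>x \<delta>. x \<subseteq> u \<Longrightarrow> \<delta> \<in> v - u \<Longrightarrow> yr S (insert \<delta> x) = ozero \<Longrightarrow> yk S (insert \<delta> x) \<noteq> card (x \<inter> {..<\<delta>})"
      and qe0: "quasi_embedding_on S v \<pi>0" and qe1: "quasi_embedding_on S v \<pi>1"
      and eq: "\<And>a. a \<in> u \<Longrightarrow> \<pi>0 a = \<pi>1 a" and disj: "\<pi>0 ` (v - u) \<inter> \<pi>1 ` (v - u) = {}"
      using * by auto
    note inj0 = qeD(2)[OF qe0] and inj1 = qeD(2)[OF qe1]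
    have finv: "finite v" using v(1) finite_w finite_subset by blast
    have coin: "a = b \<and> a \<in> u" if ab: "a \<in> v" "b \<in> v" "\<pi>0 a = \<pi>1 b" for a b
    proof (cases "b \<in> u")
      case True
      then have "\<pi>0 a = \<pi>0 b" using ab eq by simp
      then show ?thesis using inj0 ab True unfolding inj_on_def by blast
    next
      case False
      have "a \<in> u" using disj ab False by blast
      then have "\<pi>1 a = \<pi>1 b" using ab eq by simp
      then show ?thesis using inj1 ab \<open>a \<in> u\<close> unfolding inj_on_def by blast
    qed
    have "avoids S (\<pi>0 ` v) (\<pi>1 ` v)"
      unfolding avoids_def
    proof (intro allI impI, elim conjE)
      fix x' y assume x': "x' \<subseteq> \<pi>0 ` v \<inter> \<pi>1 ` v" and y: "y \<in> \<pi>0 ` v - \<pi>1 ` v" and r: "yr S (insert y x') = ozero"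
      obtain \<delta> where \<delta>: "\<delta> \<in> v" "y = \<pi>0 \<delta>" using y by blast
      have \<delta>u: "\<delta> \<notin> u" using y \<delta> eq by auto
      have "x' \<subseteq> \<pi>0 ` u"
      proof
        fix z assume "z \<in> x'"
        then obtain a b where "a \<in> v" "z = \<pi>0 a" "b \<in> v" "\<pi>0 a = \<pi>1 b" using x' by force
        then show "z \<in> \<pi>0 ` u" using coin by blast
      qed
      then obtain x where x: "x \<subseteq> u" "x' = \<pi>0 ` x" by (auto simp: subset_image_iff)
      have sub: "insert \<delta> x \<subseteq> v" using x(1) u \<delta>(1) by blast
      have fin: "finite (insert \<delta> x)" by (rule finite_subset[OF sub finv])
      have im: "insert y x' = \<pi>0 ` insert \<delta> x" using x(2) \<delta>(2) by simp
      have "yr S (insert \<delta> x) = ozero" "yk S (insert y x') = yk S (insert \<delta> x)"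
        using qeD(3,4)[OF qe0 sub fin] r unfolding im by auto
      then have "yk S (insert y x') \<noteq> card (x \<inter> {..<\<delta>})" using crit[OF x(1), of \<delta>] \<delta> \<delta>u by auto
      moreover have "card (insert y x' \<inter> {..<y}) = card (insert \<delta> x \<inter> {..<\<delta>})"
        unfolding im unfolding \<delta>(2)
        by (rule card_below_image[OF qeD(1)[OF qe_subset[OF qe0 sub]]]) simp
      moreover have "insert y x' \<inter> {..<y} = x' \<inter> {..<y}" "insert \<delta> x \<inter> {..<\<delta>} = x \<inter> {..<\<delta>}" by auto
      ultimately show "yk S (insert y x') \<noteq> card (x' \<inter> {..<y})" by simp
    qed
    note av = this
    have fin: "finite (\<pi>0 ` v \<union> \<pi>1 ` v)" using finv by simp
    have inj: "\<forall>a\<in>v. \<forall>b\<in>v. \<pi>0 a = \<pi>1 b \<longrightarrow> a = b" using coin by blast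
    show "\<exists>K \<pi>. quasi_embedding_on S (\<pi>0 ` v \<union> \<pi>1 ` v) \<pi> \<and>
              \<pi> ` (\<pi>0 ` v \<union> \<pi>1 ` v) \<subseteq> bw (brick K) \<and>
              (\<forall>\<pi>'\<in>{\<pi>0, \<pi>1}.
                 brick_le \<iota> (brick_image S \<iota> T c (\<pi> \<circ> \<pi>') (brick_restrict S \<iota> T c (brick n) v))
                            (brick_restrict S \<iota> T c (brick K) ((\<pi> \<circ> \<pi>') ` v)))"
      by (rule demand_bricks[OF v qe0 qe1 order_refl fin inj av])
  next
    fix v \<pi>0 U
    assume *: "v \<subseteq> bw (brick n) \<and> 3 \<le> card v \<and> quasi_embedding_on S v \<pi>0 \<and> \<pi>0 ` v \<subseteq> U \<and> finite U"
    then have v: "v \<subseteq> w (Suc n)" "3 \<le> card v" and qe0: "quasi_embedding_on S v \<pi>0"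
      and U: "\<pi>0 ` v \<union> \<pi>0 ` v \<subseteq> U" "finite U" by auto
    have inj: "\<forall>a\<in>v. \<forall>b\<in>v. \<pi>0 a = \<pi>0 b \<longrightarrow> a = b"
      using qeD(2)[OF qe0] unfolding inj_on_def by blast
    have "avoids S (\<pi>0 ` v) (\<pi>0 ` v)" by (simp add: avoids_def)
    from demand_bricks[OF v qe0 qe0 U inj this] show "\<exists>K \<pi>. quasi_embedding_on S U \<pi> \<and> \<pi> ` U \<subseteq> bw (brick K) \<and>
              brick_le \<iota> (brick_image S \<iota> T c (\<pi> \<circ> \<pi>0) (brick_restrict S \<iota> T c (brick n) v))
                         (brick_restrict S \<iota> T c (brick K) ((\<pi> \<circ> \<pi>0) ` v))"
      unfolding insert_absorb2 ball_simps by blast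
  }
qed

end

section \<open>Extending and interpolating tuples\<close>

lemma extends_refl: "m \<in> M_family \<iota> T \<Longrightarrow> extends \<iota> m m"
  using M_familyD(2,9) by (intro extendsI) force+

text \<open>Every successor step of the rank pays for one longer level and one further element.\<close>

lemma ndrk_ge_chain:
  fixes y :: "'o::ordinals"
  assumes "m \<in> M_family \<iota> T" "countable {..<y}" "ndrk_ge \<iota> T ((osuc ^^ j) y) m"
  shows "\<exists>n\<in>M_family \<iota> T. extends \<iota> m n \<and> ml m + j \<le> ml n \<and> card (mu m) + j \<le> card (mu n) \<and> ndrk_ge \<iota> T y n"
  using assms(1,3)
proof (induction j arbitrary: m)
  case 0
  then show ?case using extends_refl by auto
next
  case (Suc j)
  have c: "countable {..<(osuc ^^ j) y}" by (rule countable_osuc_funpow[OF assms(2)])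
  obtain \<nu> where "\<nu> \<in> mu m" using M_familyD(5)[OF Suc.prems(1)] by blast
  then obtain n where n: "splitting_ext \<iota> T m \<nu> n" "ndrk_ge \<iota> T ((osuc ^^ j) y) n"
    using Suc.prems(2) ndrk_ge_osuc[OF less_osuc[OF c]] by auto
  have nM: "n \<in> M_family \<iota> T" and lt: "ml m < ml n" and ext: "extends \<iota> m n"
    and two: "2 \<le> card {\<eta> \<in> mu n. strict_prefix \<nu> \<eta>}"
    using n(1) unfolding splitting_ext_def by auto
  have "card (mu m) < card (mu n)"
  proof (rule ccontr)
    assume "\<not> ?thesis"
    moreover have "mu m = take (ml m) ` mu n" using ext unfolding extends_def by blast
    ultimately have "card (take (ml m) ` mu n) = card (mu n)"
      using card_image_le[OF M_familyD(4)[OF nM], of "take (ml m)"] by simp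
    then have inj: "inj_on (take (ml m)) (mu n)"
      using eq_card_imp_inj_on M_familyD(4)[OF nM] by blast
    have "take (ml m) \<eta> = \<nu>" if "strict_prefix \<nu> \<eta>" for \<eta>
      using that M_familyD(2)[OF Suc.prems(1) \<open>\<nu> \<in> mu m\<close>] by (auto simp: strict_prefix_def prefix_def)
    then have "\<exists>z. {\<eta> \<in> mu n. strict_prefix \<nu> \<eta>} \<subseteq> {z}"
      using inj unfolding inj_on_def by (metis (mono_tags, lifting) mem_Collect_eq singletonI subsetI)
    then have "card {\<eta> \<in> mu n. strict_prefix \<nu> \<eta>} \<le> 1"
      using card_mono[OF finite.insertI[OF finite.emptyI]] by (metis One_nat_def card.empty card.insert empty_iff finite.emptyI)
    then show False using two by simp
  qed
  moreover obtain p where "p \<in> M_family \<iota> T" "extends \<iota> n p" "ml n + j \<le> ml p" "card (mu n) + j \<le> card (mu p)" "ndrk_ge \<iota> T y p"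
    using Suc.IH[OF nM n(2)] by blast
  ultimately show ?case
    using extends_trans[OF ext] lt by (intro bexI[of _ p]) auto
qed

text \<open>Choose one element of \<open>n\<close> above each element of \<open>m\<close> and cut at level \<open>L\<close>: no pair of the result is new, so
  nothing can collide that was distinct at the level of \<open>m\<close>.\<close>

lemma interpolate:
  assumes m: "m \<in> M_family \<iota> T" and n: "n \<in> M_family \<iota> T" and ext: "extends \<iota> m n"
    and L: "ml m \<le> L" "L \<le> ml n"
  shows "\<exists>m'\<in>M_family \<iota> T. extends \<iota> m m' \<and> ml m' = L \<and> inj_on (take (ml m)) (mu m') \<and>
    (\<forall>\<alpha>::'o::wellorder. ndrk_ge \<iota> T \<alpha> n \<longrightarrow> ndrk_ge \<iota> T \<alpha> m')"
proof -
  have mu: "mu m = take (ml m) ` mu n" using ext unfolding extends_def by blast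
  define s where "s = inv_into (mu n) (take (ml m))"
  have s: "s \<eta> \<in> mu n" "take (ml m) (s \<eta>) = \<eta>" if "\<eta> \<in> mu m" for \<eta>
    using that unfolding s_def mu by (auto simp: inv_into_into f_inv_into_f)
  define U where "U = s ` mu m"
  have tkL: "take (ml m) (take L z) = take (ml m) z" for z :: "bit list"
    using L by (simp add: min_def)
  have injs: "inj_on s (mu m)" using s(2) by (metis inj_onI)
  have injm: "inj_on (take (ml m)) U" unfolding U_def using s(2) by (auto simp: inj_on_def)
  have injL: "inj_on (take L) U" using injm unfolding inj_on_def by (metis tkL)
  have U: "U \<subseteq> mu n" using s unfolding U_def by blast
  have c: "2 \<le> card U" unfolding U_def card_image[OF injs] by (rule M_familyD(3)[OF m])
  have L0: "0 < L" using M_familyD(1)[OF m] L by simp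
  have imU: "take (ml m) ` U = mu m" unfolding U_def image_image using s(2) by simp
  define m' where "m' = sub_tuple \<iota> n U L"
  have nr: "nonrep \<iota> (\<lambda>i. take L (mg n i (x, y))) (\<lambda>i. take L (mg n i (y, x)))"
    if xy: "x \<in> U" "y \<in> U" "x \<noteq> y" for x y
  proof -
    have ne: "take (ml m) x \<noteq> take (ml m) y" using injm xy unfolding inj_on_def by blast
    have in': "take (ml m) x \<in> mu m" "take (ml m) y \<in> mu m" using imU xy by blast+
    have xyn: "x \<in> mu n" "y \<in> mu n" using xy U by auto
    have "nonrep \<iota> (\<lambda>i. take (ml m) (take L (mg n i (x, y)))) (\<lambda>i. take (ml m) (take L (mg n i (y, x))))"
      using M_familyD(11)[OF m in' ne] extends_pair(2)[OF ext xyn ne] extends_pair(2)[OF ext xyn(2,1) ne[symmetric]]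
      unfolding tkL nonrep_def by simp
    then show ?thesis unfolding nonrep_def by metis
  qed
  have M': "m' \<in> M_family \<iota> T"
    unfolding m'_def by (rule sub_tuple_in_M[OF n U c L0 L(2) injL nr])
  have "extends \<iota> m m'"
  proof (rule extendsI)
    show "ml m \<le> ml m'" using L unfolding m'_def by simp
    show "mu m = take (ml m) ` mu m'" unfolding m'_def sub_tuple_simps image_image tkL imU ..
    fix x' y' i assume "x' \<in> mu m'" "y' \<in> mu m'" "take (ml m) x' \<noteq> take (ml m) y'" "i < \<iota>"
    then obtain x y where xy: "x \<in> U" "y \<in> U" "x' = take L x" "y' = take L y" unfolding m'_def by auto
    then have ne: "take (ml m) x \<noteq> take (ml m) y" using \<open>take (ml m) x' \<noteq> take (ml m) y'\<close> tkL by simp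
    then have "x \<noteq> y" by blast
    then show "mh m i (take (ml m) x', take (ml m) y') = mh m' i (x', y') \<and>
      mg m i (take (ml m) x', take (ml m) y') = take (ml m) (mg m' i (x', y'))"
      using sub_tuple_nth[OF injL xy(1,2) _ \<open>i < \<iota>\<close>, of n] extends_pair[OF ext _ _ ne \<open>i < \<iota>\<close>] xy U
      unfolding m'_def by (auto simp: subset_iff min.absorb1[OF L(1)])
  qed
  moreover have "inj_on (take (ml m)) (mu m')"
    unfolding m'_def sub_tuple_simps using injm by (auto simp: inj_on_def min.absorb1[OF L(1)])
  moreover have "ndrk_ge \<iota> T \<alpha> m'" if "ndrk_ge \<iota> T \<alpha> n" for \<alpha> :: 'o
    unfolding m'_def by (rule ndrk_ge_sub_tuple[OF n U c L0 L(2) injL that])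
  ultimately show ?thesis
    using M' by (intro bexI[of _ m']) (auto simp: m'_def)
qed

section \<open>The normal form of large tuples\<close>

lemma bit_swap: "(a::bit) + b = c + d \<Longrightarrow> b + d = a + c"
  by (cases a; cases b; cases c; cases d) auto

lemma pairwise_meeting_edges:
  assumes two: "\<And>e. e \<in> F \<Longrightarrow> card e = 2" and meet: "\<And>e e'. e \<in> F \<Longrightarrow> e' \<in> F \<Longrightarrow> e \<inter> e' \<noteq> {}"
    and "4 \<le> card F"
  shows "\<exists>a. \<forall>e\<in>F. a \<in> e"
proof -
  have big: "\<not> F \<subseteq> {e1, e2, e3}" for e1 e2 e3
  proof
    assume "F \<subseteq> {e1, e2, e3}"
    then have "card F \<le> card {e1, e2, e3}" by (rule card_mono[rotated]) simp
    also have "\<dots> \<le> 3" by (simp add: card_insert_if)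
    finally show False using assms(3) by simp
  qed
  obtain e1 where e1: "e1 \<in> F" using assms(3) by fastforce
  obtain e2 where e2: "e2 \<in> F" "e2 \<noteq> e1" using big[of e1 e1 e1] by blast
  obtain a where a: "a \<in> e1" "a \<in> e2" using meet[OF e1 e2(1)] by blast
  obtain b where b: "e1 = {a, b}" "a \<noteq> b" using two[OF e1] a(1) unfolding card_2_iff by auto
  obtain c where c: "e2 = {a, c}" "a \<noteq> c" using two[OF e2(1)] a(2) unfolding card_2_iff by auto
  have bc: "b \<noteq> c" using b c e2(2) by blast
  show ?thesis
  proof (rule ccontr)
    assume "\<not> ?thesis"
    then obtain e3 where e3: "e3 \<in> F" "a \<notin> e3" by blast
    have "b \<in> e3" "c \<in> e3" using meet[OF e1 e3(1)] meet[OF e2(1) e3(1)] b c e3(2) by auto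
    then have e3': "e3 = {b, c}" using two[OF e3(1)] bc unfolding card_2_iff by auto
    have "e4 \<in> {e1, e2, e3}" if e4: "e4 \<in> F" for e4
    proof -
      have "finite e4" using two[OF e4] by (auto intro: card_ge_0_finite)
      then have eq: "e = e4" if "e \<subseteq> e4" "e \<in> F" for e
        using card_subset_eq[of e4 e] two[OF e4] two[OF that(2)] that(1) by simp
      have "a \<in> e4 \<or> b \<in> e4" "a \<in> e4 \<or> c \<in> e4" "b \<in> e4 \<or> c \<in> e4"
        using meet[OF e4 e1] meet[OF e4 e2(1)] meet[OF e4 e3(1)] b(1) c(1) e3' by blast+
      then have "e1 \<subseteq> e4 \<or> e2 \<subseteq> e4 \<or> e3 \<subseteq> e4" using b(1) c(1) e3' by blast
      then show ?thesis using eq e1 e2(1) e3(1) by blast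
    qed
    then have "F \<subseteq> {e1, e2, e3}" by (rule subsetI)
    then show False using big[of e1 e2 e3] by (rule notE[rotated])
  qed
qed

context tower
begin

text \<open>A height that is present at stage \<open>K\<close> occurs later only on copies, so the edge can be projected down stage by
  stage without changing its nodes below level \<open>N K\<close>.\<close>

lemma pull_back:
  assumes "a \<in> w (K + d)" "b \<in> w (K + d)" "a \<noteq> b" "i < \<iota>" "H i {a, b} \<in> Hval K"
  shows "\<exists>a'\<in>w K. \<exists>b'\<in>w K. a' \<noteq> b' \<and> H i {a', b'} = H i {a, b} \<and> gnode (N K) i a' b' = gnode (N K) i a b"
  using assms
proof (induction d arbitrary: a b)
  case (Suc d)
  define n where "n = K + d"
  obtain C1 C2 p where copies: "\<And>C. C \<in> chunks n C1 C2 \<Longrightarrow> copies n C p"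
    and new: "\<And>e i. e \<in> edges (w (Suc n)) \<Longrightarrow> (\<And>C. C \<in> chunks n C1 C2 \<Longrightarrow> \<not> e \<subseteq> C) \<Longrightarrow> i < \<iota> \<Longrightarrow> H i e \<notin> Hval n"
    by (rule stageE[of n]) blast
  have ed: "{a, b} \<in> edges (w (Suc n))" using Suc.prems unfolding n_def by (intro edgesI) auto
  have "H i {a, b} \<in> Hval n" using Suc.prems(5) Hval_mono[of K n] unfolding n_def by auto
  then obtain C where C: "C \<in> chunks n C1 C2" "{a, b} \<subseteq> C"
    using new[OF ed _ Suc.prems(4)] by blast
  note cp = copies[OF C(1)]
  have abC: "a \<in> C" "b \<in> C" using C(2) by auto
  have ne: "p a \<noteq> p b" using copies_inj[OF cp C(2)] Suc.prems(3) by (auto simp: inj_on_def)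
  have pw: "p a \<in> w (K + d)" "p b \<in> w (K + d)" using copies_image[OF cp C(2)] unfolding n_def by auto
  have edC: "{a, b} \<in> edges C" using abC Suc.prems(3) by (rule edgesI)
  have HG: "H i {p a, p b} = H i {a, b}" "t < N n \<Longrightarrow> Gam i {a, b} t = Gam i {p a, p b} t" for t
    using cp Suc.prems(4) edC unfolding copies_def by fastforce+
  have le: "N K \<le> N n" unfolding n_def by (rule N_mono) simp
  have "gnode (N K) i (p a) (p b) = gnode (N K) i a b"
    unfolding gnode_def using HG(2) cp abC le unfolding copies_def by auto
  then show ?case
    using Suc.IH[OF pw ne Suc.prems(4)] HG(1) Suc.prems(5) by simp
qed auto

text \<open>A node of level \<open>N K\<close> in normal form, with the generator \<open>(j, e)\<close> and the endpoint \<open>b\<close> it comes from.\<close>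

definition code :: "nat \<Rightarrow> bit list \<Rightarrow> nat \<Rightarrow> nat set \<Rightarrow> nat \<Rightarrow> bool" where
  "code K g j e b \<longleftrightarrow> j < \<iota> \<and> e \<in> edges (w K) \<and> b \<in> e \<and> g = map (\<lambda>t. E b t + Gam j e t) [0..<N K]"

text \<open>Above its threshold, a tree has no nodes at a brick level beyond those of the brick.\<close>

lemma T_level:
  assumes "g \<in> T h" "length g = N K" "c h \<le> N K"
  shows "\<exists>j e b. code K g j e b \<and> H j e = h"
proof -
  obtain l i a b where g: "g = gnode l i a b" "i < \<iota>" "a \<noteq> b" "H i {a, b} = h"
    using assms(1) unfolding T_def by blast
  have l: "l = N K" using assms(2) g(1) by simp
  obtain K' where "{a, b} \<subseteq> w K'" using finite_subset_w[of "{a, b}"] by auto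
  then have ab: "a \<in> w (K + K')" "b \<in> w (K + K')" using w_mono[of K' "K + K'"] by auto
  have "h \<in> Hval (K + K')"
    unfolding g(4)[symmetric] Hval_def using g(2) edgesI[OF ab g(3)] by blast
  then have "H i {a, b} \<in> Hval K" using c_le_iff assms(3) g(4) by blast
  then obtain a' b' where *: "a' \<in> w K" "b' \<in> w K" "a' \<noteq> b'" "H i {a', b'} = H i {a, b}"
      "gnode (N K) i a' b' = gnode (N K) i a b"
    using pull_back[OF ab g(3,2)] by blast
  have "code K g i {a', b'} b'"
    unfolding code_def using g(2) edgesI[OF *(1-3)] *(5) g(1) l unfolding gnode_def by simp
  then show ?thesis using * g(4) by metis
qed

lemma Lab_code: "code K g j e b \<Longrightarrow> (g, H j e) \<in> Lab (N K) e"
  unfolding code_def Lab_def by blast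

definition sE :: "nat set \<Rightarrow> nat \<Rightarrow> bit" where
  "sE e t = (\<Sum>x\<in>e. E x t)"

lemma sE_pair: "a \<noteq> b \<Longrightarrow> sE {a, b} t = E a t + E b t"
  by (simp add: sE_def)

lemma sE_at:
  assumes "e \<in> edges (w K)" "\<forall>x\<in>w K. E x t = (if x = a then 1 else 0)"
  shows "sE e t = (if a \<in> e then 1 else 0)"
  using assms by (elim edgesE) (auto simp: sE_pair)

lemma sE_zero: "e \<in> edges (w K) \<Longrightarrow> \<forall>x\<in>w K. E x t = 0 \<Longrightarrow> sE e t = 0"
  by (elim edgesE) (auto simp: sE_pair)

lemma sE_inject:
  assumes "e \<in> edges (w K)" "e' \<in> edges (w K)" "\<And>t. t < N K \<Longrightarrow> sE e t = sE e' t"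
  shows "e = e'"
proof -
  have "x \<in> e \<longleftrightarrow> x \<in> e'" if x: "x \<in> w K" for x
  proof -
    obtain t where t: "t < N K" "\<forall>z\<in>w K. E z t = (if z = x then 1 else 0)"
      using E_indep[OF x] by blast
    show ?thesis
      using assms(3)[OF t(1)] sE_at[OF assms(1) t(2)] sE_at[OF assms(2) t(2)] by (auto split: if_splits)
  qed
  moreover have "e \<subseteq> w K" "e' \<subseteq> w K" using assms(1,2) by (auto simp: edges_def)
  ultimately show ?thesis by blast
qed

lemma edge_three: "e \<in> edges A \<Longrightarrow> x \<in> e \<Longrightarrow> y \<in> e \<Longrightarrow> z \<in> e \<Longrightarrow> x = y \<or> y = z \<or> x = z"
  by (elim edgesE) auto

lemma edge_eq: "e \<in> edges A \<Longrightarrow> x \<in> e \<Longrightarrow> y \<in> e \<Longrightarrow> x \<noteq> y \<Longrightarrow> e = {x, y}"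
  by (elim edgesE) auto

text \<open>Linear algebra of one pair.  Two different sums \<open>x 0 + y 0 = x 1 + y 1\<close> of nodes are
  possible only inside one edge.  Either every \<open>x i\<close> is matched with the
  node of the same index and the other endpoint, and the difference is the sum over the edge of the \<open>E\<close>'s; or \<open>\<iota> = 2\<close> and
  the nodes of indices 0 and 1 are matched with each other.\<close>

lemma normal_pair:
  assumes x: "\<And>i. i < \<iota> \<Longrightarrow> \<exists>j e b. code K (x i) j e b \<and> H j e = hx i"
    and y: "\<And>i. i < \<iota> \<Longrightarrow> \<exists>j e b. code K (y i) j e b \<and> H j e = hy i"
    and nonrep: "nonrep \<iota> x y"
    and d: "\<And>i t. i < \<iota> \<Longrightarrow> t < N K \<Longrightarrow> x i ! t + y i ! t = d t"
  shows "\<exists>e\<in>edges (w K).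
    (\<forall>t<N K. d t = sE e t) \<and> (\<Union>i<\<iota>. {(x i, hx i), (y i, hy i)}) = Lab (N K) e \<or>
    (\<forall>t<N K. d t = Gam 0 e t + Gam 1 e t) \<or> (\<forall>t<N K. d t = Gam 0 e t + Gam 1 e t + sE e t)"
proof -
  have "\<forall>i\<in>{..<\<iota>}. \<exists>q. code K (x i) (fst q) (fst (snd q)) (snd (snd q)) \<and> H (fst q) (fst (snd q)) = hx i"
    using x by simp
  then obtain Q where Q: "\<And>i. i < \<iota> \<Longrightarrow> code K (x i) (fst (Q i)) (fst (snd (Q i))) (snd (snd (Q i))) \<and> H (fst (Q i)) (fst (snd (Q i))) = hx i"
    by (metis lessThan_iff)
  have "\<forall>i\<in>{..<\<iota>}. \<exists>q. code K (y i) (fst q) (fst (snd q)) (snd (snd q)) \<and> H (fst q) (fst (snd q)) = hy i"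
    using y by simp
  then obtain R where R: "\<And>i. i < \<iota> \<Longrightarrow> code K (y i) (fst (R i)) (fst (snd (R i))) (snd (snd (R i))) \<and> H (fst (R i)) (fst (snd (R i))) = hy i"
    by (metis lessThan_iff)
  define L D P where "L i = fst (Q i)" and "D i = fst (snd (Q i))" and "P i = snd (snd (Q i))" for i
  define L' D' P' where "L' i = fst (R i)" and "D' i = fst (snd (R i))" and "P' i = snd (snd (R i))" for i
  have cx: "code K (x i) (L i) (D i) (P i)" "H (L i) (D i) = hx i"
    and cy: "code K (y i) (L' i) (D' i) (P' i)" "H (L' i) (D' i) = hy i" if "i < \<iota>" for i
    using Q R that unfolding L_def D_def P_def L'_def D'_def P'_def by auto
  have L: "L i < \<iota>" "D i \<in> edges (w K)" "P i \<in> D i" "x i = map (\<lambda>t. E (P i) t + Gam (L i) (D i) t) [0..<N K]"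
    and L': "L' i < \<iota>" "D' i \<in> edges (w K)" "P' i \<in> D' i" "y i = map (\<lambda>t. E (P' i) t + Gam (L' i) (D' i) t) [0..<N K]"
    if "i < \<iota>" for i
    using cx[OF that] cy[OF that] unfolding code_def by auto
  have dt: "d t = (E (P i) t + Gam (L i) (D i) t) + (E (P' i) t + Gam (L' i) (D' i) t)" if "i < \<iota>" "t < N K" for i t
    using d[OF that] L(4)[OF that(1)] L'(4)[OF that(1)] that(2) by simp
  have inw: "P i \<in> w K" "P' i \<in> w K" if "i < \<iota>" for i
    using L(2,3)[OF that] L'(2,3)[OF that] by (auto simp: edges_def)
  have xeq: "i = j" if "i < \<iota>" "j < \<iota>" "L i = L j" "D i = D j" "P i = P j" for i j
  proof -
    have "x i = x j" using L(4)[OF that(1)] L(4)[OF that(2)] that(3-) by simp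
    then show ?thesis using nonrep that(1,2) unfolding nonrep_def by blast
  qed
  have yeq: "i = j" if "i < \<iota>" "j < \<iota>" "L' i = L' j" "D' i = D' j" "P' i = P' j" for i j
  proof -
    have "y i = y j" using L'(4)[OF that(1)] L'(4)[OF that(2)] that(3-) by simp
    then show ?thesis using nonrep that(1,2) unfolding nonrep_def by blast
  qed
  have xyne: "\<not> (L i = L' j \<and> D i = D' j \<and> P i = P' j)" if "i < \<iota>" "j < \<iota>" for i j
  proof
    assume "L i = L' j \<and> D i = D' j \<and> P i = P' j"
    then have "x i = y j" using L(4)[OF that(1)] L'(4)[OF that(2)] by simp
    then show False using nonrep that unfolding nonrep_def by blast
  qed
  \<comment> \<open>The parity of the number of occurrences of a generator is the same on both sides.\<close>
  define ind where "ind i l e = ((if L i = l \<and> D i = e then 1 else 0) + (if L' i = l \<and> D' i = e then 1 else 0) :: bit)" for i l e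
  have parity: "ind i l e = ind j l e" if ij: "i < \<iota>" "j < \<iota>" "l < \<iota>" "e \<in> edges (w K)" for i j l e
  proof -
    obtain t where t: "t < N K" "\<forall>x\<in>w K. E x t = 0"
      "\<forall>j<\<iota>. \<forall>e'\<in>edges (w K). Gam j e' t = (if j = l \<and> e' = e then 1 else 0)"
      using Gam_indep[OF ij(3,4)] by blast
    have "d t = ind k l e" if "k < \<iota>" for k
      using dt[OF that t(1)] t(2,3) inw[OF that] L(1,2)[OF that] L'(1,2)[OF that] unfolding ind_def by simp
    then show ?thesis using ij(1,2) by metis
  qed
  have "0 < \<iota>" "1 < \<iota>" using \<iota> by auto
  show ?thesis
  proof (cases "L 0 = L' 0 \<and> D 0 = D' 0")
    case True
    have same: "L j = L' j \<and> D j = D' j" if "j < \<iota>" for j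
    proof -
      have "ind 0 (L j) (D j) = 0" unfolding ind_def using True by auto
      then have "ind j (L j) (D j) = 0" using parity[OF \<open>0 < \<iota>\<close> that L(1,2)[OF that]] by simp
      then show ?thesis unfolding ind_def by (auto split: if_splits)
    qed
    have Dj: "D j = {P j, P' j}" "P j \<noteq> P' j" if "j < \<iota>" for j
    proof -
      show "P j \<noteq> P' j" using xyne[OF that that] same[OF that] by blast
      then show "D j = {P j, P' j}" using edge_eq[OF L(2)[OF that] L(3)[OF that]] L'(3)[OF that] same[OF that] by metis
    qed
    have dD: "d t = sE (D j) t" if "j < \<iota>" "t < N K" for j t
      using dt[OF that] same[OF that(1)] Dj[OF that(1)] sE_pair[OF Dj(2)[OF that(1)]]
      by (simp add: add_ac)
    define e where "e = D 0"
    have e: "e \<in> edges (w K)" unfolding e_def by (rule L(2)[OF \<open>0 < \<iota>\<close>])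
    have De: "D j = e" if "j < \<iota>" for j
      unfolding e_def by (rule sE_inject[OF L(2)[OF that] L(2)[OF \<open>0 < \<iota>\<close>]]) (use dD that \<open>0 < \<iota>\<close> in metis)
    have "inj_on L {..<\<iota>}"
    proof (rule inj_onI, rule ccontr)
      fix i j assume ij: "i \<in> {..<\<iota>}" "j \<in> {..<\<iota>}" "L i = L j" "i \<noteq> j"
      then have i: "i < \<iota>" and j: "j < \<iota>" by auto
      have "P i \<noteq> P j" using xeq[OF i j ij(3)] De[OF i] De[OF j] ij(4) by auto
      moreover have "P j \<noteq> P' i" using xyne[OF j i] same[OF i] De[OF i] De[OF j] ij(3) by auto
      moreover have "P j \<in> D i" using L(3)[OF j] De[OF i] De[OF j] by simp
      ultimately show False using Dj[OF i] by auto
    qed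
    then have surj: "L ` {..<\<iota>} = {..<\<iota>}"
      using L(1) by (intro endo_inj_surj) auto
    have "(\<Union>i<\<iota>. {(x i, hx i), (y i, hy i)}) = Lab (N K) e"
    proof (intro equalityI subsetI)
      fix z assume "z \<in> (\<Union>i<\<iota>. {(x i, hx i), (y i, hy i)})"
      then obtain i where i: "i < \<iota>" "z = (x i, hx i) \<or> z = (y i, hy i)" by auto
      show "z \<in> Lab (N K) e"
        using Lab_code[OF cx(1)[OF i(1)]] Lab_code[OF cy(1)[OF i(1)]] cx(2)[OF i(1)] cy(2)[OF i(1)]
          i(2) same[OF i(1)] De[OF i(1)] by metis
    next
      fix z assume "z \<in> Lab (N K) e"
      then obtain l b where l: "l < \<iota>" "b \<in> e" "z = (map (\<lambda>t. E b t + Gam l e t) [0..<N K], H l e)"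
        unfolding Lab_def by blast
      obtain i where i: "i < \<iota>" "L i = l" using surj l(1) by (metis imageE lessThan_iff)
      have "b = P i \<or> b = P' i" using l(2) Dj(1)[OF i(1)] De[OF i(1)] by auto
      then have "z = (x i, hx i) \<or> z = (y i, hy i)"
        using L(4)[OF i(1)] L'(4)[OF i(1)] same[OF i(1)] De[OF i(1)] cx(2)[OF i(1)] cy(2)[OF i(1)] i(2) l(3) by metis
      then show "z \<in> (\<Union>i<\<iota>. {(x i, hx i), (y i, hy i)})" using i(1) by blast
    qed
    then show ?thesis
      using e dD[OF \<open>0 < \<iota>\<close>] unfolding e_def by blast
  next
    case False
    have one0: "ind 0 (L 0) (D 0) = 1" "ind 0 (L' 0) (D' 0) = 1" unfolding ind_def using False by auto
    have split: "(L j = L 0 \<and> D j = D 0) \<noteq> (L' j = L 0 \<and> D' j = D 0)"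
      "(L j = L' 0 \<and> D j = D' 0) \<noteq> (L' j = L' 0 \<and> D' j = D' 0)" if "j < \<iota>" for j
      using parity[OF that \<open>0 < \<iota>\<close> L(1,2)[OF \<open>0 < \<iota>\<close>]] parity[OF that \<open>0 < \<iota>\<close> L'(1,2)[OF \<open>0 < \<iota>\<close>]] one0
      unfolding ind_def by (auto split: if_splits)
    have tips_differ: "(if L i = l \<and> D i = e then P i else P' i) \<noteq> (if L j = l \<and> D j = e then P j else P' j)"
      if ij: "i < \<iota>" "j < \<iota>" "i \<noteq> j"
        and i: "(L i = l \<and> D i = e) \<noteq> (L' i = l \<and> D' i = e)"
        and j: "(L j = l \<and> D j = e) \<noteq> (L' j = l \<and> D' j = e)" for i j l e
    proof (cases "L i = l \<and> D i = e")
      case Ti: True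
      show ?thesis
      proof (cases "L j = l \<and> D j = e")
        case True
        then show ?thesis using xeq[OF ij(1,2)] Ti ij(3) by auto
      next
        case False
        then have "L' j = l \<and> D' j = e" using j by blast
        then show ?thesis using xyne[OF ij(1,2)] Ti False by auto
      qed
    next
      case Fi: False
      then have Ti: "L' i = l \<and> D' i = e" using i by blast
      show ?thesis
      proof (cases "L j = l \<and> D j = e")
        case True
        then have "P' i \<noteq> P j" using xyne[OF ij(2,1)] Ti by auto
        then show ?thesis using Fi True by auto
      next
        case False
        then have "L' j = l \<and> D' j = e" using j by blast
        then have "P' i \<noteq> P' j" using yeq[OF ij(1,2)] Ti ij(3) by auto
        then show ?thesis using Fi False by auto
      qed
    qed
    \<comment> \<open>The tip over the generator of \<open>x 0\<close>; three indices would need three tips in one edge.\<close>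
    define tip where "tip j = (if L j = L 0 \<and> D j = D 0 then P j else P' j)" for j
    have tip_in: "tip j \<in> D 0" if "j < \<iota>" for j
      using split(1)[OF that] L(3)[OF that] L'(3)[OF that] unfolding tip_def by auto
    have tip_ne: "tip i \<noteq> tip j" if "i < \<iota>" "j < \<iota>" "i \<noteq> j" for i j
      unfolding tip_def by (rule tips_differ[OF that split(1)[OF that(1)] split(1)[OF that(2)]])
    have \<iota>2: "\<iota> = 2"
    proof (rule ccontr)
      assume "\<iota> \<noteq> 2"
      then have "2 < \<iota>" using \<iota> by simp
      then show False
        using edge_three[OF L(2)[OF \<open>0 < \<iota>\<close>] tip_in[OF \<open>0 < \<iota>\<close>] tip_in[OF \<open>1 < \<iota>\<close>] tip_in[OF \<open>2 < \<iota>\<close>]]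
          tip_ne[OF \<open>0 < \<iota>\<close> \<open>1 < \<iota>\<close>] tip_ne[OF \<open>1 < \<iota>\<close> \<open>2 < \<iota>\<close>] tip_ne[OF \<open>0 < \<iota>\<close> \<open>2 < \<iota>\<close>] by auto
    qed
    define tip' where "tip' j = (if L j = L' 0 \<and> D j = D' 0 then P j else P' j)" for j
    have tip'_in: "tip' j \<in> D' 0" if "j < \<iota>" for j
      using split(2)[OF that] L(3)[OF that] L'(3)[OF that] unfolding tip'_def by auto
    have tip'_ne: "tip' i \<noteq> tip' j" if "i < \<iota>" "j < \<iota>" "i \<noteq> j" for i j
      unfolding tip'_def by (rule tips_differ[OF that split(2)[OF that(1)] split(2)[OF that(2)]])
    have D0: "D 0 = {tip 0, tip 1}" "D' 0 = {tip' 0, tip' 1}"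
      using edge_eq[OF L(2)[OF \<open>0 < \<iota>\<close>] tip_in[OF \<open>0 < \<iota>\<close>] tip_in[OF \<open>1 < \<iota>\<close>]]
        edge_eq[OF L'(2)[OF \<open>0 < \<iota>\<close>] tip'_in[OF \<open>0 < \<iota>\<close>] tip'_in[OF \<open>1 < \<iota>\<close>]]
        tip_ne[OF \<open>0 < \<iota>\<close> \<open>1 < \<iota>\<close>] tip'_ne[OF \<open>0 < \<iota>\<close> \<open>1 < \<iota>\<close>] by auto
    have dtip: "d t = (E (tip j) t + Gam (L 0) (D 0) t) + (E (tip' j) t + Gam (L' 0) (D' 0) t)"
      if j: "j < \<iota>" "t < N K" for j t
    proof (cases "L j = L 0 \<and> D j = D 0")
      case True
      then have "L' j = L' 0 \<and> D' j = D' 0" using split[OF j(1)] False by auto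
      then show ?thesis
        using dt[OF j] True split(2)[OF j(1)] unfolding tip_def tip'_def by auto
    next
      case F: False
      then have 1: "L' j = L 0 \<and> D' j = D 0" using split(1)[OF j(1)] by blast
      then have 2: "L j = L' 0 \<and> D j = D' 0" using split(2)[OF j(1)] False by auto
      show ?thesis
        using dt[OF j] F 1 2 unfolding tip_def tip'_def by (auto simp: add_ac)
    qed
    have "D 0 = D' 0"
    proof (rule sE_inject[OF L(2)[OF \<open>0 < \<iota>\<close>] L'(2)[OF \<open>0 < \<iota>\<close>]])
      fix t assume t: "t < N K"
      have "E (tip 0) t + E (tip' 0) t = E (tip 1) t + E (tip' 1) t"
      proof -
        have "(E (tip 0) t + E (tip' 0) t) + (Gam (L 0) (D 0) t + Gam (L' 0) (D' 0) t) =
            (E (tip 1) t + E (tip' 1) t) + (Gam (L 0) (D 0) t + Gam (L' 0) (D' 0) t)"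
          using dtip[OF \<open>0 < \<iota>\<close> t] dtip[OF \<open>1 < \<iota>\<close> t] by (simp only: ac_simps)
        then show ?thesis by (simp only: add_right_cancel)
      qed
      then have "E (tip' 0) t + E (tip' 1) t = E (tip 0) t + E (tip 1) t" by (rule bit_swap)
      then show "sE (D 0) t = sE (D' 0) t"
        unfolding D0 using sE_pair[OF tip_ne[OF \<open>0 < \<iota>\<close> \<open>1 < \<iota>\<close>]] sE_pair[OF tip'_ne[OF \<open>0 < \<iota>\<close> \<open>1 < \<iota>\<close>]] by simp
    qed
    define e where "e = D 0"
    have e: "e \<in> edges (w K)" "D 0 = e" "D' 0 = e" using L(2)[OF \<open>0 < \<iota>\<close>] \<open>D 0 = D' 0\<close> unfolding e_def by auto
    have LL: "L 0 = 0 \<and> L' 0 = 1 \<or> L 0 = 1 \<and> L' 0 = 0"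
      using L(1)[OF \<open>0 < \<iota>\<close>] L'(1)[OF \<open>0 < \<iota>\<close>] False e(2,3) \<iota>2 by auto
    have d0: "d t = Gam 0 e t + Gam 1 e t + (E (P 0) t + E (P' 0) t)" if "t < N K" for t
      using dt[OF \<open>0 < \<iota>\<close> that] LL e(2,3) by (auto simp: add_ac)
    show ?thesis
    proof (cases "P 0 = P' 0")
      case True
      then show ?thesis using e(1) d0 by auto
    next
      case False
      have "e = {P 0, P' 0}"
        using edge_eq[OF e(1) _ _ False] L(3)[OF \<open>0 < \<iota>\<close>] L'(3)[OF \<open>0 < \<iota>\<close>] e(2,3) by blast
      then have "sE e t = E (P 0) t + E (P' 0) t" for t using sE_pair[OF False] by simp
      then have "\<forall>t<N K. d t = Gam 0 e t + Gam 1 e t + sE e t" using d0 by simp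
      then show ?thesis using e(1) by blast
    qed
  qed
qed

text \<open>The translate of \<open>m(N K, v)\<close> by \<open>\<rho>\<close>, with labels in place of the indexed functions.\<close>

definition placed :: "nat \<Rightarrow> nat set \<Rightarrow> bit list \<Rightarrow> mtuple \<Rightarrow> bool" where
  "placed K v \<rho> m \<longleftrightarrow> v \<subseteq> w K \<and> length \<rho> = N K \<and> ml m = N K \<and>
     mu m = (\<lambda>a. seq_add (node (N K) a) \<rho>) ` v \<and>
     (\<forall>a\<in>v. \<forall>b\<in>v. a \<noteq> b \<longrightarrow>
        labels \<iota> m (seq_add (node (N K) a) \<rho>) (seq_add (node (N K) b) \<rho>) = Lab (N K) {a, b})"

text \<open>A tuple with five elements at a brick level above all its thresholds is a translate of a part of the brick.
  Five elements are needed twice.  For \<open>\<iota> = 2\<close>, four elements could form a coset of the group of order four that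
  consists of 0 and the differences available in one edge.  And three edges that meet pairwise, being
  the differences to a fixed element, could form a triangle; four must share an endpoint, and this endpoint
  provides the translation.\<close>

lemma normal_form:
  assumes m: "m \<in> M_family \<iota> T" and five: "5 \<le> card (mu m)" and ml: "ml m = N K"
    and cl: "\<And>i \<eta> \<nu>. i < \<iota> \<Longrightarrow> \<eta> \<in> mu m \<Longrightarrow> \<nu> \<in> mu m \<Longrightarrow> \<eta> \<noteq> \<nu> \<Longrightarrow> c (mh m i (\<eta>, \<nu>)) \<le> N K"
  shows "\<exists>v \<rho>. placed K v \<rho> m"
proof -
  note D = M_familyD[OF m]
  have len: "length \<eta> = N K" if "\<eta> \<in> mu m" for \<eta> using D(2)[OF that] ml by simp
  have codes: "\<exists>j e b. code K (mg m i (\<eta>, \<nu>)) j e b \<and> H j e = mh m i (\<eta>, \<nu>)"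
    if "i < \<iota>" "\<eta> \<in> mu m" "\<nu> \<in> mu m" "\<eta> \<noteq> \<nu>" for i \<eta> \<nu>
    using T_level[OF D(8)[OF that] _ cl[OF that]] D(9)[OF that] ml by simp
  have eqI: "\<sigma> = seq_add \<eta> (map f [0..<N K])" if "\<eta> \<in> mu m" "\<sigma> \<in> mu m" "\<And>t. t < N K \<Longrightarrow> \<eta> ! t + \<sigma> ! t = f t" for \<eta> \<sigma> f
  proof (rule nth_equalityI)
    show "length \<sigma> = length (seq_add \<eta> (map f [0..<N K]))" using len that by simp
    fix t assume "t < length \<sigma>"
    then have t: "t < N K" using len that by simp
    show "\<sigma> ! t = seq_add \<eta> (map f [0..<N K]) ! t"
      using that(3)[OF t, symmetric] t len[OF that(1)] by simp
  qed
  define good where "good \<eta> \<nu> e \<longleftrightarrow> e \<in> edges (w K) \<and> (\<forall>t<N K. \<eta> ! t + \<nu> ! t = sE e t) \<and> labels \<iota> m \<eta> \<nu> = Lab (N K) e" for \<eta> \<nu> e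
  define bad where "bad \<eta> \<nu> e \<longleftrightarrow> e \<in> edges (w K) \<and> ((\<forall>t<N K. \<eta> ! t + \<nu> ! t = Gam 0 e t + Gam 1 e t) \<or>
      (\<forall>t<N K. \<eta> ! t + \<nu> ! t = Gam 0 e t + Gam 1 e t + sE e t))" for \<eta> \<nu> e
  have dichotomy: "\<exists>e. good \<eta> \<nu> e \<or> bad \<eta> \<nu> e" if en: "\<eta> \<in> mu m" "\<nu> \<in> mu m" "\<eta> \<noteq> \<nu>" for \<eta> \<nu>
  proof -
    have sum: "mg m i (\<eta>, \<nu>) ! t + mg m i (\<nu>, \<eta>) ! t = \<eta> ! t + \<nu> ! t" if i: "i < \<iota>" and t: "t < N K" for i t
    proof (rule bit_swap)
      have "seq_add \<eta> (mg m i (\<eta>, \<nu>)) ! t = seq_add \<nu> (mg m i (\<nu>, \<eta>)) ! t"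
        using D(10)[OF i \<open>\<eta> \<in> mu m\<close> \<open>\<nu> \<in> mu m\<close> \<open>\<eta> \<noteq> \<nu>\<close>] by simp
      then show "\<eta> ! t + mg m i (\<eta>, \<nu>) ! t = \<nu> ! t + mg m i (\<nu>, \<eta>) ! t"
        using t len \<open>\<eta> \<in> mu m\<close> \<open>\<nu> \<in> mu m\<close> D(9)[OF i] \<open>\<eta> \<noteq> \<nu>\<close> ml by simp
    qed
    have nr: "nonrep \<iota> (\<lambda>i. mg m i (\<eta>, \<nu>)) (\<lambda>i. mg m i (\<nu>, \<eta>))" by (rule D(11)[OF en])
    obtain e where "e \<in> edges (w K)"
      "(\<forall>t<N K. \<eta> ! t + \<nu> ! t = sE e t) \<and> (\<Union>i<\<iota>. {(mg m i (\<eta>, \<nu>), mh m i (\<eta>, \<nu>)), (mg m i (\<nu>, \<eta>), mh m i (\<nu>, \<eta>))}) = Lab (N K) e \<or>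
       (\<forall>t<N K. \<eta> ! t + \<nu> ! t = Gam 0 e t + Gam 1 e t) \<or> (\<forall>t<N K. \<eta> ! t + \<nu> ! t = Gam 0 e t + Gam 1 e t + sE e t)"
      using normal_pair[OF codes[OF _ en] codes[OF _ en(2,1) en(3)[symmetric]] nr sum] by blast
    then show ?thesis unfolding good_def bad_def labels_def by blast
  qed
  have no_bad: "\<not> bad \<eta> \<nu> e" if "\<eta> \<in> mu m" "\<nu> \<in> mu m" "\<eta> \<noteq> \<nu>" for \<eta> \<nu> e
  proof
    assume bad: "bad \<eta> \<nu> e"
    then have e: "e \<in> edges (w K)" unfolding bad_def by blast
    define A1 A2 A3 where "A1 = seq_add \<eta> (map (\<lambda>t. Gam 0 e t + Gam 1 e t) [0..<N K])"
      and "A2 = seq_add \<eta> (map (\<lambda>t. Gam 0 e t + Gam 1 e t + sE e t) [0..<N K])"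
      and "A3 = seq_add \<eta> (map (sE e) [0..<N K])"
    have badA: "\<sigma> \<in> {A1, A2}" if b: "\<sigma> \<in> mu m" "bad \<eta> \<sigma> e" for \<sigma>
      using b(2) eqI[OF \<open>\<eta> \<in> mu m\<close> b(1), of "\<lambda>t. Gam 0 e t + Gam 1 e t"]
        eqI[OF \<open>\<eta> \<in> mu m\<close> b(1), of "\<lambda>t. Gam 0 e t + Gam 1 e t + sE e t"]
      unfolding bad_def A1_def A2_def by blast
    have "\<sigma> \<in> {\<eta>, A1, A2, A3}" if \<sigma>: "\<sigma> \<in> mu m" for \<sigma>
    proof (cases "\<sigma> = \<eta> \<or> \<sigma> = \<nu>")
      case True
      then show ?thesis
        using badA[OF \<open>\<nu> \<in> mu m\<close> bad] by blast
    next
      case False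
      have "0 < \<iota>" "1 < \<iota>" using \<iota> by auto
      obtain t where t: "t < N K" "\<forall>x\<in>w K. E x t = 0"
        "\<forall>j<\<iota>. \<forall>e'\<in>edges (w K). Gam j e' t = (if j = 0 \<and> e' = e then 1 else 0)"
        using Gam_indep[OF \<open>0 < \<iota>\<close> e] by blast
      have bt: "x ! t + y ! t = (if e' = e then 1 else 0)" if "bad x y e'" for x y e'
      proof -
        have e': "e' \<in> edges (w K)" using that unfolding bad_def by blast
        have g: "Gam 0 e' t = (if e' = e then 1 else 0)" "Gam 1 e' t = 0"
          using t(3) \<open>0 < \<iota>\<close> \<open>1 < \<iota>\<close> e' by auto
        have "x ! t + y ! t = Gam 0 e' t + Gam 1 e' t \<or> x ! t + y ! t = Gam 0 e' t + Gam 1 e' t + sE e' t"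
          using that t(1) unfolding bad_def by blast
        then show ?thesis unfolding g sE_zero[OF e' t(2)] by (simp only: add_0_right simp_thms)
      qed
      have gt: "x ! t + y ! t = 0" if "good x y e'" for x y e'
        using that t(1) sE_zero[OF _ t(2), of e'] unfolding good_def by auto
      obtain e1 where e1: "good \<eta> \<sigma> e1 \<or> bad \<eta> \<sigma> e1" using dichotomy[OF \<open>\<eta> \<in> mu m\<close> \<sigma>] False by blast
      obtain e2 where e2: "good \<nu> \<sigma> e2 \<or> bad \<nu> \<sigma> e2" using dichotomy[OF \<open>\<nu> \<in> mu m\<close> \<sigma>] False by blast
      have "\<eta> ! t + \<nu> ! t = 1" using bt[OF bad] by simp
      then have "\<eta> ! t + \<sigma> ! t \<noteq> 0 \<or> \<nu> ! t + \<sigma> ! t \<noteq> 0" by (cases "\<eta> ! t"; cases "\<nu> ! t"; cases "\<sigma> ! t") auto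
      then have "bad \<eta> \<sigma> e \<or> bad \<nu> \<sigma> e"
        using e1 e2 gt bt by metis
      then show ?thesis
      proof
        assume "bad \<eta> \<sigma> e"
        then show ?thesis
          using badA[OF \<sigma>] by blast
      next
        assume b2: "bad \<nu> \<sigma> e"
        have tri: "\<eta> ! t + \<sigma> ! t = (\<eta> ! t + \<nu> ! t) + (\<nu> ! t + \<sigma> ! t)" for t
          by (cases "\<nu> ! t") (auto simp: add_ac)
        have canc: "(p + q) + (p + q + r) = r" "(p + q + r) + (p + q) = r" "(p + q + r) + (p + q + r) = 0" "(p + q) + (p + q) = 0" for p q r :: bit
          by (cases p; cases q; cases r; auto)+
        have "(\<forall>t<N K. \<eta> ! t + \<sigma> ! t = 0) \<or> (\<forall>t<N K. \<eta> ! t + \<sigma> ! t = sE e t)"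
          using bad b2 unfolding bad_def tri by (elim conjE disjE) (simp_all add: canc)
        then show ?thesis
        proof
          assume z: "\<forall>t<N K. \<eta> ! t + \<sigma> ! t = 0"
          have "\<sigma> = \<eta>"
          proof (rule nth_equalityI)
            fix t assume "t < length \<sigma>"
            then have "\<eta> ! t + \<sigma> ! t = 0" using z len[OF \<sigma>] by simp
            then show "\<sigma> ! t = \<eta> ! t" by (cases "\<sigma> ! t"; cases "\<eta> ! t") auto
          qed (use len \<sigma> \<open>\<eta> \<in> mu m\<close> in simp)
          then show ?thesis by blast
        next
          assume "\<forall>t<N K. \<eta> ! t + \<sigma> ! t = sE e t"
          then show ?thesis using eqI[OF \<open>\<eta> \<in> mu m\<close> \<sigma>, of "sE e"] unfolding A3_def by blast
        qed
      qed
    qed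
    then have "mu m \<subseteq> {\<eta>, A1, A2, A3}" by blast
    then have "card (mu m) \<le> card {\<eta>, A1, A2, A3}" by (rule card_mono[rotated]) simp
    also have "\<dots> \<le> 4" by (simp add: card_insert_if)
    finally show False using five by simp
  qed
  have all_good: "\<exists>e. good \<eta> \<nu> e" if "\<eta> \<in> mu m" "\<nu> \<in> mu m" "\<eta> \<noteq> \<nu>" for \<eta> \<nu>
    using dichotomy[OF that] no_bad[OF that] by blast
  obtain \<eta>0 where \<eta>0: "\<eta>0 \<in> mu m" using D(5) by blast
  define ed where "ed \<sigma> = (SOME e. good \<eta>0 \<sigma> e)" for \<sigma>
  define V where "V = mu m - {\<eta>0}"
  have ed: "good \<eta>0 \<sigma> (ed \<sigma>)" if "\<sigma> \<in> V" for \<sigma>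
    unfolding ed_def by (rule someI_ex) (use all_good \<eta>0 that in \<open>auto simp: V_def\<close>)
  have "inj_on ed V"
  proof (rule inj_onI)
    fix \<sigma> \<sigma>' assume *: "\<sigma> \<in> V" "\<sigma>' \<in> V" "ed \<sigma> = ed \<sigma>'"
    have "\<sigma> = seq_add \<eta>0 (map (sE (ed \<sigma>)) [0..<N K])" "\<sigma>' = seq_add \<eta>0 (map (sE (ed \<sigma>)) [0..<N K])"
      using eqI[OF \<eta>0, of \<sigma>] eqI[OF \<eta>0, of \<sigma>'] ed[OF *(1)] ed[OF *(2)] * unfolding good_def V_def by auto
    then show "\<sigma> = \<sigma>'" by simp
  qed
  moreover have "4 \<le> card V" unfolding V_def using five \<eta>0 by (simp add: card_Diff_singleton)
  ultimately have c4: "4 \<le> card (ed ` V)" by (simp add: card_image)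
  have edw: "ed \<sigma> \<in> edges (w K)" if "\<sigma> \<in> V" for \<sigma> using ed[OF that] unfolding good_def by blast
  have "\<exists>a. \<forall>e\<in>ed ` V. a \<in> e"
  proof (rule pairwise_meeting_edges[OF _ _ c4])
    fix e e' assume "e \<in> ed ` V" "e' \<in> ed ` V"
    then obtain \<sigma> \<sigma>' where \<sigma>: "\<sigma> \<in> V" "e = ed \<sigma>" and \<sigma>': "\<sigma>' \<in> V" "e' = ed \<sigma>'" by blast
    show "card e = 2" using edw[OF \<sigma>(1)] \<sigma>(2) unfolding edges_def by simp
    show "e \<inter> e' \<noteq> {}"
    proof (cases "\<sigma> = \<sigma>'")
      case True
      then show ?thesis using edw[OF \<sigma>(1)] \<sigma> \<sigma>' by (auto elim: edgesE)
    next
      case False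
      then obtain e'' where e'': "good \<sigma> \<sigma>' e''" using all_good \<sigma>(1) \<sigma>'(1) unfolding V_def by blast
      then have ee: "e'' \<in> edges (w K)" unfolding good_def by blast
      show ?thesis
      proof
        assume disj: "e \<inter> e' = {}"
        have "e \<union> e' \<subseteq> e''"
        proof
          fix x assume x: "x \<in> e \<union> e'"
          then have "x \<in> w K" using edw[OF \<sigma>(1)] edw[OF \<sigma>'(1)] \<sigma>(2) \<sigma>'(2) unfolding edges_def by blast
          then obtain t where t: "t < N K" "\<forall>z\<in>w K. E z t = (if z = x then 1 else 0)" using E_indep by blast
          have "sE e'' t = sE e t + sE e' t"
            using ed[OF \<sigma>(1)] ed[OF \<sigma>'(1)] e'' t(1) \<sigma>(2) \<sigma>'(2) unfolding good_def
            by (cases "\<eta>0 ! t"; cases "\<sigma> ! t"; cases "\<sigma>' ! t") force+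
          moreover have "sE e t + sE e' t = 1"
            using x disj sE_at[OF edw[OF \<sigma>(1)] t(2)] sE_at[OF edw[OF \<sigma>'(1)] t(2)] \<sigma>(2) \<sigma>'(2) by auto
          ultimately show "x \<in> e''" using sE_at[OF ee t(2)] by (auto split: if_splits)
        qed
        moreover have "card (e \<union> e') = 4" "finite e''" "card e'' = 2"
          using disj edw[OF \<sigma>(1)] edw[OF \<sigma>'(1)] \<sigma>(2) \<sigma>'(2) ee unfolding edges_def
          by (auto simp: card_Un_disjoint card_ge_0_finite)
        ultimately show False using card_mono[of e'' "e \<union> e'"] by simp
      qed
    qed
  qed
  then obtain a where a: "\<And>\<sigma>. \<sigma> \<in> V \<Longrightarrow> a \<in> ed \<sigma>" by blast
  define \<rho> where "\<rho> = seq_add \<eta>0 (node (N K) a)"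
  define v where "v = {x \<in> w K. seq_add (node (N K) x) \<rho> \<in> mu m}"
  have len\<rho>: "length \<rho> = N K" using len[OF \<eta>0] by (simp add: \<rho>_def)
  have "V \<noteq> {}" using c4 by auto
  then have aw: "a \<in> w K" using a edw unfolding edges_def by blast
  have ex: "\<exists>x\<in>w K. \<sigma> = seq_add (node (N K) x) \<rho>" if \<sigma>: "\<sigma> \<in> mu m" for \<sigma>
  proof (cases "\<sigma> = \<eta>0")
    case True
    have "\<eta>0 = seq_add (node (N K) a) \<rho>"
      by (rule nth_equalityI) (use len[OF \<eta>0] in \<open>auto simp: \<rho>_def add_ac\<close>)
    then show ?thesis using aw True by blast
  next
    case False
    then have sV: "\<sigma> \<in> V" using \<sigma> unfolding V_def by blast
    obtain p q where pq: "ed \<sigma> = {p, q}" "p \<in> w K" "q \<in> w K" "p \<noteq> q" using edw[OF sV] by (rule edgesE)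
    have "\<exists>b. ed \<sigma> = {a, b} \<and> a \<noteq> b \<and> b \<in> w K"
    proof (cases "a = p")
      case True
      then show ?thesis using pq by blast
    next
      case False
      then have "a = q" using a[OF sV] pq(1) by simp
      then show ?thesis using pq by (intro exI[of _ p]) auto
    qed
    then obtain b where b: "ed \<sigma> = {a, b}" "a \<noteq> b" "b \<in> w K" by blast
    have "\<sigma> = seq_add (node (N K) b) \<rho>"
    proof (rule nth_equalityI)
      show "length \<sigma> = length (seq_add (node (N K) b) \<rho>)" using len[OF \<sigma>] len\<rho> by simp
      fix t assume "t < length \<sigma>"
      then have t: "t < N K" using len[OF \<sigma>] by simp
      have "\<eta>0 ! t + \<sigma> ! t = E a t + E b t"
        using ed[OF sV] t b sE_pair[OF b(2)] unfolding good_def by simp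
      then have "\<sigma> ! t = E b t + (\<eta>0 ! t + E a t)"
        by (cases "\<eta>0 ! t"; cases "\<sigma> ! t"; cases "E a t"; cases "E b t") auto
      then show "\<sigma> ! t = seq_add (node (N K) b) \<rho> ! t"
        using t len[OF \<eta>0] by (simp add: \<rho>_def node_def)
    qed
    then show ?thesis using b(3) by blast
  qed
  have mu: "mu m = (\<lambda>a. seq_add (node (N K) a) \<rho>) ` v"
    using ex unfolding v_def by blast
  have "labels \<iota> m (seq_add (node (N K) x) \<rho>) (seq_add (node (N K) y) \<rho>) = Lab (N K) {x, y}"
    if xy: "x \<in> v" "y \<in> v" "x \<noteq> y" for x y
  proof -
    have xyw: "x \<in> w K" "y \<in> w K" using xy unfolding v_def by auto
    have "node (N K) x \<noteq> node (N K) y" using inj_node xyw xy(3) unfolding inj_on_def by blast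
    then have ne: "seq_add (node (N K) x) \<rho> \<noteq> seq_add (node (N K) y) \<rho>"
      using len\<rho> by (simp add: seq_add_right_inject[where l = "N K"])
    obtain e where e: "good (seq_add (node (N K) x) \<rho>) (seq_add (node (N K) y) \<rho>) e"
      using all_good[OF _ _ ne] xy unfolding v_def by blast
    have "e = {x, y}"
    proof (rule sE_inject)
      show "e \<in> edges (w K)" using e unfolding good_def by blast
      show "{x, y} \<in> edges (w K)" using xyw xy(3) by (rule edgesI)
      fix t assume t: "t < N K"
      have "sE e t = seq_add (node (N K) x) \<rho> ! t + seq_add (node (N K) y) \<rho> ! t"
        using e t unfolding good_def by simp
      also have "\<dots> = E x t + E y t"
        using t len\<rho> by (simp add: node_def add_ac)
      finally show "sE e t = sE {x, y} t" using sE_pair[OF xy(3)] by simp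
    qed
    then show ?thesis using e unfolding good_def by simp
  qed
  then have "placed K v \<rho> m"
    unfolding placed_def
    by (intro conjI ballI impI mu len\<rho> ml) (auto simp: v_def)
  then show ?thesis by blast
qed

end

section \<open>The upper bound for the rank\<close>

lemma sorted_list_of_set_nth_card:
  assumes "finite (A :: 'x::linorder set)" "i < card A"
  shows "sorted_list_of_set A ! i \<in> A" "card (A \<inter> {..<sorted_list_of_set A ! i}) = i"
proof -
  define xs where "xs = sorted_list_of_set A"
  have xs: "set xs = A" "distinct xs" "sorted_wrt (<) xs" "length xs = card A"
    unfolding xs_def using assms(1) by auto
  show "sorted_list_of_set A ! i \<in> A"
    using xs assms(2) nth_mem[of i xs] unfolding xs_def[symmetric] by simp
  have lt: "xs ! j < xs ! i \<longleftrightarrow> j < i" if "j < length xs" for j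
    using xs(3,4) assms(2) that sorted_wrt_nth_less[OF xs(3)] by (metis linorder_neqE_nat not_less_iff_gr_or_eq)
  have "A \<inter> {..<xs ! i} = (\<lambda>j. xs ! j) ` {..<i}"
  proof (intro equalityI subsetI)
    fix x assume "x \<in> A \<inter> {..<xs ! i}"
    then obtain j where "j < length xs" "x = xs ! j" "x < xs ! i"
      using xs(1) by (auto simp: in_set_conv_nth)
    then show "x \<in> (\<lambda>j. xs ! j) ` {..<i}" using lt by auto
  next
    fix x assume "x \<in> (\<lambda>j. xs ! j) ` {..<i}"
    then obtain j where j: "j < i" "x = xs ! j" by auto
    then have "j < length xs" using assms(2) xs(4) by simp
    then show "x \<in> A \<inter> {..<xs ! i}" using j lt xs(1) nth_mem by auto
  qed
  moreover have "inj_on (\<lambda>j. xs ! j) {..<i}"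
    using xs(2,4) assms(2) by (auto simp: inj_on_def nth_eq_iff_index_eq)
  ultimately show "card (A \<inter> {..<sorted_list_of_set A ! i}) = i"
    unfolding xs_def[symmetric] by (simp add: card_image)
qed

lemma sorted_list_of_set_nth_eq:
  assumes "finite (A :: 'x::linorder set)" "a \<in> A"
  shows "sorted_list_of_set A ! card (A \<inter> {..<a}) = a"
proof -
  obtain i where i: "i < card A" "a = sorted_list_of_set A ! i"
    using assms by (metis in_set_conv_nth length_sorted_list_of_set set_sorted_list_of_set)
  then show ?thesis using sorted_list_of_set_nth_card(2)[OF assms(1) i(1)] by simp
qed

lemma osuc_mono:
  fixes a b :: "'o::ordinals"
  assumes "a \<le> b" "countable {..<b}"
  shows "osuc a \<le> osuc b"
  using assms less_osuc[OF assms(2)] by (intro osuc_le) (rule le_less_trans)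

lemma countable_initial: "a \<le> (b::'o::wellorder) \<Longrightarrow> countable {..<b} \<Longrightarrow> countable {..<a}"
  by (erule countable_subset[rotated]) auto

context tower
begin

lemma yr_mono:
  assumes "u \<noteq> {}" "u \<subseteq> v" "finite v"
  shows "yr S v \<le> yr S u"
proof -
  have "v \<in> fin_subsets (yX S)" using assms unfolding fin_subsets_def S_UNIV by blast
  moreover have "\<forall>w\<in>fin_subsets (yX S). \<forall>u. u \<noteq> {} \<and> u \<subseteq> w \<longrightarrow> yr S w \<le> yr S u"
    using S_system unfolding yzr_system_def by blast
  ultimately show ?thesis using assms by blast
qed

lemma yr_le: "finite v \<Longrightarrow> v \<noteq> {} \<Longrightarrow> yr S v \<le> \<epsilon>"
  using S_system unfolding yzr_system_def fin_subsets_def S_UNIV by simp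

lemma yk_less: "finite v \<Longrightarrow> v \<noteq> {} \<Longrightarrow> yk S v < card v"
  using S_system unfolding yzr_system_def fin_subsets_def S_UNIV by simp

text \<open>The last axiom of a system, with the critical point described by the number of points below it.\<close>

lemma no_twin:
  assumes "finite v" "x \<in> v" "card (v \<inter> {..<x}) = yk S v" "y \<notin> v" "card (v \<inter> {..<y}) = yk S v"
    and "yj S (insert y (v - {x})) = yj S v"
  shows "yr S (insert y v) \<noteq> yr S v"
proof
  assume r: "yr S (insert y v) = yr S v"
  have "sorted_list_of_set v ! yk S v = x"
    using sorted_list_of_set_nth_eq[OF assms(1,2)] assms(3) by simp
  moreover have "v \<in> fin_subsets (yX S)" unfolding fin_subsets_def S_UNIV using assms by auto
  ultimately show False
    using S_system assms(4-6) r unfolding yzr_system_def S_UNIV by auto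
qed

text \<open>Losing \<open>\<omega>\<close> in the rank buys any finite number of extensions, and thus a brick level above all
  thresholds of the tuple; the elements that were split on the way are discarded again.\<close>

lemma normalise:
  fixes x :: 'o
  assumes m: "m \<in> M_family \<iota> T" and five: "5 \<le> card (mu m)" and x: "countable {..<x}"
    and rk: "ndrk_ge \<iota> T (x \<oplus> omega) m"
  shows "\<exists>K m' v \<rho>. K0 \<le> K \<and> m' \<in> M_family \<iota> T \<and> extends \<iota> m m' \<and> placed K v \<rho> m' \<and>
    ndrk_ge \<iota> T (osuc x) m' \<and> inj_on (take (ml m)) (mu m')"
proof -
  note D = M_familyD[OF m]
  have "\<exists>K. mh m i (\<eta>, \<nu>) \<in> Hval K" if en: "i < \<iota>" "\<eta> \<in> mu m" "\<nu> \<in> mu m" "\<eta> \<noteq> \<nu>" for i \<eta> \<nu>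
  proof -
    obtain j a b where g: "j < \<iota>" "a \<noteq> b" "H j {a, b} = mh m i (\<eta>, \<nu>)"
      using D(8)[OF en] unfolding T_def by blast
    obtain K where "{a, b} \<subseteq> w K" using finite_subset_w[of "{a, b}"] by auto
    then have "{a, b} \<in> edges (w K)" using g(2) by (intro edgesI) auto
    then have "H j {a, b} \<in> Hval K" unfolding Hval_def using g(1) by blast
    then show ?thesis using g(3) by auto
  qed
  then obtain \<kappa> where \<kappa>: "\<And>i \<eta> \<nu>. i < \<iota> \<Longrightarrow> \<eta> \<in> mu m \<Longrightarrow> \<nu> \<in> mu m \<Longrightarrow> \<eta> \<noteq> \<nu> \<Longrightarrow> mh m i (\<eta>, \<nu>) \<in> Hval (\<kappa> i \<eta> \<nu>)"
    by metis
  define B where "B = (\<lambda>(i, \<eta>, \<nu>). \<kappa> i \<eta> \<nu>) ` ({..<\<iota>} \<times> mu m \<times> mu m)"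
  have finB: "finite B" unfolding B_def using D(4) by simp
  define K where "K = Max (insert K0 (insert (ml m) B))"
  have "k \<le> K" if "k \<in> insert K0 (insert (ml m) B)" for k
    unfolding K_def by (rule Max_ge) (use finB that in auto)
  then have K: "K0 \<le> K" "ml m \<le> K" "\<And>k. k \<in> B \<Longrightarrow> k \<le> K" by auto
  have cm: "c (mh m i (\<eta>, \<nu>)) \<le> N K" if "i < \<iota>" "\<eta> \<in> mu m" "\<nu> \<in> mu m" "\<eta> \<noteq> \<nu>" for i \<eta> \<nu>
  proof -
    have "\<kappa> i \<eta> \<nu> \<in> B" unfolding B_def using that by force
    then show ?thesis using \<kappa>[OF that] K(3) Hval_mono c_le by blast
  qed
  have "K \<le> N K" by (induction K) (use N_Suc in \<open>auto intro: le_less_trans Suc_leI\<close>)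
  then have mlN: "ml m \<le> N K" using K(2) by simp
  have "ndrk_ge \<iota> T ((osuc ^^ N K) (osuc x)) m"
  proof (rule ndrk_ge_mono[OF rk _ D(5)])
    have "(osuc ^^ N K) (osuc x) = (osuc ^^ Suc (N K)) x" by (simp add: funpow_swap1)
    then show "(osuc ^^ N K) (osuc x) \<le> x \<oplus> omega"
      using osuc_funpow_less_add_omega[OF x, of "Suc (N K)"] by simp
  qed
  then obtain n where n: "n \<in> M_family \<iota> T" "extends \<iota> m n" "ml m + N K \<le> ml n" "ndrk_ge \<iota> T (osuc x) n"
    using ndrk_ge_chain[OF m countable_osuc[OF x]] by blast
  obtain m' where m': "m' \<in> M_family \<iota> T" "extends \<iota> m m'" "ml m' = N K" "inj_on (take (ml m)) (mu m')"
      "ndrk_ge \<iota> T (osuc x) m'"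
    using interpolate[OF m n(1,2) mlN, where 'o = 'o] n(3,4) by auto
  have im: "mu m = take (ml m) ` mu m'" using m'(2) unfolding extends_def by blast
  have "\<exists>v \<rho>. placed K v \<rho> m'"
  proof (rule normal_form[OF m'(1) _ m'(3)])
    show "5 \<le> card (mu m')" using five card_image[OF m'(4)] im by simp
    fix i \<eta> \<nu> assume i: "i < \<iota>" and en: "\<eta> \<in> mu m'" "\<nu> \<in> mu m'" "\<eta> \<noteq> \<nu>"
    have ne: "take (ml m) \<eta> \<noteq> take (ml m) \<nu>" using m'(4) en unfolding inj_on_def by blast
    have in': "take (ml m) \<eta> \<in> mu m" "take (ml m) \<nu> \<in> mu m" using im en by blast+
    show "c (mh m' i (\<eta>, \<nu>)) \<le> N K"
      using extends_pair(1)[OF m'(2) en(1,2) ne i] cm[OF i in' ne] by simp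
  qed
  then show ?thesis using K(1) m' by blast
qed

text \<open>Split the critical point of \<open>v\<close> and normalise.  By rigidity the result contains a copy of \<open>v\<close> together with a second copy
  of the critical point, in a position that clause \<open>no_twin\<close> forbids at the same positive rank; so the rank of the
  system drops, and at rank zero even the split is impossible.  A step costs one for the split and
  \<open>\<omega>\<close> for the normalisation.\<close>

lemma placed_rank:
  assumes \<epsilon>: "countable {..<\<epsilon>}" and "m \<in> M_family \<iota> T" "placed K v \<rho> m" "5 \<le> card v"
  shows "\<not> ndrk_ge \<iota> T (osuc ((omega \<otimes> yr S v) \<oplus> omega)) m"
  using assms(2-4)
proof (induction "yr S v" arbitrary: m K v \<rho> rule: less_induct)
  case less
  note m = less.prems(1) and pl = less.prems(2) and v5 = less.prems(3)
  have v: "v \<subseteq> w K" and len\<rho>: "length \<rho> = N K" and ml: "ml m = N K"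
    and mu: "mu m = (\<lambda>a. seq_add (node (N K) a) \<rho>) ` v"
    and lab: "\<And>a b. a \<in> v \<Longrightarrow> b \<in> v \<Longrightarrow> a \<noteq> b \<Longrightarrow>
        labels \<iota> m (seq_add (node (N K) a) \<rho>) (seq_add (node (N K) b) \<rho>) = Lab (N K) {a, b}"
    using pl unfolding placed_def by auto
  have finv: "finite v" and nev: "v \<noteq> {}" using v5 by (auto intro: card_ge_0_finite)
  let ?r = "yr S v"
  have "countable {..<?r}" by (rule countable_initial[OF yr_le[OF finv nev] \<epsilon>])
  then have c1: "countable {..<omega \<otimes> ?r}"
    using ord_mult_props[of "omega :: 'o" ?r] omega_limit_countable[where 'o = 'o] by blast
  then have c2: "countable {..<(omega \<otimes> ?r) \<oplus> omega}"
    using ord_add_props[OF c1] omega_limit_countable[where 'o = 'o] by blast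
  have inj: "inj_on (\<lambda>a. seq_add (node (N K) a) \<rho>) v"
    using inj_node v len\<rho> by (auto simp: inj_on_def seq_add_right_inject[where l = "N K"])
  define a where "a = sorted_list_of_set v ! yk S v"
  have a: "a \<in> v" "card (v \<inter> {..<a}) = yk S v"
    unfolding a_def using sorted_list_of_set_nth_card[OF finv yk_less[OF finv nev]] by auto
  define \<nu> where "\<nu> = seq_add (node (N K) a) \<rho>"
  have \<nu>: "\<nu> \<in> mu m" unfolding mu \<nu>_def using a(1) by blast
  show ?case
  proof
    assume "ndrk_ge \<iota> T (osuc ((omega \<otimes> ?r) \<oplus> omega)) m"
    then obtain n where n: "splitting_ext \<iota> T m \<nu> n" "ndrk_ge \<iota> T ((omega \<otimes> ?r) \<oplus> omega) n"
      unfolding ndrk_ge_osuc[OF less_osuc[OF c2]] using \<nu> by blast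
    have nM: "n \<in> M_family \<iota> T" and mn: "extends \<iota> m n" "ml m < ml n"
      and two: "2 \<le> card {\<eta> \<in> mu n. strict_prefix \<nu> \<eta>}"
      using n(1) unfolding splitting_ext_def by auto
    have "card (mu m) \<le> card (mu n)"
      using mn(1) card_image_le[OF M_familyD(4)[OF nM]] unfolding extends_def by metis
    then have n5: "5 \<le> card (mu n)" using v5 card_image[OF inj] mu by simp
    obtain K' n' v' \<rho>' where KK: "K \<le> K'" and n'M: "n' \<in> M_family \<iota> T" and nn': "extends \<iota> n n'"
      and pl': "placed K' v' \<rho>' n'" and rk': "ndrk_ge \<iota> T (osuc (omega \<otimes> ?r)) n'"
      and injn: "inj_on (take (ml n)) (mu n')"
      using normalise[OF nM n5 c1 n(2)] by blast
    have mn': "extends \<iota> m n'" by (rule extends_trans[OF mn(1) nn'])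
    have v': "v' \<subseteq> w K'" and len\<rho>': "length \<rho>' = N K'" and ml': "ml n' = N K'"
      and mu': "mu n' = (\<lambda>a. seq_add (node (N K') a) \<rho>') ` v'"
      and lab': "\<And>a b. a \<in> v' \<Longrightarrow> b \<in> v' \<Longrightarrow> a \<noteq> b \<Longrightarrow>
        labels \<iota> n' (seq_add (node (N K') a) \<rho>') (seq_add (node (N K') b) \<rho>') = Lab (N K') {a, b}"
      using pl' unfolding placed_def by auto
    have NN: "N K \<le> N K'" by (rule N_mono[OF KK])
    have inj': "inj_on (\<lambda>a. seq_add (node (N K') a) \<rho>') v'"
      using inj_node v' len\<rho>' by (auto simp: inj_on_def seq_add_right_inject[where l = "N K'"])
    have "card (mu n') = card (mu n)"
      using nn' card_image[OF injn] unfolding extends_def by metis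
    then have v'5: "5 \<le> card v'" using n5 card_image[OF inj'] mu' by simp
    have finv': "finite v'" using v'5 by (auto intro: card_ge_0_finite)
    \<comment> \<open>Every point of \<open>v'\<close> lies over a point of \<open>v\<close>.\<close>
    have tk: "take (N K) (seq_add (node (N K') x) \<rho>') = seq_add (node (N K) x) (take (N K) \<rho>')" for x
      using NN by (simp add: take_seq_add min_def)
    have im: "mu m = (\<lambda>x. seq_add (node (N K) x) (take (N K) \<rho>')) ` v'"
    proof -
      have "mu m = take (N K) ` mu n'" using mn' unfolding extends_def ml by blast
      then show ?thesis unfolding mu' image_image tk .
    qed
    define \<sigma> where "\<sigma> x = (SOME b. b \<in> v \<and> seq_add (node (N K) x) (take (N K) \<rho>') = seq_add (node (N K) b) \<rho>)" for x
    have \<sigma>: "\<sigma> x \<in> v \<and> seq_add (node (N K) x) (take (N K) \<rho>') = seq_add (node (N K) (\<sigma> x)) \<rho>" if "x \<in> v'" for x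
    proof -
      have "seq_add (node (N K) x) (take (N K) \<rho>') \<in> mu m" unfolding im using that by blast
      then have "\<exists>b. b \<in> v \<and> seq_add (node (N K) x) (take (N K) \<rho>') = seq_add (node (N K) b) \<rho>"
        unfolding mu by blast
      then show ?thesis unfolding \<sigma>_def by (rule someI_ex)
    qed
    have \<sigma>eq: "\<sigma> x = b" if "x \<in> v'" "b \<in> v" "seq_add (node (N K) x) (take (N K) \<rho>') = seq_add (node (N K) b) \<rho>" for x b
      using \<sigma>[OF that(1)] that inj unfolding inj_on_def by metis
    have im\<sigma>: "\<sigma> ` v' = v"
    proof (intro equalityI subsetI)
      fix b assume b: "b \<in> v"
      then have "seq_add (node (N K) b) \<rho> \<in> mu m" unfolding mu by blast
      then obtain x where "x \<in> v'" "seq_add (node (N K) b) \<rho> = seq_add (node (N K) x) (take (N K) \<rho>')"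
        unfolding im by blast
      then show "b \<in> \<sigma> ` v'" using \<sigma>eq[OF _ b] by force
    qed (use \<sigma> in blast)
    define \<tau> where "\<tau> t = \<rho> ! t + \<rho>' ! t" for t
    have \<sigma>t: "E (\<sigma> x) t + \<tau> t = E x t" if "x \<in> v'" "t < N K" for x t
    proof -
      have "seq_add (node (N K) x) (take (N K) \<rho>') ! t = seq_add (node (N K) (\<sigma> x)) \<rho> ! t"
        using \<sigma>[OF that(1)] by simp
      then have "E x t + \<rho>' ! t = E (\<sigma> x) t + \<rho> ! t"
        using that(2) NN len\<rho> len\<rho>' by (simp add: node_def)
      then show ?thesis unfolding \<tau>_def by (cases "\<rho>' ! t"; cases "\<rho> ! t"; cases "E x t"; cases "E (\<sigma> x) t") auto
    qed
    have node\<sigma>: "node (N K) x = node (N K) y" if "x \<in> v'" "y \<in> v'" "\<sigma> x = \<sigma> y" for x y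
      unfolding node_eq_iff using \<sigma>t[OF that(1)] \<sigma>t[OF that(2)] that(3) by metis
    have Lab\<sigma>: "Lab (N K) {x, y} = Lab (N K) {\<sigma> x, \<sigma> y}" if "x \<in> v'" "y \<in> v'" "\<sigma> x \<noteq> \<sigma> y" for x y
    proof -
      let ?x = "seq_add (node (N K') x) \<rho>'" and ?y = "seq_add (node (N K') y) \<rho>'"
      have xy: "x \<noteq> y" using that(3) by blast
      have 1: "take (ml m) ?x = seq_add (node (N K) (\<sigma> x)) \<rho>" "take (ml m) ?y = seq_add (node (N K) (\<sigma> y)) \<rho>"
        using tk \<sigma> that(1,2) unfolding ml by auto
      have ne: "take (ml m) ?x \<noteq> take (ml m) ?y"
        unfolding 1 using inj \<sigma> that unfolding inj_on_def by blast
      have "labels \<iota> m (take (ml m) ?x) (take (ml m) ?y) = cut (ml m) (labels \<iota> n' ?x ?y)"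
        by (rule extends_labels[OF mn' _ _ ne]) (use mu' that in auto)
      then have "Lab (N K) {\<sigma> x, \<sigma> y} = cut (N K) (Lab (N K') {x, y})"
        unfolding 1 using lab[of "\<sigma> x" "\<sigma> y"] lab'[OF that(1,2) xy] \<sigma> that ml by simp
      then show ?thesis using cut_Lab[OF NN] by simp
    qed
    obtain p q where pq: "p \<in> v'" "q \<in> v'" "\<sigma> p = a" "\<sigma> q = a" "q < p"
    proof -
      have "\<exists>\<eta>1 \<eta>2. \<eta>1 \<in> mu n \<and> \<eta>2 \<in> mu n \<and> \<eta>1 \<noteq> \<eta>2 \<and> strict_prefix \<nu> \<eta>1 \<and> strict_prefix \<nu> \<eta>2"
        using two card_le_Suc0_iff_eq[OF finite_mu[OF nM], of "strict_prefix \<nu>"] by fastforce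
      then obtain \<eta>1 \<eta>2 where \<eta>: "\<eta>1 \<in> mu n" "\<eta>2 \<in> mu n" "\<eta>1 \<noteq> \<eta>2" "strict_prefix \<nu> \<eta>1" "strict_prefix \<nu> \<eta>2" by blast
      have over: "\<exists>x\<in>v'. \<sigma> x = a \<and> take (ml n) (seq_add (node (N K') x) \<rho>') = \<eta>" if "\<eta> \<in> mu n" "strict_prefix \<nu> \<eta>" for \<eta>
      proof -
        have "\<eta> \<in> take (ml n) ` mu n'" using nn' that(1) unfolding extends_def by blast
        then obtain x where x: "x \<in> v'" "\<eta> = take (ml n) (seq_add (node (N K') x) \<rho>')" unfolding mu' by blast
        have "\<nu> = take (ml m) \<eta>"
          using that(2) M_familyD(2)[OF m \<nu>] by (auto simp: strict_prefix_def prefix_def)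
        also have "\<dots> = seq_add (node (N K) x) (take (N K) \<rho>')"
          unfolding x(2) using mn(2) tk ml by (simp add: min_def)
        finally have "\<sigma> x = a" using \<sigma>eq[OF x(1) a(1)] unfolding \<nu>_def by simp
        then show ?thesis using x by blast
      qed
      obtain x1 where x1: "x1 \<in> v'" "\<sigma> x1 = a" "take (ml n) (seq_add (node (N K') x1) \<rho>') = \<eta>1" using over[OF \<eta>(1,4)] by blast
      obtain x2 where x2: "x2 \<in> v'" "\<sigma> x2 = a" "take (ml n) (seq_add (node (N K') x2) \<rho>') = \<eta>2" using over[OF \<eta>(2,5)] by blast
      have "x1 \<noteq> x2" using x1 x2 \<eta>(3) by blast
      then show thesis using that[of x1 x2] that[of x2 x1] x1 x2 by (cases "x1 < x2") auto
    qed
    have section_qe: "quasi_embedding_on S v s" if s: "\<And>b. b \<in> v \<Longrightarrow> s b \<in> v' \<and> \<sigma> (s b) = b" for s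
    proof (rule rigid[where K = K' and ?v1.0 = "s ` v" and l = "N K" and \<rho> = \<tau>])
      show "v \<subseteq> w K'" using v w_mono[OF KK] by blast
      show "s ` v \<subseteq> w K'" using s v' by blast
      show "3 \<le> card v" using v5 by simp
      show "inj_on (node (N K)) v" using inj_node v by (rule inj_on_subset)
      show "inj_on (node (N K)) (s ` v)"
      proof (rule inj_onI)
        fix x y assume "x \<in> s ` v" "y \<in> s ` v" and eq: "node (N K) x = node (N K) y"
        then obtain b b' where b: "b \<in> v" "x = s b" "b' \<in> v" "y = s b'" by blast
        have xv: "x \<in> v'" "y \<in> v'" using b s by auto
        have "seq_add (node (N K) x) (take (N K) \<rho>') = seq_add (node (N K) (\<sigma> y)) \<rho>"
          unfolding eq using \<sigma>[OF xv(2)] by simp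
        then have "\<sigma> x = \<sigma> y" using \<sigma>eq[OF xv(1)] \<sigma>[OF xv(2)] by blast
        then show "x = y" using b s by auto
      qed
      show "E b t + \<tau> t = E (s b) t" if "b \<in> v" "t < N K" for b t
        using \<sigma>t[of "s b" t] s[OF that(1)] that(2) by simp
      show "Lab (N K) (s ` e) = Lab (N K) e" if e: "e \<in> edges v" for e
      proof -
        obtain b1 b2 where b: "e = {b1, b2}" "b1 \<in> v" "b2 \<in> v" "b1 \<noteq> b2" using e by (rule edgesE)
        then show ?thesis using Lab\<sigma>[of "s b1" "s b2"] s by simp
      qed
    qed (use NN level_ok_w[OF v] in auto)
    define s where "s z b = (if b = a then z else inv_into v' \<sigma> b)" for z b
    have s: "s z b \<in> v' \<and> \<sigma> (s z b) = b" if "z \<in> v'" "\<sigma> z = a" "b \<in> v" for z b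
      using that im\<sigma> unfolding s_def by (auto simp: inv_into_into f_inv_into_f)
    have qep: "quasi_embedding_on S v (s p)" and qeq: "quasi_embedding_on S v (s q)"
      using section_qe s pq by blast+
    define A where "A = s p ` v"
    have sA: "A \<subseteq> v'" unfolding A_def using s pq by blast
    have finA: "finite A" unfolding A_def using finv by simp
    have spa: "s p a = p" "s q a = q" unfolding s_def by auto
    have pA: "p \<in> A" unfolding A_def using a(1) spa by force
    have qA: "q \<notin> A"
    proof
      assume "q \<in> A"
      then obtain b where b: "b \<in> v" "q = s p b" unfolding A_def by blast
      then have "b = a" using s[OF pq(1,3) b(1)] pq(4) by simp
      then show False using b spa pq(5) by simp
    qed
    have img: "f ` v = insert (f a) (f ` (v - {a}))" for f :: "nat \<Rightarrow> nat"
      using a(1) by auto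
    have "s p ` (v - {a}) = s q ` (v - {a})" unfolding s_def by (intro image_cong) auto
    moreover have "A = insert p (s p ` (v - {a}))" "s q ` v = insert q (s q ` (v - {a}))"
      using img[of "s p"] img[of "s q"] spa unfolding A_def by simp_all
    moreover have "p \<notin> s p ` (v - {a})"
    proof
      assume "p \<in> s p ` (v - {a})"
      then obtain b where "b \<in> v" "b \<noteq> a" "p = s p b" by blast
      then show False using s[OF pq(1,3)] pq(3) by metis
    qed
    ultimately have Aq: "insert q (A - {p}) = s q ` v" by auto
    have rA: "yr S A = ?r" "yk S A = yk S v"
      unfolding A_def using qeD(3,4)[OF qep order_refl finv nev] by auto
    have cpA: "card (A \<inter> {..<p}) = yk S A"
      using card_below_image[OF qeD(1)[OF qep] a(1)] a(2) rA(2) spa unfolding A_def by simp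
    show False
    proof (cases "?r = ozero")
      case True
      have "p = q"
      proof (rule critical_no_split[where v = A and K = K' and W = v' and l = "N K" and L = "N K'" and \<sigma> = "s p \<circ> \<sigma>" and a = p])
        have "node (N K) x = node (N K) (s p (\<sigma> x))" if "x \<in> v'" for x
          by (rule node\<sigma>[OF that]) (use s[OF pq(1,3)] \<sigma> that in auto)
        then show "node (N K) x = node (N K) ((s p \<circ> \<sigma>) x)" if "x \<in> v'" for x using that by simp
        have injs: "inj_on (s p) v" by (rule qeD(2)[OF qep])
        have cA: "card A = card v" unfolding A_def by (rule card_image[OF injs])
        then show "3 \<le> card A" using v5 by simp
        show "A \<subseteq> w K'" "v' \<subseteq> w K'" using sA v' by auto
        show "(s p \<circ> \<sigma>) ` v' = A" unfolding A_def image_comp[symmetric] im\<sigma> ..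
        show "level_ok (N K) A"
          unfolding level_ok_def
        proof (intro allI impI ballI)
          fix i e assume i: "i < \<iota>" and "e \<in> edges A"
          then obtain b1 b2 where b: "b1 \<in> v" "b2 \<in> v" "e = {s p b1, s p b2}" "s p b1 \<noteq> s p b2"
            unfolding A_def by (auto elim!: edgesE)
          have sb: "s p b1 \<in> v'" "s p b2 \<in> v'" "\<sigma> (s p b1) = b1" "\<sigma> (s p b2) = b2"
            using s[OF pq(1,3)] b by auto
          then have ne: "b1 \<noteq> b2" using b(4) by auto
          have "Lab (N K) e = Lab (N K) {b1, b2}" using Lab\<sigma>[OF sb(1,2)] sb ne b(3) by simp
          then obtain j where "j < \<iota>" "H i e = H j {b1, b2}" using Lab_H[OF _ i] b(3) by blast
          then show "c (H i e) \<le> N K"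
            using level_ok_w[OF v] edgesI[OF b(1,2) ne] unfolding level_ok_def by auto
        qed
        show "inj_on (node (N K)) A"
        proof (rule inj_onI)
          fix x y assume "x \<in> A" "y \<in> A" and eq: "node (N K) x = node (N K) y"
          then obtain b b' where b: "b \<in> v" "x = s p b" "b' \<in> v" "y = s p b'" unfolding A_def by blast
          have xv: "x \<in> v'" "y \<in> v'" using b s[OF pq(1,3)] by auto
          have "seq_add (node (N K) x) (take (N K) \<rho>') = seq_add (node (N K) (\<sigma> y)) \<rho>"
            unfolding eq using \<sigma>[OF xv(2)] by simp
          then have "\<sigma> x = \<sigma> y" using \<sigma>eq[OF xv(1)] \<sigma>[OF xv(2)] by blast
          then show "x = y" using b s[OF pq(1,3)] by auto
        qed
        show "inj_on (node (N K')) v'" using inj_node v' by (rule inj_on_subset)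
        show "Lab (N K) {x, y} = Lab (N K) {(s p \<circ> \<sigma>) x, (s p \<circ> \<sigma>) y}"
          if xy: "x \<in> v'" "y \<in> v'" "(s p \<circ> \<sigma>) x \<noteq> (s p \<circ> \<sigma>) y" for x y
        proof -
          have ne: "\<sigma> x \<noteq> \<sigma> y" using xy(3) by auto
          have sx: "s p (\<sigma> x) \<in> v'" "s p (\<sigma> y) \<in> v'" "\<sigma> (s p (\<sigma> x)) = \<sigma> x" "\<sigma> (s p (\<sigma> y)) = \<sigma> y"
            using s[OF pq(1,3)] \<sigma> xy(1,2) by auto
          show ?thesis using Lab\<sigma>[OF xy(1,2) ne] Lab\<sigma>[OF sx(1,2)] sx(3,4) ne by simp
        qed
      qed (use NN True rA cpA pA pq spa in auto)
      then show False using pq(5) by simp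
    next
      case False
      then have pos: "ozero < ?r" using ozero_le[of ?r] by (simp add: order.order_iff_strict)
      have j: "yj S (s q ` v) = yj S A"
        unfolding A_def using qeD(5)[OF qep order_refl finv nev pos] qeD(5)[OF qeq order_refl finv nev pos] by simp
      have "card (s q ` v \<inter> {..<q}) = yk S v"
        using card_below_image[OF qeD(1)[OF qeq] a(1)] a(2) spa by simp
      moreover have "s q ` v \<inter> {..<q} = A \<inter> {..<q}"
        unfolding Aq[symmetric] using pq(5) by auto
      ultimately have cqA: "card (A \<inter> {..<q}) = yk S A" using rA by simp
      have "yr S (insert q A) \<noteq> yr S A"
        by (rule no_twin[OF finA pA cpA qA cqA]) (simp add: Aq j)
      moreover have "yr S (insert q A) \<le> yr S A"
        by (rule yr_mono) (use pA finA in auto)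
      moreover have "yr S v' \<le> yr S (insert q A)"
        by (rule yr_mono) (use sA pq finv' in auto)
      ultimately have lt: "yr S v' < ?r" using rA by simp
      have "(omega \<otimes> yr S v') \<oplus> omega \<le> omega \<otimes> ?r"
        using ord_mult_props[of "omega :: 'o" ?r] omega_limit_countable[where 'o = 'o] \<open>countable {..<?r}\<close> lt by blast
      then have "osuc ((omega \<otimes> yr S v') \<oplus> omega) \<le> osuc (omega \<otimes> ?r)" by (rule osuc_mono[OF _ c1])
      then have "ndrk_ge \<iota> T (osuc ((omega \<otimes> yr S v') \<oplus> omega)) n'"
        using ndrk_ge_mono[OF rk'] M_familyD(5)[OF n'M] by blast
      then show False using less.hyps[OF lt n'M pl' v'5] by blast
    qed
  qed
qed

text \<open>Three splits produce five elements, \<open>\<omega>\<close> pays for the normalisation, and the normal form has rank at most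
  \<open>\<omega> \<cdot> (\<epsilon> + 1)\<close>.\<close>

lemma ndrk_sup_upper:
  assumes \<epsilon>: "countable {..<\<epsilon>}"
  shows "(ndrk_sup \<iota> T :: 'o rank_value) \<le> Rank (omega \<otimes> (\<epsilon> \<oplus> ord_of_nat 2) \<oplus> ord_of_nat 2)"
proof (rule ndrk_sup_le)
  fix m assume m: "m \<in> M_family \<iota> T"
  have co: "countable {..<omega :: 'o}" using omega_limit_countable by blast
  define \<delta> where "\<delta> = omega \<otimes> (\<epsilon> \<oplus> ord_of_nat 2)"
  have e2: "\<epsilon> \<oplus> ord_of_nat 2 = osuc (osuc \<epsilon>)"
    by (simp add: ord_add_of_nat[OF \<epsilon>] numeral_2_eq_2)
  have cs: "countable {..<osuc \<epsilon>}" "countable {..<osuc (osuc \<epsilon>)}"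
    using countable_osuc \<epsilon> by blast+
  have c\<delta>: "countable {..<\<delta>}" unfolding \<delta>_def e2 using ord_mult_props[OF co cs(2)] by blast
  have c1: "countable {..<omega \<otimes> osuc \<epsilon>}" using ord_mult_props[OF co cs(1)] by blast
  have \<Omega>: "\<delta> \<oplus> ord_of_nat 2 = osuc (osuc \<delta>)"
    by (simp add: ord_add_of_nat[OF c\<delta>] numeral_2_eq_2)
  have "\<not> ndrk_ge \<iota> T (osuc (osuc (osuc \<delta>))) m"
  proof
    assume "ndrk_ge \<iota> T (osuc (osuc (osuc \<delta>))) m"
    then have "ndrk_ge \<iota> T ((osuc ^^ 3) \<delta>) m" by (simp add: numeral_3_eq_3)
    then obtain n where n: "n \<in> M_family \<iota> T" "card (mu m) + 3 \<le> card (mu n)" "ndrk_ge \<iota> T \<delta> n"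
      using ndrk_ge_chain[OF m c\<delta>] by blast
    have n5: "5 \<le> card (mu n)" using n(2) M_familyD(3)[OF m] by simp
    have "(omega \<otimes> osuc \<epsilon>) \<oplus> omega \<le> \<delta>"
      unfolding \<delta>_def e2 using ord_mult_props[OF co cs(2)] less_osuc[OF cs(1)] by blast
    then have "ndrk_ge \<iota> T ((omega \<otimes> osuc \<epsilon>) \<oplus> omega) n"
      using ndrk_ge_mono[OF n(3)] M_familyD(5)[OF n(1)] by blast
    then obtain K p v \<rho> where p: "p \<in> M_family \<iota> T" "extends \<iota> n p" "placed K v \<rho> p"
        "ndrk_ge \<iota> T (osuc (omega \<otimes> osuc \<epsilon>)) p" "inj_on (take (ml n)) (mu p)"
      using normalise[OF n(1) n5 c1] by blast
    have "card (mu p) = card (mu n)"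
      using p(2) card_image[OF p(5)] unfolding extends_def by metis
    moreover have "card (mu p) \<le> card v"
    proof -
      have "v \<subseteq> w K" using p(3) unfolding placed_def by blast
      then have "finite v" by (rule finite_subset[OF _ finite_w])
      moreover have "mu p = (\<lambda>a. seq_add (node (N K) a) \<rho>) ` v" using p(3) unfolding placed_def by blast
      ultimately show ?thesis using card_image_le[of v "\<lambda>a. seq_add (node (N K) a) \<rho>"] by simp
    qed
    ultimately have v5: "5 \<le> card v" using n5 by simp
    then have fin: "finite v" "v \<noteq> {}" by (auto intro: card_ge_0_finite)
    have "yr S v < osuc \<epsilon>" using yr_le[OF fin] less_osuc_iff[OF \<epsilon>] by simp
    then have "(omega \<otimes> yr S v) \<oplus> omega \<le> omega \<otimes> osuc \<epsilon>"
      using ord_mult_props[OF co cs(1)] by blast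
    then have "osuc ((omega \<otimes> yr S v) \<oplus> omega) \<le> osuc (omega \<otimes> osuc \<epsilon>)" by (rule osuc_mono[OF _ c1])
    then have "ndrk_ge \<iota> T (osuc ((omega \<otimes> yr S v) \<oplus> omega)) p"
      using ndrk_ge_mono[OF p(4)] M_familyD(5)[OF p(1)] by blast
    then show False using placed_rank[OF \<epsilon> p(1,3) v5] by blast
  qed
  then have "ndrk \<iota> T m \<le> Rank (\<delta> \<oplus> ord_of_nat 2)"
    unfolding \<Omega> using ndrk_le less_osuc[OF countable_osuc[OF countable_osuc[OF c\<delta>]]] M_familyD(5)[OF m] by blast
  then show "ndrk \<iota> T m \<le> Rank (omega \<otimes> (\<epsilon> \<oplus> ord_of_nat 2) \<oplus> ord_of_nat 2)" unfolding \<delta>_def .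
qed

end

section \<open>Finite systems inside a cute system\<close>

text \<open>Cuteness speaks of systems whose points are ordinals; here the points are natural numbers, copied to the finite
  ordinals.\<close>

lemma cute_absorbs:
  fixes q :: "(nat, 'o::ordinals) yzr"
  assumes cute: "cute \<epsilon> S" and q: "yzr_system \<epsilon> q" "finite (yX q)"
  shows "\<exists>\<phi>. quasi_embedding q S \<phi> \<and> \<phi> ` yX q \<subseteq> {M..}"
proof -
  let ?f = "ord_of_nat :: nat \<Rightarrow> 'o"
  have sm: "strict_mono ?f" by (rule strict_mono_ord_of_nat)
  have inj: "inj ?f" by (rule strict_mono_imp_inj_on[OF sm])
  have sm_on: "strict_mono_on A ?f" for A using sm by (auto simp: strict_mono_def strict_mono_on_def)
  define q' where "q' = \<lparr>yX = ?f ` yX q, yr = (\<lambda>s. yr q (?f -` s)), yj = (\<lambda>s. yj q (?f -` s)), yk = (\<lambda>s. yk q (?f -` s))\<rparr>"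
  have sel: "yX q' = ?f ` yX q" "yr q' s = yr q (?f -` s)" "yj q' s = yj q (?f -` s)" "yk q' s = yk q (?f -` s)" for s
    by (simp_all add: q'_def)
  have vim: "?f -` ?f ` s = s" for s using inj by (simp add: inj_vimage_image_eq)
  have sub: "\<exists>s'\<in>fin_subsets (yX q). s = ?f ` s'" if "s \<in> fin_subsets (yX q')" for s
  proof -
    have "s \<subseteq> ?f ` yX q" using that unfolding fin_subsets_def sel by blast
    then obtain s' where "s' \<subseteq> yX q" "s = ?f ` s'" unfolding subset_image_iff by blast
    then show ?thesis using that inj unfolding fin_subsets_def
      by (auto simp: finite_image_iff inj_on_subset)
  qed
  have "yzr_system \<epsilon> q'"
    unfolding yzr_system_def
  proof (intro conjI ballI allI impI notI)
    show "yX q' = {} \<Longrightarrow> False" using q(1) unfolding yzr_system_def sel by simp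
    show "yr q' s \<le> \<epsilon>" if "s \<in> fin_subsets (yX q')" for s
      using sub[OF that] q(1) unfolding yzr_system_def sel by (auto simp: vim)
    show "yr q' s \<le> yr q' u" if s: "s \<in> fin_subsets (yX q')" and u: "u \<noteq> {} \<and> u \<subseteq> s" for s u
    proof -
      obtain s' where s': "s' \<in> fin_subsets (yX q)" "s = ?f ` s'" using sub[OF s] by blast
      obtain u' where u': "u' \<subseteq> s'" "u = ?f ` u'" using u s'(2) by (auto simp: subset_image_iff)
      have "u' \<noteq> {}" using u u' by blast
      then show ?thesis using q(1) s' u' unfolding yzr_system_def sel by (auto simp: vim)
    qed
    show "ozero < yr q' {a}" if a: "a \<in> yX q'" for a
    proof -
      obtain a' where a': "a' \<in> yX q" "a = ?f a'" using a unfolding sel by blast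
      then have "?f -` {a} = {a'}" using inj by (auto simp: inj_def)
      then show ?thesis using a' q(1) unfolding yzr_system_def sel by simp
    qed
    fix s assume s: "s \<in> fin_subsets (yX q')"
    then obtain s' where s': "s' \<in> fin_subsets (yX q)" "s = ?f ` s'" using sub by blast
    have fin: "finite s'" using s'(1) unfolding fin_subsets_def by simp
    have card: "card s = card s'" unfolding s'(2) using card_image inj_on_subset[OF inj] by blast
    have k: "yk q s' < card s'" using q(1) s'(1) unfolding yzr_system_def by blast
    then show "yk q' s < card s" using card s'(2) by (simp add: sel vim)
    assume "\<exists>b\<in>yX q' - s. card (s \<inter> {..<b}) = yk q' s \<and>
             yj q' (insert b (s - {sorted_list_of_set s ! yk q' s})) = yj q' s \<and> yr q' (insert b s) = yr q' s"
    then obtain b' where b': "b' \<in> yX q" "?f b' \<notin> s" and cb: "card (s \<inter> {..<?f b'}) = yk q s'"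
      and jb: "yj q' (insert (?f b') (s - {sorted_list_of_set s ! yk q s'})) = yj q s'"
      and rb: "yr q' (insert (?f b') s) = yr q s'"
      unfolding sel s'(2) vim by blast
    have ns: "b' \<notin> s'" using b'(2) s'(2) by blast
    define x where "x = sorted_list_of_set s' ! yk q s'"
    have x: "x \<in> s'" "card (s' \<inter> {..<x}) = yk q s'"
      unfolding x_def using sorted_list_of_set_nth_card[OF fin k] by auto
    have "card (s \<inter> {..<?f x}) = yk q s'"
      unfolding s'(2) using card_below_image[OF sm_on x(1)] x(2) by simp
    then have xs: "sorted_list_of_set s ! yk q s' = ?f x"
      using sorted_list_of_set_nth_eq[of s "?f x"] fin x(1) s'(2) by auto
    have eq: "insert (?f b') (s - {?f x}) = ?f ` insert b' (s' - {x})"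
      unfolding s'(2) using inj by (auto simp: inj_def)
    have "yj q (insert b' (s' - {x})) = yj q s'"
      using jb unfolding xs eq sel vim .
    moreover have "yr q (insert b' s') = yr q s'"
      using rb unfolding s'(2) image_insert[symmetric] sel vim .
    moreover have "card (s' \<inter> {..<b'}) = yk q s'"
    proof -
      have "card (?f ` insert b' s' \<inter> {..<?f b'}) = card (insert b' s' \<inter> {..<b'})"
        by (rule card_below_image[OF sm_on]) simp
      moreover have "?f ` insert b' s' \<inter> {..<?f b'} = s \<inter> {..<?f b'}" "insert b' s' \<inter> {..<b'} = s' \<inter> {..<b'}"
        unfolding s'(2) by auto
      ultimately show ?thesis using cb by simp
    qed
    ultimately show False
      using q(1) s'(1) b'(1) ns unfolding yzr_system_def x_def by auto
  qed
  moreover have "finite (yX q')" using q(2) unfolding sel by simp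
  ultimately obtain \<phi> where \<phi>: "quasi_embedding q' S \<phi>" "\<phi> ` yX q' \<subseteq> {M..}"
    using cute unfolding cute_def by blast
  have "quasi_embedding q S (\<phi> \<circ> ?f)"
    unfolding quasi_embedding_def
  proof (intro conjI ballI impI)
    note Q = \<phi>(1)[unfolded quasi_embedding_def]
    show "(\<phi> \<circ> ?f) ` yX q \<subseteq> yX S" using Q unfolding sel by (auto simp: image_comp)
    show "strict_mono_on (yX q) (\<phi> \<circ> ?f)"
      using Q sm unfolding sel strict_mono_on_def strict_mono_def by auto
    fix v assume v: "v \<in> fin_subsets (yX q)"
    then have fv: "?f ` v \<in> fin_subsets (yX q')" unfolding fin_subsets_def sel by auto
    then show "yr S ((\<phi> \<circ> ?f) ` v) = yr q v" "yk S ((\<phi> \<circ> ?f) ` v) = yk q v"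
      using Q unfolding image_comp[symmetric] by (auto simp: sel vim)
    show "yj S ((\<phi> \<circ> ?f) ` v) = yj q v" if "ozero < yr q v"
      using Q fv that unfolding image_comp[symmetric] by (auto simp: sel vim)
  qed
  moreover have "(\<phi> \<circ> ?f) ` yX q \<subseteq> {M..}" using \<phi>(2) unfolding sel image_comp .
  ultimately show ?thesis by blast
qed

context tower
begin

section \<open>The lower bound for the rank\<close>

text \<open>Doubling the point \<open>a\<close>: a set containing both copies of \<open>a\<close> gets rank \<open>\<beta>\<close>, which is
  below all other ranks, and a value of \<open>yj\<close> that is attained nowhere else, so that no set acquires a twin.\<close>

lemma doubling:
  fixes \<beta> :: 'o
  assumes v: "finite v" "a \<in> v" and \<beta>: "\<beta> < yr S v"
  shows "\<exists>\<pi>0 \<pi>1. quasi_embedding_on S v \<pi>0 \<and> quasi_embedding_on S v \<pi>1 \<and>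
    (\<forall>b\<in>v. b \<noteq> a \<longrightarrow> \<pi>0 b = \<pi>1 b) \<and> \<pi>0 a \<noteq> \<pi>1 a \<and>
    (\<forall>b\<in>v. \<forall>b'\<in>v. \<pi>0 b = \<pi>1 b' \<longrightarrow> b = b') \<and> \<beta> \<le> yr S (\<pi>0 ` v \<union> \<pi>1 ` v)"
proof -
  define X where "X = insert (2 * a + 1) ((\<lambda>x. 2 * x) ` v)"
  define h :: "nat \<Rightarrow> nat" where "h x = x div 2" for x
  define both where "both s \<longleftrightarrow> {2 * a, 2 * a + 1} \<subseteq> s" for s :: "nat set"
  define J where "J = Suc (Max (yj S ` Pow v))"
  define q where "q = \<lparr>yX = X, yr = (\<lambda>s. if both s then \<beta> else yr S (h ` s)),
    yj = (\<lambda>s. if both s then J + set_encode s else yj S (h ` s)), yk = (\<lambda>s. if both s then 0 else yk S (h ` s))\<rparr>"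
  have sel: "yX q = X" "yr q s = (if both s then \<beta> else yr S (h ` s))"
    "yj q s = (if both s then J + set_encode s else yj S (h ` s))" "yk q s = (if both s then 0 else yk S (h ` s))" for s
    by (simp_all add: q_def)
  have finX: "finite X" using v unfolding X_def by simp
  have hX: "h x \<in> v" if "x \<in> X" for x using that v unfolding X_def h_def by auto
  have hs: "h ` s \<subseteq> v" if "s \<subseteq> X" for s using that hX by blast
  have J: "yj S s < J" if "s \<subseteq> v" for s
    unfolding J_def less_Suc_eq_le using v(1) that by (intro Max_ge) auto
  have mono: "strict_mono_on s h" if "s \<subseteq> X" "\<not> both s" for s
    unfolding strict_mono_on_def
  proof (intro allI impI, elim conjE)
    fix x y assume xy: "x \<in> s" "y \<in> s" "x < y"
    have "h x \<le> h y" unfolding h_def using xy(3) by (intro div_le_mono) simp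
    moreover have "h x \<noteq> h y"
    proof
      assume "h x = h y"
      then have "even x" "y = Suc x" using xy(3) unfolding h_def by presburger+
      then have "odd y" by simp
      moreover have "y \<in> X" using xy(2) that(1) by blast
      ultimately have "y = 2 * a + 1" unfolding X_def by auto
      then show False using that(2) xy(1,2) \<open>y = Suc x\<close> unfolding both_def by auto
    qed
    ultimately show "h x < h y" by simp
  qed
  have rge: "yr S v \<le> yr S (h ` s)" if "s \<subseteq> X" "s \<noteq> {}" for s
    using yr_mono[OF _ hs[OF that(1)] v(1)] that(2) by simp
  have "yzr_system \<epsilon> q"
    unfolding yzr_system_def
  proof (intro conjI ballI allI impI notI)
    show "yX q = {} \<Longrightarrow> False" unfolding sel X_def by simp
    show "yr q s \<le> \<epsilon>" if "s \<in> fin_subsets (yX q)" for s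
    proof -
      have s: "s \<subseteq> X" "s \<noteq> {}" "finite s" using that unfolding fin_subsets_def sel by auto
      have "yr S (h ` s) \<le> \<epsilon>" using s by (intro yr_le) auto
      moreover have "\<beta> \<le> \<epsilon>" using \<beta> yr_le[OF v(1)] v(2) by (metis empty_iff less_imp_le order.trans)
      ultimately show ?thesis unfolding sel by simp
    qed
    show "yr q s \<le> yr q u" if "s \<in> fin_subsets (yX q)" "u \<noteq> {} \<and> u \<subseteq> s" for s u
    proof -
      have s: "s \<subseteq> X" "finite s" "u \<subseteq> X" using that unfolding fin_subsets_def sel by auto
      have "yr S (h ` s) \<le> yr S (h ` u)" using s that(2) by (intro yr_mono) auto
      moreover have "\<beta> \<le> yr S (h ` u)" using rge[OF s(3)] that(2) \<beta> by force
      moreover have "both s" if "both u" using that \<open>u \<noteq> {} \<and> u \<subseteq> s\<close> unfolding both_def by blast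
      ultimately show ?thesis unfolding sel by auto
    qed
    show "ozero < yr q {x}" if "x \<in> yX q" for x
    proof -
      have "\<not> both {x}" unfolding both_def by auto
      then show ?thesis using S_system unfolding sel yzr_system_def S_UNIV by simp
    qed
    fix s assume sX: "s \<in> fin_subsets (yX q)"
    then have s: "s \<subseteq> X" "s \<noteq> {}" "finite s" unfolding fin_subsets_def sel by auto
    have inj: "inj_on h s" if "\<not> both s" using strict_mono_on_imp_inj_on[OF mono[OF s(1) that]] .
    have k: "yk q s < card s"
    proof (cases "both s")
      case True
      then show ?thesis using s by (simp add: sel card_gt_0_iff)
    next
      case False
      have "yk S (h ` s) < card (h ` s)" using s by (intro yk_less) auto
      then show ?thesis using False card_image[OF inj[OF False]] by (simp add: sel)
    qed
    then show "yk q s < card s" .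
    assume "\<exists>b\<in>yX q - s. card (s \<inter> {..<b}) = yk q s \<and>
             yj q (insert b (s - {sorted_list_of_set s ! yk q s})) = yj q s \<and> yr q (insert b s) = yr q s"
    then obtain b where b: "b \<in> X" "b \<notin> s" and cb: "card (s \<inter> {..<b}) = yk q s"
      and jb: "yj q (insert b (s - {sorted_list_of_set s ! yk q s})) = yj q s" and rb: "yr q (insert b s) = yr q s"
      unfolding sel(1) by blast
    define x where "x = sorted_list_of_set s ! yk q s"
    have x: "x \<in> s" "card (s \<inter> {..<x}) = yk q s"
      unfolding x_def using sorted_list_of_set_nth_card[OF s(3) k] by auto
    define s' where "s' = insert b (s - {x})"
    have s': "s' \<subseteq> X" "finite s'" "s' \<noteq> s" using s b x unfolding s'_def by auto
    have jb: "yj q s' = yj q s" using jb unfolding s'_def x_def .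
    show False
    proof (cases "both s")
      case True
      show False
      proof (cases "both s'")
        case T': True
        then have "set_encode s' = set_encode s" using jb True by (simp add: sel)
        then show False using set_encode_eq s' s by blast
      next
        case False
        then show False using jb True J[OF hs[OF s'(1)]] by (simp add: sel)
      qed
    next
      case False
      have nb: "\<not> both (insert b s)"
      proof
        assume "both (insert b s)"
        then have "yr S (h ` s) = \<beta>" using rb False by (simp add: sel)
        then show False using rge[OF s(1,2)] \<beta> by simp
      qed
      have nb': "\<not> both s'" using nb unfolding s'_def both_def by blast
      have bsX: "insert b s \<subseteq> X" using b s by blast
      note sm = mono[OF bsX nb]
      have injb: "inj_on h (insert b s)" using strict_mono_on_imp_inj_on[OF sm] .
      have kq: "yk q s = yk S (h ` s)" using False by (simp add: sel)
      have "yr S (insert (h b) (h ` s)) \<noteq> yr S (h ` s)"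
      proof (rule no_twin[where x = "h x"])
        show "finite (h ` s)" "h x \<in> h ` s" using s x by auto
        show "card (h ` s \<inter> {..<h x}) = yk S (h ` s)"
          using card_below_image[OF mono[OF s(1) False] x(1)] x(2) kq by simp
        show "h b \<notin> h ` s" using injb b(2) unfolding inj_on_def by blast
        have "card (h ` insert b s \<inter> {..<h b}) = card (insert b s \<inter> {..<b})"
          by (rule card_below_image[OF sm]) simp
        moreover have "h ` insert b s \<inter> {..<h b} = h ` s \<inter> {..<h b}" "insert b s \<inter> {..<b} = s \<inter> {..<b}" by auto
        ultimately show "card (h ` s \<inter> {..<h b}) = yk S (h ` s)" using cb kq by simp
        have "insert (h b) (h ` s - {h x}) = h ` s'"
          unfolding s'_def using inj[OF False] x(1) by (auto simp: inj_on_def)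
        then show "yj S (insert (h b) (h ` s - {h x})) = yj S (h ` s)"
          using jb False nb' by (simp add: sel)
      qed
      then show False using rb False nb by (simp add: sel)
    qed
  qed
  then obtain \<phi> where \<phi>: "quasi_embedding q S \<phi>"
    using cute_absorbs[OF cute _ finX[folded sel(1)], of 0] by blast
  note Q = \<phi>[unfolded quasi_embedding_def]
  have sm\<phi>: "strict_mono_on X \<phi>" using Q unfolding sel(1) by blast
  have inj\<phi>: "inj_on \<phi> X" using strict_mono_on_imp_inj_on[OF sm\<phi>] .
  have Q\<phi>: "yr S (\<phi> ` s) = yr q s \<and> yk S (\<phi> ` s) = yk q s \<and> (ozero < yr q s \<longrightarrow> yj S (\<phi> ` s) = yj q s)"
    if "s \<subseteq> X" "s \<noteq> {}" "finite s" for s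
    using Q that unfolding fin_subsets_def sel(1) by blast
  have qe: "quasi_embedding_on S v (\<phi> \<circ> f)"
    if f: "strict_mono_on v f" "f ` v \<subseteq> X" "\<not> both (f ` v)" "\<And>b. b \<in> v \<Longrightarrow> h (f b) = b" for f
    unfolding quasi_embedding_on_iff[OF S_UNIV]
  proof (intro conjI allI impI, goal_cases)
    case 1
    show ?case using sm\<phi> f(1,2) unfolding strict_mono_on_def by (auto simp: image_subset_iff)
  next
    have fu: "yr q (f ` u) = yr S u" "yk q (f ` u) = yk S u" "yj q (f ` u) = yj S u" if "u \<subseteq> v" for u
    proof -
      have "h ` f ` u = u" using f(4) that by (force simp: image_image)
      moreover have "\<not> both (f ` u)" using f(3) that unfolding both_def by blast
      ultimately show "yr q (f ` u) = yr S u" "yk q (f ` u) = yk S u" "yj q (f ` u) = yj S u"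
        by (simp_all add: sel)
    qed
    have fuX: "f ` u \<subseteq> X" if "u \<subseteq> v" for u using f(2) that by blast
    { case (2 u) then show ?case using Q\<phi>[of "f ` u"] fu[of u] fuX[of u] unfolding image_comp[symmetric] by auto }
    { case (3 u) then show ?case using Q\<phi>[of "f ` u"] fu[of u] fuX[of u] unfolding image_comp[symmetric] by auto }
    { case (4 u) then show ?case using Q\<phi>[of "f ` u"] fu[of u] fuX[of u] unfolding image_comp[symmetric] by auto }
  qed
  define f1 where "f1 x = (if x = a then 2 * a + 1 else 2 * x)" for x :: nat
  have q0: "quasi_embedding_on S v (\<phi> \<circ> (\<lambda>x. 2 * x))"
  proof (rule qe)
    have "2 * a + 1 \<notin> (\<lambda>x. 2 * x) ` v" by (auto simp: image_iff) presburger
    then show "\<not> both ((\<lambda>x. 2 * x) ` v)" unfolding both_def by blast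
  qed (auto simp: strict_mono_on_def X_def h_def)
  have q1: "quasi_embedding_on S v (\<phi> \<circ> f1)"
  proof (rule qe)
    have "2 * a \<notin> f1 ` v" by (auto simp: f1_def split: if_splits)
    then show "\<not> both (f1 ` v)" unfolding both_def by blast
  qed (auto simp: strict_mono_on_def X_def h_def f1_def)
  have in01: "2 * b \<in> X" "f1 b \<in> X" if "b \<in> v" for b using that v(2) unfolding X_def f1_def by auto
  have same: "b = b'" if "b \<in> v" "b' \<in> v" "\<phi> (2 * b) = \<phi> (f1 b')" for b b'
  proof -
    have "2 * b = f1 b'" using inj\<phi> in01 that unfolding inj_on_def by blast
    then show ?thesis unfolding f1_def by (auto split: if_splits)
  qed
  have "\<phi> (2 * a) \<noteq> \<phi> (f1 a)"
  proof
    assume "\<phi> (2 * a) = \<phi> (f1 a)"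
    then have "2 * a = f1 a" using inj\<phi> in01 v(2) unfolding inj_on_def by blast
    then show False by (simp add: f1_def)
  qed
  moreover have "(\<phi> \<circ> (\<lambda>x. 2 * x)) ` v \<union> (\<phi> \<circ> f1) ` v = \<phi> ` X"
  proof -
    have "2 * a + 1 \<in> f1 ` v" using v(2) by (intro image_eqI[of _ _ a]) (simp_all add: f1_def)
    then have "(\<lambda>x. 2 * x) ` v \<union> f1 ` v = X"
      using in01 unfolding X_def by blast
    then show ?thesis by (metis image_Un image_comp)
  qed
  moreover have "yr S (\<phi> ` X) = \<beta>"
  proof -
    have "both X" using v(2) unfolding both_def X_def by auto
    then show ?thesis using Q\<phi>[OF order_refl _ finX] by (auto simp: sel X_def)
  qed
  ultimately show ?thesis
    using q0 q1 same by (intro exI[of _ "\<phi> \<circ> (\<lambda>x. 2 * x)"] exI[of _ "\<phi> \<circ> f1"]) (auto simp: f1_def)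
qed

text \<open>To split the point of \<open>a\<close>, double \<open>a\<close> in the system and let a demand copy the doubled configuration over everything except
  \<open>a\<close>.  The demand is admissible because all ranks involved are positive, and the doubled configuration
  still has rank at least \<open>\<beta>\<close>.\<close>

lemma config_rank:
  fixes \<alpha> :: 'o
  assumes "v \<subseteq> w K" "3 \<le> card v" "m \<in> M_family \<iota> T" "config (N K) v m" "\<alpha> \<le> yr S v"
  shows "ndrk_ge \<iota> T \<alpha> m"
  using assms
proof (induction \<alpha> arbitrary: v K m rule: less_induct)
  case (less \<alpha>)
  note v = less.prems(1,2) and m = less.prems(3) and conf = less.prems(4)
  have finv: "finite v" using v(2) by (auto intro: card_ge_0_finite)
  show ?case
  proof (cases \<alpha> rule: zero_suc_or_limit)
    case 1
    then show ?thesis by (simp add: ndrk_ge_ozero)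
  next
    case 3
    have "ndrk_ge \<iota> T \<beta> m" if "\<beta> < \<alpha>" for \<beta>
      using less.IH[OF that v m conf] less.prems(5) that by simp
    then show ?thesis using ndrk_ge_limit[OF 3] by blast
  next
    case (2 \<beta>)
    then have \<beta>: "\<beta> < osuc \<beta>" by simp
    have \<beta>r: "\<beta> < yr S v" using 2(1) less.prems(5) by simp
    show ?thesis
      unfolding 2(2) ndrk_ge_osuc[OF \<beta>]
    proof
      fix \<nu> assume "\<nu> \<in> mu m"
      then obtain a where a: "a \<in> v" "\<nu> = node (N K) a" using conf unfolding config_def by blast
      obtain \<pi>0 \<pi>1 where qe0: "quasi_embedding_on S v \<pi>0" and qe1: "quasi_embedding_on S v \<pi>1"
        and off: "\<forall>b\<in>v. b \<noteq> a \<longrightarrow> \<pi>0 b = \<pi>1 b" and ne: "\<pi>0 a \<noteq> \<pi>1 a"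
        and coin: "\<forall>b\<in>v. \<forall>b'\<in>v. \<pi>0 b = \<pi>1 b' \<longrightarrow> b = b'" and rU: "\<beta> \<le> yr S (\<pi>0 ` v \<union> \<pi>1 ` v)"
        using doubling[OF finv a(1) \<beta>r] by blast
      define U where "U = \<pi>0 ` v \<union> \<pi>1 ` v"
      have U: "finite U" "U \<noteq> {}" using finv a(1) unfolding U_def by auto
      have "avoids S (\<pi>0 ` v) (\<pi>1 ` v)"
        unfolding avoids_def
      proof (intro allI impI, elim conjE)
        fix u x assume u: "u \<subseteq> \<pi>0 ` v \<inter> \<pi>1 ` v" "x \<in> \<pi>0 ` v - \<pi>1 ` v" "yr S (insert x u) = ozero"
        have "yr S (\<pi>0 ` v) \<le> yr S (insert x u)" using u finv by (intro yr_mono) auto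
        moreover have "yr S (\<pi>0 ` v) = yr S v" using qeD(3)[OF qe0 order_refl finv] a(1) by blast
        moreover have "ozero < yr S v" by (rule le_less_trans[OF ozero_le \<beta>r])
        ultimately have False using u(3) by simp
        then show "yk S (insert x u) \<noteq> card (u \<inter> {..<x})" ..
      qed
      then have "demand S (w K) v \<pi>0 \<pi>1 U"
        unfolding demand_def using v qe0 qe1 U coin unfolding U_def by blast
      from demands_met[OF this] obtain K' \<pi> where K': "N K < N K'" and \<pi>: "quasi_embedding_on S U \<pi>" "\<pi> ` U \<subseteq> w K'"
        and emb: "\<And>\<psi>. \<psi> \<in> {\<pi>0, \<pi>1} \<Longrightarrow> embeds \<iota> (N K) \<lparr>lE = E, lG = Gam, lH = H\<rparr> \<lparr>lE = E, lG = Gam, lH = H\<rparr> v (\<pi> \<circ> \<psi>)"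
        unfolding demand_met_def by auto
      have E\<psi>: "E (\<pi> (\<psi> b)) t = E b t" if "\<psi> \<in> {\<pi>0, \<pi>1}" "b \<in> v" "t < N K" for \<psi> b t
        using emb[OF that(1)] that(2,3) unfolding embeds_def by simp
      have HG: "H i {\<pi> (\<psi> b), \<pi> (\<psi> b')} = H i {b, b'} \<and> (\<forall>t<N K. Gam i {\<pi> (\<psi> b), \<pi> (\<psi> b')} t = Gam i {b, b'} t)"
        if "\<psi> \<in> {\<pi>0, \<pi>1}" "b \<in> v" "b' \<in> v" "b \<noteq> b'" "i < \<iota>" for \<psi> b b' i
        using emb[OF that(1)] edgesI[OF that(2-4)] that(5) unfolding embeds_def by fastforce
      define v2 where "v2 = \<pi> ` U"
      note inj\<pi> = qeD(2)[OF \<pi>(1)]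
      have "card v = card (\<pi>0 ` v)" using card_image[OF qeD(2)[OF qe0]] by simp
      also have "\<dots> \<le> card U" using U(1) by (intro card_mono) (auto simp: U_def)
      also have "\<dots> = card v2" unfolding v2_def using card_image[OF inj\<pi>] by simp
      finally have c2: "3 \<le> card v2" using v(2) by simp
      have v2: "v2 \<subseteq> w K'" unfolding v2_def by (rule \<pi>(2))
      obtain m2 where m2: "m2 \<in> M_family \<iota> T" "config (N K') v2 m2"
        using config_exists[OF v2] c2 by auto
      have "yr S v2 = yr S U" unfolding v2_def using qeD(3)[OF \<pi>(1) order_refl U] .
      then have rk2: "ndrk_ge \<iota> T \<beta> m2"
        using less.IH[OF 2(1) v2 c2 m2] rU unfolding U_def by simp
      have ml: "ml m = N K" "mu m = node (N K) ` v" "ml m2 = N K'" "mu m2 = node (N K') ` v2"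
        and inj2: "inj_on (node (N K')) v2"
        using conf m2(2) unfolding config_def by auto
      have nd: "take (N K) (node (N K') (\<pi> (\<psi> b))) = node (N K) b" if "\<psi> \<in> {\<pi>0, \<pi>1}" "b \<in> v" for \<psi> b
        using E\<psi>[OF that] K' by (simp add: min_def node_eq_iff)
      have v2E: "\<exists>b\<in>v. \<exists>\<psi>\<in>{\<pi>0, \<pi>1}. x = \<pi> (\<psi> b)" if "x \<in> v2" for x
        using that unfolding v2_def U_def by auto
      have "extends \<iota> m m2"
      proof (rule extendsI)
        show "ml m \<le> ml m2" using ml K' by simp
        have "node (N K) ` v = take (N K) ` node (N K') ` v2"
        proof (intro equalityI subsetI)
          fix \<eta> assume "\<eta> \<in> node (N K) ` v"
          then obtain b where b: "b \<in> v" "\<eta> = node (N K) b" by blast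
          have "\<pi> (\<pi>0 b) \<in> v2" using b unfolding v2_def U_def by blast
          then show "\<eta> \<in> take (N K) ` node (N K') ` v2" using nd[of \<pi>0 b] b by force
        next
          fix \<eta> assume "\<eta> \<in> take (N K) ` node (N K') ` v2"
          then obtain x where x: "x \<in> v2" "\<eta> = take (N K) (node (N K') x)" by blast
          then show "\<eta> \<in> node (N K) ` v" using v2E[OF x(1)] nd by blast
        qed
        then show "mu m = take (ml m) ` mu m2" using ml by simp
        fix \<eta>1 \<eta>2 i
        assume \<eta>: "\<eta>1 \<in> mu m2" "\<eta>2 \<in> mu m2" "take (ml m) \<eta>1 \<noteq> take (ml m) \<eta>2" and i: "i < \<iota>"
        obtain x1 x2 where x: "x1 \<in> v2" "\<eta>1 = node (N K') x1" "x2 \<in> v2" "\<eta>2 = node (N K') x2"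
          using \<eta>(1,2) ml by auto
        obtain b1 \<psi>1 where b1: "b1 \<in> v" "\<psi>1 \<in> {\<pi>0, \<pi>1}" "x1 = \<pi> (\<psi>1 b1)" using v2E[OF x(1)] by blast
        obtain b2 \<psi>2 where b2: "b2 \<in> v" "\<psi>2 \<in> {\<pi>0, \<pi>1}" "x2 = \<pi> (\<psi>2 b2)" using v2E[OF x(3)] by blast
        have t: "take (N K) \<eta>1 = node (N K) b1" "take (N K) \<eta>2 = node (N K) b2"
          using nd b1 b2 x by auto
        have bne: "b1 \<noteq> b2" using \<eta>(3) t ml by auto
        \<comment> \<open>Only \<open>a\<close> has two copies, so both points belong to the same copy of \<open>v\<close>.\<close>
        have "\<exists>\<psi>\<in>{\<pi>0, \<pi>1}. x1 = \<pi> (\<psi> b1) \<and> x2 = \<pi> (\<psi> b2)"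
        proof (cases "b1 = a")
          case True
          then have "\<pi>0 b2 = \<pi>1 b2" using off b2(1) bne by auto
          then show ?thesis using b1 b2 by auto
        next
          case False
          then have "\<pi>0 b1 = \<pi>1 b1" using off b1(1) by auto
          then show ?thesis using b1 b2 by auto
        qed
        then obtain \<psi> where \<psi>: "\<psi> \<in> {\<pi>0, \<pi>1}" "x1 = \<pi> (\<psi> b1)" "x2 = \<pi> (\<psi> b2)" by blast
        have xne: "x1 \<noteq> x2" using \<eta>(3) x by auto
        have "mh m2 i (\<eta>1, \<eta>2) = H i {x1, x2} \<and> mg m2 i (\<eta>1, \<eta>2) = gnode (N K') i x1 x2"
          using m2(2) x xne i unfolding config_def by blast
        moreover have "mh m i (node (N K) b1, node (N K) b2) = H i {b1, b2} \<and>
            mg m i (node (N K) b1, node (N K) b2) = gnode (N K) i b1 b2"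
          using conf b1(1) b2(1) bne i unfolding config_def by blast
        moreover have "take (N K) (gnode (N K') i x1 x2) = gnode (N K) i b1 b2"
          using HG[OF \<psi>(1) b1(1) b2(1) bne i] E\<psi>[OF \<psi>(1) b2(1)] K' \<psi>(2,3) by (simp add: min_def gnode_def)
        ultimately show "mh m i (take (ml m) \<eta>1, take (ml m) \<eta>2) = mh m2 i (\<eta>1, \<eta>2) \<and>
          mg m i (take (ml m) \<eta>1, take (ml m) \<eta>2) = take (ml m) (mg m2 i (\<eta>1, \<eta>2))"
          using HG[OF \<psi>(1) b1(1) b2(1) bne i] t ml \<psi>(2,3) by simp
      qed
      moreover have "2 \<le> card {\<eta> \<in> mu m2. strict_prefix \<nu> \<eta>}"
      proof -
        let ?x = "node (N K') (\<pi> (\<pi>0 a))" and ?y = "node (N K') (\<pi> (\<pi>1 a))"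
        have in2: "\<pi> (\<pi>0 a) \<in> v2" "\<pi> (\<pi>1 a) \<in> v2" using a(1) unfolding v2_def U_def by auto
        have "\<pi> (\<pi>0 a) \<noteq> \<pi> (\<pi>1 a)" using inj\<pi> ne a(1) unfolding inj_on_def U_def by blast
        then have "?x \<noteq> ?y" using inj2 in2 unfolding inj_on_def by blast
        moreover have "strict_prefix \<nu> ?x" "strict_prefix \<nu> ?y"
        proof -
          have "prefix \<nu> ?x" "prefix \<nu> ?y" unfolding a(2) using nd[of \<pi>0 a] nd[of \<pi>1 a] a(1) take_is_prefix by (metis insertCI)+
          moreover have "length \<nu> < length ?x" "length \<nu> < length ?y" using K' a(2) by auto
          ultimately show "strict_prefix \<nu> ?x" "strict_prefix \<nu> ?y" by (auto simp: strict_prefix_def)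
        qed
        ultimately have "{?x, ?y} \<subseteq> {\<eta> \<in> mu m2. strict_prefix \<nu> \<eta>}" "card {?x, ?y} = 2"
          using in2 ml by auto
        then show ?thesis using card_mono[OF finite_mu[OF m2(1)], of "{?x, ?y}" "strict_prefix \<nu>"] by simp
      qed
      ultimately have "splitting_ext \<iota> T m \<nu> m2"
        unfolding splitting_ext_def using m2(1) ml(1,3) K' by simp
      then show "\<exists>n. splitting_ext \<iota> T m \<nu> n \<and> ndrk_ge \<iota> T \<beta> n"
        using rk2 by blast
    qed
  qed
qed

text \<open>A system of three points with constant rank \<open>\<epsilon>\<close> and injective \<open>yj\<close> starts the splitting.\<close>

lemma ndrk_sup_lower:
  assumes "ozero < \<epsilon>"
  shows "Rank \<epsilon> \<le> (ndrk_sup \<iota> T :: 'o rank_value)"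
proof -
  define q :: "(nat, 'o) yzr" where "q = \<lparr>yX = {0, 1, 2}, yr = (\<lambda>_. \<epsilon>), yj = set_encode, yk = (\<lambda>_. 0)\<rparr>"
  have "yzr_system \<epsilon> q"
    unfolding yzr_system_def
  proof (intro conjI ballI allI impI notI)
    fix s assume s: "s \<in> fin_subsets (yX q)"
    then have fin: "finite s" "s \<noteq> {}" unfolding fin_subsets_def by auto
    then show k: "yk q s < card s" by (simp add: q_def card_gt_0_iff)
    assume "\<exists>b\<in>yX q - s. card (s \<inter> {..<b}) = yk q s \<and>
             yj q (insert b (s - {sorted_list_of_set s ! yk q s})) = yj q s \<and> yr q (insert b s) = yr q s"
    then obtain b where "b \<notin> s" "set_encode (insert b (s - {sorted_list_of_set s ! yk q s})) = set_encode s"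
      by (auto simp: q_def)
    then have "insert b (s - {sorted_list_of_set s ! yk q s}) = s" using fin set_encode_eq by (metis finite_Diff finite_insert)
    then show False using \<open>b \<notin> s\<close> by blast
  qed (use assms in \<open>auto simp: q_def\<close>)
  moreover have "finite (yX q)" by (simp add: q_def)
  ultimately obtain \<phi> where \<phi>: "quasi_embedding q S \<phi>" using cute_absorbs[OF cute, of q 0] by blast
  define v where "v = \<phi> ` {0, 1, 2}"
  have "yX q = {0, 1, 2}" by (simp add: q_def)
  then have "strict_mono_on {0, 1, 2} \<phi>"
    using \<phi> unfolding quasi_embedding_def by metis
  then have "inj_on \<phi> {0, 1, 2}" by (rule strict_mono_on_imp_inj_on)
  then have "card v = card {0, 1, 2 :: nat}" unfolding v_def by (rule card_image)
  then have c: "3 \<le> card v" by simp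
  have r: "yr S v = \<epsilon>"
  proof -
    have "{0, 1, 2} \<in> fin_subsets (yX q)" by (simp add: fin_subsets_def q_def)
    then have "yr S (\<phi> ` {0, 1, 2}) = yr q {0, 1, 2}" using \<phi> unfolding quasi_embedding_def by blast
    then show ?thesis by (simp add: v_def q_def)
  qed
  have "finite v" by (simp add: v_def)
  then obtain K where K: "v \<subseteq> w K" using finite_subset_w by blast
  obtain m where m: "m \<in> M_family \<iota> T" "config (N K) v m" using config_exists[OF K] c by auto
  have "ndrk_ge \<iota> T \<epsilon> m" by (rule config_rank[OF K c m]) (simp add: r)
  then have "Rank \<epsilon> \<le> (ndrk \<iota> T m :: 'o rank_value)" by (rule le_ndrk) (rule M_familyD(5)[OF m(1)])
  also have "\<dots> \<le> ndrk_sup \<iota> T" by (rule ndrk_le_ndrk_sup[OF m(1)])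
  finally show ?thesis .
qed

end

section \<open>Construction of a tower\<close>

lemma embeds_cong:
  assumes "embeds \<iota> k D D' v \<phi>" "inj_on \<phi> v" "v \<subseteq> A" "\<phi> ` v \<subseteq> A'"
    and "embeds \<iota> k D D1 A (\<lambda>x. x)" "embeds \<iota> k D' D1' A' (\<lambda>x. x)"
  shows "embeds \<iota> k D1 D1' v \<phi>"
  unfolding embeds_def
proof (intro conjI ballI allI impI)
  fix a t assume "a \<in> v" "t < k"
  moreover then have "a \<in> A" "\<phi> a \<in> A'" using assms(3,4) by auto
  ultimately show "lE D1' (\<phi> a) t = lE D1 a t" using assms(1,5,6) unfolding embeds_def by simp
next
  fix i e assume i: "i < \<iota>" and e: "e \<in> edges v"
  have 1: "e \<in> edges A" using e edges_mono[OF assms(3)] by blast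
  have "\<phi> ` e \<in> edges (\<phi> ` v)" using edges_image[OF assms(2)] e by blast
  then have 2: "\<phi> ` e \<in> edges A'" using edges_mono[OF assms(4)] by blast
  show "lH D1' i (\<phi> ` e) = lH D1 i e" using assms(1,5,6) i e 1 2 unfolding embeds_def by simp
  show "lG D1' i (\<phi> ` e) t = lG D1 i e t" if "t < k" for t
    using assms(1,5,6) i e 1 2 that unfolding embeds_def by simp
qed

lemma embeds_less: "embeds \<iota> k D D' v \<phi> \<Longrightarrow> k' \<le> k \<Longrightarrow> embeds \<iota> k' D D' v \<phi>"
  unfolding embeds_def by (meson less_le_trans)

lemma embeds_comp:
  assumes "embeds \<iota> k D D' v (\<lambda>x. x)" "embeds \<iota> k' D' D'' v' (\<lambda>x. x)" "v \<subseteq> v'" "k \<le> k'"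
  shows "embeds \<iota> k D D'' v (\<lambda>x. x)"
  using assms edges_mono[OF assms(3)] unfolding embeds_def by (auto simp: subset_iff)

lemma independent_cong:
  assumes "independent \<iota> A k D" "embeds \<iota> k D D' A (\<lambda>x. x)"
  shows "independent \<iota> A k D'"
  unfolding independent_def
proof (intro conjI ballI allI impI)
  fix a assume "a \<in> A"
  then obtain t where "t < k" "\<forall>x\<in>A. lE D x t = (if x = a then 1 else 0)"
    using assms(1) unfolding independent_def by blast
  then show "\<exists>t<k. \<forall>x\<in>A. lE D' x t = (if x = a then 1 else 0)"
    using assms(2) unfolding embeds_def by (intro exI[of _ t]) simp
next
  fix i e assume "i < \<iota>" "e \<in> edges A"
  then obtain t where "t < k" "\<forall>x\<in>A. lE D x t = 0" "\<forall>j<\<iota>. \<forall>e'\<in>edges A. lG D j e' t = (if j = i \<and> e' = e then 1 else 0)"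
    using assms(1) unfolding independent_def by blast
  then show "\<exists>t<k. (\<forall>x\<in>A. lE D' x t = 0) \<and>
       (\<forall>j<\<iota>. \<forall>e'\<in>edges A. lG D' j e' t = (if j = i \<and> e' = e then 1 else 0))"
    using assms(2) unfolding embeds_def by (intro exI[of _ t]) simp
qed

lemma heights_cong:
  assumes "embeds \<iota> k D D' A (\<lambda>x. x)"
  shows "heights \<iota> D' A = heights \<iota> D A"
proof -
  have "lH D' i e = lH D i e" if "i < \<iota>" "e \<in> edges A" for i e
    using assms that unfolding embeds_def by simp
  then show ?thesis unfolding heights_def by (metis (no_types, lifting))
qed

lemma stage_ok_cong:
  fixes S :: "(nat, 'o::wellorder) yzr"
  assumes X: "yX S = UNIV" and st: "stage_ok S \<iota> A k D A' D'"
    and D: "embeds \<iota> k D D1 A (\<lambda>x. x)" and D': "embeds \<iota> k D' D1' A' (\<lambda>x. x)"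
  shows "stage_ok S \<iota> A k D1 A' D1'"
proof -
  obtain C1 C2 p where *: "C1 \<inter> A = {}" "C2 \<inter> A = {}" "C1 \<subseteq> A'" "C2 \<subseteq> A'"
     "\<forall>a\<in>A. p a = a" "projects S \<iota> A k D D' C1 p" "projects S \<iota> A k D D' C2 p" "avoids S C1 C2"
     and fresh: "\<forall>e\<in>edges A'. \<not> e \<subseteq> A \<and> \<not> e \<subseteq> C1 \<and> \<not> e \<subseteq> C2 \<longrightarrow>
       (\<forall>i<\<iota>. lH D' i e \<notin> heights \<iota> D A \<and> (\<forall>j<\<iota>. \<forall>e'\<in>edges A'. lH D' j e' = lH D' i e \<longrightarrow> e' = e))"
    using st unfolding stage_ok_def by (elim exE conjE) (rule that; assumption)
  have pr: "projects S \<iota> A k D1 D1' C p" if "projects S \<iota> A k D D' C p" "C \<subseteq> A'" for C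
    using that embeds_cong[OF _ _ that(2) _ D' D] quasi_embedding_onD(2)[OF X] unfolding projects_def by blast
  have eqH: "lH D1' i e = lH D' i e" if "i < \<iota>" "e \<in> edges A'" for i e
    using D' that unfolding embeds_def by simp
  show ?thesis
    unfolding stage_ok_def heights_cong[OF D]
    by (rule exI[of _ C1], rule exI[of _ C2], rule exI[of _ p])
      (use * pr[OF *(6,3)] pr[OF *(7,4)] fresh eqH in auto)
qed

text \<open>The generators are \<open>2 * a\<close> for an index \<open>a\<close> and \<open>2 * height_code i e + 1\<close> for an edge; position \<open>t\<close>
  belongs to the generator \<open>gen t\<close>, and every generator owns positions beyond any bound.\<close>

definition height_code :: "nat \<Rightarrow> nat set \<Rightarrow> nat" where
  "height_code i e = prod_encode (i, set_encode e)"

definition gen :: "nat \<Rightarrow> nat" where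
  "gen t = fst (prod_decode t)"

lemma gen_encode [simp]: "gen (prod_encode (g, k)) = g"
  by (simp add: gen_def)

lemma edges_finite: "e \<in> edges A \<Longrightarrow> finite e"
  by (auto simp: edges_def intro: card_ge_0_finite)

lemma height_code_inject:
  "e \<in> edges A \<Longrightarrow> e' \<in> edges B \<Longrightarrow> height_code i e = height_code j e' \<longleftrightarrow> i = j \<and> e = e'"
  by (simp add: height_code_def set_encode_eq edges_finite)

text \<open>Below level \<open>k\<close> the new points copy old ones; from \<open>k\<close> on, all branches are independent.\<close>

definition extend_labelling ::
    "labelling \<Rightarrow> nat set \<Rightarrow> nat \<Rightarrow> nat set \<Rightarrow> nat set \<Rightarrow> (nat \<Rightarrow> nat) \<Rightarrow> labelling" where
  "extend_labelling D A k C1 C2 p =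
    \<lparr>lE = (\<lambda>a t. if t < k then (if a \<in> A then lE D a t else if a \<in> C1 \<union> C2 then lE D (p a) t else 0)
       else if gen t = 2 * a then 1 else 0),
     lG = (\<lambda>i e t. if t < k then (if e \<subseteq> A then lG D i e t else if e \<subseteq> C1 \<or> e \<subseteq> C2 then lG D i (p ` e) t else 0)
       else if gen t = 2 * height_code i e + 1 then 1 else 0),
     lH = (\<lambda>i e. if e \<subseteq> A then lH D i e else if e \<subseteq> C1 \<or> e \<subseteq> C2 then lH D i (p ` e) else height_code i e)\<rparr>"

text \<open>This makes the code of a fresh edge differ from all old heights.\<close>

definition coded_heights :: "nat set \<Rightarrow> labelling \<Rightarrow> bool" where
  "coded_heights A D \<longleftrightarrow> (\<forall>i. \<forall>e\<in>edges A. \<exists>j. \<exists>e0\<in>edges A. lH D i e = height_code j e0)"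

lemma extend_labelling:
  fixes S :: "(nat, 'o::wellorder) yzr"
  assumes X: "yX S = UNIV" and fin: "finite A'" and A: "A \<subseteq> A'" and coded: "coded_heights A D"
    and C: "C1 \<inter> A = {}" "C2 \<inter> A = {}" "C1 \<subseteq> A'" "C2 \<subseteq> A'"
    and p: "\<forall>a\<in>A. p a = a" "p ` C1 \<subseteq> A" "p ` C2 \<subseteq> A" "quasi_embedding_on S C1 p" "quasi_embedding_on S C2 p"
    and avoids: "avoids S C1 C2"
    and D': "D' = extend_labelling D A k C1 C2 p"
  shows "\<exists>k'>k. independent \<iota> A' k' D'" "coded_heights A' D'" "embeds \<iota> k D D' A (\<lambda>x. x)"
    "projects S \<iota> A k D D' C1 p" "projects S \<iota> A k D D' C2 p" "stage_ok S \<iota> A k D A' D'"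
proof -
  have sel: "lE D' a t = (if t < k then (if a \<in> A then lE D a t else if a \<in> C1 \<union> C2 then lE D (p a) t else 0)
       else if gen t = 2 * a then 1 else 0)"
    "lG D' i e t = (if t < k then (if e \<subseteq> A then lG D i e t else if e \<subseteq> C1 \<or> e \<subseteq> C2 then lG D i (p ` e) t else 0)
       else if gen t = 2 * height_code i e + 1 then 1 else 0)"
    "lH D' i e = (if e \<subseteq> A then lH D i e else if e \<subseteq> C1 \<or> e \<subseteq> C2 then lH D i (p ` e) else height_code i e)"
    for a t i e
    by (simp_all add: D' extend_labelling_def)
  have not_old: "\<not> e \<subseteq> A" if "e \<in> edges B" "B \<inter> A = {}" for e B
    using that by (elim edgesE) auto
  show emb: "embeds \<iota> k D D' A (\<lambda>x. x)"
    unfolding embeds_def by (auto simp: sel edges_def)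
  have pr: "projects S \<iota> A k D D' C p" if Cc: "C = C1 \<or> C = C2" for C
  proof -
    have CA: "C \<inter> A = {}" "C \<subseteq> C1 \<union> C2" using Cc C by auto
    have "lE D (p a) t = lE D' a t" if "a \<in> C" "t < k" for a t
      using that CA by (auto simp: sel)
    moreover have "lH D i (p ` e) = lH D' i e \<and> (\<forall>t<k. lG D i (p ` e) t = lG D' i e t)" if "e \<in> edges C" for i e
    proof -
      have "e \<subseteq> C1 \<or> e \<subseteq> C2" using that Cc unfolding edges_def by blast
      then show ?thesis using not_old[OF that CA(1)] by (simp add: sel)
    qed
    ultimately show ?thesis
      using Cc p unfolding projects_def embeds_def by auto
  qed
  show p1: "projects S \<iota> A k D D' C1 p" and p2: "projects S \<iota> A k D D' C2 p" using pr by auto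
  have pe: "p ` e \<in> edges A" if "e \<in> edges C" "C = C1 \<or> C = C2" for e C
  proof -
    have "inj_on p C" "p ` C \<subseteq> A" using that(2) p quasi_embedding_onD(2)[OF X] by auto
    then show ?thesis using edges_image[of p C] edges_mono[of "p ` C" A] that(1) by blast
  qed
  have edge_sub: "e \<in> edges B" if "e \<in> edges A'" "e \<subseteq> B" for e B using that by (simp add: edges_def)
  have coded_old: "\<exists>j. \<exists>e0\<in>edges A. lH D' i e = height_code j e0"
    if e: "e \<in> edges A'" "e \<subseteq> A \<or> e \<subseteq> C1 \<or> e \<subseteq> C2" for i e
  proof (cases "e \<subseteq> A")
    case True
    then show ?thesis using coded edge_sub[OF e(1) True] unfolding coded_heights_def by (simp add: sel)
  next
    case False
    then have "p ` e \<in> edges A" using pe edge_sub[OF e(1)] e(2) by blast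
    then show ?thesis using coded False e(2) unfolding coded_heights_def by (simp add: sel)
  qed
  have eA': "edges A \<subseteq> edges A'" by (rule edges_mono[OF A])
  show "coded_heights A' D'"
    unfolding coded_heights_def
  proof (intro allI ballI)
    fix i e assume e: "e \<in> edges A'"
    show "\<exists>j. \<exists>e0\<in>edges A'. lH D' i e = height_code j e0"
    proof (cases "e \<subseteq> A \<or> e \<subseteq> C1 \<or> e \<subseteq> C2")
      case True
      then show ?thesis using coded_old[OF e] eA' by blast
    next
      case False
      then have "lH D' i e = height_code i e" by (simp add: sel)
      then show ?thesis using e by blast
    qed
  qed
  have fresh: "lH D' i e \<notin> heights \<iota> D A" "e' \<in> edges A' \<Longrightarrow> lH D' j e' = lH D' i e \<Longrightarrow> e' = e"
    if e: "e \<in> edges A'" "\<not> e \<subseteq> A" "\<not> e \<subseteq> C1" "\<not> e \<subseteq> C2" for e i j e'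
  proof -
    have He: "lH D' i e = height_code i e" using e by (simp add: sel)
    show "lH D' i e \<notin> heights \<iota> D A"
    proof
      assume "lH D' i e \<in> heights \<iota> D A"
      then obtain j e0 where "e0 \<in> edges A" "lH D' i e = lH D j e0" unfolding heights_def by blast
      then obtain j' e1 where "e1 \<in> edges A" "height_code i e = height_code j' e1"
        using coded He unfolding coded_heights_def by metis
      then have "e \<in> edges A" using height_code_inject[OF e(1)] by metis
      then show False using e(2) by (simp add: edges_def)
    qed
    show "e' = e" if e': "e' \<in> edges A'" "lH D' j e' = lH D' i e"
    proof (cases "e' \<subseteq> A \<or> e' \<subseteq> C1 \<or> e' \<subseteq> C2")
      case True
      then obtain j' e0 where "e0 \<in> edges A" "height_code i e = height_code j' e0"
        using coded_old[OF e'(1), of j] e'(2) He by metis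
      then have "e \<in> edges A" using height_code_inject[OF e(1)] by metis
      then show ?thesis using e(2) by (simp add: edges_def)
    next
      case False
      then have "height_code j e' = height_code i e" using e'(2) He by (simp add: sel)
      then show ?thesis using height_code_inject[OF e'(1) e(1)] by blast
    qed
  qed
  show "stage_ok S \<iota> A k D A' D'"
    unfolding stage_ok_def
    by (rule exI[of _ C1], rule exI[of _ C2], rule exI[of _ p], intro conjI C p(1) p1 p2 avoids) (use fresh in blast)
  define P where "P = (\<lambda>a. prod_encode (2 * a, k)) ` A' \<union> (\<lambda>(i, e). prod_encode (2 * height_code i e + 1, k)) ` ({..<\<iota>} \<times> edges A')"
  have "finite (edges A')" unfolding edges_def using fin by simp
  then have finP: "finite P" unfolding P_def using fin by simp
  define k' where "k' = Suc (Max (insert k P))"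
  have k': "k < k'" "\<And>t. t \<in> P \<Longrightarrow> t < k'"
    unfolding k'_def using finP by (auto simp: less_Suc_eq_le)
  have ge: "\<not> prod_encode (g, k) < k" for g using le_prod_encode_2[of k g] by simp
  have "independent \<iota> A' k' D'"
    unfolding independent_def
  proof (intro conjI ballI allI impI)
    fix a assume a: "a \<in> A'"
    have "prod_encode (2 * a, k) \<in> P" unfolding P_def using a by blast
    then show "\<exists>t<k'. \<forall>x\<in>A'. lE D' x t = (if x = a then 1 else 0)"
      using k'(2) ge by (intro exI[of _ "prod_encode (2 * a, k)"]) (auto simp: sel)
  next
    fix i e assume ie: "i < \<iota>" "e \<in> edges A'"
    let ?t = "prod_encode (2 * height_code i e + 1, k)"
    have "?t \<in> P" unfolding P_def using ie by force
    then have t: "?t < k'" by (rule k'(2))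
    have "2 * height_code i e + 1 \<noteq> 2 * x" for x by presburger
    then have "lE D' x ?t = 0" for x using ge by (simp add: sel)
    moreover have "lG D' j e' ?t = (if j = i \<and> e' = e then 1 else 0)" if "e' \<in> edges A'" for j e'
      using ge height_code_inject[OF ie(2) that, of i j] by (auto simp: sel)
    ultimately show "\<exists>t<k'. (\<forall>x\<in>A'. lE D' x t = 0) \<and>
       (\<forall>j<\<iota>. \<forall>e'\<in>edges A'. lG D' j e' t = (if j = i \<and> e' = e then 1 else 0))"
      using t by blast
  qed
  then show "\<exists>k'>k. independent \<iota> A' k' D'" using k'(1) by blast
qed

lemma cute_shift:
  fixes S :: "(nat, 'o::ordinals) yzr"
  assumes cute: "cute \<epsilon> S" and U: "finite U" "U \<noteq> {}"
  shows "\<exists>\<pi>. quasi_embedding_on S U \<pi> \<and> \<pi> ` U \<subseteq> {M..}"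
proof -
  have S: "yzr_system \<epsilon> S" "yX S = UNIV" using cute unfolding cute_def by auto
  have "fin_subsets U \<subseteq> fin_subsets UNIV" unfolding fin_subsets_def by blast
  then have "yzr_system \<epsilon> (yzr_restrict S U)"
    using S U unfolding yzr_system_def yzr_restrict_def by (simp add: subset_iff)
  then obtain \<pi> where "quasi_embedding (yzr_restrict S U) S \<pi>" "\<pi> ` yX (yzr_restrict S U) \<subseteq> {M..}"
    using cute_absorbs[OF cute, of "yzr_restrict S U" M] U(1) by (auto simp: yzr_restrict_def)
  then show ?thesis unfolding quasi_embedding_on_def S(2) by (auto simp: yzr_restrict_def)
qed

text \<open>A quasi-embedding of \<open>U\<close> far out provides new points for the two copies; inverse to it is the projection
  \<open>p\<close>, which is well defined on common points because the two maps agree there.\<close>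

lemma extend_stage:
  fixes S :: "(nat, 'o::ordinals) yzr"
  assumes cute: "cute \<epsilon> S" and fin: "finite A" "finite F" and coded: "coded_heights A D"
  shows "\<exists>A' k' D'. A \<subseteq> A' \<and> F \<subseteq> A' \<and> finite A' \<and> k < k' \<and> independent \<iota> A' k' D' \<and> coded_heights A' D' \<and>
    embeds \<iota> k D D' A (\<lambda>x. x) \<and> stage_ok S \<iota> A k D A' D' \<and>
    (demand S A v \<pi>0 \<pi>1 U \<longrightarrow> demand_met S \<iota> k D A' D' v \<pi>0 \<pi>1 U)"
proof -
  have X: "yX S = UNIV" using cute unfolding cute_def by blast
  note qeD = quasi_embedding_onD[OF X]
  show ?thesis
  proof (cases "demand S A v \<pi>0 \<pi>1 U")
    case False
    have q0: "quasi_embedding_on S {} (\<lambda>x. x)" by (rule quasi_embedding_on_id[OF X])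
    have av: "avoids S {} {}" by (simp add: avoids_def)
    have finA: "finite (A \<union> F)" using fin by simp
    have sub: "A \<subseteq> A \<union> F" "F \<subseteq> A \<union> F" "{} \<inter> A = {}" "{} \<subseteq> A \<union> F" "\<forall>a\<in>A. a = a" "(\<lambda>x. x) ` {} \<subseteq> A"
      by auto
    note E = extend_labelling(1,3,6)[OF X finA sub(1) coded sub(3,3,4,4) sub(5,6,6) q0 q0 av refl, where \<iota> = \<iota> and k = k]
      extend_labelling(2)[OF X finA sub(1) coded sub(3,3,4,4) sub(5,6,6) q0 q0 av refl, where k = k]
    show ?thesis
      using E sub(1,2) False finA by blast
  next
    case True
    then have v: "v \<subseteq> A" and qe0: "quasi_embedding_on S v \<pi>0" and qe1: "quasi_embedding_on S v \<pi>1"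
      and U: "\<pi>0 ` v \<union> \<pi>1 ` v \<subseteq> U" "finite U" "U \<noteq> {}"
      and coin: "\<And>a b. a \<in> v \<Longrightarrow> b \<in> v \<Longrightarrow> \<pi>0 a = \<pi>1 b \<Longrightarrow> a = b" and av: "avoids S (\<pi>0 ` v) (\<pi>1 ` v)"
      unfolding demand_def by auto
    obtain \<pi> where \<pi>: "quasi_embedding_on S U \<pi>" "\<pi> ` U \<subseteq> {Suc (Max A)..}"
      using cute_shift[OF cute U(2,3)] by blast
    note inj\<pi> = qeD(2)[OF \<pi>(1)]
    have disj: "x \<notin> A" if "x \<in> \<pi> ` U" for x
      using that \<pi>(2) Max_ge[OF fin(1), of x] by fastforce
    define C1 C2 where "C1 = (\<pi> \<circ> \<pi>0) ` v" and "C2 = (\<pi> \<circ> \<pi>1) ` v"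
    have CU: "C1 \<subseteq> \<pi> ` U" "C2 \<subseteq> \<pi> ` U" using U(1) unfolding C1_def C2_def by auto
    have q0: "quasi_embedding_on S v (\<pi> \<circ> \<pi>0)" and q1: "quasi_embedding_on S v (\<pi> \<circ> \<pi>1)"
      using U(1) by (intro quasi_embedding_on_comp[OF X] qe0 qe1 quasi_embedding_on_subset[OF X \<pi>(1)]; blast)+
    define p where "p x = (if x \<in> A then x else if x \<in> C1 then inv_into v (\<pi> \<circ> \<pi>0) x else inv_into v (\<pi> \<circ> \<pi>1) x)" for x
    have p0: "p ((\<pi> \<circ> \<pi>0) a) = a" if "a \<in> v" for a
    proof -
      have "(\<pi> \<circ> \<pi>0) a \<in> C1" "(\<pi> \<circ> \<pi>0) a \<notin> A" using that CU disj unfolding C1_def by blast+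
      then show ?thesis using inv_into_f_f[OF qeD(2)[OF q0] that] unfolding p_def by simp
    qed
    have p1: "p ((\<pi> \<circ> \<pi>1) b) = b" if b: "b \<in> v" for b
    proof (cases "(\<pi> \<circ> \<pi>1) b \<in> C1")
      case True
      then obtain a where a: "a \<in> v" "(\<pi> \<circ> \<pi>1) b = (\<pi> \<circ> \<pi>0) a" unfolding C1_def by blast
      have "\<pi>0 a \<in> U" "\<pi>1 b \<in> U" using a(1) b U(1) by auto
      then have "\<pi>1 b = \<pi>0 a" using inj\<pi> a(2) unfolding inj_on_def by simp
      then have "a = b" using coin[OF a(1) b] by simp
      then show ?thesis using a p0[OF a(1)] by simp
    next
      case False
      moreover have "(\<pi> \<circ> \<pi>1) b \<notin> A" using b CU disj unfolding C2_def by blast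
      ultimately show ?thesis using inv_into_f_f[OF qeD(2)[OF q1] b] unfolding p_def by simp
    qed
    have pC: "p ` C1 \<subseteq> A" "p ` C2 \<subseteq> A"
      using p0 p1 v unfolding C1_def C2_def by auto
    have qpC: "quasi_embedding_on S (\<phi> ` v) p" if "quasi_embedding_on S v \<phi>" "\<And>a. a \<in> v \<Longrightarrow> p (\<phi> a) = a" for \<phi>
      by (rule quasi_embedding_on_cong[OF X quasi_embedding_on_inverse[OF X that(1)]])
        (use that(2) inv_into_f_f[OF qeD(2)[OF that(1)]] in auto)
    have qp: "quasi_embedding_on S C1 p" "quasi_embedding_on S C2 p"
      unfolding C1_def C2_def using qpC[OF q0 p0] qpC[OF q1 p1] by auto
    have finU: "finite v" using v fin(1) by (rule finite_subset)
    have "avoids S C1 C2"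
      unfolding avoids_def
    proof (intro allI impI, elim conjE)
      fix u x assume u: "u \<subseteq> C1 \<inter> C2" and x: "x \<in> C1 - C2" and r: "yr S (insert x u) = ozero"
      define x' u' where "x' = inv_into U \<pi> x" and "u' = inv_into U \<pi> ` u"
      have inv: "inv_into U \<pi> z \<in> \<pi>0 ` v \<longleftrightarrow> z \<in> C1" "inv_into U \<pi> z \<in> \<pi>1 ` v \<longleftrightarrow> z \<in> C2" if z: "z \<in> \<pi> ` U" for z
      proof -
        obtain y where y: "y \<in> U" "z = \<pi> y" using z by blast
        have iz: "inv_into U \<pi> z = y" using y inj\<pi> by simp
        have mem: "y \<in> B \<longleftrightarrow> z \<in> \<pi> ` B" if "B \<subseteq> U" for B
          using y inj\<pi> that unfolding inj_on_def by blast
        have vU: "\<pi>0 ` v \<subseteq> U" "\<pi>1 ` v \<subseteq> U" using U(1) by auto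
        show "inv_into U \<pi> z \<in> \<pi>0 ` v \<longleftrightarrow> z \<in> C1"
          unfolding iz C1_def image_comp[symmetric] by (rule mem[OF vU(1)])
        show "inv_into U \<pi> z \<in> \<pi>1 ` v \<longleftrightarrow> z \<in> C2"
          unfolding iz C2_def image_comp[symmetric] by (rule mem[OF vU(2)])
      qed
      have xU: "x \<in> \<pi> ` U" and uU: "u \<subseteq> \<pi> ` U" using x u CU by auto
      have qi: "quasi_embedding_on S (\<pi> ` U) (inv_into U \<pi>)" by (rule quasi_embedding_on_inverse[OF X \<pi>(1)])
      have sub: "insert x u \<subseteq> \<pi> ` U" using xU uU by blast
      have finxu: "finite (insert x u)" by (rule finite_subset[OF sub finite_imageI[OF U(2)]])
      have im: "insert x' u' = inv_into U \<pi> ` insert x u" unfolding x'_def u'_def by simp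
      have "x' \<in> \<pi>0 ` v - \<pi>1 ` v" unfolding x'_def using inv[OF xU] x by blast
      moreover have "u' \<subseteq> \<pi>0 ` v \<inter> \<pi>1 ` v"
      proof
        fix z' assume "z' \<in> u'"
        then obtain z where z: "z \<in> u" "z' = inv_into U \<pi> z" unfolding u'_def by blast
        have "z \<in> \<pi> ` U" "z \<in> C1" "z \<in> C2" using z(1) uU u by auto
        then show "z' \<in> \<pi>0 ` v \<inter> \<pi>1 ` v" using inv z(2) by simp
      qed
      moreover have "yr S (insert x' u') = ozero"
        unfolding im using qeD(3)[OF qi sub finxu] r by simp
      ultimately have "yk S (insert x' u') \<noteq> card (u' \<inter> {..<x'})" using av unfolding avoids_def by blast
      moreover have "yk S (insert x' u') = yk S (insert x u)"
        unfolding im using qeD(4)[OF qi sub finxu] by simp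
      moreover have "card (insert x' u' \<inter> {..<x'}) = card (insert x u \<inter> {..<x})"
        unfolding im unfolding x'_def
        by (rule card_below_image[OF qeD(1)[OF quasi_embedding_on_subset[OF X qi sub]]]) simp
      moreover have "insert x' u' \<inter> {..<x'} = u' \<inter> {..<x'}" "insert x u \<inter> {..<x} = u \<inter> {..<x}" by auto
      ultimately show "yk S (insert x u) \<noteq> card (u \<inter> {..<x})" by simp
    qed
    note avC = this
    define A' where "A' = A \<union> F \<union> \<pi> ` U"
    have finA': "finite A'" unfolding A'_def using fin U(2) by simp
    have AA': "A \<subseteq> A'" "C1 \<subseteq> A'" "C2 \<subseteq> A'" using CU unfolding A'_def by auto
    have CA: "C1 \<inter> A = {}" "C2 \<inter> A = {}" using CU disj by blast+
    have pA: "\<forall>a\<in>A. p a = a" by (simp add: p_def)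
    define D' where "D' = extend_labelling D A k C1 C2 p"
    note E = extend_labelling(1,3-6)[OF X finA' AA'(1) coded CA AA'(2,3) pA pC qp avC D'_def, where \<iota> = \<iota>]
      extend_labelling(2)[OF X finA' AA'(1) coded CA AA'(2,3) pA pC qp avC D'_def]
    have met: "embeds \<iota> k D D' v \<phi>" if pr: "projects S \<iota> A k D D' (\<phi> ` v) p" and q: "quasi_embedding_on S v \<phi>"
      and inv: "\<And>a. a \<in> v \<Longrightarrow> p (\<phi> a) = a" for \<phi>
      unfolding embeds_def
    proof (intro conjI ballI allI impI)
      have e: "embeds \<iota> k D' D (\<phi> ` v) p" using pr unfolding projects_def by blast
      show "lE D' (\<phi> a) t = lE D a t" if "a \<in> v" "t < k" for a t
        using e that inv[OF that(1)] unfolding embeds_def by force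
      fix i e' assume i: "i < \<iota>" and e': "e' \<in> edges v"
      have "\<phi> ` e' \<in> edges (\<phi> ` v)" using edges_image[OF qeD(2)[OF q]] e' by blast
      moreover have "p ` \<phi> ` e' = e'" using inv e' by (force simp: edges_def image_image)
      ultimately show "lH D' i (\<phi> ` e') = lH D i e'" "t < k \<Longrightarrow> lG D' i (\<phi> ` e') t = lG D i e' t" for t
        using e i unfolding embeds_def by fastforce+
    qed
    have "demand_met S \<iota> k D A' D' v \<pi>0 \<pi>1 U"
      unfolding demand_met_def
    proof (intro exI[of _ \<pi>] conjI)
      show "\<pi> ` U \<subseteq> A'" unfolding A'_def by blast
      show "embeds \<iota> k D D' v (\<pi> \<circ> \<pi>0)" by (rule met[OF E(3)[unfolded C1_def] q0 p0])
      show "embeds \<iota> k D D' v (\<pi> \<circ> \<pi>1)" by (rule met[OF E(4)[unfolded C2_def] q1 p1])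
    qed (rule \<pi>(1))
    moreover have "F \<subseteq> A'" unfolding A'_def by blast
    ultimately show ?thesis using E(1,2,5,6) finA' AA'(1) by blast
  qed
qed

lemma demand_cong:
  fixes S :: "(nat, 'o::wellorder) yzr"
  assumes X: "yX S = UNIV" and d: "demand S A v \<pi>0 \<pi>1 U" and "A \<subseteq> A'"
    and eq: "\<And>a. a \<in> v \<Longrightarrow> \<pi>0 a = \<pi>0' a" "\<And>a. a \<in> v \<Longrightarrow> \<pi>1 a = \<pi>1' a"
  shows "demand S A' v \<pi>0' \<pi>1' U"
proof -
  have im: "\<pi>0' ` v = \<pi>0 ` v" "\<pi>1' ` v = \<pi>1 ` v" using eq by (auto simp: image_def)
  have "quasi_embedding_on S v \<pi>0" "quasi_embedding_on S v \<pi>1"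
    using d unfolding demand_def by blast+
  note qe = quasi_embedding_on_cong[OF X this(1) eq(1)] quasi_embedding_on_cong[OF X this(2) eq(2)]
  have "a = b" if "a \<in> v" "b \<in> v" "\<pi>0' a = \<pi>1' b" for a b
    using d eq(1)[OF that(1)] eq(2)[OF that(2)] that unfolding demand_def by simp
  moreover have "v \<subseteq> A'" "\<pi>0 ` v \<union> \<pi>1 ` v \<subseteq> U" "finite U" "U \<noteq> {}" "avoids S (\<pi>0 ` v) (\<pi>1 ` v)"
    using d assms(3) unfolding demand_def by blast+
  ultimately show ?thesis
    unfolding demand_def im using qe by blast
qed

lemma demand_met_cong:
  assumes d: "demand_met S \<iota> k D A' D' v \<pi>0 \<pi>1 U"
    and eq: "\<And>a. a \<in> v \<Longrightarrow> \<pi>0 a = \<pi>0' a" "\<And>a. a \<in> v \<Longrightarrow> \<pi>1 a = \<pi>1' a"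
  shows "demand_met S \<iota> k D A' D' v \<pi>0' \<pi>1' U"
proof -
  have e: "embeds \<iota> k D D' v (\<pi> \<circ> \<psi>')" if "embeds \<iota> k D D' v (\<pi> \<circ> \<psi>)" "\<And>a. a \<in> v \<Longrightarrow> \<psi> a = \<psi>' a" for \<pi> \<psi> \<psi>'
  proof -
    have "(\<pi> \<circ> \<psi>') ` e = (\<pi> \<circ> \<psi>) ` e" if "e \<in> edges v" for e
      by (intro image_cong refl) (use that \<open>\<And>a. a \<in> v \<Longrightarrow> \<psi> a = \<psi>' a\<close> in \<open>auto simp: edges_def\<close>)
    then show ?thesis using that unfolding embeds_def by simp
  qed
  show ?thesis
    using d e[of _ \<pi>0 \<pi>0'] e[of _ \<pi>1 \<pi>1'] eq unfolding demand_met_def by blast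
qed

text \<open>Demands are coded by lists, and every demand comes up at arbitrarily late stages.\<close>

definition task :: "nat \<Rightarrow> nat list \<times> nat list \<times> nat list \<times> nat list" where
  "task n = from_nat (fst (prod_decode n))"

text \<open>Each stage answers the demand that is its turn, if it makes sense by then, and adds an initial segment of the indices.
  On the old points and below the old level nothing changes, so the stages have a limit.\<close>

lemma tower_exists:
  fixes S :: "(nat, 'o::ordinals) yzr"
  assumes cute: "cute \<epsilon> S" and \<iota>: "2 \<le> \<iota>"
  shows "\<exists>w N E Gam H. tower \<epsilon> S \<iota> w N E Gam H"
proof -
  have X: "yX S = UNIV" using cute unfolding cute_def by blast
  define P where "P n x = (case x of (A, k, D) \<Rightarrow> finite A \<and> coded_heights A D \<and> independent \<iota> A k D \<and>
      n \<le> k \<and> {..<n} \<subseteq> A \<and> (n = 0 \<longrightarrow> A = {}) \<and> (0 < n \<longrightarrow> 3 \<le> card A))"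
    for n and x :: "nat set \<times> nat \<times> labelling"
  define Q where "Q n x y = (case x of (A, k, D) \<Rightarrow> case y of (A', k', D') \<Rightarrow>
      A \<subseteq> A' \<and> k < k' \<and> embeds \<iota> k D D' A (\<lambda>x. x) \<and> stage_ok S \<iota> A k D A' D' \<and>
      (\<forall>xs l0 l1 ys. task n = (xs, l0, l1, ys) \<longrightarrow> demand S A (set xs) ((!) l0) ((!) l1) (set ys) \<longrightarrow>
         demand_met S \<iota> k D A' D' (set xs) ((!) l0) ((!) l1) (set ys)))"
    for n and x y :: "nat set \<times> nat \<times> labelling"
  have "\<exists>f. \<forall>n. P n (f n) \<and> Q n (f n) (f (Suc n))"
  proof (rule dependent_nat_choice)
    have "P 0 ({}, 0, \<lparr>lE = \<lambda>_ _. 0, lG = \<lambda>_ _ _. 0, lH = \<lambda>_ _. 0\<rparr>)"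
      by (auto simp: P_def coded_heights_def independent_def edges_def)
    then show "\<exists>x. P 0 x" by blast
    fix x n assume Px: "P n x"
    obtain A k D where x: "x = (A, k, D)" by (cases x)
    have A: "finite A" "coded_heights A D" "n \<le> k" using Px unfolding P_def x by auto
    obtain xs l0 l1 ys where t: "task n = (xs, l0, l1, ys)" by (cases "task n")
    obtain A' k' D' where *: "A \<subseteq> A'" "{..n + 2} \<subseteq> A'" "finite A'" "k < k'" "independent \<iota> A' k' D'" "coded_heights A' D'"
        "embeds \<iota> k D D' A (\<lambda>x. x)" "stage_ok S \<iota> A k D A' D'"
        "demand S A (set xs) ((!) l0) ((!) l1) (set ys) \<longrightarrow> demand_met S \<iota> k D A' D' (set xs) ((!) l0) ((!) l1) (set ys)"
      using extend_stage[OF cute A(1) _ A(2), of "{..n + 2}" k \<iota> "set xs" "(!) l0" "(!) l1" "set ys"] by auto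
    have "card {..n + 2} \<le> card A'" by (rule card_mono[OF *(3,2)])
    then have "3 \<le> card A'" by simp
    moreover have "{..<Suc n} \<subseteq> A'" using *(2) by (auto simp: subset_iff)
    ultimately have "P (Suc n) (A', k', D')" using * A unfolding P_def by auto
    moreover have "Q n x (A', k', D')" using * t unfolding Q_def x by auto
    ultimately show "\<exists>y. P (Suc n) y \<and> Q n x y" by blast
  qed
  then obtain f where f: "\<And>n. P n (f n)" "\<And>n. Q n (f n) (f (Suc n))" by blast
  define w N D where "w n = fst (f n)" and "N n = fst (snd (f n))" and "D n = snd (snd (f n))" for n
  have fn: "f n = (w n, N n, D n)" for n by (simp add: w_def N_def D_def)
  have fin: "finite (w n)" and ind: "independent \<iota> (w n) (N n) (D n)" and nN: "n \<le> N n" and nw: "{..<n} \<subseteq> w n"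
    and w0: "w 0 = {}" and card: "3 \<le> card (w (Suc n))" for n
    using f(1)[of n] f(1)[of 0] f(1)[of "Suc n"] unfolding P_def fn by auto
  have wS: "w n \<subseteq> w (Suc n)" and NS: "N n < N (Suc n)" and embS: "embeds \<iota> (N n) (D n) (D (Suc n)) (w n) (\<lambda>x. x)"
    and st: "stage_ok S \<iota> (w n) (N n) (D n) (w (Suc n)) (D (Suc n))" for n
    using f(2)[of n] unfolding Q_def fn by auto
  have met: "demand_met S \<iota> (N n) (D n) (w (Suc n)) (D (Suc n)) (set xs) ((!) l0) ((!) l1) (set ys)"
    if "task n = (xs, l0, l1, ys)" "demand S (w n) (set xs) ((!) l0) ((!) l1) (set ys)" for n xs l0 l1 ys
    using f(2)[of n] that unfolding Q_def fn by simp
  have w_mono: "w m \<subseteq> w n" if "m \<le> n" for m n by (rule lift_Suc_mono_le[of w, OF wS that])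
  have N_mono: "N m \<le> N n" if "m \<le> n" for m n
    by (rule lift_Suc_mono_le[of N, OF less_imp_le[OF NS] that])
  have emb: "embeds \<iota> (N m) (D m) (D n) (w m) (\<lambda>x. x)" if "m \<le> n" for m n
    using that
  proof (induction n rule: dec_induct)
    case base
    show ?case by (simp add: embeds_def)
  next
    case (step n)
    show ?case by (rule embeds_comp[OF step.IH embS w_mono[OF step.hyps(1)] N_mono[OF step.hyps(1)]])
  qed
  \<comment> \<open>The value at an argument is read off at the first stage at which it is certainly final.\<close>
  define L where "L = \<lparr>lE = (\<lambda>a t. lE (D (Suc (a + t))) a t),
    lG = (\<lambda>i e t. lG (D (Suc (Max e + t))) i e t), lH = (\<lambda>i e. lH (D (Suc (Max e))) i e)\<rparr>"
  have embL: "embeds \<iota> (N m) (D m) L (w m) (\<lambda>x. x)" for m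
    unfolding embeds_def image_ident
  proof (intro conjI ballI allI impI)
    fix a t assume a: "a \<in> w m" "t < N m"
    let ?k = "Suc (a + t)"
    have "a \<in> w ?k" "t < N ?k" using nw[of ?k] nN[of ?k] by auto
    then have "lE (D ?k) a t = lE (D m) a t"
      using a emb[of m ?k] emb[of ?k m] unfolding embeds_def by (cases "m \<le> ?k") auto
    then show "lE L a t = lE (D m) a t" by (simp add: L_def)
  next
    fix i e assume i: "i < \<iota>" and e: "e \<in> edges (w m)"
    have fe: "finite e" "e \<noteq> {}" using e edges_finite[OF e] by (auto simp: edges_def)
    have ek: "e \<in> edges (w (Suc (Max e + t)))" for t
    proof -
      have "e \<subseteq> {..<Suc (Max e + t)}" using Max_ge[OF fe(1)] by (fastforce simp: less_Suc_eq_le)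
      then show ?thesis using nw e unfolding edges_def by blast
    qed
    have "lH (D (Suc (Max e))) i e = lH (D m) i e"
      using i e ek[of 0] emb[of m "Suc (Max e)"] emb[of "Suc (Max e)" m] unfolding embeds_def
      by (cases "m \<le> Suc (Max e)") auto
    then show "lH L i e = lH (D m) i e" by (simp add: L_def)
    fix t assume t: "t < N m"
    let ?k = "Suc (Max e + t)"
    have "t < N ?k" using nN[of ?k] by auto
    then have "lG (D ?k) i e t = lG (D m) i e t"
      using i e t ek[of t] emb[of m ?k] emb[of ?k m] unfolding embeds_def by (cases "m \<le> ?k") auto
    then show "lG L i e t = lG (D m) i e t" by (simp add: L_def)
  qed
  have L: "\<lparr>lE = lE L, lG = lG L, lH = lH L\<rparr> = L" by simp
  have "tower \<epsilon> S \<iota> w N (lE L) (lG L) (lH L)"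
    unfolding tower_def L
  proof (intro conjI allI impI)
    show "cute \<epsilon> S" "2 \<le> \<iota>" "w 0 = {}" by (fact cute \<iota> w0)+
    show "finite (w n)" "w n \<subseteq> w (Suc n)" "3 \<le> card (w (Suc n))" "N n < N (Suc n)" for n
      by (fact fin wS card NS)+
    show "\<exists>n. a \<in> w n" for a using nw[of "Suc a"] by (intro exI[of _ "Suc a"]) auto
    show "independent \<iota> (w n) (N n) L" for n by (rule independent_cong[OF ind embL])
    show "stage_ok S \<iota> (w n) (N n) L (w (Suc n)) L" for n
      by (rule stage_ok_cong[OF X st embL embeds_less[OF embL less_imp_le[OF NS]]])
    fix n v \<pi>0 \<pi>1 U assume d: "demand S (w n) v \<pi>0 \<pi>1 U"
    then have v: "v \<subseteq> w n" and finU: "finite U" unfolding demand_def by auto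
    have finv: "finite v" using v fin finite_subset by blast
    define l0 l1 where "l0 = map \<pi>0 [0..<Suc (Max v)]" and "l1 = map \<pi>1 [0..<Suc (Max v)]"
    have eq: "\<pi>0 a = l0 ! a" "\<pi>1 a = l1 ! a" if "a \<in> v" for a
      unfolding l0_def l1_def using Max_ge[OF finv that] by (simp_all del: upt_Suc add: less_Suc_eq_le)
    define xs ys where "xs = sorted_list_of_set v" and "ys = sorted_list_of_set U"
    have sets: "set xs = v" "set ys = U" unfolding xs_def ys_def using finv finU by auto
    define j where "j = prod_encode (to_nat (xs, l0, l1, ys), n)"
    have j: "task j = (xs, l0, l1, ys)" by (simp add: task_def j_def)
    have nj: "n \<le> j" unfolding j_def by (rule le_prod_encode_2)
    have "demand S (w j) v ((!) l0) ((!) l1) U"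
      by (rule demand_cong[OF X d w_mono[OF nj] eq])
    then have "demand_met S \<iota> (N j) (D j) (w (Suc j)) (D (Suc j)) v ((!) l0) ((!) l1) U"
      using met[OF j] unfolding sets by blast
    then have "demand_met S \<iota> (N j) (D j) (w (Suc j)) (D (Suc j)) v \<pi>0 \<pi>1 U"
      by (rule demand_met_cong) (use eq in auto)
    then obtain \<pi> where \<pi>: "quasi_embedding_on S U \<pi>" "\<pi> ` U \<subseteq> w (Suc j)"
      "embeds \<iota> (N j) (D j) (D (Suc j)) v (\<pi> \<circ> \<pi>0)" "embeds \<iota> (N j) (D j) (D (Suc j)) v (\<pi> \<circ> \<pi>1)"
      unfolding demand_met_def by blast
    have vj: "v \<subseteq> w j" using v w_mono[OF nj] by blast
    have e: "embeds \<iota> (N n) L L v (\<pi> \<circ> \<psi>)"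
      if "embeds \<iota> (N j) (D j) (D (Suc j)) v (\<pi> \<circ> \<psi>)" "quasi_embedding_on S v \<psi>" "\<psi> ` v \<subseteq> U" for \<psi>
    proof (rule embeds_less[OF embeds_cong[OF that(1) _ vj _ embL embeds_less[OF embL less_imp_le[OF NS]]] N_mono[OF nj]])
      have "quasi_embedding_on S v (\<pi> \<circ> \<psi>)"
        by (rule quasi_embedding_on_comp[OF X that(2) quasi_embedding_on_subset[OF X \<pi>(1) that(3)]])
      then show "inj_on (\<pi> \<circ> \<psi>) v" by (rule quasi_embedding_onD(2)[OF X])
      show "(\<pi> \<circ> \<psi>) ` v \<subseteq> w (Suc j)" using that(3) \<pi>(2) by auto
    qed
    have "demand_met S \<iota> (N n) L (w (Suc j)) L v \<pi>0 \<pi>1 U"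
      unfolding demand_met_def using \<pi>(1,2) e[OF \<pi>(3)] e[OF \<pi>(4)] d unfolding demand_def by blast
    moreover have "N n < N (Suc j)" using N_mono[OF nj] NS[of j] by simp
    ultimately show "\<exists>K. N n < N K \<and> demand_met S \<iota> (N n) L (w K) L v \<pi>0 \<pi>1 U" by blast
  qed
  then show ?thesis by blast
qed

theorem theorem4p4:
  fixes \<epsilon> :: "'o::ordinals"
    and \<iota> :: nat
    and S :: "(nat, 'o) yzr"
  assumes "ozero < \<epsilon>" and "countable {..<\<epsilon>}"
    and "2 \<le> \<iota>"
    and "cute \<epsilon> S"
  shows "\<exists>(T :: nat \<Rightarrow> bit list set) (c :: nat \<Rightarrow> nat).
     (\<forall>m. tree (T m) \<and> no_maximal_nodes (T m)) \<and>
     controlled_amalgamation S \<iota> T c \<and>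
     Rank \<epsilon> \<le> (ndrk_sup \<iota> T :: 'o rank_value) \<and>
     (ndrk_sup \<iota> T :: 'o rank_value) \<le>
       Rank (omega \<otimes> (\<epsilon> \<oplus> ord_of_nat 2) \<oplus> ord_of_nat 2)"
proof -
  obtain w N E Gam H where "tower \<epsilon> S \<iota> w N E Gam H"
    using tower_exists[OF assms(4,3)] by blast
  then interpret tower \<epsilon> S \<iota> w N E Gam H .
  show ?thesis
    using tree_T no_maximal_nodes_T controlled_amalgamation_T ndrk_sup_lower[OF assms(1)] ndrk_sup_upper[OF assms(2)]
    by blast
qed

end
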